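(* Let $f:D\to S^3_1$ be a CMC $1$ face with Weierstrass data $(g,\omega)$, $(\varphi,V)$ its characteristic pair, and $p\in D$ a singular point. Then: (1) $f$ has a cuspidal $S_1$ singular point at $p$ iff at $p$: $\operatorname{Im}\varphi\neq0$, $\operatorname{Re}\varphi=\operatorname{Im}(V\varphi)=0$, and $\operatorname{Re}(V^2\varphi)\notin\{0,12\}$; (2) for an integer $k>1$, $f$ has a cuspidal $S_k$ singular point at $p$ iff $\operatorname{Im}\varphi(p)\neq0$ and, at $p$, $\operatorname{Re}\varphi=\operatorname{Re}(iV\varphi)=\dots=\operatorname{Re}(i^kV^k\varphi)=0$ and $\operatorname{Re}(i^{k+1}V^{k+1}\varphi)\neq0$.
   Context: $S^3_1=\{X\in\mathrm{Herm}(2):\det X=-1\}$; a CMC $1$ face with Weierstrass data $(g,\omega)$ ($g$ meromorphic, $\omega=h\,dz$ holomorphic on a domain $D\subset\mathbb{C}$, $(1+|g|^2)^2|\omega|^2$ Riemannian, $1-|g|^2\not\equiv0$) is $f=Fe_3F^*$ with $F:D\to SL(2,\mathbb{C})$ holomorphic, $F^{-1}dF=\begin{pmatrix}g&-g^2\\1&-g\end{pmatrix}\omega$, $e_3=\mathrm{diag}(1,-1)$. Singular set $\Sigma(f)=\{|g|=1\}$. Characteristic pair: $\varphi=g_z/(g^2h)$, $V\psi=g\psi_z/g_z$, iterates $V^k$; $i=\sqrt{-1}$. Cuspidal $S_k^\pm$: map germ $\mathcal{A}$-equivalent (equal after composing with diffeomorphism germs of source and target) to $(u,v)\mapsto(u,v^2,v^3(u^{k+1}\pm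 v^2))$ at $0$; cuspidal $S_k$ means $S_k^+$ or $S_k^-$. *)

theory Defs
  imports "HOL-Analysis.Analysis" "HOL-Complex_Analysis.Complex_Analysis"
begin

fun Ck_on :: "nat \<Rightarrow> 'a::euclidean_space set \<Rightarrow> ('a \<Rightarrow> 'b::euclidean_space) \<Rightarrow> bool" where
  "Ck_on 0 S f = continuous_on S f"
| "Ck_on (Suc n) S f = (f differentiable_on S \<and>
       (\<forall>v. Ck_on n S (\<lambda>x. frechet_derivative f (at x) v)))"

definition smooth_on :: "'a::euclidean_space set \<Rightarrow> ('a \<Rightarrow> 'b::euclidean_space) \<Rightarrow> bool" where
  "smooth_on S f \<longleftrightarrow> (\<forall>n. Ck_on n S f)"

definition diffeo_on :: "'a::euclidean_space set \<Rightarrow> ('a \<Rightarrow> 'b::euclidean_space) \<Rightarrow> bool" where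
  "diffeo_on U f \<longleftrightarrow> open U \<and> open (f ` U) \<and> smooth_on U f \<and>
     (\<exists>f'. smooth_on (f ` U) f' \<and> (\<forall>x\<in>U. f' (f x) = x) \<and> (\<forall>y\<in>f ` U. f (f' y) = y))"

text \<open>A Hermitian 2x2 matrix [[a, b],[cnj b, d]] (a, d real) is encoded by the real
  coordinates (a, d, Re b, Im b) in R^4 (a linear isomorphism Herm(2) = R^4).\<close>
type_synonym herm2 = "real \<times> real \<times> real \<times> real"

definition herm_det :: "herm2 \<Rightarrow> real" where
  "herm_det X = (case X of (a, d, b1, b2) \<Rightarrow> a * d - (b1\<^sup>2 + b2\<^sup>2))"

definition deSitter3 :: "herm2 set" where
  "deSitter3 = {X. herm_det X = -1}"

text \<open>The map f = F e3 F^* for F = [[F11, F12],[F21, F22]], e3 = diag(1,-1):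
  F e3 F^* = [[|F11|^2-|F12|^2, F11 cnj F21 - F12 cnj F22], [.., |F21|^2-|F22|^2]].\<close>
definition Fe3Fstar ::
  "(complex \<Rightarrow> complex) \<Rightarrow> (complex \<Rightarrow> complex) \<Rightarrow> (complex \<Rightarrow> complex) \<Rightarrow> (complex \<Rightarrow> complex)
    \<Rightarrow> complex \<Rightarrow> herm2" where
  "Fe3Fstar F11 F12 F21 F22 z =
     (let b = F11 z * cnj (F21 z) - F12 z * cnj (F22 z) in
       ((cmod (F11 z))\<^sup>2 - (cmod (F12 z))\<^sup>2, (cmod (F21 z))\<^sup>2 - (cmod (F22 z))\<^sup>2, Re b, Im b))"

text \<open>(g, omega = h dz) is Weierstrass data on the domain D and F is a holomorphic
  SL(2,C)-valued solution of F^{-1} dF = [[g, -g^2],[1, -g]] h dz, i.e. F' = F M.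
  g is meromorphic (normalised: value 0 at poles, no removable singularities); the
  equation is required away from poles of g (at poles it then extends by continuity).
  The metric (1+|g|^2)^2 |h|^2 |dz|^2 is Riemannian: positive at non-poles, and at poles
  its continuous extension is positive.  Also 1 - |g|^2 is not identically zero.\<close>
definition CMC1_face_data ::
  "complex set \<Rightarrow> (complex \<Rightarrow> complex) \<Rightarrow> (complex \<Rightarrow> complex) \<Rightarrow>
   (complex \<Rightarrow> complex) \<Rightarrow> (complex \<Rightarrow> complex) \<Rightarrow> (complex \<Rightarrow> complex) \<Rightarrow> (complex \<Rightarrow> complex)
   \<Rightarrow> bool" where
  "CMC1_face_data D g h F11 F12 F21 F22 \<longleftrightarrow>
     open D \<and> connected D \<and> D \<noteq> {} \<and>
     g nicely_meromorphic_on D \<and> h holomorphic_on D \<and>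
     F11 holomorphic_on D \<and> F12 holomorphic_on D \<and> F21 holomorphic_on D \<and> F22 holomorphic_on D \<and>
     (\<forall>z\<in>D. F11 z * F22 z - F12 z * F21 z = 1) \<and>
     (\<forall>z\<in>D. \<not> is_pole g z \<longrightarrow>
        deriv F11 z = (F11 z * g z + F12 z) * h z \<and>
        deriv F12 z = (- F11 z * (g z)\<^sup>2 - F12 z * g z) * h z \<and>
        deriv F21 z = (F21 z * g z + F22 z) * h z \<and>
        deriv F22 z = (- F21 z * (g z)\<^sup>2 - F22 z * g z) * h z) \<and>
     (\<forall>z\<in>D. \<not> is_pole g z \<longrightarrow> (1 + (cmod (g z))\<^sup>2)\<^sup>2 * (cmod (h z))\<^sup>2 > 0) \<and>
     (\<forall>z\<in>D. is_pole g z \<longrightarrow>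
        (\<exists>L>0. ((\<lambda>w. (1 + (cmod (g w))\<^sup>2)\<^sup>2 * (cmod (h w))\<^sup>2) \<longlongrightarrow> L) (at z))) \<and>
     (\<exists>z\<in>D. \<not> is_pole g z \<and> cmod (g z) \<noteq> 1)"

definition singular_set :: "complex set \<Rightarrow> (complex \<Rightarrow> complex) \<Rightarrow> complex set" where
  "singular_set D g = {z\<in>D. \<not> is_pole g z \<and> cmod (g z) = 1}"

definition char_phi :: "(complex \<Rightarrow> complex) \<Rightarrow> (complex \<Rightarrow> complex) \<Rightarrow> complex \<Rightarrow> complex" where
  "char_phi g h = (\<lambda>z. deriv g z / ((g z)\<^sup>2 * h z))"

definition char_V :: "(complex \<Rightarrow> complex) \<Rightarrow> (complex \<Rightarrow> complex) \<Rightarrow> complex \<Rightarrow> complex" where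
  "char_V g \<psi> = (\<lambda>z. g z * deriv \<psi> z / deriv g z)"

definition cuspS_model :: "nat \<Rightarrow> real \<Rightarrow> real \<times> real \<Rightarrow> real \<times> real \<times> real" where
  "cuspS_model k s = (\<lambda>(u, v). (u, v\<^sup>2, v ^ 3 * (u ^ (k + 1) + s * v\<^sup>2)))"

text \<open>The germ at p of f : D -> S^3_1 is A-equivalent to the germ at 0 of G : R^2 -> R^3:
  there are a diffeomorphism germ sigma : (R^2,0) -> (D,p) and a diffeomorphism germ
  Psi : (S^3_1, f p) -> (R^3, 0) of the target (a diffeomorphism from a relatively open
  neighbourhood of f p in the submanifold S^3_1 onto an open subset of R^3, i.e. Psi is
  the restriction of a smooth map on an open set W of R^4, with smooth inverse psi
  taking values in S^3_1) such that Psi o f o sigma = G near 0.\<close>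
definition A_equiv_germ_dS ::
  "complex set \<Rightarrow> (complex \<Rightarrow> herm2) \<Rightarrow> complex \<Rightarrow> (real \<times> real \<Rightarrow> real \<times> real \<times> real) \<Rightarrow> bool" where
  "A_equiv_germ_dS D f p G \<longleftrightarrow>
     (\<exists>U (\<sigma> :: real \<times> real \<Rightarrow> complex) W (\<Psi> :: herm2 \<Rightarrow> real \<times> real \<times> real) Ob \<psi>.
        (0::real\<times>real) \<in> U \<and> diffeo_on U \<sigma> \<and> \<sigma> 0 = p \<and> \<sigma> ` U \<subseteq> D \<and>
        open W \<and> f p \<in> W \<and> smooth_on W \<Psi> \<and> \<Psi> (f p) = 0 \<and>
        open Ob \<and> smooth_on Ob \<psi> \<and> \<Psi> ` (W \<inter> deSitter3) = Ob \<and>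
        (\<forall>y\<in>Ob. \<psi> y \<in> W \<inter> deSitter3 \<and> \<Psi> (\<psi> y) = y) \<and>
        (\<forall>X\<in>W \<inter> deSitter3. \<psi> (\<Psi> X) = X) \<and>
        (\<forall>x\<in>U. f (\<sigma> x) \<in> W \<and> \<Psi> (f (\<sigma> x)) = G x))"

definition cuspidal_S :: "nat \<Rightarrow> complex set \<Rightarrow> (complex \<Rightarrow> herm2) \<Rightarrow> complex \<Rightarrow> bool" where
  "cuspidal_S k D f p \<longleftrightarrow> (\<exists>s\<in>{1, -1}. A_equiv_germ_dS D f p (cuspS_model k s))"

end

theory Submission
  imports Defs
begin

text \<open>
  In the coordinate \<open>t\<close> with \<open>dt = g h dz\<close>, and after an isometry of the target, the face is
  \<open>X = e e\<^sup>* - e c\<^sup>* - c e\<^sup>* + mu c c\<^sup>*\<close> with \<open>mu = 1 - \<bar>g\<bar>\<^sup>2\<close>, \<open>e' = - \<phi> c\<close>, \<open>c' = - e - \<phi> c\<close>,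
  \<open>g' = \<phi> g\<close>. The derivative of \<open>X\<close> in the imaginary direction is divisible by \<open>mu\<close>, so the singular
  curve is \<open>mu = 0\<close> and the imaginary direction is null. If \<open>Im \<phi> = 0\<close> at the point, then the second
  derivative of \<open>X\<close> in the null direction lies in the image of \<open>dX\<close>, which is not the case for a
  cuspidal \<open>S\<close> singularity.

  If \<open>Im \<phi> \<noteq> 0\<close>, then \<open>X\<close> is right-left equivalent to \<open>(u, v\<^sup>2, v\<^sup>3 d (u, v\<^sup>2))\<close>; this uses only the
  inverse function theorem and Hadamard division, which are carried out for holomorphic functions of
  two variables with real values at real points. Such a germ is a cuspidal \<open>S\<^sub>k\<close> singularity iff
  \<open>d (u, 0)\<close> vanishes to order \<open>k + 1\<close> and \<open>\<partial>\<^sub>2 d \<noteq> 0\<close>. Comparing the slopes of the tangent planes shows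
  that \<open>d (u, 0)\<close> is a nonvanishing multiple of \<open>Re \<phi>\<close> on the singular curve. With respect to \<open>log g\<close>
  this curve is a piece of the imaginary axis and \<open>V\<close> is differentiation, so the order of vanishing is
  expressed by the numbers \<open>Re (i\<^sup>j V\<^sup>j \<phi>)\<close>. Finally \<open>\<partial>\<^sub>2 d\<close> is a nonzero multiple of \<open>Re (V\<^sup>2 \<phi>) - 12\<close>
  by comparing Taylor coefficients in the null direction.
\<close>

subsection \<open>Calculus of smooth maps\<close>

text \<open>The data are real analytic, and this shapes the method. In complexified variables,
  division, the splitting into even and odd parts and roots of units become Cauchy integrals or
  principal branches, so no structure theory of smooth function germs enters. This covers reduction
  to a normal form only. A given equivalence with the model is merely smooth; its invariants have to
  be extracted from limits of difference quotients along curves. The coordinate \<open>t\<close> is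
  singled out by \<open>d (log g) / dt = \<phi>\<close>, which leaves \<open>\<phi>\<close> as the
  only coefficient of the frame equations. The slope identity avoids computing \<open>d\<close>: it
  involves only first derivatives of the frame, and \<open>d\<close> enters it linearly. The
  constant 12 is 8 + 4. With \<open>b = Im \<phi>\<close>, the cubic coefficient of the slope
  identity along the null direction contains 8 b^2 from the frame and 4 b^2 from the mixed second
  derivative of the even part. The second null derivative of \<open>Re \<phi>\<close> is b^2 times
  \<open>Re (V^2 \<phi>)\<close>, whence the factor \<open>Re (V^2 \<phi>) - 12\<close>. For
  \<open>k > 1\<close> the vanishing conditions include \<open>Re (V^2 \<phi>) = 0\<close>, so the
  exceptional value is visible only for \<open>k = 1\<close>.\<close>

lemma Ck_on_cong:
  assumes "open S" "\<And>x. x \<in> S \<Longrightarrow> f x = g x" "Ck_on n S f"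
  shows "Ck_on n S g"
  using assms(2,3)
proof (induction n arbitrary: f g)
  case 0
  then show ?case
    using continuous_on_eq[of S f g] by simp
next
  case (Suc n)
  have d: "f differentiable at x" if "x \<in> S" for x
    using Suc.prems that assms(1) by (simp add: differentiable_on_eq_differentiable_at)
  have e: "frechet_derivative f (at x) = frechet_derivative g (at x)" if "x \<in> S" for x
    using frechet_derivative_transform_within_open[OF d[OF that] assms(1) that] Suc.prems by blast
  have "g differentiable_on S"
  proof (rule differentiable_at_imp_differentiable_on)
    fix x assume "x \<in> S"
    have "(g has_derivative frechet_derivative f (at x)) (at x)"
      by (rule has_derivative_transform_within_open[OF d[OF \<open>x \<in> S\<close>, unfolded frechet_derivative_works] assms(1)])
        (use \<open>x \<in> S\<close> Suc.prems in auto)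
    then show "g differentiable at x" by (rule differentiableI)
  qed
  moreover have "Ck_on n S (\<lambda>x. frechet_derivative g (at x) v)" for v
    by (rule Suc.IH[of "\<lambda>x. frechet_derivative f (at x) v"]) (use Suc.prems e in auto)
  ultimately show ?case by simp
qed

lemma Ck_on_imp_continuous_on: "Ck_on n S f \<Longrightarrow> continuous_on S f"
  by (cases n) (auto intro: differentiable_imp_continuous_on)

lemma Ck_on_SucD: "Ck_on (Suc n) S f \<Longrightarrow> Ck_on n S f"
proof (induction n arbitrary: f)
  case 0
  then show ?case using Ck_on_imp_continuous_on[of "Suc 0"] by auto
next
  case (Suc n)
  then show ?case by (metis Ck_on.simps(2))
qed

lemma Ck_on_subset:
  assumes "Ck_on n S f" "T \<subseteq> S"
  shows "Ck_on n T f"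
  using assms(1)
proof (induction n arbitrary: f)
  case 0
  then show ?case using assms(2) continuous_on_subset by auto
next
  case (Suc n)
  then show ?case using assms(2) differentiable_on_subset by auto
qed

lemma Ck_on_const: "Ck_on n S (\<lambda>x. c)"
  by (induction n arbitrary: c) auto

lemma Ck_on_bounded_linear:
  assumes "bounded_linear L"
  shows "Ck_on n S L"
proof (cases n)
  case 0
  then show ?thesis using assms by (simp add: linear_continuous_on)
next
  case (Suc m)
  have "frechet_derivative L (at x) = L" for x
    using assms frechet_derivative_at[OF bounded_linear.has_derivative[OF assms has_derivative_ident]]
    by simp
  moreover have "L differentiable_on S"
    using assms bounded_linear_imp_differentiable_on by blast
  ultimately show ?thesis using Suc by (simp add: Ck_on_const)
qed

lemma Ck_on_linear_comp:
  assumes "open S" "bounded_linear L" "Ck_on n S f"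
  shows "Ck_on n S (\<lambda>x. L (f x))"
  using assms(3)
proof (induction n arbitrary: f)
  case 0
  then show ?case
    using assms(2) by (simp add: bounded_linear.continuous_on)
next
  case (Suc n)
  have d: "f differentiable at x" if "x \<in> S" for x
    using Suc.prems that assms(1) by (simp add: differentiable_on_eq_differentiable_at)
  have D: "((\<lambda>x. L (f x)) has_derivative (\<lambda>v. L (frechet_derivative f (at x) v))) (at x)" if "x \<in> S" for x
    by (rule bounded_linear.has_derivative[OF assms(2) d[OF that, unfolded frechet_derivative_works]])
  have "(\<lambda>x. L (f x)) differentiable_on S"
    by (intro differentiable_at_imp_differentiable_on) (metis D differentiableI)
  moreover have "Ck_on n S (\<lambda>x. frechet_derivative (\<lambda>x. L (f x)) (at x) v)" for v
    by (rule Ck_on_cong[OF assms(1) _ Suc.IH[of "\<lambda>x. frechet_derivative f (at x) v"]])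
      (use Suc.prems in \<open>simp_all add: frechet_derivative_at[OF D, symmetric]\<close>)
  ultimately show ?case by simp
qed

lemma Ck_on_add:
  assumes "open S" "Ck_on n S f" "Ck_on n S g"
  shows "Ck_on n S (\<lambda>x. f x + g x)"
  using assms(2,3)
proof (induction n arbitrary: f g)
  case 0
  then show ?case by (auto intro: continuous_intros)
next
  case (Suc n)
  have D: "((\<lambda>x. f x + g x) has_derivative
      (\<lambda>v. frechet_derivative f (at x) v + frechet_derivative g (at x) v)) (at x)" if "x \<in> S" for x
    using Suc.prems that assms(1) unfolding Ck_on.simps
    by (intro has_derivative_add)
      (auto simp: differentiable_on_eq_differentiable_at frechet_derivative_works[symmetric])
  have "(\<lambda>x. f x + g x) differentiable_on S"
    by (intro differentiable_at_imp_differentiable_on) (metis D differentiableI)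
  moreover have "Ck_on n S (\<lambda>x. frechet_derivative (\<lambda>x. f x + g x) (at x) v)" for v
    by (rule Ck_on_cong[OF assms(1) _ Suc.IH[of "\<lambda>x. frechet_derivative f (at x) v"
          "\<lambda>x. frechet_derivative g (at x) v"]])
      (use Suc.prems in \<open>simp_all add: frechet_derivative_at[OF D, symmetric]\<close>)
  ultimately show ?case by simp
qed

lemma Ck_on_sum:
  assumes "open S" "finite I" "\<And>i. i \<in> I \<Longrightarrow> Ck_on n S (f i)"
  shows "Ck_on n S (\<lambda>x. \<Sum>i\<in>I. f i x)"
  using assms(2,3)
  by (induction I rule: finite_induct) (auto intro: Ck_on_const Ck_on_add[OF assms(1)])

lemma Ck_on_bilinear:
  assumes "open S" "bounded_bilinear B" "Ck_on n S f" "Ck_on n S g"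
  shows "Ck_on n S (\<lambda>x. B (f x) (g x))"
  using assms(3,4)
proof (induction n arbitrary: f g)
  case 0
  then show ?case
    using assms(2) by (simp add: bounded_bilinear.continuous_on)
next
  case (Suc n)
  have D: "((\<lambda>x. B (f x) (g x)) has_derivative
      (\<lambda>v. B (f x) (frechet_derivative g (at x) v) + B (frechet_derivative f (at x) v) (g x))) (at x)"
    if "x \<in> S" for x
    using Suc.prems that assms(1) unfolding Ck_on.simps
    by (intro bounded_bilinear.FDERIV[OF assms(2)])
      (auto simp: differentiable_on_eq_differentiable_at frechet_derivative_works[symmetric])
  have "(\<lambda>x. B (f x) (g x)) differentiable_on S"
    by (intro differentiable_at_imp_differentiable_on) (metis D differentiableI)
  moreover have "Ck_on n S (\<lambda>x. frechet_derivative (\<lambda>x. B (f x) (g x)) (at x) v)" for v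
    by (rule Ck_on_cong[OF assms(1) _ Ck_on_add[OF assms(1) Suc.IH[of f "\<lambda>x. frechet_derivative g (at x) v"]
          Suc.IH[of "\<lambda>x. frechet_derivative f (at x) v" g]]])
      (use Suc.prems Ck_on_SucD[of n S f] Ck_on_SucD[of n S g] in
        \<open>simp_all add: frechet_derivative_at[OF D, symmetric]\<close>)
  ultimately show ?case by simp
qed

lemma Ck_on_compose:
  fixes g :: "'a::euclidean_space \<Rightarrow> 'b::euclidean_space" and f :: "'b \<Rightarrow> 'c::euclidean_space"
  assumes "open S" "open T" "g ` S \<subseteq> T" "Ck_on n T f" "Ck_on n S g"
  shows "Ck_on n S (\<lambda>x. f (g x))"
  using assms(4,5)
proof (induction n arbitrary: f)
  case 0
  then show ?case using assms(3) by (auto intro: continuous_on_compose2)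
next
  case (Suc n)
  have dg: "g differentiable at x" and df: "f differentiable at (g x)" if "x \<in> S" for x
    using Suc.prems that assms by (auto simp: differentiable_on_eq_differentiable_at)
  have D: "((\<lambda>x. f (g x)) has_derivative
      (\<lambda>v. frechet_derivative f (at (g x)) (frechet_derivative g (at x) v))) (at x)" if "x \<in> S" for x
    by (rule has_derivative_compose[OF dg[OF that, unfolded frechet_derivative_works]
          df[OF that, unfolded frechet_derivative_works]])
  \<comment> \<open>In the chain rule the direction fed to the outer derivative varies with the
    point, whereas \<open>Ck_on\<close> controls derivatives in fixed directions. Expanding in the
    basis gives a finite sum of products of functions that the induction hypothesis covers.\<close>
  have e: "frechet_derivative f (at (g x)) w = (\<Sum>b\<in>Basis. (w \<bullet> b) *\<^sub>R frechet_derivative f (at (g x)) b)"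
    if "x \<in> S" for x w
  proof -
    have "linear (frechet_derivative f (at (g x)))"
      using df[OF that] by (simp add: linear_frechet_derivative)
    then have "frechet_derivative f (at (g x)) (\<Sum>b\<in>Basis. (w \<bullet> b) *\<^sub>R b)
        = (\<Sum>b\<in>Basis. (w \<bullet> b) *\<^sub>R frechet_derivative f (at (g x)) b)"
      by (simp add: linear_sum linear_scale)
    then show ?thesis
      by (simp add: euclidean_representation)
  qed
  have "(\<lambda>x. f (g x)) differentiable_on S"
    by (intro differentiable_at_imp_differentiable_on) (metis D differentiableI)
  moreover have "Ck_on n S (\<lambda>x. frechet_derivative (\<lambda>x. f (g x)) (at x) v)" for v
  proof (rule Ck_on_cong[OF assms(1)])
    show "Ck_on n S (\<lambda>x. \<Sum>b\<in>Basis. (frechet_derivative g (at x) v \<bullet> b) *\<^sub>R frechet_derivative f (at (g x)) b)"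
      using Suc Ck_on_SucD[of n S g]
      by (intro Ck_on_sum assms finite_Basis Ck_on_bilinear[OF assms(1) bounded_bilinear_scaleR]
           Ck_on_linear_comp[OF assms(1) bounded_linear_inner_left]) auto
  next
    fix x assume "x \<in> S"
    show "(\<Sum>b\<in>Basis. (frechet_derivative g (at x) v \<bullet> b) *\<^sub>R frechet_derivative f (at (g x)) b) =
         frechet_derivative (\<lambda>x. f (g x)) (at x) v"
      by (simp add: frechet_derivative_at[OF D[OF \<open>x \<in> S\<close>], symmetric] e[OF \<open>x \<in> S\<close>, symmetric])
  qed
  ultimately show ?case by simp
qed

lemma smooth_on_subset: "smooth_on S f \<Longrightarrow> T \<subseteq> S \<Longrightarrow> smooth_on T f"
  unfolding smooth_on_def by (blast intro: Ck_on_subset)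

lemma smooth_on_cong:
  assumes "open S" "\<And>x. x \<in> S \<Longrightarrow> f x = g x" "smooth_on S f"
  shows "smooth_on S g"
  unfolding smooth_on_def
proof
  fix n show "Ck_on n S g"
    by (rule Ck_on_cong[OF assms(1,2)]) (use assms(3) in \<open>auto simp: smooth_on_def\<close>)
qed

lemma smooth_on_linear: "bounded_linear L \<Longrightarrow> smooth_on S L"
  unfolding smooth_on_def by (blast intro: Ck_on_bounded_linear)

lemma smooth_on_const: "smooth_on S (\<lambda>x. c)"
  unfolding smooth_on_def by (blast intro: Ck_on_const)

lemma smooth_on_linear_comp:
  "open S \<Longrightarrow> bounded_linear L \<Longrightarrow> smooth_on S f \<Longrightarrow> smooth_on S (\<lambda>x. L (f x))"
  unfolding smooth_on_def by (blast intro: Ck_on_linear_comp)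

lemma smooth_on_add:
  "open S \<Longrightarrow> smooth_on S f \<Longrightarrow> smooth_on S g \<Longrightarrow> smooth_on S (\<lambda>x. f x + g x)"
  unfolding smooth_on_def by (blast intro: Ck_on_add)

lemma smooth_on_diff:
  assumes "open S" "smooth_on S f" "smooth_on S g"
  shows "smooth_on S (\<lambda>x. f x - g x)"
  using smooth_on_add[OF assms(1,2) smooth_on_linear_comp[OF assms(1) _ assms(3), of uminus]]
  by (simp add: bounded_linear_minus bounded_linear_ident)

lemma smooth_on_mult:
  fixes f g :: "'a::euclidean_space \<Rightarrow> 'b::{euclidean_space, real_normed_algebra}"
  shows "open S \<Longrightarrow> smooth_on S f \<Longrightarrow> smooth_on S g \<Longrightarrow> smooth_on S (\<lambda>x. f x * g x)"
  unfolding smooth_on_def by (blast intro: Ck_on_bilinear[OF _ bounded_bilinear_mult])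

lemma smooth_on_Pair:
  assumes "open S" "smooth_on S f" "smooth_on S g"
  shows "smooth_on S (\<lambda>x. (f x, g x))"
  using smooth_on_add[OF assms(1) smooth_on_linear_comp[OF assms(1) _ assms(2), of "\<lambda>x. (x, 0)"]
      smooth_on_linear_comp[OF assms(1) _ assms(3), of "\<lambda>x. (0, x)"]]
  by (simp add: bounded_linear_Pair bounded_linear_ident bounded_linear_zero)

lemma smooth_on_compose:
  "open S \<Longrightarrow> open T \<Longrightarrow> g ` S \<subseteq> T \<Longrightarrow> smooth_on T f \<Longrightarrow> smooth_on S g \<Longrightarrow> smooth_on S (\<lambda>x. f (g x))"
  unfolding smooth_on_def by (blast intro: Ck_on_compose)

lemma smooth_on_imp_continuous_on: "smooth_on S f \<Longrightarrow> continuous_on S f"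
  unfolding smooth_on_def by (blast intro: Ck_on_imp_continuous_on)

lemma smooth_on_imp_differentiable:
  "open S \<Longrightarrow> smooth_on S f \<Longrightarrow> x \<in> S \<Longrightarrow> f differentiable at x"
  unfolding smooth_on_def using Ck_on.simps(2)[of 0 S f]
  by (simp add: differentiable_on_eq_differentiable_at del: Ck_on.simps)

lemma smooth_on_frechet_derivative:
  "smooth_on S f \<Longrightarrow> smooth_on S (\<lambda>x. frechet_derivative f (at x) v)"
  unfolding smooth_on_def using Ck_on.simps(2)[of _ S f] by (simp del: Ck_on.simps)

text \<open>All orders are obtained at once from a class that is closed under directional
  derivatives. It is applied to the class of holomorphic functions of one and of two
  variables.\<close>

lemma smooth_on_coinduct:
  assumes "open S" "f \<in> \<F>"
    and "\<And>f. f \<in> \<F> \<Longrightarrow> f differentiable_on S"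
    and "\<And>f v. f \<in> \<F> \<Longrightarrow> \<exists>g\<in>\<F>. \<forall>x\<in>S. frechet_derivative f (at x) v = g x"
  shows "smooth_on S f"
proof -
  have "Ck_on n S f" for n
    using assms(2)
  proof (induction n arbitrary: f)
    case 0
    then show ?case using assms(3) differentiable_imp_continuous_on by auto
  next
    case (Suc n)
    have "Ck_on n S (\<lambda>x. frechet_derivative f (at x) v)" for v
    proof -
      obtain g where g: "g \<in> \<F>" "\<forall>x\<in>S. frechet_derivative f (at x) v = g x"
        using assms(4) Suc.prems by blast
      show ?thesis
        by (rule Ck_on_cong[OF assms(1) _ Suc.IH[OF g(1)]]) (use g in auto)
    qed
    then show ?case using assms(3) Suc.prems by simp
  qed
  then show ?thesis by (simp add: smooth_on_def)
qed

lemma holomorphic_on_imp_smooth_on: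
  assumes "open S" "f holomorphic_on S"
  shows "smooth_on S f"
proof (rule smooth_on_coinduct[OF assms(1), of f "{f. f holomorphic_on S}"])
  have D: "(f has_derivative (\<lambda>v. deriv f x * v)) (at x)" if "f holomorphic_on S" "x \<in> S" for f x
    using that assms(1) by (simp add: holomorphic_derivI has_field_derivative_imp_has_derivative)
  show "f differentiable_on S" if "f \<in> {f. f holomorphic_on S}" for f
    using that by (intro differentiable_at_imp_differentiable_on) (metis D differentiableI mem_Collect_eq)
  show "\<exists>g\<in>{f. f holomorphic_on S}. \<forall>x\<in>S. frechet_derivative f (at x) v = g x"
    if "f \<in> {f. f holomorphic_on S}" for f v
  proof (rule bexI)
    show "\<forall>x\<in>S. frechet_derivative f (at x) v = deriv f x * v"
      using that by (simp add: frechet_derivative_at[OF D, symmetric])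
    show "(\<lambda>x. deriv f x * v) \<in> {f. f holomorphic_on S}"
      using that assms(1) by (auto intro!: holomorphic_intros holomorphic_deriv)
  qed
qed (use assms in auto)

subsection \<open>Holomorphic functions of two variables\<close>

text \<open>The real Frechet derivative is required to be complex linear, so that one predicate
  carries joint differentiability and the Cauchy-Riemann equations in both variables.\<close>

definition has_pderivs :: "(complex \<times> complex \<Rightarrow> complex) \<Rightarrow> complex \<Rightarrow> complex \<Rightarrow> complex \<times> complex \<Rightarrow> bool" where
  "has_pderivs f a b x \<longleftrightarrow> (f has_derivative (\<lambda>h. a * fst h + b * snd h)) (at x)"

definition hol2 :: "(complex \<times> complex) set \<Rightarrow> (complex \<times> complex \<Rightarrow> complex) \<Rightarrow> bool" where
  "hol2 S f \<longleftrightarrow> (\<forall>x\<in>S. \<exists>a b. has_pderivs f a b x)"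

definition pd1 :: "(complex \<times> complex \<Rightarrow> complex) \<Rightarrow> complex \<times> complex \<Rightarrow> complex" where
  "pd1 f x = deriv (\<lambda>t. f (t, snd x)) (fst x)"

definition pd2 :: "(complex \<times> complex \<Rightarrow> complex) \<Rightarrow> complex \<times> complex \<Rightarrow> complex" where
  "pd2 f x = deriv (\<lambda>t. f (fst x, t)) (snd x)"

lemma has_pderivs_fst_line:
  assumes "has_pderivs f a b (u, v)"
  shows "((\<lambda>t. f (t, v)) has_field_derivative a) (at u)"
proof -
  have "((\<lambda>t. (t, v)) has_derivative (\<lambda>h. (h, 0))) (at u)"
    by (auto intro!: derivative_eq_intros)
  from has_derivative_compose[OF this, of f "\<lambda>h. a * fst h + b * snd h"] assms
  have "((\<lambda>t. f (t, v)) has_derivative (\<lambda>h. a * h)) (at u)"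
    by (simp add: has_pderivs_def)
  then show ?thesis by (simp add: has_field_derivative_def)
qed

lemma has_pderivs_snd_line:
  assumes "has_pderivs f a b (u, v)"
  shows "((\<lambda>t. f (u, t)) has_field_derivative b) (at v)"
proof -
  have "((\<lambda>t. (u, t)) has_derivative (\<lambda>h. (0, h))) (at v)"
    by (auto intro!: derivative_eq_intros)
  from has_derivative_compose[OF this, of f "\<lambda>h. a * fst h + b * snd h"] assms
  have "((\<lambda>t. f (u, t)) has_derivative (\<lambda>h. b * h)) (at v)"
    by (simp add: has_pderivs_def)
  then show ?thesis by (simp add: has_field_derivative_def)
qed

lemma has_pderivs_pd:
  assumes "has_pderivs f a b x"
  shows "pd1 f x = a" "pd2 f x = b"
  using has_pderivs_fst_line[of f a b "fst x" "snd x"] has_pderivs_snd_line[of f a b "fst x" "snd x"] assms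
  by (auto simp: pd1_def pd2_def intro: DERIV_imp_deriv)

lemma hol2D: "hol2 S f \<Longrightarrow> x \<in> S \<Longrightarrow> has_pderivs f (pd1 f x) (pd2 f x) x"
  unfolding hol2_def using has_pderivs_pd by metis

lemma hol2I: "(\<And>x. x \<in> S \<Longrightarrow> has_pderivs f (a x) (b x) x) \<Longrightarrow> hol2 S f"
  unfolding hol2_def by blast

lemma hol2_subset: "hol2 S f \<Longrightarrow> T \<subseteq> S \<Longrightarrow> hol2 T f"
  unfolding hol2_def by blast

lemma has_pderivs_isCont: "has_pderivs f a b x \<Longrightarrow> isCont f x"
  unfolding has_pderivs_def by (rule has_derivative_continuous)

lemma hol2_imp_continuous_on: "hol2 S f \<Longrightarrow> continuous_on S f"
  unfolding hol2_def using has_pderivs_isCont by (blast intro: continuous_at_imp_continuous_on)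

lemma has_pderivs_const: "has_pderivs (\<lambda>x. c) 0 0 x"
  by (simp add: has_pderivs_def)

lemma has_pderivs_fst: "has_pderivs fst 1 0 x"
  unfolding has_pderivs_def by (auto intro!: derivative_eq_intros)

lemma has_pderivs_snd: "has_pderivs snd 0 1 x"
  unfolding has_pderivs_def by (auto intro!: derivative_eq_intros)

lemma has_pderivs_add:
  "has_pderivs f a b x \<Longrightarrow> has_pderivs g c d x \<Longrightarrow> has_pderivs (\<lambda>x. f x + g x) (a + c) (b + d) x"
  unfolding has_pderivs_def
  by (drule has_derivative_add, assumption) (simp add: algebra_simps)

lemma has_pderivs_diff:
  "has_pderivs f a b x \<Longrightarrow> has_pderivs g c d x \<Longrightarrow> has_pderivs (\<lambda>x. f x - g x) (a - c) (b - d) x"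
  unfolding has_pderivs_def
  by (drule has_derivative_diff, assumption) (simp add: algebra_simps)

lemma has_pderivs_mult:
  "has_pderivs f a b x \<Longrightarrow> has_pderivs g c d x \<Longrightarrow>
    has_pderivs (\<lambda>x. f x * g x) (a * g x + f x * c) (b * g x + f x * d) x"
  unfolding has_pderivs_def
  by (drule has_derivative_mult, assumption) (simp add: algebra_simps)

lemma has_pderivs_field_compose:
  assumes "has_pderivs f a b x" "(\<psi> has_field_derivative c) (at (f x))"
  shows "has_pderivs (\<lambda>x. \<psi> (f x)) (c * a) (c * b) x"
  using has_derivative_compose[OF assms(1)[unfolded has_pderivs_def]
      assms(2)[unfolded has_field_derivative_def]]
  by (simp add: has_pderivs_def algebra_simps)

lemma has_pderivs_compose:
  assumes "has_pderivs f a b (g1 x, g2 x)" "has_pderivs g1 a1 b1 x" "has_pderivs g2 a2 b2 x"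
  shows "has_pderivs (\<lambda>x. f (g1 x, g2 x)) (a * a1 + b * a2) (a * b1 + b * b2) x"
  using has_derivative_compose[OF has_derivative_Pair[OF assms(2,3)[unfolded has_pderivs_def]]
      assms(1)[unfolded has_pderivs_def]]
  by (simp add: has_pderivs_def algebra_simps)

lemma has_pderivs_cong:
  assumes "has_pderivs f a b x" "open S" "x \<in> S" "\<And>y. y \<in> S \<Longrightarrow> f y = g y"
  shows "has_pderivs g a b x"
  using assms has_derivative_transform_within_open unfolding has_pderivs_def by blast

lemma has_pderivs_swap:
  assumes "has_pderivs f a b (v, u)"
  shows "has_pderivs (\<lambda>x. f (snd x, fst x)) b a (u, v)"
  using has_pderivs_compose[of f a b snd "(u, v)" fst 0 1 1 0] assms
  by (simp add: has_pderivs_fst has_pderivs_snd)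

section \<open>Integrals depending holomorphically on parameters\<close>

lemma hol2_integral:
  fixes H :: "complex \<times> complex \<Rightarrow> real \<Rightarrow> complex"
  assumes T: "open T" "convex T"
    and H: "\<And>x t. x \<in> T \<Longrightarrow> t \<in> {0..1} \<Longrightarrow> has_pderivs (\<lambda>x. H x t) (A x t) (B x t) x"
    and cH: "continuous_on (T \<times> {0..1}) (\<lambda>(x, t). H x t)"
    and cA: "continuous_on (T \<times> {0..1}) (\<lambda>(x, t). A x t)"
    and cB: "continuous_on (T \<times> {0..1}) (\<lambda>(x, t). B x t)"
  shows "hol2 T (\<lambda>x. integral {0..1} (H x))"
proof (rule hol2I)
  fix x assume x: "x \<in> T"
  \<comment> \<open>The Leibniz rule takes the derivative of the integrand as a continuous family of
    bounded linear maps; \<open>fx\<close> packs the two partial derivatives in this form.\<close>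
  define fx where "fx \<equiv> \<lambda>x t. (blinfun_mult_right (A x t) o\<^sub>L Blinfun fst) + (blinfun_mult_right (B x t) o\<^sub>L Blinfun snd)"
  have app: "blinfun_apply (fx x t) h = A x t * fst h + B x t * snd h" for x t and h :: "complex \<times> complex"
    by (simp add: fx_def plus_blinfun.rep_eq bounded_linear_Blinfun_apply bounded_linear_fst bounded_linear_snd)
  have c: "continuous_on (T \<times> cbox 0 1) (\<lambda>(x, t). fx x t)"
    using cA cB unfolding fx_def split_beta
    by (auto intro!: continuous_intros bounded_linear_blinfun_mult_right
          bounded_linear.continuous_on[OF bounded_linear_blinfun_mult_right])
  have slice: "continuous_on {0..1} (G x)" if "continuous_on (T \<times> {0..1}) (\<lambda>(x, t). G x t)"
    for G :: "complex \<times> complex \<Rightarrow> real \<Rightarrow> 'z::topological_space"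
    by (rule continuous_on_compose2[OF that, of "{0..1}" "\<lambda>t. (x, t)", simplified])
      (use x in \<open>auto intro!: continuous_intros\<close>)
  have "((\<lambda>x. integral (cbox 0 1) (H x)) has_derivative integral (cbox 0 1) (fx x)) (at x within T)"
  proof (rule leibniz_rule[OF _ _ c x T(2)])
    fix y t assume "y \<in> T" "t \<in> cbox 0 (1::real)"
    then show "((\<lambda>y. H y t) has_derivative blinfun_apply (fx y t)) (at y within T)"
      using H[of y t] unfolding has_pderivs_def
      by (auto simp: app[abs_def] intro: has_derivative_at_withinI)
  next
    fix y assume "y \<in> T"
    have "continuous_on {0..1} (H y)"
      by (rule continuous_on_compose2[OF cH, of "{0..1}" "\<lambda>t. (y, t)", simplified])
        (use \<open>y \<in> T\<close> in \<open>auto intro!: continuous_intros\<close>)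
    then show "H y integrable_on cbox 0 1"
      by (simp add: integrable_continuous_interval)
  qed
  note D = this
  have "blinfun_apply (integral (cbox 0 1) (fx x)) h
      = integral {0..1} (A x) * fst h + integral {0..1} (B x) * snd h" for h
  proof -
    have fi: "fx x integrable_on {0..1}"
      using slice[OF c[simplified]] by (simp add: integrable_continuous_interval)
    have "blinfun_apply (integral {0..1} (fx x)) h = integral {0..1} (\<lambda>t. blinfun_apply (fx x t) h)"
      using integral_linear[OF fi, of "\<lambda>F. blinfun_apply F h"] by (simp add: o_def bounded_linear_intros)
    also have "\<dots> = integral {0..1} (\<lambda>t. A x t * fst h + B x t * snd h)"
      by (simp add: app)
    also have "\<dots> = integral {0..1} (A x) * fst h + integral {0..1} (B x) * snd h"
      using slice[OF cA] slice[OF cB]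
      by (subst integral_add)
        (auto intro!: integrable_continuous_interval continuous_intros)
    finally show ?thesis by simp
  qed
  then have "blinfun_apply (integral (cbox 0 1) (fx x))
      = (\<lambda>h. integral {0..1} (A x) * fst h + integral {0..1} (B x) * snd h)" by (rule ext)
  with D have "((\<lambda>x. integral (cbox 0 1) (H x)) has_derivative
      (\<lambda>h. integral {0..1} (A x) * fst h + integral {0..1} (B x) * snd h)) (at x within T)" by simp
  then show "has_pderivs (\<lambda>x. integral {0..1} (H x)) (integral {0..1} (A x)) (integral {0..1} (B x)) x"
    using at_within_open[OF x T(1)] unfolding has_pderivs_def
    by simp
qed

lemma has_field_derivative_inverse_power:
  fixes c s :: complex
  assumes "c \<noteq> s"
  shows "((\<lambda>w. inverse ((c - w) ^ n)) has_field_derivative of_nat n / (c - s) ^ (n + 1)) (at s)"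
proof -
  define y where "y = c - s"
  have y: "y \<noteq> 0" using assms by (simp add: y_def)
  have "((\<lambda>w. (c - w) ^ n) has_field_derivative of_nat n * (c - s) ^ (n - 1) * (-1)) (at s)"
    by (auto intro!: derivative_eq_intros)
  from DERIV_inverse_fun[OF this] assms
  have "((\<lambda>w. inverse ((c - w) ^ n)) has_field_derivative
      - (inverse (y ^ n) * (of_nat n * y ^ (n - 1) * (-1)) * inverse (y ^ n))) (at s)"
    by (simp add: y_def mult_ac)
  moreover have "- (inverse (y ^ n) * (of_nat n * y ^ (n - 1) * (-1)) * inverse (y ^ n)) = of_nat n / y ^ (n + 1)"
    using y by (cases n) (auto simp: field_simps)
  ultimately show ?thesis by (simp add: y_def)
qed

text \<open>The Cauchy-type transform \<open>(u, w) \<mapsto> \<integral> f (u, z) k z / (m z - w) ^ n dz\<close> over a circle, written as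
  an integral over the unit interval.\<close>

definition ctransform ::
  "complex \<Rightarrow> real \<Rightarrow> (complex \<Rightarrow> complex) \<Rightarrow> (complex \<Rightarrow> complex) \<Rightarrow> nat \<Rightarrow> (complex \<times> complex \<Rightarrow> complex)
     \<Rightarrow> complex \<times> complex \<Rightarrow> complex" where
  "ctransform c r k m n f x = integral {0..1} (\<lambda>t. f (fst x, circlepath c r t) * k (circlepath c r t)
      / (m (circlepath c r t) - snd x) ^ n * vector_derivative (circlepath c r) (at t))"

lemma ctransform_contour_integral:
  "ctransform c r k m n f x = contour_integral (circlepath c r) (\<lambda>z. f (fst x, z) * k z / (m z - snd x) ^ n)"
  by (simp add: ctransform_def contour_integral_integral)

lemma continuous_vector_derivative_circlepath:
  "continuous_on S (\<lambda>t. vector_derivative (circlepath c r) (at t))"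
  unfolding vector_derivative_circlepath by (intro continuous_intros)

lemma ctransform_continuous:
  assumes "0 \<le> r"
    and f: "continuous_on (U \<times> sphere c r) f"
    and k: "continuous_on (sphere c r) k" and m: "continuous_on (sphere c r) m"
    and ne: "\<And>z w. z \<in> sphere c r \<Longrightarrow> w \<in> W \<Longrightarrow> m z \<noteq> w"
  shows "continuous_on (U \<times> W) (ctransform c r k m n f)"
proof -
  have [simp]: "dist c (circlepath c r t) = r" if "0 \<le> t" "t \<le> 1" for t
    using that assms(1) path_image_circlepath_nonneg[OF assms(1), of c] by (auto simp: path_image_def)
  have cp: "continuous_on S (circlepath c r)" for S
    unfolding circlepath by (intro continuous_intros)
  have ne': "m (circlepath c r t) \<noteq> w" if "0 \<le> t" "t \<le> 1" "w \<in> W" for t w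
    using ne[of "circlepath c r t" w] that by simp
  have "continuous_on ((U \<times> W) \<times> cbox 0 1) (\<lambda>(x, t). f (fst x, circlepath c r t) * k (circlepath c r t)
      / (m (circlepath c r t) - snd x) ^ n * vector_derivative (circlepath c r) (at t))"
    unfolding split_beta
    by (intro continuous_intros continuous_on_compose2[OF f] continuous_on_compose2[OF k]
        continuous_on_compose2[OF m] continuous_on_compose2[OF cp]
        continuous_on_compose2[OF continuous_vector_derivative_circlepath]) (auto simp: ne')
  from integral_continuous_on_param[OF this] show ?thesis
    by (simp add: ctransform_def[abs_def])
qed

text \<open>Continuity of the partial derivatives is not part of the definition of \<open>hol2\<close>; it follows from
  Cauchy's formula for the derivative.\<close>

lemma hol2_polydisc:
  assumes "open S" "(u, v) \<in> S"
  obtains r where "r > 0" "cball u r \<times> cball v r \<subseteq> S"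
proof -
  obtain A B where AB: "open A" "open B" "(u, v) \<in> A \<times> B" "A \<times> B \<subseteq> S"
    using open_prod_elim[OF assms] by blast
  obtain r1 where "r1 > 0" "cball u r1 \<subseteq> A" using AB open_contains_cball by blast
  moreover obtain r2 where "r2 > 0" "cball v r2 \<subseteq> B" using AB open_contains_cball by blast
  ultimately have "cball u (min r1 r2) \<times> cball v (min r1 r2) \<subseteq> S" "min r1 r2 > 0"
    using AB by (auto simp: subset_iff)
  then show ?thesis using that by blast
qed

lemma hol2_pd2_eq_ctransform:
  assumes "r > 0" "u \<in> U" "U \<times> cball v r \<subseteq> S" "hol2 S f" "w \<in> ball v r"
  shows "pd2 f (u, w) = 1 / (2 * of_real pi * \<i>) * ctransform v r (\<lambda>_. 1) (\<lambda>z. z) 2 f (u, w)"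
proof -
  have D: "((\<lambda>t. f (u, t)) has_field_derivative pd2 f (u, t)) (at t)" if "t \<in> cball v r" for t
    using hol2D[OF assms(4), of "(u, t)"] that assms has_pderivs_snd_line by blast
  have "(\<lambda>t. f (u, t)) holomorphic_on cball v r"
    using D field_differentiable_def field_differentiable_at_within
    by (metis holomorphic_on_def)
  then have "continuous_on (cball v r) (\<lambda>t. f (u, t))" "(\<lambda>t. f (u, t)) holomorphic_on ball v r"
    using holomorphic_on_imp_continuous_on holomorphic_on_subset ball_subset_cball by blast+
  from Cauchy_derivative_integral_circlepath(2)[OF this assms(5)] D[of w] assms(5)
  show ?thesis
    by (auto simp: ctransform_contour_integral dest: DERIV_unique)
qed

lemma hol2_swap: "hol2 S f \<Longrightarrow> hol2 (prod.swap ` S) (\<lambda>x. f (snd x, fst x))"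
  unfolding hol2_def using has_pderivs_swap by fastforce

lemma pd1_swap: "pd1 f (u, v) = pd2 (\<lambda>x. f (snd x, fst x)) (v, u)"
  by (simp add: pd1_def pd2_def)

lemma open_swap_image: "open S \<Longrightarrow> open (prod.swap ` S)" for S :: "(complex \<times> complex) set"
proof -
  assume "open S"
  moreover have "prod.swap ` S = (\<lambda>x. (snd x, fst x)) -` S" by force
  ultimately show ?thesis
    by (auto intro!: open_vimage continuous_intros)
qed

lemma hol2_continuous_pd2:
  assumes "open S" "hol2 S f"
  shows "continuous_on S (pd2 f)"
proof -
  have "isCont (pd2 f) (u, v)" if uv: "(u, v) \<in> S" for u v
  proof -
    obtain r where r: "r > 0" "cball u r \<times> cball v r \<subseteq> S" by (rule hol2_polydisc[OF assms(1) uv])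
    have "continuous_on (cball u r \<times> ball v r) (ctransform v r (\<lambda>_. 1) (\<lambda>z. z) 2 f)"
      by (rule ctransform_continuous)
        (use r in \<open>auto intro!: continuous_on_subset[OF hol2_imp_continuous_on[OF assms(2)]]
           continuous_intros simp: subset_iff\<close>)
    then have "continuous_on (ball u r \<times> ball v r) (ctransform v r (\<lambda>_. 1) (\<lambda>z. z) 2 f)"
      by (rule continuous_on_subset) auto
    then have "continuous_on (ball u r \<times> ball v r) (pd2 f)"
      using hol2_pd2_eq_ctransform[OF r(1) _ r(2) assms(2)]
      by (subst continuous_on_cong[OF refl, of _ "pd2 f" "\<lambda>x. 1 / (2 * of_real pi * \<i>) * ctransform v r (\<lambda>_. 1) (\<lambda>z. z) 2 f x"])
        (auto intro!: continuous_intros)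
    then show ?thesis
      using r by (auto simp: continuous_on_eq_continuous_at open_Times)
  qed
  then show ?thesis by (auto intro: continuous_at_imp_continuous_on)
qed

lemma hol2_continuous_pd1:
  assumes "open S" "hol2 S f"
  shows "continuous_on S (pd1 f)"
proof -
  have "continuous_on S (\<lambda>x. pd2 (\<lambda>x. f (snd x, fst x)) (snd x, fst x))"
    by (rule continuous_on_compose2[OF hol2_continuous_pd2[OF open_swap_image[OF assms(1)] hol2_swap[OF assms(2)]]])
      (auto intro!: continuous_intros image_eqI)
  then show ?thesis
    by (rule continuous_on_eq) (auto simp: pd1_swap)
qed

text \<open>Differentiation under the integral: the first partial derivative falls on
  \<open>f\<close>, the second on the kernel, whose exponent rises by one. Joint continuity of
  \<open>pd1 f\<close> on the circle, already obtained from Cauchy's formula, makes the Leibniz rule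
  applicable.\<close>

lemma hol2_ctransform:
  assumes "0 \<le> r" "open S" "hol2 S f" "ball u \<rho> \<times> sphere c r \<subseteq> S"
    and k: "continuous_on (sphere c r) k" and m: "continuous_on (sphere c r) m"
    and ne: "\<And>z w. z \<in> sphere c r \<Longrightarrow> w \<in> ball w0 \<rho>' \<Longrightarrow> m z \<noteq> w"
  shows "hol2 (ball u \<rho> \<times> ball w0 \<rho>') (ctransform c r k m n f)"
proof -
  let ?T = "ball u \<rho> \<times> ball w0 \<rho>'" and ?c = "circlepath c r"
  let ?d = "\<lambda>t. vector_derivative ?c (at t)"
  have [simp]: "dist c (?c t) = r" if "0 \<le> t" "t \<le> 1" for t
    using that assms(1) path_image_circlepath_nonneg[OF assms(1), of c] by (auto simp: path_image_def)
  have cp: "continuous_on S (circlepath c r)" for S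
    unfolding circlepath by (intro continuous_intros)
  have ne': "m (?c t) \<noteq> w" if "0 \<le> t" "t \<le> 1" "dist w0 w < \<rho>'" for t w
    using ne[of "?c t" w] that by simp
  have f: "continuous_on (ball u \<rho> \<times> sphere c r) f"
    using hol2_imp_continuous_on[OF assms(3)] assms(4) continuous_on_subset by blast
  have f1: "continuous_on (ball u \<rho> \<times> sphere c r) (pd1 f)"
    using hol2_continuous_pd1[OF assms(2,3)] assms(4) continuous_on_subset by blast
  note ci = continuous_intros continuous_on_compose2[OF f] continuous_on_compose2[OF f1] continuous_on_compose2[OF k]
        continuous_on_compose2[OF m] continuous_on_compose2[OF cp]
        continuous_on_compose2[OF continuous_vector_derivative_circlepath]
  have "hol2 ?T (\<lambda>x. integral {0..1} ((\<lambda>x t. f (fst x, ?c t) * k (?c t) / (m (?c t) - snd x) ^ n * ?d t) x))"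
  proof (rule hol2_integral[where A = "\<lambda>x t. pd1 f (fst x, ?c t) * k (?c t) / (m (?c t) - snd x) ^ n * ?d t"
        and B = "\<lambda>x t. f (fst x, ?c t) * k (?c t) * (of_nat n / (m (?c t) - snd x) ^ (n + 1)) * ?d t"])
    show "open ?T" by (simp add: open_Times)
    show "convex ?T" by (simp add: convex_Times)
    fix x t assume x: "x \<in> ?T" and t: "t \<in> {0..(1::real)}"
    then have xe: "x = (fst x, snd x)" "(fst x, ?c t) \<in> S" "m (?c t) \<noteq> snd x"
      using assms(4) ne[of "?c t" "snd x"] by (auto simp: subset_iff mem_Times_iff)
    have 1: "has_pderivs (\<lambda>x. f (fst x, ?c t)) (pd1 f (fst x, ?c t)) 0 x"
      using has_pderivs_compose[OF _ has_pderivs_fst has_pderivs_const, of f "pd1 f (fst x, ?c t)"]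
        hol2D[OF assms(3) xe(2)] by simp
    have 2: "((\<lambda>w. k (?c t) / (m (?c t) - w) ^ n * ?d t) has_field_derivative
       k (?c t) * (of_nat n / (m (?c t) - snd x) ^ (n + 1)) * ?d t) (at (snd x))"
    proof -
      have "((\<lambda>w. inverse ((m (?c t) - w) ^ n)) has_field_derivative
           of_nat n / (m (?c t) - snd x) ^ (n + 1)) (at (snd x))"
        by (rule has_field_derivative_inverse_power) (rule xe(3))
      from DERIV_cmult[OF this, of "k (?c t) * ?d t"] show ?thesis
        by (simp add: divide_inverse mult_ac)
    qed
    from has_pderivs_mult[OF 1 has_pderivs_field_compose[OF has_pderivs_snd 2]]
    show "has_pderivs (\<lambda>x. f (fst x, ?c t) * k (?c t) / (m (?c t) - snd x) ^ n * ?d t)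
       (pd1 f (fst x, ?c t) * k (?c t) / (m (?c t) - snd x) ^ n * ?d t)
       (f (fst x, ?c t) * k (?c t) * (of_nat n / (m (?c t) - snd x) ^ (n + 1)) * ?d t) x"
      by (simp add: mult_ac)
  next
    show "continuous_on (?T \<times> {0..1}) (\<lambda>(x, t). f (fst x, ?c t) * k (?c t) / (m (?c t) - snd x) ^ n * ?d t)"
      unfolding split_beta by (intro ci; auto simp: ne')
    show "continuous_on (?T \<times> {0..1}) (\<lambda>(x, t). pd1 f (fst x, ?c t) * k (?c t) / (m (?c t) - snd x) ^ n * ?d t)"
      unfolding split_beta by (intro ci; auto simp: ne')
    show "continuous_on (?T \<times> {0..1}) (\<lambda>(x, t). f (fst x, ?c t) * k (?c t) * (of_nat n / (m (?c t) - snd x) ^ (n + 1)) * ?d t)"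
      unfolding split_beta by (intro ci; auto simp: ne')
  qed
  then show ?thesis by (simp add: ctransform_def[abs_def])
qed

text \<open>Locally the derivative is a transform with kernel exponent 2, and such transforms are
  again holomorphic in both variables.\<close>

lemma hol2_pd2:
  assumes "open S" "hol2 S f"
  shows "hol2 S (pd2 f)"
proof -
  have "\<exists>a b. has_pderivs (pd2 f) a b (u, v)" if uv: "(u, v) \<in> S" for u v
  proof -
    obtain r where r: "r > 0" "cball u r \<times> cball v r \<subseteq> S" by (rule hol2_polydisc[OF assms(1) uv])
    have "hol2 (ball u r \<times> ball v r) (ctransform v r (\<lambda>_. 1) (\<lambda>z. z) 2 f)"
      by (rule hol2_ctransform[OF _ assms])
        (use r in \<open>auto intro!: continuous_intros simp: subset_iff\<close>)
    then obtain a b where ab: "has_pderivs (ctransform v r (\<lambda>_. 1) (\<lambda>z. z) 2 f) a b (u, v)"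
      using r unfolding hol2_def by fastforce
    show ?thesis
      using has_pderivs_cong[OF has_pderivs_mult[OF has_pderivs_const[of "1 / (2 * of_real pi * \<i>)"] ab],
          of "ball u r \<times> ball v r" "pd2 f"] hol2_pd2_eq_ctransform[OF r(1) _ r(2) assms(2)] r
      by (intro exI) (auto simp: open_Times)
  qed
  then show ?thesis by (auto simp: hol2_def)
qed

lemma hol2_pd1:
  assumes "open S" "hol2 S f"
  shows "hol2 S (pd1 f)"
proof (rule hol2I)
  fix x assume x: "x \<in> S"
  have "hol2 (prod.swap ` S) (pd2 (\<lambda>x. f (snd x, fst x)))"
    by (intro hol2_pd2 open_swap_image hol2_swap assms)
  from hol2D[OF this, of "(snd x, fst x)"] x
  have "has_pderivs (pd2 (\<lambda>x. f (snd x, fst x))) (pd1 (pd2 (\<lambda>x. f (snd x, fst x))) (snd x, fst x))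
      (pd2 (pd2 (\<lambda>x. f (snd x, fst x))) (snd x, fst x)) (snd x, fst x)"
    by (auto simp: image_iff prod.swap_def)
  note this' = this
  show "has_pderivs (pd1 f) (pd2 (pd2 (\<lambda>x. f (snd x, fst x))) (snd x, fst x))
      (pd1 (pd2 (\<lambda>x. f (snd x, fst x))) (snd x, fst x)) x"
  proof -
    have "(\<lambda>x. pd2 (\<lambda>x. f (snd x, fst x)) (snd x, fst x)) = pd1 f"
      using pd1_swap[of f] by fastforce
    with has_pderivs_swap[OF this'] show ?thesis by simp
  qed
qed

lemma hol2_imp_smooth_on:
  assumes "open S" "hol2 S f"
  shows "smooth_on S f"
proof (rule smooth_on_coinduct[OF assms(1), of f "{f. hol2 S f}"])
  have D: "(f has_derivative (\<lambda>h. pd1 f x * fst h + pd2 f x * snd h)) (at x)" if "hol2 S f" "x \<in> S" for f x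
    using hol2D[OF that] by (simp add: has_pderivs_def)
  show "f differentiable_on S" if "f \<in> {f. hol2 S f}" for f
    using that by (intro differentiable_at_imp_differentiable_on) (metis D differentiableI mem_Collect_eq)
  show "\<exists>g\<in>{f. hol2 S f}. \<forall>x\<in>S. frechet_derivative f (at x) v = g x" if "f \<in> {f. hol2 S f}" for f v
  proof (rule bexI)
    show "\<forall>x\<in>S. frechet_derivative f (at x) v = pd1 f x * fst v + pd2 f x * snd v"
      using that by (simp add: frechet_derivative_at[OF D, symmetric])
    have "hol2 S (pd1 f)" "hol2 S (pd2 f)" using that assms hol2_pd1 hol2_pd2 by auto
    then show "(\<lambda>x. pd1 f x * fst v + pd2 f x * snd v) \<in> {f. hol2 S f}"
      unfolding mem_Collect_eq
      by (intro hol2I) (erule has_pderivs_add[OF has_pderivs_mult[OF hol2D has_pderivs_const]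
            has_pderivs_mult[OF hol2D has_pderivs_const]], assumption+)
  qed
qed (use assms in auto)

subsection \<open>Real holomorphic germs at the origin\<close>

definition cnj2 :: "complex \<times> complex \<Rightarrow> complex \<times> complex" where
  "cnj2 x = (cnj (fst x), cnj (snd x))"

text \<open>Commuting with conjugation encodes real values at real points while all computations
  stay complex. Both conditions are imposed only near the origin, so the functions are treated as
  germs.\<close>

definition rhol :: "(complex \<times> complex \<Rightarrow> complex) \<Rightarrow> bool" where
  "rhol f \<longleftrightarrow> (\<forall>\<^sub>F x in nhds 0. (\<exists>a b. has_pderivs f a b x) \<and> f (cnj2 x) = cnj (f x))"

lemma norm_cnj2 [simp]: "norm (cnj2 x) = norm x"
  by (simp add: cnj2_def norm_prod_def)

lemma cnj2_cnj2 [simp]: "cnj2 (cnj2 x) = x"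
  by (simp add: cnj2_def)

lemma cnj2_0 [simp]: "cnj2 0 = 0"
  by (simp add: cnj2_def zero_prod_def)

lemma bounded_linear_cnj2: "bounded_linear cnj2"
  unfolding cnj2_def
  by (intro bounded_linear_Pair bounded_linear_compose[OF bounded_linear_cnj] bounded_linear_fst bounded_linear_snd)

lemma filterlim_cnj2: "filterlim cnj2 (nhds 0) (nhds 0)"
proof -
  have "isCont cnj2 0" using bounded_linear_cnj2 linear_continuous_at by blast
  then show ?thesis using tendsto_at_iff_tendsto_nhds[of cnj2 0] by (simp add: isCont_def)
qed

lemma has_pderivs_cnj:
  assumes "has_pderivs f a b x"
  shows "has_pderivs (\<lambda>y. cnj (f (cnj2 y))) (cnj a) (cnj b) (cnj2 x)"
proof -
  have "(cnj2 has_derivative cnj2) (at (cnj2 x))"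
    by (rule bounded_linear.has_derivative[OF bounded_linear_cnj2 has_derivative_ident])
  from has_derivative_compose[OF this, of f "\<lambda>h. a * fst h + b * snd h"] assms
  have "((\<lambda>y. f (cnj2 y)) has_derivative (\<lambda>h. a * fst (cnj2 h) + b * snd (cnj2 h))) (at (cnj2 x))"
    by (simp add: has_pderivs_def)
  from bounded_linear.has_derivative[OF bounded_linear_cnj this]
  show ?thesis by (simp add: has_pderivs_def cnj2_def)
qed

lemma rhol_ballE:
  assumes "rhol f"
  obtains e where "e > 0" "hol2 (ball 0 e) f" "\<And>x. x \<in> ball 0 e \<Longrightarrow> f (cnj2 x) = cnj (f x)"
proof -
  obtain e where "e > 0" "\<And>x. dist x 0 < e \<Longrightarrow> (\<exists>a b. has_pderivs f a b x) \<and> f (cnj2 x) = cnj (f x)"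
    using assms unfolding rhol_def eventually_nhds_metric by blast
  then show ?thesis using that[of e] by (auto simp: hol2_def)
qed

lemma rholI_ball:
  assumes "e > 0" "hol2 (ball 0 e) f" "\<And>x. x \<in> ball 0 e \<Longrightarrow> f (cnj2 x) = cnj (f x)"
  shows "rhol f"
  using assms unfolding rhol_def eventually_nhds_metric hol2_def by (intro exI[of _ e]) auto

lemma rhol_has_pderivs: "rhol f \<Longrightarrow> \<forall>\<^sub>F x in nhds 0. has_pderivs f (pd1 f x) (pd2 f x) x"
  unfolding rhol_def by (erule eventually_mono) (use has_pderivs_pd in blast)

lemma rhol_has_pderivs_0: "rhol f \<Longrightarrow> has_pderivs f (pd1 f 0) (pd2 f 0) 0"
  using rhol_has_pderivs eventually_nhds_x_imp_x by blast

lemma rhol_cnj: "rhol f \<Longrightarrow> \<forall>\<^sub>F x in nhds 0. f (cnj2 x) = cnj (f x)"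
  unfolding rhol_def by (erule eventually_mono) blast

lemma rhol_tendsto: "rhol f \<Longrightarrow> (f \<longlongrightarrow> f 0) (nhds 0)"
  using has_pderivs_isCont[OF rhol_has_pderivs_0] by (simp add: isCont_def tendsto_at_iff_tendsto_nhds)

lemma rhol_tendsto_Pair:
  assumes "rhol f" "rhol g" "f 0 = 0" "g 0 = 0"
  shows "((\<lambda>x. (f x, g x)) \<longlongrightarrow> 0) (nhds 0)"
  using tendsto_Pair[OF rhol_tendsto[OF assms(1)] rhol_tendsto[OF assms(2)]] assms(3,4)
  by (simp add: zero_prod_def)

lemma rhol_eventually_compose:
  assumes "\<forall>\<^sub>F x in nhds 0. P x" "rhol f" "rhol g" "f 0 = 0" "g 0 = 0"
  shows "\<forall>\<^sub>F x in nhds 0. P (f x, g x)"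
  using eventually_compose_filterlim[OF assms(1) rhol_tendsto_Pair[OF assms(2-)]] .

lemma rhol_eventually_ne:
  assumes "rhol f" "f 0 \<noteq> 0"
  shows "\<forall>\<^sub>F x in nhds 0. f x \<noteq> 0"
  using tendsto_imp_eventually_ne[OF rhol_tendsto[OF assms(1)]] assms(2) by blast

lemma rhol_real: "rhol f \<Longrightarrow> cnj (f 0) = f 0"
  using eventually_nhds_x_imp_x[OF rhol_cnj] by fastforce

lemma rhol_const: "cnj c = c \<Longrightarrow> rhol (\<lambda>x. c)"
  unfolding rhol_def using has_pderivs_const by (intro always_eventually allI conjI exI) auto

lemma rhol_fst: "rhol fst"
  unfolding rhol_def using has_pderivs_fst by (intro always_eventually) (auto simp: cnj2_def)

lemma rhol_snd: "rhol snd"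
  unfolding rhol_def using has_pderivs_snd by (intro always_eventually) (auto simp: cnj2_def)

lemma rhol_add:
  assumes "rhol f" "rhol g"
  shows "rhol (\<lambda>x. f x + g x)"
  using assms unfolding rhol_def by eventually_elim (auto dest: has_pderivs_add)

lemma rhol_diff:
  assumes "rhol f" "rhol g"
  shows "rhol (\<lambda>x. f x - g x)"
  using assms unfolding rhol_def by eventually_elim (auto dest: has_pderivs_diff)

lemma rhol_mult:
  assumes "rhol f" "rhol g"
  shows "rhol (\<lambda>x. f x * g x)"
  using assms unfolding rhol_def by eventually_elim (auto dest: has_pderivs_mult)

lemma rhol_power: "rhol f \<Longrightarrow> rhol (\<lambda>x. f x ^ n)"
  by (induction n) (simp_all add: rhol_const rhol_mult)

lemma rhol_field_compose:
  assumes "rhol f" "\<forall>\<^sub>F z in nhds (f 0). \<psi> field_differentiable (at z) \<and> \<psi> (cnj z) = cnj (\<psi> z)"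
  shows "rhol (\<lambda>x. \<psi> (f x))"
  using assms(1)[unfolded rhol_def] eventually_compose_filterlim[OF assms(2) rhol_tendsto[OF assms(1)]]
  unfolding rhol_def
  by eventually_elim (auto simp: field_differentiable_def dest: has_pderivs_field_compose)

lemma rhol_inverse:
  assumes "rhol f" "f 0 \<noteq> 0"
  shows "rhol (\<lambda>x. inverse (f x))"
proof (rule rhol_field_compose[OF assms(1)])
  show "\<forall>\<^sub>F z in nhds (f 0). inverse field_differentiable (at z) \<and> inverse (cnj z) = cnj (inverse z)"
    using t1_space_nhds[OF assms(2)]
    by eventually_elim (auto simp: field_differentiable_def intro: DERIV_inverse)
qed

lemma rhol_divide: "rhol f \<Longrightarrow> rhol g \<Longrightarrow> g 0 \<noteq> 0 \<Longrightarrow> rhol (\<lambda>x. f x / g x)"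
  unfolding divide_inverse by (intro rhol_mult rhol_inverse)

text \<open>The principal logarithm commutes with conjugation off the closed negative axis;
  positivity of the value at the origin keeps \<open>f\<close> away from that axis.\<close>

lemma rhol_pos_power:
  assumes "rhol f" "f 0 = of_real c" "c > 0" "n > 0"
  shows "rhol (\<lambda>x. exp (Ln (f x) / of_nat n))"
proof (rule rhol_field_compose[OF assms(1)])
  have "f 0 \<notin> \<real>\<^sub>\<le>\<^sub>0" using assms by simp
  then have "\<forall>\<^sub>F z in nhds (f 0). z \<in> - \<real>\<^sub>\<le>\<^sub>0"
    by (intro eventually_nhds_in_open) (auto simp: closed_Compl open_Compl)
  then show "\<forall>\<^sub>F z in nhds (f 0). (\<lambda>z. exp (Ln z / of_nat n)) field_differentiable (at z) \<and>
     exp (Ln (cnj z) / of_nat n) = cnj (exp (Ln z / of_nat n))"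
  proof eventually_elim
    case (elim z)
    have "((\<lambda>z. exp (Ln z / of_nat n)) has_field_derivative exp (Ln z / of_nat n) * (inverse z / of_nat n)) (at z)"
      using elim assms(4) by (auto intro!: derivative_eq_intros simp: field_simps)
    then show ?case
      using elim by (auto simp: field_differentiable_def exp_cnj cnj_Ln[symmetric])
  qed
qed

lemma rhol_compose:
  assumes "rhol f" "rhol g1" "rhol g2" "g1 0 = 0" "g2 0 = 0"
  shows "rhol (\<lambda>x. f (g1 x, g2 x))"
  using rhol_eventually_compose[OF assms(1)[unfolded rhol_def] assms(2-)]
    assms(2)[unfolded rhol_def] assms(3)[unfolded rhol_def]
  unfolding rhol_def
proof eventually_elim
  case (elim x)
  have "f (g1 (cnj2 x), g2 (cnj2 x)) = f (cnj2 (g1 x, g2 x))" using elim by (simp add: cnj2_def)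
  then show ?case using elim by (auto dest: has_pderivs_compose)
qed

lemma rhol_pd:
  assumes "rhol f"
  shows "rhol (pd1 f)" "rhol (pd2 f)"
proof -
  obtain e where e: "e > 0" "hol2 (ball 0 e) f" "\<And>x. x \<in> ball 0 e \<Longrightarrow> f (cnj2 x) = cnj (f x)"
    by (rule rhol_ballE[OF assms]) blast
  have c: "pd1 f (cnj2 x) = cnj (pd1 f x) \<and> pd2 f (cnj2 x) = cnj (pd2 f x)" if "x \<in> ball 0 e" for x
  proof -
    have "cnj2 x \<in> ball 0 e" using that by simp
    moreover have "cnj (f (cnj2 y)) = f y" if "y \<in> ball 0 e" for y using e(3)[OF that] by simp
    ultimately have "has_pderivs f (cnj (pd1 f x)) (cnj (pd2 f x)) (cnj2 x)"
      using has_pderivs_cong[OF has_pderivs_cnj[OF hol2D[OF e(2) that]] open_ball] by blast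
    then show ?thesis using has_pderivs_pd by blast
  qed
  show "rhol (pd1 f)" "rhol (pd2 f)"
    using rholI_ball[OF e(1) hol2_pd1[OF open_ball e(2)]] rholI_ball[OF e(1) hol2_pd2[OF open_ball e(2)]] c
    by blast+
qed

text \<open>Functions built by Cauchy integrals are holomorphic, but their reality is not apparent.
  Averaging with the reflected function enforces it and preserves every linear identity whose other
  terms are real.\<close>

lemma rhol_symmetrize:
  assumes "\<forall>\<^sub>F x in nhds 0. \<exists>a b. has_pderivs k a b x"
  shows "rhol (\<lambda>x. (k x + cnj (k (cnj2 x))) / 2)"
  using assms eventually_compose_filterlim[OF assms filterlim_cnj2] unfolding rhol_def
proof eventually_elim
  case (elim x)
  then obtain a b c d where "has_pderivs k a b x" "has_pderivs k c d (cnj2 x)" by blast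
  from has_pderivs_mult[OF has_pderivs_const[of "1 / 2"] has_pderivs_add[OF this(1) has_pderivs_cnj[OF this(2), unfolded cnj2_cnj2]]]
  show ?case by (auto simp: add.commute)
qed

section \<open>Division by a variable and even-odd splitting by Cauchy integrals\<close>

lemma Cauchy_circle_0:
  assumes "e > 0" "hol2 (ball 0 e) f"
  obtains r where "r > 0" "ball 0 r \<times> cball 0 r \<subseteq> ball (0 :: complex \<times> complex) e"
    "\<And>u v. u \<in> ball 0 r \<Longrightarrow> v \<in> ball 0 r \<Longrightarrow>
      ((\<lambda>z. f (u, z) / (z - v)) has_contour_integral (2 * of_real pi * \<i> * f (u, v))) (circlepath 0 r)"
proof -
  have "(0, 0) \<in> ball (0 :: complex \<times> complex) e" using assms(1) by (simp add: zero_prod_def[symmetric])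
  then obtain r where r: "r > 0" "cball 0 r \<times> cball 0 r \<subseteq> ball (0 :: complex \<times> complex) e"
    by (rule hol2_polydisc[OF open_ball])
  have "((\<lambda>z. f (u, z) / (z - v)) has_contour_integral (2 * of_real pi * \<i> * f (u, v))) (circlepath 0 r)"
    if "u \<in> ball 0 r" "v \<in> ball 0 r" for u v
  proof (rule Cauchy_integral_circlepath_simple)
    have "(\<lambda>z. f (u, z)) field_differentiable (at z)" if "z \<in> cball 0 r" for z
    proof -
      have "(u, z) \<in> ball 0 e" using r(2) that \<open>u \<in> ball 0 r\<close> by (auto simp: subset_iff)
      from has_pderivs_snd_line[OF hol2D[OF assms(2) this]] show ?thesis
        unfolding field_differentiable_def by blast
    qed
    then show "(\<lambda>z. f (u, z)) holomorphic_on cball 0 r"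
      by (simp add: holomorphic_on_def field_differentiable_at_within)
  qed (use that in simp)
  moreover have "ball 0 r \<times> cball 0 r \<subseteq> ball (0 :: complex \<times> complex) e"
    using r(2) ball_subset_cball by blast
  ultimately show ?thesis using that[OF r(1)] by blast
qed

lemma eventually_polydisc:
  assumes "r > 0" "s > 0"
  shows "\<forall>\<^sub>F x in nhds (0 :: complex \<times> complex). fst x \<in> ball 0 r \<and> snd x \<in> ball 0 s"
  using eventually_nhds_in_open[of "ball 0 r \<times> ball 0 s" "0 :: complex \<times> complex"] assms
  by (simp add: open_Times zero_prod_def mem_Times_iff)

lemma eventually_cnj2: "eventually P (nhds 0) \<Longrightarrow> \<forall>\<^sub>F x in nhds 0. P (cnj2 x)"
  by (rule eventually_compose_filterlim[OF _ filterlim_cnj2])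

text \<open>Hadamard division from Cauchy's formula: the kernel identity
  \<open>1 / (z - v) - 1 / z = v / (z * (z - v))\<close> exhibits the factor \<open>v\<close> of
  \<open>f (u, v) - f (u, 0)\<close> and leaves a transform as quotient.\<close>

lemma rhol_divide_snd:
  assumes "rhol f" "\<forall>\<^sub>F u in nhds 0. f (u, 0) = 0"
  shows "\<exists>k. rhol k \<and> (\<forall>\<^sub>F x in nhds 0. f x = snd x * k x)"
proof -
  obtain e where e: "e > 0" "hol2 (ball 0 e) f" "\<And>x. x \<in> ball 0 e \<Longrightarrow> f (cnj2 x) = cnj (f x)"
    by (rule rhol_ballE[OF assms(1)]) blast
  obtain r where r: "r > 0" "ball 0 r \<times> cball 0 r \<subseteq> ball (0 :: complex \<times> complex) e"
    "\<And>u v. u \<in> ball 0 r \<Longrightarrow> v \<in> ball 0 r \<Longrightarrow>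
      ((\<lambda>z. f (u, z) / (z - v)) has_contour_integral (2 * of_real pi * \<i> * f (u, v))) (circlepath 0 r)"
    by (rule Cauchy_circle_0[OF e(1,2)]) blast
  define k0 where "k0 = (\<lambda>x. 1 / (2 * of_real pi * \<i>) * ctransform 0 r inverse (\<lambda>z. z) 1 f x)"
  have "hol2 (ball 0 r \<times> ball 0 r) (ctransform 0 r inverse (\<lambda>z. z) 1 f)"
    by (rule hol2_ctransform[OF _ open_ball e(2)]) (use r in \<open>auto intro!: continuous_intros\<close>)
  then have "\<exists>a b. has_pderivs k0 a b x" if "x \<in> ball 0 r \<times> ball 0 r" for x
    using that has_pderivs_mult[OF has_pderivs_const] unfolding hol2_def k0_def by blast
  then have k0: "\<forall>\<^sub>F x in nhds 0. \<exists>a b. has_pderivs k0 a b x"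
    using eventually_polydisc[OF r(1) r(1)] by (auto elim!: eventually_mono simp: mem_Times_iff)
  have "f x - f (fst x, 0) = snd x * k0 x" if "fst x \<in> ball 0 r" "snd x \<in> ball 0 r" for x
  proof -
    obtain u v where x: "x = (u, v)" by (cases x)
    note uv = that[unfolded x fst_conv snd_conv]
    have h: "((\<lambda>z. f (u, z) / (z - v) - f (u, z) / (z - 0)) has_contour_integral
        (2 * of_real pi * \<i> * f (u, v) - 2 * of_real pi * \<i> * f (u, 0))) (circlepath 0 r)"
      using r(1) uv by (intro has_contour_integral_diff r(3)) auto
    have "contour_integral (circlepath 0 r) (\<lambda>z. v * (f (u, z) * inverse z / (z - v)))
        = contour_integral (circlepath 0 r) (\<lambda>z. f (u, z) / (z - v) - f (u, z) / (z - 0))"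
    proof (rule contour_integral_cong[OF refl])
      fix z assume "z \<in> path_image (circlepath 0 r)"
      then have "z \<noteq> 0" "z \<noteq> v" using r(1) uv by auto
      then show "v * (f (u, z) * inverse z / (z - v)) = f (u, z) / (z - v) - f (u, z) / (z - 0)"
        by (simp add: field_simps)
    qed
    also have "\<dots> = 2 * of_real pi * \<i> * (f (u, v) - f (u, 0))"
      using contour_integral_unique[OF h] by (simp add: algebra_simps)
    also have "contour_integral (circlepath 0 r) (\<lambda>z. v * (f (u, z) * inverse z / (z - v)))
        = v * ctransform 0 r inverse (\<lambda>z. z) 1 f x"
      unfolding ctransform_def contour_integral_integral x
      by (subst integral_mult_right[symmetric]) (simp add: mult_ac)
    finally show ?thesis by (simp add: x k0_def field_simps)
  qed
  then have eq: "\<forall>\<^sub>F x in nhds 0. f x - f (fst x, 0) = snd x * k0 x"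
    using eventually_polydisc[OF r(1) r(1)] by (auto elim!: eventually_mono)
  have "filterlim fst (nhds 0) (nhds (0 :: complex \<times> complex))"
    using rhol_tendsto[OF rhol_fst] by simp
  from eventually_compose_filterlim[OF assms(2) this] eq
  have eq': "\<forall>\<^sub>F x in nhds 0. f x = snd x * k0 x"
    by eventually_elim simp
  \<comment> \<open>Conjugating the identity at the reflected point shows that the reflected
    quotient serves equally well, since \<open>f\<close> itself is real; hence so does the
    average.\<close>
  define k where "k = (\<lambda>x. (k0 x + cnj (k0 (cnj2 x))) / 2)"
  have "\<forall>\<^sub>F x in nhds 0. f x = snd x * k x"
    using eq' eventually_cnj2[OF eq'] rhol_cnj[OF assms(1)]
  proof eventually_elim
    case (elim x)
    have "cnj (f (cnj2 x)) = snd x * cnj (k0 (cnj2 x))" using elim(2) by (simp add: cnj2_def)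
    then have "f x = snd x * cnj (k0 (cnj2 x))" using elim(3) by simp
    then show ?case using elim(1) by (simp add: k_def field_simps)
  qed
  moreover have "rhol k" unfolding k_def by (rule rhol_symmetrize[OF k0])
  ultimately show ?thesis by blast
qed

lemma average:
  fixes f :: complex
  assumes "f = a + v * b" "f = c + v * d"
  shows "f = (a + c) / 2 + v * ((b + d) / 2)"
proof -
  have "f + f = (a + v * b) + (c + v * d)"
    by (rule arg_cong2[OF assms, of "(+)"])
  then show ?thesis by (simp add: algebra_simps add_divide_distrib[symmetric])
qed

text \<open>The kernel splits as \<open>1 / (z - v) = z / (z^2 - v^2) + v / (z^2 - v^2)\<close>.
  Both fractions see \<open>v\<close> only through its square, so the coefficient functions are
  transforms in the variable \<open>v^2\<close>. This is the analytic counterpart of Whitney's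
  theorem on even functions.\<close>

lemma rhol_even_odd:
  assumes "rhol f"
  shows "\<exists>K0 K1. rhol K0 \<and> rhol K1 \<and>
    (\<forall>\<^sub>F x in nhds 0. f x = K0 (fst x, (snd x)\<^sup>2) + snd x * K1 (fst x, (snd x)\<^sup>2))"
proof -
  obtain e where e: "e > 0" "hol2 (ball 0 e) f" "\<And>x. x \<in> ball 0 e \<Longrightarrow> f (cnj2 x) = cnj (f x)"
    by (rule rhol_ballE[OF assms(1)]) blast
  obtain r where r: "r > 0" "ball 0 r \<times> cball 0 r \<subseteq> ball (0 :: complex \<times> complex) e"
    "\<And>u v. u \<in> ball 0 r \<Longrightarrow> v \<in> ball 0 r \<Longrightarrow>
      ((\<lambda>z. f (u, z) / (z - v)) has_contour_integral (2 * of_real pi * \<i> * f (u, v))) (circlepath 0 r)"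
    by (rule Cauchy_circle_0[OF e(1,2)]) blast
  define T where "T = (\<lambda>k. ctransform 0 r k (\<lambda>z. z\<^sup>2) 1 f)"
  define A where "A = (\<lambda>k x. 1 / (2 * of_real pi * \<i>) * T k x)"
  \<comment> \<open>On the circle of radius \<open>r\<close> the square of \<open>z\<close> has
    modulus exactly \<open>r^2\<close>, so the second variable of the transform may range over the
    ball of that radius.\<close>
  have ne: "z\<^sup>2 \<noteq> w" if "z \<in> sphere 0 r" "w \<in> ball 0 (r\<^sup>2)" for z w :: complex
    using that by (auto simp: norm_power)
  have T: "hol2 (ball 0 r \<times> ball 0 (r\<^sup>2)) (T k)" if "continuous_on (sphere 0 r) k" for k
    unfolding T_def
    by (rule hol2_ctransform[OF _ open_ball e(2)]) (use r ne that in \<open>auto intro!: continuous_intros\<close>)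
  have r2: "r\<^sup>2 > 0" using r(1) by simp
  have A: "\<forall>\<^sub>F x in nhds 0. \<exists>a b. has_pderivs (A k) a b x" if "continuous_on (sphere 0 r) k" for k
  proof -
    have "\<exists>a b. has_pderivs (A k) a b x" if x: "x \<in> ball 0 r \<times> ball 0 (r\<^sup>2)" for x
      using T[OF \<open>continuous_on (sphere 0 r) k\<close>] x has_pderivs_mult[OF has_pderivs_const]
      unfolding hol2_def A_def by blast
    then show ?thesis
      using eventually_polydisc[OF r(1) r2] by (auto elim!: eventually_mono simp: mem_Times_iff)
  qed
  have A0: "\<forall>\<^sub>F x in nhds 0. \<exists>a b. has_pderivs (A (\<lambda>z. z)) a b x" and
    A1: "\<forall>\<^sub>F x in nhds 0. \<exists>a b. has_pderivs (A (\<lambda>z. 1)) a b x"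
    by (intro A continuous_intros)+
  have "f x = A (\<lambda>z. z) (fst x, (snd x)\<^sup>2) + snd x * A (\<lambda>z. 1) (fst x, (snd x)\<^sup>2)"
    if "fst x \<in> ball 0 r" "snd x \<in> ball 0 r" for x
  proof -
    obtain u v where x: "x = (u, v)" by (cases x)
    note uv = that[unfolded x fst_conv snd_conv]
    have ne': "z\<^sup>2 \<noteq> v\<^sup>2" if "z \<in> sphere 0 r" for z
      using that uv by (intro ne) (auto simp: norm_power intro: power_strict_mono)
    have int: "(\<lambda>z. f (u, z) * k z / (z\<^sup>2 - v\<^sup>2)) contour_integrable_on circlepath 0 r"
      if "continuous_on (sphere 0 r) k" for k
      using that r uv ne'
      by (intro contour_integrable_continuous_circlepath continuous_intros
           continuous_on_compose2[OF hol2_imp_continuous_on[OF e(2)]]) (auto simp: subset_iff)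
    have "2 * of_real pi * \<i> * f (u, v) = contour_integral (circlepath 0 r) (\<lambda>z. f (u, z) / (z - v))"
      using contour_integral_unique[OF r(3)[OF uv]] by simp
    also have "\<dots> = contour_integral (circlepath 0 r)
        (\<lambda>z. f (u, z) * z / (z\<^sup>2 - v\<^sup>2) + v * (f (u, z) * 1 / (z\<^sup>2 - v\<^sup>2)))"
    proof (rule contour_integral_cong[OF refl])
      fix z assume "z \<in> path_image (circlepath 0 r)"
      then have *: "z\<^sup>2 \<noteq> v\<^sup>2" using ne' r(1) by auto
      then have "z - v \<noteq> 0" "z + v \<noteq> 0" "z\<^sup>2 - v\<^sup>2 = (z - v) * (z + v)"
        by (auto simp: power2_eq_square algebra_simps eq_neg_iff_add_eq_0[symmetric])
      then show "f (u, z) / (z - v) = f (u, z) * z / (z\<^sup>2 - v\<^sup>2) + v * (f (u, z) * 1 / (z\<^sup>2 - v\<^sup>2))"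
        by (simp add: divide_simps) (simp add: algebra_simps)
    qed
    also have "\<dots> = T (\<lambda>z. z) (u, v\<^sup>2) + v * T (\<lambda>z. 1) (u, v\<^sup>2)"
      unfolding T_def ctransform_contour_integral fst_conv snd_conv power_one_right
      by (subst contour_integral_add, (intro int contour_integrable_lmul continuous_intros)+,
          subst contour_integral_lmul, intro int continuous_intros, rule refl)
    finally show ?thesis by (simp add: x A_def field_simps)
  qed
  then have eq: "\<forall>\<^sub>F x in nhds 0. f x = A (\<lambda>z. z) (fst x, (snd x)\<^sup>2) + snd x * A (\<lambda>z. 1) (fst x, (snd x)\<^sup>2)"
    using eventually_polydisc[OF r(1) r(1)] by (auto elim!: eventually_mono)
  define K where "K = (\<lambda>k x. (A k x + cnj (A k (cnj2 x))) / 2)"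
  have "\<forall>\<^sub>F x in nhds 0. f x = K (\<lambda>z. z) (fst x, (snd x)\<^sup>2) + snd x * K (\<lambda>z. 1) (fst x, (snd x)\<^sup>2)"
    using eq eventually_cnj2[OF eq] rhol_cnj[OF assms(1)]
  proof eventually_elim
    case (elim x)
    have "f x = cnj (A (\<lambda>z. z) (cnj2 (fst x, (snd x)\<^sup>2))) + snd x * cnj (A (\<lambda>z. 1) (cnj2 (fst x, (snd x)\<^sup>2)))"
      using arg_cong[OF elim(2), of cnj] elim(3) by (simp add: cnj2_def)
    with elim(1) show ?case unfolding K_def by (rule average)
  qed
  moreover have "rhol (K (\<lambda>z. z))" "rhol (K (\<lambda>z. 1))"
    unfolding K_def by (rule rhol_symmetrize[OF A0], rule rhol_symmetrize[OF A1])
  ultimately show ?thesis by blast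
qed

text \<open>The inverse function theorem over the reals supplies the inverse. It is holomorphic
  because its derivative is the inverse of a complex linear map, and it is real because conjugating
  it gives an inverse of the same map, which local uniqueness identifies with it.\<close>

theorem rhol_inverse_function:
  assumes f: "rhol f1" "rhol f2" "f1 0 = 0" "f2 0 = 0"
    and det: "pd1 f1 0 * pd2 f2 0 - pd2 f1 0 * pd1 f2 0 \<noteq> 0"
  shows "\<exists>g1 g2. rhol g1 \<and> rhol g2 \<and> g1 0 = 0 \<and> g2 0 = 0 \<and>
    (\<forall>\<^sub>F y in nhds 0. f1 (g1 y, g2 y) = fst y \<and> f2 (g1 y, g2 y) = snd y) \<and>
    (\<forall>\<^sub>F x in nhds 0. g1 (f1 x, f2 x) = fst x \<and> g2 (f1 x, f2 x) = snd x)"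
proof -
  obtain e1 where e1: "e1 > 0" "hol2 (ball 0 e1) f1" "\<And>x. x \<in> ball 0 e1 \<Longrightarrow> f1 (cnj2 x) = cnj (f1 x)"
    by (rule rhol_ballE[OF f(1)]) blast
  obtain e2 where e2: "e2 > 0" "hol2 (ball 0 e2) f2" "\<And>x. x \<in> ball 0 e2 \<Longrightarrow> f2 (cnj2 x) = cnj (f2 x)"
    by (rule rhol_ballE[OF f(2)]) blast
  define U where "U = ball (0 :: complex \<times> complex) (min e1 e2)"
  have U: "open U" "0 \<in> U" using e1 e2 by (auto simp: U_def)
  have h: "hol2 U f1" "hol2 U f2"
    using e1 e2 by (auto simp: U_def intro: hol2_subset)
  define F where "F = (\<lambda>x. (f1 x, f2 x))"
  define L where "L = (\<lambda>x h. (pd1 f1 x * fst h + pd2 f1 x * snd h, pd1 f2 x * fst h + pd2 f2 x * snd h))"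
  have bl: "bounded_linear (L x)" for x
    unfolding L_def
    by (intro bounded_linear_Pair bounded_linear_add bounded_linear_compose[OF bounded_linear_mult_right]
        bounded_linear_fst bounded_linear_snd)
  define F' where "F' = (\<lambda>x. Blinfun (L x))"
  have F'[simp]: "blinfun_apply (F' x) = L x" for x
    by (simp add: F'_def bounded_linear_Blinfun_apply[OF bl])
  have derF: "(F has_derivative blinfun_apply (F' x)) (at x)" if "x \<in> U" for x
    using hol2D[OF h(1) that] hol2D[OF h(2) that] unfolding F' L_def F_def has_pderivs_def
    by (intro has_derivative_Pair)
  have contF: "continuous_on U F'"
    by (rule continuous_on_blinfun_componentwise)
      (auto simp: L_def intro!: continuous_intros hol2_continuous_pd1 hol2_continuous_pd2 U h)
  define d where "d = pd1 f1 0 * pd2 f2 0 - pd2 f1 0 * pd1 f2 0"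
  define i where "i = inverse d"
  have id: "i * d = 1" using det by (simp add: i_def d_def)
  define I where "I = (\<lambda>k. ((i * pd2 f2 0) * fst k + (- i * pd2 f1 0) * snd k, (- i * pd1 f2 0) * fst k + (i * pd1 f1 0) * snd k))"
  have blI: "bounded_linear I"
    unfolding I_def
    by (intro bounded_linear_Pair bounded_linear_add bounded_linear_compose[OF bounded_linear_mult_right]
        bounded_linear_fst bounded_linear_snd)
  have "I (L 0 k) = k" for k
  proof -
    have "fst (I (L 0 k)) = (i * d) * fst k" "snd (I (L 0 k)) = (i * d) * snd k"
      by (simp_all add: I_def L_def d_def algebra_simps)
    then show ?thesis using id by (simp add: prod_eq_iff)
  qed
  then have inv: "Blinfun I o\<^sub>L F' 0 = id_blinfun"
    by (intro blinfun_eqI) (simp add: bounded_linear_Blinfun_apply[OF blI])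
  obtain U' V g g' where UV: "open U'" "U' \<subseteq> U" "0 \<in> U'" "open V" "F 0 \<in> V" "homeomorphism U' V F g"
    "\<And>y. y \<in> V \<Longrightarrow> (g has_derivative (g' y)) (at y)"
    "\<And>y. y \<in> V \<Longrightarrow> g' y = inv (blinfun_apply (F' (g y)))"
    "\<And>y. y \<in> V \<Longrightarrow> bij (blinfun_apply (F' (g y)))"
    by (rule inverse_function_theorem[OF U(1) derF contF U(2) inv]) blast+
  have F0: "F 0 = 0" using f by (simp add: F_def zero_prod_def)
  have gF: "g (F x) = x" if "x \<in> U'" for x using UV(6) that by (simp add: homeomorphism_def)
  have Fg: "F (g y) = y" if "y \<in> V" for y using UV(6) that by (simp add: homeomorphism_def)
  have g0: "g 0 = 0" using gF[OF UV(3)] F0 by simp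
  have V0: "0 \<in> V" using UV(5) F0 by simp
  have evV: "\<forall>\<^sub>F y in nhds 0. y \<in> V" using UV(4) V0 eventually_nhds_in_open by blast
  have evU: "\<forall>\<^sub>F x in nhds 0. x \<in> U'" using UV(1,3) eventually_nhds_in_open by blast
  have pg: "\<exists>a b. has_pderivs (\<lambda>y. fst (g y)) a b y" "\<exists>a b. has_pderivs (\<lambda>y. snd (g y)) a b y"
    if y: "y \<in> V" for y
  proof -
    define M where "M = L (g y)"
    have b: "bij M" using UV(9)[OF y] by (simp add: M_def)
    have MM: "M (inv M k) = k" for k using b by (simp add: bij_is_surj surj_f_inv_f)
    obtain a1 a2 where a: "inv M (1, 0) = (a1, a2)" by (cases "inv M (1, 0)")
    obtain b1 b2 where b': "inv M (0, 1) = (b1, b2)" by (cases "inv M (0, 1)")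
    have lin: "M (s * a1 + t * b1, s * a2 + t * b2)
      = (s * fst (M (a1, a2)) + t * fst (M (b1, b2)), s * snd (M (a1, a2)) + t * snd (M (b1, b2)))" for s t
      by (simp add: M_def L_def algebra_simps)
    \<comment> \<open>Complex linearity of the inverse: the candidate determined by the images of
      the two unit vectors is mapped by \<open>M\<close> to \<open>k\<close>, and \<open>M\<close>
      is bijective.\<close>
    have "inv M k = (fst k * a1 + snd k * b1, fst k * a2 + snd k * b2)" for k
    proof -
      have "M (fst k * a1 + snd k * b1, fst k * a2 + snd k * b2) = k"
        using MM[of "(1, 0)"] MM[of "(0, 1)"] unfolding lin a b' by simp
      then show ?thesis using b by (metis bij_inv_eq_iff)
    qed
    then have "inv M = (\<lambda>k. (a1 * fst k + b1 * snd k, a2 * fst k + b2 * snd k))"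
      by (simp add: fun_eq_iff mult.commute)
    then have "(g has_derivative (\<lambda>k. (a1 * fst k + b1 * snd k, a2 * fst k + b2 * snd k))) (at y)"
      using UV(7,8)[OF y] by (simp add: M_def)
    from has_derivative_fst[OF this] has_derivative_snd[OF this]
    show "\<exists>a b. has_pderivs (\<lambda>y. fst (g y)) a b y" "\<exists>a b. has_pderivs (\<lambda>y. snd (g y)) a b y"
      unfolding has_pderivs_def by auto
  qed
  have "(g \<longlongrightarrow> g 0) (nhds 0)"
    using has_derivative_continuous[OF UV(7)[OF V0]] by (simp add: isCont_def tendsto_at_iff_tendsto_nhds)
  then have gl: "filterlim g (nhds 0) (nhds 0)" by (simp add: g0)
  \<comment> \<open>All four points involved must lie in the neighbourhoods where \<open>F\<close>
    and \<open>g\<close> are mutually inverse; then \<open>F\<close> sends \<open>cnj2 (g y)\<close>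
    to \<open>cnj2 y\<close>, and applying \<open>g\<close> gives the claim.\<close>
  have sym: "\<forall>\<^sub>F y in nhds 0. g (cnj2 y) = cnj2 (g y)"
    using evV eventually_cnj2[OF evV] eventually_compose_filterlim[OF evU gl]
      eventually_compose_filterlim[OF eventually_cnj2[OF evU] gl]
  proof eventually_elim
    case (elim y)
    have "g y \<in> ball 0 e1" "g y \<in> ball 0 e2" using elim(3) UV(2) by (auto simp: U_def)
    then have "F (cnj2 (g y)) = cnj2 (F (g y))" using e1(3) e2(3) by (simp add: F_def cnj2_def)
    then have "F (cnj2 (g y)) = cnj2 y" using Fg elim by simp
    then show ?case using gF[OF elim(4)] by simp
  qed
  have "rhol (\<lambda>y. fst (g y))" "rhol (\<lambda>y. snd (g y))"
    unfolding rhol_def using evV sym by (eventually_elim, use pg in \<open>simp add: cnj2_def\<close>)+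
  moreover have "\<forall>\<^sub>F y in nhds 0. f1 (fst (g y), snd (g y)) = fst y \<and> f2 (fst (g y), snd (g y)) = snd y"
    using evV by eventually_elim (use Fg in \<open>auto simp: F_def prod_eq_iff\<close>)
  moreover have "\<forall>\<^sub>F x in nhds 0. fst (g (f1 x, f2 x)) = fst x \<and> snd (g (f1 x, f2 x)) = snd x"
    using evU by eventually_elim (use gF in \<open>auto simp: F_def\<close>)
  ultimately show ?thesis
    using g0 by (intro exI[of _ "\<lambda>y. fst (g y)"] exI[of _ "\<lambda>y. snd (g y)"]) auto
qed

subsection \<open>Normal form of a fold-type map\<close>

lemma rhol_chain:
  assumes "rhol f" "rhol g1" "rhol g2" "g1 0 = 0" "g2 0 = 0"
  shows "\<forall>\<^sub>F x in nhds 0. has_pderivs (\<lambda>x. f (g1 x, g2 x))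
    (pd1 f (g1 x, g2 x) * pd1 g1 x + pd2 f (g1 x, g2 x) * pd1 g2 x)
    (pd1 f (g1 x, g2 x) * pd2 g1 x + pd2 f (g1 x, g2 x) * pd2 g2 x) x"
  using rhol_eventually_compose[OF rhol_has_pderivs[OF assms(1)] assms(2-)]
    rhol_has_pderivs[OF assms(2)] rhol_has_pderivs[OF assms(3)]
  by eventually_elim (rule has_pderivs_compose)

lemma has_pderivs_eqI: "has_pderivs f a b x \<Longrightarrow> a = a' \<Longrightarrow> b = b' \<Longrightarrow> has_pderivs f a' b' x"
  by simp

lemma has_pderivs_unique:
  "has_pderivs f a b x \<Longrightarrow> has_pderivs f c d x \<Longrightarrow> a = c \<and> b = d"
  using has_pderivs_pd by blast

lemma eventually_has_pderivs_cong:
  assumes "\<forall>\<^sub>F x in nhds 0. has_pderivs f (a x) (b x) x" "\<forall>\<^sub>F x in nhds 0. f x = g x"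
  shows "\<forall>\<^sub>F x in nhds 0. has_pderivs g (a x) (b x) x"
  using assms(1) eventually_eventually[THEN iffD2, OF assms(2)]
proof eventually_elim
  case (elim x)
  then obtain S where "open S" "x \<in> S" "\<forall>y\<in>S. f y = g y" unfolding eventually_nhds by blast
  then show ?case using has_pderivs_cong[OF elim(1)] by blast
qed

lemma filterlim_axis: "filterlim (\<lambda>u. (u, 0)) (nhds (0 :: complex \<times> complex)) (nhds (0 :: complex))"
proof -
  have "((\<lambda>u. (u, 0)) \<longlongrightarrow> (0, 0)) (nhds (0 :: complex))"
    by (intro tendsto_intros filterlim_ident)
  then show ?thesis by (simp add: zero_prod_def)
qed

lemma eventually_axis: "\<forall>\<^sub>F x in nhds 0. P x \<Longrightarrow> \<forall>\<^sub>F u in nhds 0. P (u :: complex, 0 :: complex)"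
  by (rule eventually_compose_filterlim[OF _ filterlim_axis])

text \<open>Where \<open>m\<close> vanishes at \<open>x\<close>, its nonzero derivative in the
  second direction keeps it nonzero at nearby points of that line; there \<open>D\<close> vanishes,
  and continuity carries this over to \<open>x\<close>.\<close>

lemma mult_eq_0_cancel:
  assumes "\<forall>\<^sub>F y in nhds x. m y * D y = 0" "isCont D x" "has_pderivs m a b x" "b \<noteq> 0"
  shows "D x = 0"
proof (cases "m x = 0")
  case False
  then show ?thesis using eventually_nhds_x_imp_x[OF assms(1)] by simp
next
  case True
  obtain r s where x: "x = (r, s)" by (cases x)
  have l: "filterlim (\<lambda>t. (r, t)) (nhds (r, s)) (nhds s)"
    by (intro tendsto_intros filterlim_ident)
  have "((\<lambda>t. m (r, t)) has_field_derivative b) (at s)"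
    using has_pderivs_snd_line assms(3) x by blast
  then have "((\<lambda>t. (m (r, t) - m (r, s)) / (t - s)) \<longlongrightarrow> b) (at s)"
    by (simp add: has_field_derivative_iff)
  from tendsto_imp_eventually_ne[OF this assms(4)]
  have "\<forall>\<^sub>F t in at s. m (r, t) \<noteq> 0"
    using True x by (auto elim!: eventually_mono)
  moreover have "\<forall>\<^sub>F t in at s. m (r, t) * D (r, t) = 0"
    using eventually_compose_filterlim[OF assms(1)[unfolded x] l] eventually_at_filter
    by (auto simp: eventually_at_filter elim: eventually_mono)
  ultimately have "\<forall>\<^sub>F t in at s. D (r, t) = 0" by eventually_elim simp
  then have "((\<lambda>t. D (r, t)) \<longlongrightarrow> 0) (at s)" by (rule tendsto_eventually)
  moreover have "((\<lambda>t. D (r, t)) \<longlongrightarrow> D (r, s)) (at s)"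
  proof -
    have "isCont (\<lambda>t. D (r, t)) s"
      by (rule isCont_o2[of s "\<lambda>t. (r, t)" D]) (use assms(2) x in \<open>auto intro!: continuous_intros\<close>)
    then show ?thesis by (simp add: isCont_def)
  qed
  ultimately show ?thesis using x tendsto_unique[OF at_neq_bot] by blast
qed

text \<open>A map into three-space whose derivative in the second direction is divisible by
  \<open>mu\<close>. The number \<open>\<beta>\<close> is the coefficient of \<open>mu^2\<close> in
  \<open>Y\<close> at the origin, once \<open>Y\<close> is expressed through \<open>U\<close> and
  \<open>mu\<close>; its positivity permits a real square root.\<close>

locale fold_data =
  fixes U Y Z mu nU nY nZ :: "complex \<times> complex \<Rightarrow> complex" and \<beta> :: real
  assumes rh: "rhol U" "rhol Y" "rhol Z" "rhol mu" "rhol nU" "rhol nY" "rhol nZ"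
    and at0: "U 0 = 0" "Y 0 = 0" "Z 0 = 0" "mu 0 = 0" "nU 0 = 0"
    and D2: "\<forall>\<^sub>F x in nhds 0. pd2 U x = mu x * nU x \<and> pd2 Y x = mu x * nY x \<and> pd2 Z x = mu x * nZ x"
    and nondeg: "pd1 U 0 \<noteq> 0" "pd2 mu 0 \<noteq> 0" "nY 0 / (2 * pd2 mu 0) = of_real \<beta>" "\<beta> > 0"
begin

lemma D2_0: "pd2 U 0 = 0" "pd2 Y 0 = 0" "pd2 Z 0 = 0"
  using eventually_nhds_x_imp_x[OF D2] at0 by auto

text \<open>On the singular set the \<open>v\<close>-direction of the coordinates \<open>(U, mu)\<close> is the null direction.\<close>

lemma pd2_transfer:
  assumes "rhol h1" "rhol h2" "h1 0 = 0" "h2 0 = 0" "rhol W"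
    and "\<forall>\<^sub>F y in nhds 0. U (h1 y, h2 y) = fst y"
    and "\<forall>\<^sub>F y in nhds 0. snd y = 0 \<longrightarrow> mu (h1 y, h2 y) = 0"
    and "\<forall>\<^sub>F x in nhds 0. pd2 W x = mu x * nW x"
  shows "\<forall>\<^sub>F y in nhds 0. snd y = 0 \<longrightarrow> pd2 (\<lambda>y. W (h1 y, h2 y)) y = 0"
  using rhol_chain[OF assms(5,1-4)]
    eventually_has_pderivs_cong[OF rhol_chain[OF rh(1) assms(1-4)] assms(6)] assms(7)
    rhol_eventually_compose[OF assms(8,1-4)] rhol_eventually_compose[OF D2 assms(1-4)]
    rhol_eventually_compose[OF rhol_eventually_ne[OF rhol_pd(1)[OF rh(1)] nondeg(1)] assms(1-4)]
proof eventually_elim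
  case (elim y)
  show ?case
  proof
    assume y: "snd y = 0"
    then have "pd2 W (h1 y, h2 y) = 0" "pd2 U (h1 y, h2 y) = 0" using elim by auto
    moreover have "pd2 h1 y = 0"
      using has_pderivs_unique[OF elim(2) has_pderivs_fst] calculation elim(6) by simp
    ultimately show "pd2 (\<lambda>y. W (h1 y, h2 y)) y = 0"
      using has_pderivs_pd(2)[OF elim(1)] by simp
  qed
qed

text \<open>In the coordinates \<open>(U, mu)\<close> the function \<open>Y\<close> has vanishing
  second derivative along the axis, so two divisions give \<open>Y = y0 (U) + mu^2 * B\<close>. As
  \<open>B\<close> is positive at the origin, \<open>v\<close> can be taken as \<open>mu\<close>
  times the square root of \<open>B\<close>.\<close>

lemma fold_coordinate:
  obtains v s y0 where "rhol v" "rhol s" "rhol y0" "v = (\<lambda>x. mu x * s x)" "s 0 \<noteq> 0" "(s 0)\<^sup>2 = of_real \<beta>"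
    "\<forall>\<^sub>F x in nhds 0. Y x = y0 (U x, 0) + (v x)\<^sup>2"
proof -
  have "pd1 U 0 * pd2 mu 0 - pd2 U 0 * pd1 mu 0 \<noteq> 0" using nondeg D2_0 by simp
  from rhol_inverse_function[OF rh(1,4) at0(1,4) this]
  obtain h1 h2 where h: "rhol h1" "rhol h2" "h1 0 = 0" "h2 0 = 0"
    "\<forall>\<^sub>F y in nhds 0. U (h1 y, h2 y) = fst y \<and> mu (h1 y, h2 y) = snd y"
    "\<forall>\<^sub>F x in nhds 0. h1 (U x, mu x) = fst x \<and> h2 (U x, mu x) = snd x" by blast
  define Yh where "Yh = (\<lambda>y. Y (h1 y, h2 y))"
  have Yh: "rhol Yh" unfolding Yh_def by (rule rhol_compose[OF rh(2) h(1-4)])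
  have pdYh: "\<forall>\<^sub>F y in nhds 0. snd y = 0 \<longrightarrow> pd2 Yh y = 0"
    unfolding Yh_def
  proof (rule pd2_transfer[OF h(1-4) rh(2), where nW = nY])
    show "\<forall>\<^sub>F y in nhds 0. U (h1 y, h2 y) = fst y" using h(5) by eventually_elim simp
    show "\<forall>\<^sub>F y in nhds 0. snd y = 0 \<longrightarrow> mu (h1 y, h2 y) = 0" using h(5) by eventually_elim simp
    show "\<forall>\<^sub>F x in nhds 0. pd2 Y x = mu x * nY x" using D2 by eventually_elim simp
  qed
  define y0 where "y0 = (\<lambda>y :: complex \<times> complex. Yh (fst y, 0))"
  have y0: "rhol y0" unfolding y0_def by (rule rhol_compose[OF Yh rhol_fst rhol_const]) auto
  have "rhol (\<lambda>y. Yh y - y0 y)" by (rule rhol_diff[OF Yh y0])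
  from rhol_divide_snd[OF this] obtain k where
    k: "rhol k" "\<forall>\<^sub>F y in nhds 0. Yh y - y0 y = snd y * k y" by (auto simp: y0_def)
  have k0: "\<forall>\<^sub>F y in nhds 0. snd y = 0 \<longrightarrow> k y = 0"
  proof -
    have "\<forall>\<^sub>F y in nhds 0. has_pderivs (\<lambda>y. Yh y - y0 y) (pd1 Yh y - pd1 y0 y) (pd2 Yh y - pd2 y0 y) y"
      using rhol_has_pderivs[OF Yh] rhol_has_pderivs[OF y0] by eventually_elim (rule has_pderivs_diff)
    from eventually_has_pderivs_cong[OF this k(2)] pdYh rhol_has_pderivs[OF k(1)] rhol_has_pderivs[OF Yh] rhol_has_pderivs[OF y0]
    show ?thesis
    proof eventually_elim
      case (elim y)
      have "pd2 y0 y = 0" by (simp add: y0_def pd2_def)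
      then show ?case
        using has_pderivs_unique[OF elim(1) has_pderivs_mult[OF has_pderivs_snd elim(3)]] elim(2) by auto
    qed
  qed
  have "\<forall>\<^sub>F u in nhds 0. k (u, 0) = 0" using eventually_axis[OF k0] by simp
  from rhol_divide_snd[OF k(1) this] obtain B where
    B: "rhol B" "\<forall>\<^sub>F y in nhds 0. k y = snd y * B y" by blast
  have YB: "\<forall>\<^sub>F y in nhds 0. Yh y = y0 y + (snd y)\<^sup>2 * B y"
    using k(2) B(2) by eventually_elim (simp add: power2_eq_square algebra_simps)
  have Um: "\<forall>\<^sub>F y in nhds 0. P y \<Longrightarrow> \<forall>\<^sub>F x in nhds 0. P (U x, mu x)" for P
    by (rule rhol_eventually_compose[OF _ rh(1,4) at0(1,4)])
  have Yeq: "\<forall>\<^sub>F x in nhds 0. Y x = Yh (U x, mu x)"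
    using h(6) by eventually_elim (simp add: Yh_def)
  \<comment> \<open>Differentiating the expression for \<open>Y\<close> in the second direction and
    comparing with \<open>mu * nY\<close> gives an identity with a common factor \<open>mu\<close>;
    cancelling it and evaluating at the origin yields
    \<open>nY 0 = 2 * B 0 * pd2 mu 0\<close>.\<close>
  have B0: "B 0 = of_real \<beta>"
  proof -
    define D where "D = (\<lambda>x. nY x - pd1 Yh (U x, mu x) * nU x
      - (2 * B (U x, mu x) + mu x * pd2 B (U x, mu x)) * pd2 mu x)"
    have rD: "rhol D"
    proof -
      have *: "rhol (\<lambda>x. pd1 Yh (U x, mu x))" "rhol (\<lambda>x. B (U x, mu x))" "rhol (\<lambda>x. pd2 B (U x, mu x))"
        using rhol_compose[OF _ rh(1,4) at0(1,4)] rhol_pd Yh B(1) by blast+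
      show ?thesis
        unfolding D_def by (intro rhol_diff rhol_mult rhol_add rhol_pd rh *) (simp add: rhol_const)
    qed
    have pYB: "\<forall>\<^sub>F y in nhds 0. pd2 Yh y = 2 * snd y * B y + (snd y)\<^sup>2 * pd2 B y"
    proof -
      have "\<forall>\<^sub>F y in nhds 0. has_pderivs (\<lambda>y. y0 y + snd y * snd y * B y)
         (pd1 y0 y + (snd y * snd y) * pd1 B y)
         (pd2 y0 y + (2 * snd y * B y + (snd y)\<^sup>2 * pd2 B y)) y"
        using rhol_has_pderivs[OF y0] rhol_has_pderivs[OF B(1)]
      proof eventually_elim
        case (elim y)
        from has_pderivs_add[OF elim(1) has_pderivs_mult[OF has_pderivs_mult[OF has_pderivs_snd has_pderivs_snd] elim(2)]]
        show ?case by (simp add: power2_eq_square algebra_simps)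
      qed
      moreover have "\<forall>\<^sub>F y in nhds 0. y0 y + snd y * snd y * B y = Yh y"
        using YB by eventually_elim (simp add: power2_eq_square)
      ultimately have "\<forall>\<^sub>F y in nhds 0. has_pderivs Yh (pd1 y0 y + (snd y * snd y) * pd1 B y)
         (pd2 y0 y + (2 * snd y * B y + (snd y)\<^sup>2 * pd2 B y)) y"
        by (rule eventually_has_pderivs_cong)
      then show ?thesis
      proof eventually_elim
        case (elim y)
        have "pd2 y0 y = 0" by (simp add: y0_def pd2_def)
        then show ?case using has_pderivs_pd(2)[OF elim] by simp
      qed
    qed
    have "\<forall>\<^sub>F x in nhds 0. Yh (U x, mu x) = Y x" using Yeq by eventually_elim simp
    from eventually_has_pderivs_cong[OF rhol_chain[OF Yh rh(1,4) at0(1,4)] this]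
      D2 Um[OF pYB]
    have "\<forall>\<^sub>F x in nhds 0. mu x * D x = 0"
    proof eventually_elim
      case (elim x)
      have "mu x * nY x = pd1 Yh (U x, mu x) * (mu x * nU x)
          + (2 * mu x * B (U x, mu x) + (mu x)\<^sup>2 * pd2 B (U x, mu x)) * pd2 mu x"
        using has_pderivs_pd(2)[OF elim(1)] elim(2,3) by simp
      then show ?case by (simp add: D_def power2_eq_square algebra_simps)
    qed
    from mult_eq_0_cancel[OF this has_pderivs_isCont[OF rhol_has_pderivs_0[OF rD]]
        rhol_has_pderivs_0[OF rh(4)] nondeg(2)]
    have "nY 0 = 2 * B 0 * pd2 mu 0" using at0 by (simp add: D_def zero_prod_def)
    then show ?thesis using nondeg(2,3) by (simp add: field_simps)
  qed
  define s where "s = (\<lambda>x. exp (Ln (B (U x, mu x)) / of_nat 2))"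
  have s: "rhol s" unfolding s_def
    by (rule rhol_pos_power[OF rhol_compose[OF B(1) rh(1,4) at0(1,4)], of \<beta>])
      (use B0 at0 nondeg in \<open>simp_all add: zero_prod_def\<close>)
  have s2: "\<forall>\<^sub>F x in nhds 0. (s x)\<^sup>2 = B (U x, mu x)"
    using Um[OF rhol_eventually_ne[OF B(1)]] B0 nondeg(4)
    by (auto elim!: eventually_mono simp: s_def exp_double[symmetric])
  show ?thesis
  proof
    show "rhol (\<lambda>x. mu x * s x)" by (rule rhol_mult[OF rh(4) s])
    show "rhol s" by fact
    show "rhol y0" by fact
    show "s 0 \<noteq> 0" by (simp add: s_def)
    show "(s 0)\<^sup>2 = of_real \<beta>"
      using eventually_nhds_x_imp_x[OF s2] B0 at0 by (simp add: zero_prod_def)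
    show "\<forall>\<^sub>F x in nhds 0. Y x = y0 (U x, 0) + (mu x * s x)\<^sup>2"
      using Yeq Um[OF YB] s2
      by eventually_elim (simp add: y0_def power_mult_distrib)
  qed simp
qed

end

locale fold_normal = fold_data +
  fixes v s y0 K0 d G1 G2 :: "complex \<times> complex \<Rightarrow> complex"
  assumes rn: "rhol v" "rhol s" "rhol y0" "rhol K0" "rhol d" "rhol G1" "rhol G2"
    and v_def: "v = (\<lambda>x. mu x * s x)" and s0: "s 0 \<noteq> 0" "(s 0)\<^sup>2 = of_real \<beta>"
    and G0: "G1 0 = 0" "G2 0 = 0"
    and Y_eq: "\<forall>\<^sub>F x in nhds 0. Y x = y0 (U x, 0) + (v x)\<^sup>2"
    and Z_eq: "\<forall>\<^sub>F x in nhds 0. Z x = K0 (U x, (v x)\<^sup>2) + (v x) ^ 3 * d (U x, (v x)\<^sup>2)"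
    and inv: "\<forall>\<^sub>F y in nhds 0. U (G1 y, G2 y) = fst y \<and> v (G1 y, G2 y) = snd y"
      "\<forall>\<^sub>F x in nhds 0. G1 (U x, v x) = fst x \<and> G2 (U x, v x) = snd x"

lemma zero_snd2: "(snd 0)\<^sup>2 = (0 :: complex)"
  by simp

text \<open>In the coordinates \<open>(U, v)\<close> the third component splits into even and odd
  parts in \<open>v\<close>. Its \<open>v\<close>-derivative vanishes on the axis, hence so does the
  odd coefficient \<open>K1\<close>; dividing \<open>K1\<close> by its second argument, which stands
  for \<open>v^2\<close>, turns the odd part into \<open>v^3 * d\<close>.\<close>

lemma (in fold_data) fold_normal_exists:
  "\<exists>v s y0 K0 d G1 G2. fold_normal U Y Z mu nU nY nZ \<beta> v s y0 K0 d G1 G2"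
proof -
  obtain v s y0 where v: "rhol v" "rhol s" "rhol y0" "v = (\<lambda>x. mu x * s x)" "s 0 \<noteq> 0" "(s 0)\<^sup>2 = of_real \<beta>"
    "\<forall>\<^sub>F x in nhds 0. Y x = y0 (U x, 0) + (v x)\<^sup>2"
    by (rule fold_coordinate) blast
  have v0: "v 0 = 0" using v(4) at0 by simp
  have "has_pderivs v (pd1 mu 0 * s 0 + mu 0 * pd1 s 0) (pd2 mu 0 * s 0 + mu 0 * pd2 s 0) 0"
    unfolding v(4) by (rule has_pderivs_mult[OF rhol_has_pderivs_0[OF rh(4)] rhol_has_pderivs_0[OF v(2)]])
  then have "pd2 v 0 = pd2 mu 0 * s 0" using has_pderivs_pd(2) at0(4) by simp
  then have "pd1 U 0 * pd2 v 0 - pd2 U 0 * pd1 v 0 \<noteq> 0" using nondeg v(5) D2_0 by simp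
  from rhol_inverse_function[OF rh(1) v(1) at0(1) v0 this]
  obtain G1 G2 where G: "rhol G1" "rhol G2" "G1 0 = 0" "G2 0 = 0"
    "\<forall>\<^sub>F y in nhds 0. U (G1 y, G2 y) = fst y \<and> v (G1 y, G2 y) = snd y"
    "\<forall>\<^sub>F x in nhds 0. G1 (U x, v x) = fst x \<and> G2 (U x, v x) = snd x" by blast
  define Zh where "Zh = (\<lambda>y. Z (G1 y, G2 y))"
  have Zh: "rhol Zh" unfolding Zh_def by (rule rhol_compose[OF rh(3) G(1-4)])
  have "\<forall>\<^sub>F y in nhds 0. snd y = 0 \<longrightarrow> mu (G1 y, G2 y) = 0"
    using G(5) rhol_eventually_compose[OF rhol_eventually_ne[OF v(2,5)] G(1-4)]
    by eventually_elim (auto simp: v(4))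
  note m0 = this
  have pdZh: "\<forall>\<^sub>F y in nhds 0. snd y = 0 \<longrightarrow> pd2 Zh y = 0"
    unfolding Zh_def
  proof (rule pd2_transfer[OF G(1-4) rh(3) _ m0])
    show "\<forall>\<^sub>F y in nhds 0. U (G1 y, G2 y) = fst y" using G(5) by eventually_elim simp
    show "\<forall>\<^sub>F x in nhds 0. pd2 Z x = mu x * nZ x" using D2 by eventually_elim simp
  qed
  obtain K0 K1 where K: "rhol K0" "rhol K1"
    "\<forall>\<^sub>F y in nhds 0. Zh y = K0 (fst y, (snd y)\<^sup>2) + snd y * K1 (fst y, (snd y)\<^sup>2)"
    using rhol_even_odd[OF Zh] by blast
  have r2': "rhol (\<lambda>y. (snd y)\<^sup>2)" by (intro rhol_power rhol_snd)
  note r2 = r2' fst_zero zero_snd2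
  \<comment> \<open>On the axis the \<open>v\<close>-derivative of \<open>Zh\<close> is
    \<open>K1\<close>, because the even part contributes the factor \<open>2 * v\<close>.\<close>
  have K10: "\<forall>\<^sub>F y in nhds 0. snd y = 0 \<longrightarrow> K1 y = 0"
  proof -
    have "\<forall>\<^sub>F y in nhds 0. K0 (fst y, (snd y)\<^sup>2) + snd y * K1 (fst y, (snd y)\<^sup>2) = Zh y"
      using K(3) by eventually_elim simp
    moreover have "\<forall>\<^sub>F y in nhds 0. has_pderivs (\<lambda>y. K0 (fst y, (snd y)\<^sup>2) + snd y * K1 (fst y, (snd y)\<^sup>2))
       (pd1 (\<lambda>y. K0 (fst y, (snd y)\<^sup>2)) y + snd y * pd1 (\<lambda>y. K1 (fst y, (snd y)\<^sup>2)) y)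
       (pd2 K0 (fst y, (snd y)\<^sup>2) * (2 * snd y) + K1 (fst y, (snd y)\<^sup>2) + snd y * pd2 (\<lambda>y. K1 (fst y, (snd y)\<^sup>2)) y) y"
      using rhol_has_pderivs[OF rhol_compose[OF K(1) rhol_fst r2]]
        rhol_has_pderivs[OF rhol_compose[OF K(2) rhol_fst r2]]
        rhol_eventually_compose[OF rhol_has_pderivs[OF K(1)] rhol_fst r2]
    proof eventually_elim
      case (elim y)
      have p: "has_pderivs (\<lambda>y. (snd y)\<^sup>2) 0 (2 * snd y) y"
        using has_pderivs_mult[OF has_pderivs_snd has_pderivs_snd, of y] by (simp add: power2_eq_square)
      have "pd2 (\<lambda>y. K0 (fst y, (snd y)\<^sup>2)) y = pd2 K0 (fst y, (snd y)\<^sup>2) * (2 * snd y)"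
        using has_pderivs_unique[OF elim(1) has_pderivs_compose[of K0 _ _ fst y "\<lambda>y. (snd y)\<^sup>2", OF elim(3) has_pderivs_fst p]] by simp
      then show ?case
        using has_pderivs_add[OF elim(1) has_pderivs_mult[OF has_pderivs_snd elim(2)]] by (simp add: algebra_simps)
    qed
    ultimately have "\<forall>\<^sub>F y in nhds 0. has_pderivs Zh
       (pd1 (\<lambda>y. K0 (fst y, (snd y)\<^sup>2)) y + snd y * pd1 (\<lambda>y. K1 (fst y, (snd y)\<^sup>2)) y)
       (pd2 K0 (fst y, (snd y)\<^sup>2) * (2 * snd y) + K1 (fst y, (snd y)\<^sup>2) + snd y * pd2 (\<lambda>y. K1 (fst y, (snd y)\<^sup>2)) y) y"
      by (rule eventually_has_pderivs_cong[rotated])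
    from this pdZh
    show ?thesis
    proof eventually_elim
      case (elim y)
      show ?case
      proof
        assume "snd y = 0"
        then have "K1 (fst y, 0) = 0" using has_pderivs_pd(2)[OF elim(1)] elim(2) by simp
        then show "K1 y = 0" using \<open>snd y = 0\<close> by (cases y) auto
      qed
    qed
  qed
  have "\<forall>\<^sub>F u in nhds 0. K1 (u, 0) = 0" using eventually_axis[OF K10] by simp
  from rhol_divide_snd[OF K(2) this] obtain d where
    d: "rhol d" "\<forall>\<^sub>F y in nhds 0. K1 y = snd y * d y" by blast
  have "\<forall>\<^sub>F y in nhds 0. Zh y = K0 (fst y, (snd y)\<^sup>2) + (snd y) ^ 3 * d (fst y, (snd y)\<^sup>2)"
    using K(3) rhol_eventually_compose[OF d(2) rhol_fst r2]
    by eventually_elim (simp add: power2_eq_square power3_eq_cube)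
  from rhol_eventually_compose[OF this rh(1) v(1) at0(1) v0] G(6)
  have "\<forall>\<^sub>F x in nhds 0. Z x = K0 (U x, (v x)\<^sup>2) + (v x) ^ 3 * d (U x, (v x)\<^sup>2)"
    by eventually_elim (simp add: Zh_def)
  then have "fold_normal U Y Z mu nU nY nZ \<beta> v s y0 K0 d G1 G2"
    using v G K(1) d(1) by unfold_locales auto
  then show ?thesis by blast
qed

section \<open>Slopes of the tangent planes\<close>

context fold_normal
begin

lemma v0: "v 0 = 0"
  using v_def at0 by simp

text \<open>In the coordinates \<open>(U, v)\<close> this is the \<open>v\<close>-derivative of
  \<open>K0 (U, v^2) + v^3 * d (U, v^2)\<close> divided by \<open>2 * v\<close>, that is, the rate
  of change of \<open>Z\<close> against \<open>v^2\<close> at fixed \<open>U\<close>.\<close>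

definition Sl :: "complex \<times> complex \<Rightarrow> complex" where
  "Sl x = pd2 K0 (U x, (v x)\<^sup>2) + 3 / 2 * v x * d (U x, (v x)\<^sup>2) + (v x) ^ 3 * pd2 d (U x, (v x)\<^sup>2)"

text \<open>\<open>num\<close> and \<open>den\<close> are the minors in the \<open>(U, Z)\<close>
  and \<open>(U, Y)\<close> components of the frame formed by the first partial derivative and the
  second one divided by \<open>mu\<close>. Unlike the Jacobian minors they need not vanish on the
  singular curve.\<close>

definition num :: "complex \<times> complex \<Rightarrow> complex" where
  "num x = nZ x * pd1 U x - pd1 Z x * nU x"

definition den :: "complex \<times> complex \<Rightarrow> complex" where
  "den x = nY x * pd1 U x - pd1 Y x * nU x"

lemma rhol_v2: "rhol (\<lambda>x. (v x)\<^sup>2)" "(v 0)\<^sup>2 = 0"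
  by (simp_all add: rhol_power rn v0)

lemma rhol_Uv2: "rhol f \<Longrightarrow> rhol (\<lambda>x. f (U x, (v x)\<^sup>2))"
  by (rule rhol_compose[OF _ rh(1) rhol_v2(1) at0(1) rhol_v2(2)])

lemma rhol_Sl: "rhol Sl"
proof -
  have "rhol (\<lambda>x. pd2 K0 (U x, (v x)\<^sup>2))" "rhol (\<lambda>x. d (U x, (v x)\<^sup>2))" "rhol (\<lambda>x. pd2 d (U x, (v x)\<^sup>2))"
    using rhol_Uv2 rhol_pd rn by blast+
  then show ?thesis
    unfolding Sl_def[abs_def] by (intro rhol_add rhol_mult rhol_power rn) (simp_all add: rhol_const)
qed

lemma rhol_num: "rhol num" "rhol den"
  unfolding num_def[abs_def] den_def[abs_def] by (intro rhol_diff rhol_mult rhol_pd rh)+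

lemma has_pderivs_v2: "\<forall>\<^sub>F x in nhds 0. has_pderivs (\<lambda>x. (v x)\<^sup>2) (2 * v x * pd1 v x) (2 * v x * pd2 v x) x"
  using rhol_has_pderivs[OF rn(1)]
proof eventually_elim
  case (elim x)
  from has_pderivs_mult[OF this this] show ?case by (simp add: power2_eq_square algebra_simps)
qed

lemma has_pderivs_Uv2:
  assumes "rhol f"
  shows "\<forall>\<^sub>F x in nhds 0. has_pderivs (\<lambda>x. f (U x, (v x)\<^sup>2))
      (pd1 f (U x, (v x)\<^sup>2) * pd1 U x + pd2 f (U x, (v x)\<^sup>2) * (2 * v x * pd1 v x))
      (pd1 f (U x, (v x)\<^sup>2) * pd2 U x + pd2 f (U x, (v x)\<^sup>2) * (2 * v x * pd2 v x)) x"
  using rhol_eventually_compose[OF rhol_has_pderivs[OF assms] rh(1) rhol_v2(1) at0(1) rhol_v2(2)]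
    rhol_has_pderivs[OF rh(1)] has_pderivs_v2
  by eventually_elim (rule has_pderivs_compose)

text \<open>On the singular curve \<open>v\<close> and the second partial derivative of
  \<open>U\<close> vanish, so only terms linear in \<open>v\<close> survive. The transversal
  derivative of the slope is therefore a multiple of \<open>d\<close>, which is how \<open>d\<close>
  is recovered.\<close>

lemma Sl_pderivs:
  "\<forall>\<^sub>F x in nhds 0. mu x = 0 \<longrightarrow> has_pderivs Sl
     (pd1 (pd2 K0) (U x, 0) * pd1 U x + 3 / 2 * pd1 v x * d (U x, 0)) (3 / 2 * pd2 v x * d (U x, 0)) x"
  using has_pderivs_Uv2[OF rhol_pd(2)[OF rn(4)]] has_pderivs_Uv2[OF rn(5)]
    has_pderivs_Uv2[OF rhol_pd(2)[OF rn(5)]] has_pderivs_v2 rhol_has_pderivs[OF rn(1)] D2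
proof eventually_elim
  case (elim x)
  have S: "Sl = (\<lambda>x. pd2 K0 (U x, (v x)\<^sup>2) + (3 / 2 * v x * d (U x, (v x)\<^sup>2)
      + v x * (v x)\<^sup>2 * pd2 d (U x, (v x)\<^sup>2)))"
    by (simp add: fun_eq_iff Sl_def power2_eq_square power3_eq_cube)
  from has_pderivs_add[OF elim(1) has_pderivs_add[OF has_pderivs_mult[OF has_pderivs_mult[OF has_pderivs_const[of "3 / 2"] elim(5)] elim(2)]
      has_pderivs_mult[OF has_pderivs_mult[OF elim(5,4)] elim(3)]], folded S]
  show ?case using elim(6) by (auto simp: v_def)
qed

lemma Y_pderivs:
  "\<forall>\<^sub>F x in nhds 0. has_pderivs Y (pd1 y0 (U x, 0) * pd1 U x + 2 * v x * pd1 v x)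
      (pd1 y0 (U x, 0) * pd2 U x + 2 * v x * pd2 v x) x"
proof (rule eventually_has_pderivs_cong)
  show "\<forall>\<^sub>F x in nhds 0. has_pderivs (\<lambda>x. y0 (U x, 0) + (v x)\<^sup>2) (pd1 y0 (U x, 0) * pd1 U x + 2 * v x * pd1 v x)
      (pd1 y0 (U x, 0) * pd2 U x + 2 * v x * pd2 v x) x"
    using rhol_eventually_compose[OF rhol_has_pderivs[OF rn(3)] rh(1) rhol_const[of 0, OF complex_cnj_zero] at0(1) refl]
      rhol_has_pderivs[OF rh(1)] has_pderivs_v2
  proof eventually_elim
    case (elim x)
    from has_pderivs_compose[of y0 _ _ U x "\<lambda>_. 0", OF elim(1,2) has_pderivs_const]
    have "has_pderivs (\<lambda>x. y0 (U x, 0)) (pd1 y0 (U x, 0) * pd1 U x) (pd1 y0 (U x, 0) * pd2 U x) x" by simp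
    from has_pderivs_add[OF this elim(3)] show ?case .
  qed
  show "\<forall>\<^sub>F x in nhds 0. y0 (U x, 0) + (v x)\<^sup>2 = Y x" using Y_eq by eventually_elim simp
qed

text \<open>The tangent planes of the surface have slope \<open>Sl\<close> with respect to the second coordinate; both
  sides compute it, once from the normal form and once from the frame \<open>\<partial>\<^sub>1\<close>, \<open>mu\<^sup>-\<^sup>1 \<partial>\<^sub>2\<close>.\<close>

lemma slope: "\<forall>\<^sub>F x in nhds 0. num x = Sl x * den x"
proof -
  note p2 = has_pderivs_v2 and c = has_pderivs_Uv2 and pY = Y_pderivs
  have "\<forall>\<^sub>F x in nhds 0. has_pderivs (\<lambda>x. K0 (U x, (v x)\<^sup>2) + v x * (v x)\<^sup>2 * d (U x, (v x)\<^sup>2))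
    ((pd1 K0 (U x, (v x)\<^sup>2) + (v x) ^ 3 * pd1 d (U x, (v x)\<^sup>2)) * pd1 U x + Sl x * (2 * v x * pd1 v x))
    ((pd1 K0 (U x, (v x)\<^sup>2) + (v x) ^ 3 * pd1 d (U x, (v x)\<^sup>2)) * pd2 U x + Sl x * (2 * v x * pd2 v x)) x"
    using c[OF rn(4)] c[OF rn(5)] p2 rhol_has_pderivs[OF rn(1)]
  proof eventually_elim
    case (elim x)
    from has_pderivs_add[OF elim(1) has_pderivs_mult[OF has_pderivs_mult[OF elim(4,3)] elim(2)]]
    show ?case by (simp add: Sl_def power2_eq_square power3_eq_cube algebra_simps)
  qed
  moreover have "\<forall>\<^sub>F x in nhds 0. K0 (U x, (v x)\<^sup>2) + v x * (v x)\<^sup>2 * d (U x, (v x)\<^sup>2) = Z x"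
    using Z_eq by eventually_elim (simp add: power2_eq_square power3_eq_cube)
  ultimately have pZ: "\<forall>\<^sub>F x in nhds 0. has_pderivs Z
    ((pd1 K0 (U x, (v x)\<^sup>2) + (v x) ^ 3 * pd1 d (U x, (v x)\<^sup>2)) * pd1 U x + Sl x * (2 * v x * pd1 v x))
    ((pd1 K0 (U x, (v x)\<^sup>2) + (v x) ^ 3 * pd1 d (U x, (v x)\<^sup>2)) * pd2 U x + Sl x * (2 * v x * pd2 v x)) x"
    by (rule eventually_has_pderivs_cong)
  have rD: "rhol (\<lambda>x. num x - Sl x * den x)" by (intro rhol_diff rhol_mult rhol_num rhol_Sl)
  have m: "\<forall>\<^sub>F x in nhds 0. mu x * (num x - Sl x * den x) = 0"
    using pY pZ D2
  proof eventually_elim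
    case (elim x)
    define T where "T = pd1 K0 (U x, (v x)\<^sup>2) + (v x) ^ 3 * pd1 d (U x, (v x)\<^sup>2)"
    define y' where "y' = pd1 y0 (U x, 0)"
    note Z = has_pderivs_pd[OF elim(2), folded T_def] and Y = has_pderivs_pd[OF elim(1), folded y'_def]
    have "mu x * num x = pd2 Z x * pd1 U x - pd1 Z x * pd2 U x"
      using elim(3) by (simp add: num_def algebra_simps)
    also have "\<dots> = Sl x * (pd2 Y x * pd1 U x - pd1 Y x * pd2 U x)"
      unfolding Z Y by (simp add: algebra_simps)
    also have "\<dots> = mu x * (Sl x * den x)"
      using elim(3) by (simp add: den_def algebra_simps)
    finally show ?case by (simp add: algebra_simps)
  qed
  \<comment> \<open>The factor \<open>mu\<close> is cancelled at every point near the origin and not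
    only at the origin, since the slope identity will be differentiated.\<close>
  have "\<forall>\<^sub>F x in nhds 0. num x - Sl x * den x = 0"
    using eventually_eventually[THEN iffD2, OF m] rhol_has_pderivs[OF rD] rhol_has_pderivs[OF rh(4)]
      rhol_eventually_ne[OF rhol_pd(2)[OF rh(4)] nondeg(2)]
    by eventually_elim (rule mult_eq_0_cancel[OF _ has_pderivs_isCont])
  then show ?thesis by eventually_elim simp
qed

end

subsection \<open>The normalized frame of a CMC 1 face\<close>

text \<open>\<open>hp F\<close> and \<open>hm F\<close> are the complexifications of \<open>F\<close> and of its conjugate in the real and
  imaginary parts of the argument.\<close>

definition hp :: "(complex \<Rightarrow> complex) \<Rightarrow> complex \<times> complex \<Rightarrow> complex" where
  "hp F x = F (fst x + \<i> * snd x)"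

definition hm :: "(complex \<Rightarrow> complex) \<Rightarrow> complex \<times> complex \<Rightarrow> complex" where
  "hm F x = cnj (F (cnj (fst x - \<i> * snd x)))"

lemma hp_cnj2: "hp F (cnj2 x) = cnj (hm F x)"
  by (simp add: hp_def hm_def cnj2_def)

lemma hm_cnj2: "hm F (cnj2 x) = cnj (hp F x)"
  by (simp add: hp_def hm_def cnj2_def)

lemma has_pderivs_hp:
  assumes "(F has_field_derivative F') (at (fst x + \<i> * snd x))"
  shows "has_pderivs (hp F) F' (\<i> * F') x"
proof -
  have "has_pderivs (\<lambda>x. fst x + \<i> * snd x) (1 + (0 * snd x + \<i> * 0)) (0 + (0 * snd x + \<i> * 1)) x"
    by (intro has_pderivs_add has_pderivs_fst has_pderivs_mult[OF has_pderivs_const has_pderivs_snd])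
  from has_pderivs_field_compose[OF this assms] show ?thesis
    by (simp add: hp_def[abs_def] mult_ac)
qed

lemma has_pderivs_hm:
  assumes "(F has_field_derivative F') (at (cnj (fst x - \<i> * snd x)))"
  shows "has_pderivs (hm F) (cnj F') (- \<i> * cnj F') x"
proof -
  have "(F has_field_derivative F') (at (fst (cnj2 x) + \<i> * snd (cnj2 x)))"
    using assms by (simp add: cnj2_def)
  from has_pderivs_cnj[OF has_pderivs_hp[OF this]] show ?thesis
    by (simp add: hp_cnj2)
qed

type_synonym family = "bool \<Rightarrow> complex \<Rightarrow> complex"
type_synonym weight = "bool \<Rightarrow> bool \<Rightarrow> complex"

text \<open>A weight \<open>w\<close> is a linear functional on \<open>2 \<times> 2\<close> matrices (rows and columns are indexed by
  truth values); \<open>bil w \<alpha> \<beta>\<close> is its value on the matrix \<open>\<alpha> \<beta>\<^sup>*\<close>.\<close>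

definition bil :: "weight \<Rightarrow> family \<Rightarrow> family \<Rightarrow> complex \<times> complex \<Rightarrow> complex" where
  "bil w \<alpha> \<beta> x = w False False * (hp (\<alpha> False) x * hm (\<beta> False) x) + w False True * (hp (\<alpha> False) x * hm (\<beta> True) x)
     + w True False * (hp (\<alpha> True) x * hm (\<beta> False) x) + w True True * (hp (\<alpha> True) x * hm (\<beta> True) x)"

text \<open>These are the functionals that take real values on Hermitian matrices.\<close>

definition herm_weight :: "weight \<Rightarrow> bool" where
  "herm_weight w \<longleftrightarrow> (\<forall>j k. w k j = cnj (w j k))"

lemma bil_cnj2: "herm_weight w \<Longrightarrow> bil w \<alpha> \<beta> (cnj2 x) = cnj (bil w \<beta> \<alpha> x)"
proof -
  assume "herm_weight w"
  then have w: "cnj (w j k) = w k j" for j k by (metis herm_weight_def)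
  show ?thesis
    unfolding bil_def hp_cnj2 hm_cnj2 complex_cnj_add complex_cnj_mult w complex_cnj_cnj by (simp add: ac_simps)
qed

lemma has_pderivs_bil:
  assumes "\<And>j. (\<alpha> j has_field_derivative \<alpha>' j (fst x + \<i> * snd x)) (at (fst x + \<i> * snd x))"
    and "\<And>j. (\<beta> j has_field_derivative \<beta>' j (cnj (fst x - \<i> * snd x))) (at (cnj (fst x - \<i> * snd x)))"
  shows "has_pderivs (bil w \<alpha> \<beta>) (bil w \<alpha>' \<beta> x + bil w \<alpha> \<beta>' x) (\<i> * bil w \<alpha>' \<beta> x - \<i> * bil w \<alpha> \<beta>' x) x"
proof -
  have a: "has_pderivs (hp (\<alpha> j)) (hp (\<alpha>' j) x) (\<i> * hp (\<alpha>' j) x) x" for j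
    using has_pderivs_hp[OF assms(1)] by (simp add: hp_def)
  have b: "has_pderivs (hm (\<beta> j)) (hm (\<beta>' j) x) (- \<i> * hm (\<beta>' j) x) x" for j
    using has_pderivs_hm[OF assms(2)] by (simp add: hm_def)
  note t = has_pderivs_mult[OF has_pderivs_const has_pderivs_mult[OF a b]]
  show ?thesis
    using has_pderivs_add[OF has_pderivs_add[OF has_pderivs_add[OF t t] t] t,
        of "w False False" False False "w False True" False True "w True False" True False "w True True" True True]
    by (simp add: bil_def[abs_def] algebra_simps)
qed

text \<open>The columns \<open>e\<close> and \<open>c\<close> start at the two unit vectors; a
  constant matrix acting on the target arranges this. Values of \<open>bil\<close> at the origin are
  then single entries of the weight.\<close>

locale frame =
  fixes e c :: family and \<phi> g :: "complex \<Rightarrow> complex" and R :: real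
  assumes R: "R > 0"
    and De: "\<And>j z. z \<in> ball 0 R \<Longrightarrow> (e j has_field_derivative - \<phi> z * c j z) (at z)"
    and Dc: "\<And>j z. z \<in> ball 0 R \<Longrightarrow> (c j has_field_derivative - e j z - \<phi> z * c j z) (at z)"
    and Dg: "\<And>z. z \<in> ball 0 R \<Longrightarrow> (g has_field_derivative \<phi> z * g z) (at z)"
    and hol_phi: "\<phi> holomorphic_on ball 0 R"
    and init: "e False 0 = 1" "e True 0 = 0" "c False 0 = 0" "c True 0 = 1" "cmod (g 0) = 1"
begin

definition good :: "(complex \<times> complex) set" where
  "good = {x. fst x + \<i> * snd x \<in> ball 0 R \<and> cnj (fst x - \<i> * snd x) \<in> ball 0 R}"

lemma open_good: "open good"
proof -
  have "good = (\<lambda>x. fst x + \<i> * snd x) -` ball 0 R \<inter> (\<lambda>x. cnj (fst x - \<i> * snd x)) -` ball 0 R"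
    by (auto simp: good_def)
  moreover have "open ((\<lambda>x. fst x + \<i> * snd x) -` ball 0 R)" "open ((\<lambda>x. cnj (fst x - \<i> * snd x)) -` ball 0 R)"
    by (intro open_vimage continuous_intros open_ball)+
  ultimately show ?thesis by (metis open_Int)
qed

lemma eventually_good: "\<forall>\<^sub>F x in nhds 0. x \<in> good"
  using open_good R by (intro eventually_nhds_in_open) (auto simp: good_def)

definition "aa x = (hp \<phi> x + hm \<phi> x) / 2"
definition "bb x = (hp \<phi> x - hm \<phi> x) / (2 * \<i>)"
definition "mu x = 1 - hp g x * hm g x"
definition "Pw w x = bil w e e x"
definition "Qw w x = bil w e c x + bil w c e x"
definition "Nw w x = \<i> * (bil w c e x - bil w e c x)"
text \<open>Used in place of \<open>bil w c c\<close>: the derivatives needed of \<open>Pw\<close>,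
  \<open>Qw\<close>, \<open>Nw\<close> and \<open>Tw\<close> are combinations of these four with
  simple coefficients in \<open>aa\<close> and \<open>bb\<close>.\<close>

definition "Tw w x = bil w e c x + bil w c e x - 2 * bil w c c x"
definition "Xw w x = bil w e e x - (bil w e c x + bil w c e x) + mu x * bil w c c x"

lemma hp_phi: "hp \<phi> x = aa x + \<i> * bb x" and hm_phi: "hm \<phi> x = aa x - \<i> * bb x"
  by (simp_all add: aa_def bb_def field_simps)

definition "e' j z = - \<phi> z * c j z"
definition "c' j z = - e j z - \<phi> z * c j z"

lemma bil_deriv:
  "bil w e' \<beta> x = - hp \<phi> x * bil w c \<beta> x" "bil w \<beta> e' x = - hm \<phi> x * bil w \<beta> c x"
  "bil w c' \<beta> x = - bil w e \<beta> x - hp \<phi> x * bil w c \<beta> x" "bil w \<beta> c' x = - bil w \<beta> e x - hm \<phi> x * bil w \<beta> c x"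
  by (simp_all add: bil_def e'_def c'_def hp_def hm_def algebra_simps)

lemma pderivs_bil:
  assumes "x \<in> good"
  shows "has_pderivs (bil w e e) (- hp \<phi> x * bil w c e x - hm \<phi> x * bil w e c x)
      (\<i> * (- hp \<phi> x * bil w c e x) - \<i> * (- hm \<phi> x * bil w e c x)) x"
    and "has_pderivs (bil w e c) (- hp \<phi> x * bil w c c x + (- bil w e e x - hm \<phi> x * bil w e c x))
      (\<i> * (- hp \<phi> x * bil w c c x) - \<i> * (- bil w e e x - hm \<phi> x * bil w e c x)) x"
    and "has_pderivs (bil w c e) ((- bil w e e x - hp \<phi> x * bil w c e x) - hm \<phi> x * bil w c c x)
      (\<i> * (- bil w e e x - hp \<phi> x * bil w c e x) - \<i> * (- hm \<phi> x * bil w c c x)) x"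
    and "has_pderivs (bil w c c) ((- bil w e c x - hp \<phi> x * bil w c c x) + (- bil w c e x - hm \<phi> x * bil w c c x))
      (\<i> * (- bil w e c x - hp \<phi> x * bil w c c x) - \<i> * (- bil w c e x - hm \<phi> x * bil w c c x)) x"
proof -
  have g: "fst x + \<i> * snd x \<in> ball 0 R" "cnj (fst x - \<i> * snd x) \<in> ball 0 R" using assms by (auto simp: good_def)
  have e: "(e j has_field_derivative e' j z) (at z)" and c: "(c j has_field_derivative c' j z) (at z)"
    if "z \<in> ball 0 R" for j z using De[OF that] Dc[OF that] by (simp_all add: e'_def c'_def)
  show "has_pderivs (bil w e e) (- hp \<phi> x * bil w c e x - hm \<phi> x * bil w e c x)
      (\<i> * (- hp \<phi> x * bil w c e x) - \<i> * (- hm \<phi> x * bil w e c x)) x"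
    using has_pderivs_bil[of e e' x e e' w, OF e[OF g(1)] e[OF g(2)], unfolded bil_deriv] by simp
  show "has_pderivs (bil w e c) (- hp \<phi> x * bil w c c x + (- bil w e e x - hm \<phi> x * bil w e c x))
      (\<i> * (- hp \<phi> x * bil w c c x) - \<i> * (- bil w e e x - hm \<phi> x * bil w e c x)) x"
    using has_pderivs_bil[of e e' x c c' w, OF e[OF g(1)] c[OF g(2)], unfolded bil_deriv] by simp
  show "has_pderivs (bil w c e) ((- bil w e e x - hp \<phi> x * bil w c e x) - hm \<phi> x * bil w c c x)
      (\<i> * (- bil w e e x - hp \<phi> x * bil w c e x) - \<i> * (- hm \<phi> x * bil w c c x)) x"
    using has_pderivs_bil[of c c' x e e' w, OF c[OF g(1)] e[OF g(2)], unfolded bil_deriv] by simp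
  show "has_pderivs (bil w c c) ((- bil w e c x - hp \<phi> x * bil w c c x) + (- bil w c e x - hm \<phi> x * bil w c c x))
      (\<i> * (- bil w e c x - hp \<phi> x * bil w c c x) - \<i> * (- bil w c e x - hm \<phi> x * bil w c c x)) x"
    using has_pderivs_bil[of c c' x c c' w, OF c[OF g(1)] c[OF g(2)], unfolded bil_deriv] by simp
qed

lemma pderivs_P:
  assumes "x \<in> good"
  shows "has_pderivs (Pw w) (- aa x * Qw w x - bb x * Nw w x) (- aa x * Nw w x + bb x * Qw w x) x"
  unfolding Pw_def[abs_def]
  by (rule has_pderivs_eqI[OF pderivs_bil(1)[OF assms]])
    (simp_all add: hp_phi hm_phi Qw_def Nw_def algebra_simps)

lemma pderivs_Q:
  assumes "x \<in> good"
  shows "has_pderivs (Qw w) (- 2 * Pw w x - aa x * Qw w x - bb x * Nw w x - aa x * (Qw w x - Tw w x))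
    (2 * bb x * Qw w x - bb x * Tw w x - aa x * Nw w x) x"
  unfolding Qw_def[abs_def]
  by (rule has_pderivs_eqI[OF has_pderivs_add[OF pderivs_bil(2,3)[OF assms]]])
    (simp_all add: hp_phi hm_phi Pw_def Qw_def Nw_def Tw_def algebra_simps)

lemma pderivs_N:
  assumes "x \<in> good"
  shows "has_pderivs (Nw w) (- aa x * Nw w x + bb x * Tw w x) (2 * Pw w x + bb x * Nw w x + aa x * Tw w x) x"
  unfolding Nw_def[abs_def]
  by (rule has_pderivs_eqI[OF has_pderivs_mult[OF has_pderivs_const has_pderivs_diff[OF pderivs_bil(3,2)[OF assms]]]])
    (simp_all add: hp_phi hm_phi Pw_def Qw_def Nw_def Tw_def algebra_simps)

lemma pderivs_T:
  assumes "x \<in> good"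
  shows "\<exists>a. has_pderivs (Tw w) a (bb x * Tw w x - (aa x + 2) * Nw w x) x"
  unfolding Tw_def[abs_def]
  by (rule exI, rule has_pderivs_eqI[OF has_pderivs_diff[OF has_pderivs_add[OF pderivs_bil(2,3)[OF assms]]
         has_pderivs_mult[OF has_pderivs_const pderivs_bil(4)[OF assms]]] refl])
    (simp_all add: hp_phi hm_phi Pw_def Qw_def Nw_def Tw_def algebra_simps)

lemma pderivs_mu:
  assumes "x \<in> good"
  shows "has_pderivs mu (- 2 * aa x * (1 - mu x)) (2 * bb x * (1 - mu x)) x"
proof -
  have g: "fst x + \<i> * snd x \<in> ball 0 R" "cnj (fst x - \<i> * snd x) \<in> ball 0 R" using assms by (auto simp: good_def)
  have p: "has_pderivs (hp g) (hp \<phi> x * hp g x) (\<i> * (hp \<phi> x * hp g x)) x"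
    using has_pderivs_hp[OF Dg[OF g(1)]] by (simp add: hp_def)
  have m: "has_pderivs (hm g) (hm \<phi> x * hm g x) (- \<i> * (hm \<phi> x * hm g x)) x"
    using has_pderivs_hm[OF Dg[OF g(2)]] by (simp add: hm_def)
  show ?thesis
    unfolding mu_def[abs_def]
    by (rule has_pderivs_eqI[OF has_pderivs_diff[OF has_pderivs_const has_pderivs_mult[OF p m]]])
      (simp_all add: hp_phi hm_phi mu_def algebra_simps)
qed

text \<open>In the second direction the derivative of \<open>mu\<close> is
  \<open>2 * bb * (1 - mu)\<close>; multiplied by \<open>bil w c c\<close> it cancels all terms free
  of \<open>mu\<close> coming from the other summands, and the factor \<open>mu\<close>
  remains.\<close>

lemma pderivs_X:
  assumes "x \<in> good"
  shows "has_pderivs (Xw w) (2 * Pw w x - mu x * Qw w x) (mu x * Nw w x) x"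
  unfolding Xw_def[abs_def]
  by (rule has_pderivs_eqI[OF has_pderivs_add[OF has_pderivs_diff[OF pderivs_bil(1)[OF assms] has_pderivs_add[OF pderivs_bil(2,3)[OF assms]]]
         has_pderivs_mult[OF pderivs_mu[OF assms] pderivs_bil(4)[OF assms]]]])
    (simp_all add: hp_phi hm_phi Pw_def Qw_def Nw_def Tw_def algebra_simps)

lemma rholI_good:
  assumes "\<And>x. x \<in> good \<Longrightarrow> \<exists>a b. has_pderivs f a b x" "\<And>x. f (cnj2 x) = cnj (f x)"
  shows "rhol f"
  unfolding rhol_def using eventually_good by eventually_elim (use assms in blast)

lemma rhol_frame:
  assumes "herm_weight w"
  shows "rhol (Pw w)" "rhol (Qw w)" "rhol (Nw w)" "rhol (Tw w)" "rhol (Xw w)"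
proof -
  have m: "mu (cnj2 x) = cnj (mu x)" for x by (simp add: mu_def hp_cnj2 hm_cnj2 mult.commute)
  show "rhol (Pw w)" by (rule rholI_good) (use pderivs_P in blast, simp add: Pw_def bil_cnj2[OF assms])
  show "rhol (Qw w)" by (rule rholI_good) (use pderivs_Q in blast, simp add: Qw_def bil_cnj2[OF assms] add.commute)
  show "rhol (Nw w)" by (rule rholI_good) (use pderivs_N in blast, simp add: Nw_def bil_cnj2[OF assms] algebra_simps)
  show "rhol (Tw w)" by (rule rholI_good) (use pderivs_T in blast, simp add: Tw_def bil_cnj2[OF assms] add.commute)
  show "rhol (Xw w)" by (rule rholI_good) (use pderivs_X in blast, simp add: Xw_def bil_cnj2[OF assms] m add.commute)
qed

lemma rhol_mu: "rhol mu"
  by (rule rholI_good) (use pderivs_mu in blast, simp add: mu_def hp_cnj2 hm_cnj2 mult.commute)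

lemma pderivs_phi:
  assumes "x \<in> good" "\<psi> holomorphic_on ball 0 R"
  shows "has_pderivs (hp \<psi>) (hp (deriv \<psi>) x) (\<i> * hp (deriv \<psi>) x) x"
    "has_pderivs (hm \<psi>) (hm (deriv \<psi>) x) (- \<i> * hm (deriv \<psi>) x) x"
proof -
  have g: "fst x + \<i> * snd x \<in> ball 0 R" "cnj (fst x - \<i> * snd x) \<in> ball 0 R" using assms by (auto simp: good_def)
  have "(\<psi> has_field_derivative deriv \<psi> z) (at z)" if "z \<in> ball 0 R" for z
    using assms(2) that holomorphic_derivI by blast
  from has_pderivs_hp[OF this[OF g(1)]] has_pderivs_hm[OF this[OF g(2)]]
  show "has_pderivs (hp \<psi>) (hp (deriv \<psi>) x) (\<i> * hp (deriv \<psi>) x) x"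
    "has_pderivs (hm \<psi>) (hm (deriv \<psi>) x) (- \<i> * hm (deriv \<psi>) x) x"
    by (simp_all add: hp_def hm_def)
qed

lemma rhol_ab: "rhol aa" "rhol bb"
proof -
  have p: "has_pderivs (\<lambda>x. k * (hp \<phi> x + l * hm \<phi> x)) (k * (hp (deriv \<phi>) x + l * hm (deriv \<phi>) x))
     (k * (\<i> * hp (deriv \<phi>) x + l * (- \<i> * hm (deriv \<phi>) x))) x" if "x \<in> good" for x k l
    using has_pderivs_mult[OF has_pderivs_const has_pderivs_add[OF pderivs_phi(1)[OF that hol_phi]
         has_pderivs_mult[OF has_pderivs_const pderivs_phi(2)[OF that hol_phi]]], of k l] by simp
  show "rhol aa"
    by (rule rholI_good) (use p[of _ "1/2" 1] in \<open>auto simp: aa_def[abs_def] hp_cnj2 hm_cnj2 add.commute\<close>)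
  show "rhol bb"
    by (rule rholI_good) (use p[of _ "1/(2*\<i>)" "-1"] in \<open>auto simp: bb_def[abs_def] hp_cnj2 hm_cnj2 right_diff_distrib diff_divide_distrib\<close>)
qed

lemma bil_0:
  "bil w e e 0 = w False False" "bil w e c 0 = w False True" "bil w c e 0 = w True False" "bil w c c 0 = w True True"
  using init by (simp_all add: bil_def hp_def hm_def)

lemma mu_0: "mu 0 = 0"
  using init(5) complex_norm_square[of "g 0"] by (simp add: mu_def hp_def hm_def)

lemma ab_0: "aa 0 = of_real (Re (\<phi> 0))" "bb 0 = of_real (Im (\<phi> 0))"
  by (simp_all add: aa_def bb_def hp_def hm_def complex_eq_iff)

end

section \<open>Three components of the surface and their first derivatives\<close>

definition wU :: weight where "wU j k = (if \<not> j \<and> \<not> k then 1 else 0)"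
definition wZ :: weight where "wZ j k = (if j \<and> k then - 1 / 2 else 0)"
definition wY :: "real \<Rightarrow> weight" where
  "wY \<epsilon> j k = (if j = k then 0 else if k then \<i> / 2 * of_real \<epsilon> else - \<i> / 2 * of_real \<epsilon>)"

lemma herm_weights: "herm_weight wU" "herm_weight (wY \<epsilon>)" "herm_weight wZ"
  by (auto simp: herm_weight_def wU_def wY_def wZ_def)

context frame
begin

lemma frame_0:
  "Pw w 0 = w False False" "Qw w 0 = w False True + w True False" "Nw w 0 = \<i> * (w True False - w False True)"
  "Tw w 0 = w False True + w True False - 2 * w True True"
  by (simp_all add: Pw_def Qw_def Nw_def Tw_def bil_0)

lemma weights_0:
  "Pw wU 0 = 1" "Qw wU 0 = 0" "Nw wU 0 = 0" "Tw wU 0 = 0"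
  "Pw (wY \<epsilon>) 0 = 0" "Qw (wY \<epsilon>) 0 = 0" "Nw (wY \<epsilon>) 0 = of_real \<epsilon>" "Tw (wY \<epsilon>) 0 = 0"
  "Pw wZ 0 = 0" "Qw wZ 0 = 0" "Nw wZ 0 = 0" "Tw wZ 0 = 1"
  by (simp_all add: frame_0 wU_def wY_def wZ_def)

lemma Xw_0: "Xw wU 0 = 1" "Xw (wY \<epsilon>) 0 = 0" "Xw wZ 0 = 0"
  by (simp_all add: Xw_def mu_0 bil_0 wU_def wY_def wZ_def)

definition U :: "complex \<times> complex \<Rightarrow> complex" where "U x = Xw wU x - 1"

lemma rhol_U: "rhol U"
  unfolding U_def[abs_def] by (intro rhol_diff rhol_frame herm_weights rhol_const) simp

lemma pderivs_U: "x \<in> good \<Longrightarrow> has_pderivs U (2 * Pw wU x - mu x * Qw wU x) (mu x * Nw wU x) x"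
  unfolding U_def[abs_def] by (rule has_pderivs_eqI[OF has_pderivs_diff[OF pderivs_X has_pderivs_const]]) auto

lemma pd_frame:
  assumes "x \<in> good"
  shows "pd1 U x = 2 * Pw wU x - mu x * Qw wU x" "pd2 U x = mu x * Nw wU x"
    "pd1 (Xw w) x = 2 * Pw w x - mu x * Qw w x" "pd2 (Xw w) x = mu x * Nw w x"
    "pd1 mu x = - 2 * aa x * (1 - mu x)" "pd2 mu x = 2 * bb x * (1 - mu x)"
    "pd2 (Pw w) x = - aa x * Nw w x + bb x * Qw w x"
    "pd2 (Qw w) x = 2 * bb x * Qw w x - bb x * Tw w x - aa x * Nw w x"
    "pd1 (Nw w) x = - aa x * Nw w x + bb x * Tw w x"
    "pd2 (Nw w) x = 2 * Pw w x + bb x * Nw w x + aa x * Tw w x"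
    "pd2 (Tw w) x = bb x * Tw w x - (aa x + 2) * Nw w x"
  using has_pderivs_pd[OF pderivs_U[OF assms]] has_pderivs_pd[OF pderivs_X[OF assms]]
    has_pderivs_pd[OF pderivs_mu[OF assms]] has_pderivs_pd[OF pderivs_P[OF assms]]
    has_pderivs_pd[OF pderivs_Q[OF assms]] has_pderivs_pd[OF pderivs_N[OF assms]]
    has_pderivs_pd(2)[OF someI_ex[OF pderivs_T[OF assms]]]
  by auto

lemma good_0: "0 \<in> good"
  using eventually_nhds_x_imp_x[OF eventually_good] .

end

text \<open>The sign \<open>\<epsilon>\<close> orients the second target coordinate so that the
  quotient required by \<open>fold_data\<close> becomes \<open>1 / (4 * \<bar>b\<bar>)\<close>,
  hence positive for either sign of \<open>b\<close>.\<close>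

locale regular_frame = frame +
  fixes b \<epsilon> :: real
  assumes b: "b = Im (\<phi> 0)" "b \<noteq> 0" and eps: "\<epsilon> = sgn b"
begin

lemma eps2: "\<epsilon> * \<epsilon> = 1"
  using eps b(2) by (simp add: sgn_if)

sublocale fold_data U "Xw (wY \<epsilon>)" "Xw wZ" mu "Nw wU" "Nw (wY \<epsilon>)" "Nw wZ" "1 / (4 * \<bar>b\<bar>)"
proof
  show "rhol U" by (rule rhol_U)
  show "rhol (Xw (wY \<epsilon>))" "rhol (Xw wZ)" "rhol (Nw wU)" "rhol (Nw (wY \<epsilon>))" "rhol (Nw wZ)"
    by (intro rhol_frame herm_weights)+
  show "rhol mu" by (rule rhol_mu)
  show "U 0 = 0" by (simp add: U_def Xw_0)
  show "Xw (wY \<epsilon>) 0 = 0" "Xw wZ 0 = 0" "mu 0 = 0" "Nw wU 0 = 0"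
    by (simp_all add: Xw_0 mu_0 weights_0)
  show "\<forall>\<^sub>F x in nhds 0. pd2 U x = mu x * Nw wU x \<and> pd2 (Xw (wY \<epsilon>)) x = mu x * Nw (wY \<epsilon>) x \<and> pd2 (Xw wZ) x = mu x * Nw wZ x"
    using eventually_good by eventually_elim (simp add: pd_frame)
  show "pd1 U 0 \<noteq> 0" "pd2 mu 0 \<noteq> 0"
    using pd_frame[OF good_0] b by (simp_all add: weights_0 mu_0 ab_0)
  show "Nw (wY \<epsilon>) 0 / (2 * pd2 mu 0) = of_real (1 / (4 * \<bar>b\<bar>))"
    using pd_frame[OF good_0] b(2) by (simp add: weights_0 mu_0 ab_0 b(1)[symmetric] eps sgn_if)
  show "0 < 1 / (4 * \<bar>b\<bar>)" using b(2) by simp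
qed

end

locale regular_frame_normal = regular_frame +
  fixes v s y0 K0 d G1 G2
  assumes normal: "fold_normal U (Xw (wY \<epsilon>)) (Xw wZ) mu (Nw wU) (Nw (wY \<epsilon>)) (Nw wZ) (1 / (4 * \<bar>b\<bar>)) v s y0 K0 d G1 G2"
begin

sublocale fold_normal U "Xw (wY \<epsilon>)" "Xw wZ" mu "Nw wU" "Nw (wY \<epsilon>)" "Nw wZ" "1 / (4 * \<bar>b\<bar>)" v s y0 K0 d G1 G2
  by (rule normal)

definition "Pd w x = 2 * Pw w x - mu x * Qw w x"

lemma num_eq: "x \<in> good \<Longrightarrow> num x = Nw wZ x * Pd wU x - Pd wZ x * Nw wU x"
  and den_eq: "x \<in> good \<Longrightarrow> den x = Nw (wY \<epsilon>) x * Pd wU x - Pd (wY \<epsilon>) x * Nw wU x"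
  by (simp_all add: num_def den_def pd_frame Pd_def)

lemma rhol_Pd: "herm_weight w \<Longrightarrow> rhol (Pd w)"
  unfolding Pd_def[abs_def] by (intro rhol_diff rhol_mult rhol_frame rhol_mu rhol_const) auto

lemma pderivs_Pd_singular:
  assumes "x \<in> good" "mu x = 0"
  shows "\<exists>a. has_pderivs (Pd w) a (- 2 * aa x * Nw w x) x"
  unfolding Pd_def[abs_def]
  by (rule exI, rule has_pderivs_eqI[OF has_pderivs_diff[OF has_pderivs_mult[OF has_pderivs_const pderivs_P[OF assms(1)]]
        has_pderivs_mult[OF pderivs_mu[OF assms(1)] pderivs_Q[OF assms(1)]]] refl])
    (simp add: assms(2) algebra_simps)

text \<open>On \<open>mu = 0\<close> the products of two \<open>Nw\<close> terms and of two
  \<open>Pw\<close> terms cancel by antisymmetry. What is left reproduces the determinant with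
  factor \<open>bb\<close> and produces a second determinant with factor
  \<open>2 * aa\<close>.\<close>

lemma pd2_det_singular:
  assumes "x \<in> good" "mu x = 0"
  shows "\<exists>a. has_pderivs (\<lambda>x. Nw w x * Pd wU x - Pd w x * Nw wU x) a
     (bb x * (Nw w x * Pd wU x - Pd w x * Nw wU x) + 2 * aa x * (Tw w x * Pw wU x - Pw w x * Tw wU x)) x"
proof -
  obtain p q where "has_pderivs (Pd wU) p (- 2 * aa x * Nw wU x) x" "has_pderivs (Pd w) q (- 2 * aa x * Nw w x) x"
    using pderivs_Pd_singular[OF assms] by blast
  from has_pderivs_diff[OF has_pderivs_mult[OF pderivs_N[OF assms(1)] this(1)] has_pderivs_mult[OF this(2) pderivs_N[OF assms(1)]]]
  show ?thesis
    by (intro exI, rule has_pderivs_eqI[OF _ refl]) (simp_all add: Pd_def assms(2) algebra_simps)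
qed

text \<open>Along the singular curve \<open>d\<close> is, up to a nonvanishing factor, the real part of \<open>\<phi>\<close>.\<close>

definition "cf x = Tw wZ x * Pw wU x - Pw wZ x * Tw wU x"
definition "cg x = Tw (wY \<epsilon>) x * Pw wU x - Pw (wY \<epsilon>) x * Tw wU x"

text \<open>The identity \<open>num = Sl * den\<close> is differentiated in the second direction.
  The terms with \<open>bb\<close> cancel by the identity itself, the derivative of
  \<open>Sl\<close> is a multiple of \<open>d\<close>, and everything else carries the factor
  \<open>aa\<close>, the complexified real part of \<open>\<phi>\<close>.\<close>

lemma d_singular:
  "\<forall>\<^sub>F x in nhds 0. mu x = 0 \<longrightarrow> 3 / 2 * pd2 v x * d (U x, 0) * (den x)\<^sup>2 = 2 * aa x * (cf x * den x - num x * cg x)"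
proof -
  have sl: "\<forall>\<^sub>F x in nhds 0. Sl x * den x = num x" using slope by eventually_elim simp
  have "\<forall>\<^sub>F x in nhds 0. has_pderivs (\<lambda>x. Sl x * den x) (pd1 Sl x * den x + Sl x * pd1 den x) (pd2 Sl x * den x + Sl x * pd2 den x) x"
    using rhol_has_pderivs[OF rhol_Sl] rhol_has_pderivs[OF rhol_num(2)] by eventually_elim (rule has_pderivs_mult)
  from eventually_has_pderivs_cong[OF this sl] eventually_good slope Sl_pderivs
  show ?thesis
  proof eventually_elim
    case (elim x)
    show ?case
    proof
      assume m: "mu x = 0"
      obtain p where p: "has_pderivs (\<lambda>x. Nw wZ x * Pd wU x - Pd wZ x * Nw wU x) p (bb x * num x + 2 * aa x * cf x) x"
        using pd2_det_singular[OF elim(2) m, of wZ] num_eq[OF elim(2)] by (auto simp: cf_def)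
      obtain q where q: "has_pderivs (\<lambda>x. Nw (wY \<epsilon>) x * Pd wU x - Pd (wY \<epsilon>) x * Nw wU x) q (bb x * den x + 2 * aa x * cg x) x"
        using pd2_det_singular[OF elim(2) m, of "wY \<epsilon>"] den_eq[OF elim(2)] by (auto simp: cg_def)
      have "pd2 num x = bb x * num x + 2 * aa x * cf x"
        using has_pderivs_pd(2)[OF has_pderivs_cong[OF p open_good elim(2)]] num_eq by simp
      moreover have "pd2 den x = bb x * den x + 2 * aa x * cg x"
        using has_pderivs_pd(2)[OF has_pderivs_cong[OF q open_good elim(2)]] den_eq by simp
      moreover have "pd2 num x = pd2 Sl x * den x + Sl x * pd2 den x"
        using has_pderivs_pd(2)[OF elim(1)] .
      moreover have "pd2 Sl x = 3 / 2 * pd2 v x * d (U x, 0)"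
        using has_pderivs_pd(2) elim(4) m by blast
      ultimately have eq: "bb x * num x + 2 * aa x * cf x = 3 / 2 * pd2 v x * d (U x, 0) * den x + Sl x * (bb x * den x + 2 * aa x * cg x)"
        by simp
      have "3 / 2 * pd2 v x * d (U x, 0) * (den x)\<^sup>2
          = (bb x * num x + 2 * aa x * cf x - Sl x * (bb x * den x + 2 * aa x * cg x)) * den x"
        unfolding eq by (simp add: power2_eq_square)
      also have "\<dots> = 2 * aa x * (cf x * den x - num x * cg x)"
        unfolding elim(3) by (simp add: algebra_simps)
      finally show "3 / 2 * pd2 v x * d (U x, 0) * (den x)\<^sup>2 = 2 * aa x * (cf x * den x - num x * cg x)" .
    qed
  qed
qed

end

subsection \<open>The fifth-order coefficient\<close>

definition ax :: "(complex \<times> complex \<Rightarrow> complex) \<Rightarrow> complex fps" where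
  "ax F = fps_expansion (\<lambda>s. F (0, s)) 0"

lemma filterlim_axis2: "filterlim (\<lambda>s. (0, s)) (nhds (0 :: complex \<times> complex)) (nhds (0 :: complex))"
proof -
  have "((\<lambda>s. (0, s)) \<longlongrightarrow> (0, 0)) (nhds (0 :: complex))"
    by (intro tendsto_intros filterlim_ident)
  then show ?thesis by (simp add: zero_prod_def)
qed

lemma eventually_axis2: "\<forall>\<^sub>F x in nhds 0. P x \<Longrightarrow> \<forall>\<^sub>F s in nhds 0. P (0 :: complex, s :: complex)"
  by (rule eventually_compose_filterlim[OF _ filterlim_axis2])

lemma ax_has_fps_expansion:
  assumes "rhol F"
  shows "(\<lambda>s. F (0, s)) has_fps_expansion ax F"
proof -
  have "\<forall>\<^sub>F s in nhds 0. (\<lambda>s. F (0, s)) field_differentiable (at s)"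
    using eventually_axis2[OF rhol_has_pderivs[OF assms]]
    unfolding field_differentiable_def by eventually_elim (rule exI, erule has_pderivs_snd_line)
  then have "(\<lambda>s. F (0, s)) analytic_on {0}"
    unfolding eventually_nhds analytic_at
    by (auto simp: holomorphic_on_def intro: field_differentiable_at_within)
  then show ?thesis
    unfolding ax_def by (rule analytic_at_imp_has_fps_expansion_0)
qed

lemma ax_cong: "\<forall>\<^sub>F x in nhds 0. f x = g x \<Longrightarrow> ax f = ax g"
  unfolding ax_def by (rule fps_expansion_cong) (rule eventually_axis2)

lemma ax_nth_0: "rhol F \<Longrightarrow> fps_nth (ax F) 0 = F 0"
  using has_fps_expansion_imp_0_eq_fps_nth_0[OF ax_has_fps_expansion] by (simp add: zero_prod_def)

lemma ax_add: "rhol f \<Longrightarrow> rhol g \<Longrightarrow> ax (\<lambda>x. f x + g x) = ax f + ax g"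
  by (subst ax_def) (intro fps_expansion_eqI has_fps_expansion_add ax_has_fps_expansion)

lemma ax_diff: "rhol f \<Longrightarrow> rhol g \<Longrightarrow> ax (\<lambda>x. f x - g x) = ax f - ax g"
  by (subst ax_def) (intro fps_expansion_eqI has_fps_expansion_diff ax_has_fps_expansion)

lemma ax_mult: "rhol f \<Longrightarrow> rhol g \<Longrightarrow> ax (\<lambda>x. f x * g x) = ax f * ax g"
  by (subst ax_def) (intro fps_expansion_eqI has_fps_expansion_mult ax_has_fps_expansion)

lemma ax_const: "ax (\<lambda>x. c) = fps_const c"
  unfolding ax_def by (intro fps_expansion_eqI has_fps_expansion_const)

lemma ax_pd2:
  assumes "rhol F"
  shows "ax (pd2 F) = fps_deriv (ax F)"
proof -
  have "(\<lambda>s. pd2 F (0, s)) = deriv (\<lambda>s. F (0, s))" by (simp add: pd2_def fun_eq_iff)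
  then show ?thesis
    unfolding ax_def[of "pd2 F"]
    using fps_expansion_eqI[OF has_fps_expansion_deriv[OF ax_has_fps_expansion[OF assms]]] by simp
qed

lemma fps_mult_nth_small:
  fixes F G :: "complex fps"
  shows "fps_nth (F * G) 0 = fps_nth F 0 * fps_nth G 0"
    "fps_nth (F * G) (Suc 0) = fps_nth F 0 * fps_nth G 1 + fps_nth F 1 * fps_nth G 0"
    "fps_nth (F * G) 2 = fps_nth F 0 * fps_nth G 2 + fps_nth F 1 * fps_nth G 1 + fps_nth F 2 * fps_nth G 0"
    "fps_nth (F * G) 3 = fps_nth F 0 * fps_nth G 3 + fps_nth F 1 * fps_nth G 2 + fps_nth F 2 * fps_nth G 1 + fps_nth F 3 * fps_nth G 0"
  by (simp_all add: fps_mult_nth eval_nat_numeral)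

lemma fps_deriv_nth_small:
  fixes F G :: "complex fps"
  assumes "fps_deriv F = G"
  shows "fps_nth F 1 = fps_nth G 0" "fps_nth F 2 = fps_nth G 1 / 2" "fps_nth F 3 = fps_nth G 2 / 3"
proof -
  have "fps_nth G n = of_nat (Suc n) * fps_nth F (Suc n)" for n using assms by (auto simp: fps_deriv_nth)
  from this[of 0] this[of 1] this[of 2]
  show "fps_nth F 1 = fps_nth G 0" "fps_nth F 2 = fps_nth G 1 / 2" "fps_nth F 3 = fps_nth G 2 / 3"
    by (simp_all add: eval_nat_numeral)
qed

context regular_frame_normal
begin

text \<open>Cubic Taylor coefficients of \<open>num = Sl * den\<close> along the null axis are
  compared. The left side is known from the frame equations; on the right \<open>pd2 d 0\<close>
  occurs in the cubic coefficient of \<open>Sl\<close>, and the mixed derivative of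
  \<open>K0\<close> is found separately.\<close>

lemma jet_identity:
  assumes a0: "aa 0 = 0" and b1: "pd2 bb 0 = 0" and d0: "d 0 = 0" and d1: "pd1 d 0 = 0"
  shows "15 * (pd2 v 0) ^ 3 * pd2 d 0 = of_real \<epsilon> * (pd2 (pd2 aa) 0 - 12 * of_real b ^ 2)"
proof -
  define B where "B = (of_real b :: complex)"
  define E where "E = (of_real \<epsilon> :: complex)"
  have EE: "E * E = 1" using eps2 unfolding E_def by (metis of_real_1 of_real_mult)
  have B0: "B \<noteq> 0" using b(2) by (simp add: B_def)
  define n :: "(complex \<times> complex \<Rightarrow> complex) \<Rightarrow> nat \<Rightarrow> complex" where "n F k = fps_nth (ax F) k" for F k
  note rf = rhol_frame
  have n0: "n F 0 = F 0" if "rhol F" for F using ax_nth_0[OF that] by (simp add: n_def)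
  have nd: "n F (Suc 0) = n (pd2 F) 0" "n F 2 = n (pd2 F) (Suc 0) / 2" "n F 3 = n (pd2 F) 2 / 3" if "rhol F" for F
    using fps_deriv_nth_small[OF ax_pd2[OF that, symmetric]] by (simp_all add: n_def)
  have nc: "n F = n G" if "\<forall>\<^sub>F x in nhds 0. F x = G x" for F G
    using ax_cong[OF that] by (simp add: n_def fun_eq_iff)
  have na: "n (\<lambda>x. F x + G x) k = n F k + n G k" and ns: "n (\<lambda>x. F x - G x) k = n F k - n G k"
    and nm: "n (\<lambda>x. F x * G x) 0 = n F 0 * n G 0" "n (\<lambda>x. F x * G x) (Suc 0) = n F 0 * n G (Suc 0) + n F (Suc 0) * n G 0"
      "n (\<lambda>x. F x * G x) 2 = n F 0 * n G 2 + n F (Suc 0) * n G (Suc 0) + n F 2 * n G 0"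
      "n (\<lambda>x. F x * G x) 3 = n F 0 * n G 3 + n F (Suc 0) * n G 2 + n F 2 * n G (Suc 0) + n F 3 * n G 0"
    if "rhol F" "rhol G" for F G k
    using that by (simp_all add: n_def ax_add ax_diff ax_mult fps_mult_nth_small)
  have nk: "n (\<lambda>x. r * F x) k = r * n F k" if "rhol F" "cnj r = r" for F r k
    using ax_mult[OF rhol_const[OF that(2)] that(1)] by (simp add: n_def ax_const)
  have nC: "n (\<lambda>x. r) 0 = r" "n (\<lambda>x. r) (Suc 0) = 0" "n (\<lambda>x. r) 2 = 0" for r
    by (simp_all add: n_def ax_const)
  note rr = rhol_add rhol_diff rhol_mult rhol_mu rhol_ab rf rhol_const
  have aw: "n aa 0 = 0" "n bb 0 = B" "n bb (Suc 0) = 0" "n mu 0 = 0" and ba: "bb 0 = B"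
    using a0 b1 ab_0 b(1) by (simp_all add: n0 nd rhol_ab rhol_mu rhol_pd mu_0 B_def)
  define a1 where "a1 = n aa (Suc 0)"
  define a2 where "a2 = n aa 2"
  have a2: "a2 = pd2 (pd2 aa) 0 / 2"
    using nd(1)[OF rhol_pd(2)[OF rhol_ab(1)]] by (simp add: a2_def nd[OF rhol_ab(1)] n0 rhol_pd rhol_ab)
  have f1: "n (Pw w) (Suc 0) = B * Qw w 0" "n (Qw w) (Suc 0) = 2 * B * Qw w 0 - B * Tw w 0"
    "n (Nw w) (Suc 0) = 2 * Pw w 0 + B * Nw w 0" "n (Tw w) (Suc 0) = B * Tw w 0 - 2 * Nw w 0" if w: "herm_weight w" for w
    using pd_frame[OF good_0] a0 ba by (simp_all add: nd[OF rf(1)[OF w]] nd[OF rf(2)[OF w]] nd[OF rf(3)[OF w]] nd[OF rf(4)[OF w]]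
       n0 rhol_pd rf[OF w])
  have pP: "n (pd2 (Pw w)) = n (\<lambda>x. bb x * Qw w x - aa x * Nw w x)" for w
    by (rule nc) (use eventually_good in \<open>eventually_elim, simp add: pd_frame\<close>)
  have pN: "n (pd2 (Nw w)) = n (\<lambda>x. 2 * Pw w x + bb x * Nw w x + aa x * Tw w x)" for w
    by (rule nc) (use eventually_good in \<open>eventually_elim, simp add: pd_frame\<close>)
  have pM: "n (pd2 mu) = n (\<lambda>x. 2 * (bb x - bb x * mu x))"
    by (rule nc) (use eventually_good in \<open>eventually_elim, simp add: pd_frame algebra_simps\<close>)
  have f2: "n (Pw w) 2 = (B * n (Qw w) (Suc 0) - a1 * Nw w 0) / 2"
    "n (Nw w) 2 = (2 * n (Pw w) (Suc 0) + B * n (Nw w) (Suc 0) + a1 * Tw w 0) / 2"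
    "n (Nw w) 3 = (2 * n (Pw w) 2 + (B * n (Nw w) 2 + n bb 2 * Nw w 0) + (a1 * n (Tw w) (Suc 0) + a2 * Tw w 0)) / 3"
    if w: "herm_weight w" for w
    using aw by (simp_all add: nd[OF rf(1)[OF w]] nd[OF rf(3)[OF w]] pP pN na ns nm nk rr w n0[OF rf(1)[OF w]]
        n0[OF rf(2)[OF w]] n0[OF rf(3)[OF w]] n0[OF rf(4)[OF w]] a1_def[symmetric] a2_def[symmetric])
  have m1: "n mu (Suc 0) = 2 * B" using pd_frame(6)[OF good_0] ba by (simp add: nd n0 rhol_mu rhol_pd mu_0)
  have m2: "n mu 2 = - 2 * B\<^sup>2"
    using aw m1 by (simp add: nd(2)[OF rhol_mu] pM nk ns nm rr power2_eq_square)
  note we = herm_weights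
  have z0: "n (Pw w) 0 = Pw w 0" "n (Qw w) 0 = Qw w 0" "n (Nw w) 0 = Nw w 0" if "herm_weight w" for w
    using n0 rf[OF that] by auto
  have Pd: "n (Pd w) 0 = 2 * Pw w 0" "n (Pd w) (Suc 0) = 2 * n (Pw w) (Suc 0) - 2 * B * Qw w 0"
    "n (Pd w) 2 = 2 * n (Pw w) 2 - 2 * B * n (Qw w) (Suc 0) + 2 * B\<^sup>2 * Qw w 0" if w: "herm_weight w" for w
    unfolding Pd_def[abs_def] using aw m1 m2 by (simp_all add: ns nk nm rr w z0)
  have nnum: "n num = n (\<lambda>x. Nw wZ x * Pd wU x - Pd wZ x * Nw wU x)"
    by (rule nc) (use eventually_good in \<open>eventually_elim, simp add: num_eq\<close>)
  have nden: "n den = n (\<lambda>x. Nw (wY \<epsilon>) x * Pd wU x - Pd (wY \<epsilon>) x * Nw wU x)"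
    by (rule nc) (use eventually_good in \<open>eventually_elim, simp add: den_eq\<close>)
  \<comment> \<open>The weight \<open>wZ\<close> has a low-order jet: \<open>Nw wZ\<close> and
    \<open>Pd wZ\<close> start at second order, so only few products contribute. The term
    \<open>8 * B\<^sup>2\<close> is the frame's share in the constant 12.\<close>
  have numc: "n num 0 = 0" "n num (Suc 0) = 0" "n num 2 = a1" "n num 3 = (2 * a2 + 3 * B * a1 - 8 * B\<^sup>2) / 3"
  proof -
    have Z1: "n (Pw wZ) (Suc 0) = 0" "n (Qw wZ) (Suc 0) = - B" "n (Nw wZ) (Suc 0) = 0" "n (Tw wZ) (Suc 0) = B"
      "n (Nw wZ) 0 = 0"
      by (simp_all add: f1 we weights_0 z0)
    have Z2: "n (Pw wZ) 2 = - B\<^sup>2 / 2" "n (Nw wZ) 2 = a1 / 2"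
      by (simp_all add: f2 we weights_0 Z1 power2_eq_square)
    have Z3: "n (Nw wZ) 3 = (- B\<^sup>2 + B * a1 / 2 + a1 * B + a2) / 3"
      by (simp add: f2 we weights_0 Z1 Z2)
    have ZP: "n (Pd wZ) 0 = 0" "n (Pd wZ) (Suc 0) = 0" "n (Pd wZ) 2 = B\<^sup>2"
      by (simp_all add: Pd we weights_0 Z1 Z2 power2_eq_square)
    have U1: "n (Pw wU) (Suc 0) = 0" "n (Qw wU) (Suc 0) = 0" "n (Nw wU) (Suc 0) = 2" "n (Nw wU) 0 = 0"
      by (simp_all add: f1 we weights_0 z0)
    have UP: "n (Pd wU) 0 = 2" "n (Pd wU) (Suc 0) = 0"
      by (simp_all add: Pd we weights_0 U1)
    show "n num 0 = 0" "n num (Suc 0) = 0" "n num 2 = a1" "n num 3 = (2 * a2 + 3 * B * a1 - 8 * B\<^sup>2) / 3"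
      unfolding nnum
      by (simp_all add: ns nm rhol_mult rf rhol_Pd we Z1 Z2 Z3 ZP U1 UP field_simps)
  qed
  have denc: "n den 0 = 2 * E" "n den (Suc 0) = 2 * B * E"
    unfolding nden
    by (simp_all add: ns nm rhol_mult rf rhol_Pd we z0 f1 Pd weights_0 E_def)
  \<comment> \<open>Both \<open>mu\<close> and \<open>Nw wU\<close> vanish at the base point, so
    \<open>U\<close> is of third order along the null axis, with coefficient
    \<open>4 * B / 3\<close>.\<close>
  have U2: "n (pd2 U) 0 = 0" "n (pd2 U) (Suc 0) = 0" "n (pd2 U) 2 = 4 * B"
  proof -
    have "n (pd2 U) = n (\<lambda>x. mu x * Nw wU x)"
      by (rule nc) (use D2 in \<open>eventually_elim, simp\<close>)
    then show "n (pd2 U) 0 = 0" "n (pd2 U) (Suc 0) = 0" "n (pd2 U) 2 = 4 * B"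
      using f1(3)[OF we(1)] m1 aw by (simp_all add: nm rr we z0 weights_0)
  qed
  define V1 where "V1 = n v (Suc 0)"
  have V1: "V1 = pd2 v 0" by (simp add: V1_def nd n0 rn rhol_pd)
  have V0: "n v 0 = 0" by (simp add: n0 rn v0)
  have pv: "n (pd2 v) 0 = V1" "n (pd2 v) (Suc 0) = 2 * n v 2"
    unfolding V1_def nd(1,2)[OF rn(1)] by simp_all
  define W where "W = (\<lambda>x. 2 * (v x * pd2 v x))"
  have rW: "rhol W" unfolding W_def by (intro rhol_mult rn rhol_pd rhol_const) simp
  have Wc: "n W 0 = 0" "n W (Suc 0) = 2 * V1\<^sup>2" "n W 2 = 6 * V1 * n v 2"
    unfolding W_def using pv V0
    by (simp_all add: nk nm rn rhol_pd rhol_mult V1_def[symmetric] power2_eq_square)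
  define yp where "yp = (\<lambda>x. pd1 y0 (U x, 0))"
  have ryp: "rhol yp" unfolding yp_def
    by (rule rhol_compose[OF rhol_pd(1)[OF rn(3)] rh(1) rhol_const at0(1)]) simp_all
  have yp0: "n yp 0 = 0"
  proof -
    have "pd1 (Xw (wY \<epsilon>)) 0 = yp 0 * pd1 U 0"
      using has_pderivs_pd(1)[OF eventually_nhds_x_imp_x[OF Y_pderivs]] v0 by (simp add: yp_def)
    then show ?thesis using pd_frame[OF good_0] by (simp add: n0 ryp weights_0 mu_0)
  qed
  have Yn: "n (\<lambda>x. yp x * pd2 U x + W x) = n (\<lambda>x. mu x * Nw (wY \<epsilon>) x)"
  proof (rule nc)
    show "\<forall>\<^sub>F x in nhds 0. yp x * pd2 U x + W x = mu x * Nw (wY \<epsilon>) x"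
      using Y_pderivs D2
    proof eventually_elim
      case (elim x)
      have "pd2 (Xw (wY \<epsilon>)) x = mu x * Nw (wY \<epsilon>) x" using elim(2) by blast
      from trans[OF has_pderivs_pd(2)[OF elim(1), symmetric] this] show ?case
        unfolding yp_def W_def by (simp only: mult.assoc)
    qed
  qed
  have nYW: "n (\<lambda>x. yp x * pd2 U x + W x) k = n (\<lambda>x. yp x * pd2 U x) k + n W k" for k
    by (rule na) (intro rhol_mult ryp rhol_pd rh rW)+
  \<comment> \<open>Linear coefficients of the differentiated relation
    \<open>Y = y0 (U) + v^2\<close>: the left gives \<open>2 * V1\<^sup>2\<close>, the right
    \<open>2 * B * E\<close>.\<close>
  have VV: "V1\<^sup>2 = B * E"
    using fun_cong[OF Yn, of "Suc 0"] U2 Wc m1 aw yp0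
    by (simp add: nYW nm ryp rhol_pd rh rr we z0 weights_0 E_def)
  have V10: "V1 \<noteq> 0" using VV B0 EE by auto
  \<comment> \<open>Quadratic coefficients of the same relation: the contributions of the second
    coefficient of \<open>mu\<close> and of the first coefficient of
    \<open>Nw (wY \<epsilon>)\<close> cancel.\<close>
  have "6 * V1 * n v 2 = 0"
    using fun_cong[OF Yn, of 2] U2 Wc m1 m2 aw yp0 f1(3)[OF we(2)]
    by (simp add: nYW nm ryp rhol_pd rh rr we z0 weights_0 E_def power2_eq_square)
  then have V2: "n v 2 = 0" using V10 by simp
  \<comment> \<open>Since \<open>U\<close> starts at third order and \<open>v\<close> has no
    quadratic term, the argument is \<open>(4 * B / 3 * s^3, V1\<^sup>2 * s^2)\<close> up to
    fourth-order terms in the axis parameter \<open>s\<close>.\<close>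
  have C1: "n (\<lambda>x. f (U x, (v x)\<^sup>2)) 0 = f 0" "n (\<lambda>x. f (U x, (v x)\<^sup>2)) (Suc 0) = 0"
    and C2: "n (\<lambda>x. f (U x, (v x)\<^sup>2)) 2 = pd2 f 0 * V1\<^sup>2"
    and C3': "n (\<lambda>x. f (U x, (v x)\<^sup>2)) 3 = (pd1 f 0 * (4 * B) + n (\<lambda>x. pd2 f (U x, (v x)\<^sup>2)) (Suc 0) * (2 * V1\<^sup>2)) / 3"
    if f: "rhol f" for f
  proof -
    have r: "rhol (\<lambda>x. pd1 f (U x, (v x)\<^sup>2))" "rhol (\<lambda>x. pd2 f (U x, (v x)\<^sup>2))"
      using rhol_Uv2 rhol_pd f by blast+
    have e: "n (pd2 (\<lambda>x. f (U x, (v x)\<^sup>2))) = n (\<lambda>x. pd1 f (U x, (v x)\<^sup>2) * pd2 U x + pd2 f (U x, (v x)\<^sup>2) * W x)"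
    proof (rule nc)
      show "\<forall>\<^sub>F x in nhds 0. pd2 (\<lambda>x. f (U x, (v x)\<^sup>2)) x = pd1 f (U x, (v x)\<^sup>2) * pd2 U x + pd2 f (U x, (v x)\<^sup>2) * W x"
        using has_pderivs_Uv2[OF f]
        by eventually_elim (simp add: has_pderivs_pd(2) W_def algebra_simps)
    qed
    have e': "n (pd2 (\<lambda>x. f (U x, (v x)\<^sup>2))) k = n (\<lambda>x. pd1 f (U x, (v x)\<^sup>2) * pd2 U x) k + n (\<lambda>x. pd2 f (U x, (v x)\<^sup>2) * W x) k" for k
      unfolding e by (rule na) (intro rhol_mult r rhol_pd rh rW)+
    have z: "n (\<lambda>x. pd1 f (U x, (v x)\<^sup>2)) 0 = pd1 f 0" "n (\<lambda>x. pd2 f (U x, (v x)\<^sup>2)) 0 = pd2 f 0"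
      using n0[OF r(1)] n0[OF r(2)] at0(1) v0 by (simp_all add: zero_prod_def)
    show "n (\<lambda>x. f (U x, (v x)\<^sup>2)) 0 = f 0"
      using n0[OF rhol_Uv2[OF f]] at0(1) v0 by (simp add: zero_prod_def)
    show "n (\<lambda>x. f (U x, (v x)\<^sup>2)) (Suc 0) = 0" "n (\<lambda>x. f (U x, (v x)\<^sup>2)) 2 = pd2 f 0 * V1\<^sup>2"
      "n (\<lambda>x. f (U x, (v x)\<^sup>2)) 3 = (pd1 f 0 * (4 * B) + n (\<lambda>x. pd2 f (U x, (v x)\<^sup>2)) (Suc 0) * (2 * V1\<^sup>2)) / 3"
      unfolding nd[OF rhol_Uv2[OF f]] e' nm[OF r(1) rhol_pd(2)[OF rh(1)]] nm[OF r(2) rW]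
      using U2 Wc V2 z by simp_all
  qed
  have C3: "n (\<lambda>x. f (U x, (v x)\<^sup>2)) 3 = pd1 f 0 * (4 * B) / 3" if f: "rhol f" for f
    unfolding C3'[OF f] C1(2)[OF rhol_pd(2)[OF f]] by simp
  define kf where "kf = (\<lambda>x. pd2 K0 (U x, (v x)\<^sup>2))"
  define df where "df = (\<lambda>x. d (U x, (v x)\<^sup>2))"
  define ef where "ef = (\<lambda>x. pd2 d (U x, (v x)\<^sup>2))"
  have rk: "rhol kf" "rhol df" "rhol ef"
    unfolding kf_def df_def ef_def using rhol_Uv2 rhol_pd rn by blast+
  have kc: "n kf 0 = pd2 K0 0" "n kf (Suc 0) = 0" "n kf 2 = pd2 (pd2 K0) 0 * V1\<^sup>2" "n kf 3 = pd1 (pd2 K0) 0 * (4 * B) / 3"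
    unfolding kf_def by (simp_all add: C1 C2 C3 rn rhol_pd)
  have dc: "n df 0 = 0" "n df (Suc 0) = 0" "n df 2 = pd2 d 0 * V1\<^sup>2"
    unfolding df_def by (simp_all add: C1 C2 rn d0)
  have ec: "n ef 0 = pd2 d 0" unfolding ef_def by (simp add: C1 rn rhol_pd)
  define gf where "gf = (\<lambda>x. v x * df x)"
  define hf where "hf = (\<lambda>x. v x * (v x * (v x * ef x)))"
  have rg: "rhol gf" "rhol hf" unfolding gf_def hf_def by (intro rhol_mult rn rk)+
  have gc: "n gf 0 = 0" "n gf (Suc 0) = 0" "n gf 3 = V1 ^ 3 * pd2 d 0"
    unfolding gf_def nm[OF rn(1) rk(2)] using dc V0 V2 by (simp_all add: V1_def power2_eq_square power3_eq_cube)
  have hc: "n hf 0 = 0" "n hf (Suc 0) = 0" "n hf 3 = V1 ^ 3 * pd2 d 0"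
    unfolding hf_def using ec V0 V2
    by (simp_all add: nm rn rk rhol_mult V1_def power3_eq_cube)
  have SlE: "Sl = (\<lambda>x. kf x + (3 / 2 * gf x + hf x))"
    by (simp add: fun_eq_iff Sl_def kf_def gf_def df_def hf_def ef_def power3_eq_cube mult_ac)
  have rg': "rhol (\<lambda>x. 3 / 2 * gf x)" by (intro rhol_mult rhol_const rg) simp
  have "n Sl k = n kf k + (n (\<lambda>x. 3 / 2 * gf x) k + n hf k)" for k
    unfolding SlE by (simp only: na[OF rk(1) rhol_add[OF rg' rg(2)]] na[OF rg' rg(2)])
  moreover have "n (\<lambda>x. 3 / 2 * gf x) k = 3 / 2 * n gf k" for k by (rule nk[OF rg(1)]) simp
  ultimately have "n Sl k = n kf k + (3 / 2 * n gf k + n hf k)" for k by simp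
  \<comment> \<open>The factor 5/2 adds 3/2 from the term \<open>v * d\<close> and 1 from
    \<open>v^3 * pd2 d\<close>; both have the same cubic coefficient.\<close>
  then have Sc: "n Sl 0 = pd2 K0 0" "n Sl (Suc 0) = 0" "n Sl 3 = pd1 (pd2 K0) 0 * (4 * B) / 3 + 5 / 2 * V1 ^ 3 * pd2 d 0"
    by (simp_all add: kc gc hc)
  have nSl: "n num = n (\<lambda>x. Sl x * den x)" by (rule nc) (rule slope)
  have S0: "n Sl 0 = 0"
    using numc(1) denc(1) EE unfolding nSl nm[OF rhol_Sl rhol_num(2)] by auto
  have S2: "a1 = n Sl 2 * (2 * E)"
    using numc(3) denc Sc S0 unfolding nSl nm[OF rhol_Sl rhol_num(2)] by simp
  have S3: "(2 * a2 + 3 * B * a1 - 8 * B\<^sup>2) / 3 = n Sl 2 * (2 * B * E) + n Sl 3 * (2 * E)"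
    using numc(4) denc Sc S0 unfolding nSl nm[OF rhol_Sl rhol_num(2)] by simp
  \<comment> \<open>The mixed derivative comes from differentiating the slope identity in the first
    direction at the origin, where \<open>Sl\<close> vanishes.\<close>
  have Kuw: "pd1 (pd2 K0) 0 * (4 * E) = 2 * B"
  proof -
    have "has_pderivs (\<lambda>x. Nw wZ x * pd1 U x - pd1 (Xw wZ) x * Nw wU x)
      (pd1 (Nw wZ) 0 * pd1 U 0 + Nw wZ 0 * pd1 (pd1 U) 0 - (pd1 (pd1 (Xw wZ)) 0 * Nw wU 0 + pd1 (Xw wZ) 0 * pd1 (Nw wU) 0))
      (pd2 (Nw wZ) 0 * pd1 U 0 + Nw wZ 0 * pd2 (pd1 U) 0 - (pd2 (pd1 (Xw wZ)) 0 * Nw wU 0 + pd1 (Xw wZ) 0 * pd2 (Nw wU) 0)) 0"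
      by (intro has_pderivs_diff has_pderivs_mult rhol_has_pderivs_0 rhol_pd rh)
    then have "pd1 num 0 = 2 * B"
      using pd_frame[OF good_0] ba aw has_pderivs_pd(1) by (simp add: num_def[abs_def] weights_0 mu_0 a0)
    moreover have "pd1 num 0 = pd1 Sl 0 * den 0"
    proof -
      have sl: "\<forall>\<^sub>F x in nhds 0. Sl x * den x = num x" using slope by eventually_elim simp
      have "\<forall>\<^sub>F x in nhds 0. has_pderivs (\<lambda>x. Sl x * den x) (pd1 Sl x * den x + Sl x * pd1 den x) (pd2 Sl x * den x + Sl x * pd2 den x) x"
        using rhol_has_pderivs[OF rhol_Sl] rhol_has_pderivs[OF rhol_num(2)] by eventually_elim (rule has_pderivs_mult)
      from has_pderivs_pd(1)[OF eventually_nhds_x_imp_x[OF eventually_has_pderivs_cong[OF this sl]]]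
      show ?thesis using S0 by (simp add: n0 rhol_Sl)
    qed
    moreover have "pd1 Sl 0 = pd1 (pd2 K0) 0 * 2"
      using eventually_nhds_x_imp_x[OF Sl_pderivs] pd_frame[OF good_0] mu_0 at0(1) d0 has_pderivs_pd(1)
      by (auto simp: weights_0 zero_prod_def[symmetric])
    moreover have "den 0 = 2 * E" using denc(1) by (simp add: n0 rhol_num)
    ultimately show ?thesis by simp
  qed
  have K: "pd1 (pd2 K0) 0 = B * E / 2"
  proof -
    have "pd1 (pd2 K0) 0 * (4 * E) * E = 2 * B * E" using Kuw by simp
    then have "pd1 (pd2 K0) 0 * 4 * (E * E) = 2 * B * E" by (simp add: mult_ac)
    then show ?thesis unfolding EE by (simp add: field_simps)
  qed
  \<comment> \<open>The terms with \<open>a1\<close> cancel, so the result does not depend on the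
    first null derivative of \<open>aa\<close>. The summand \<open>4 / 3 * B\<^sup>2\<close>,
    multiplied by 3 and moved across, raises 8 to 12.\<close>
  have "(2 * a2 + 3 * B * a1 - 8 * B\<^sup>2) / 3 = B * a1 + (B * E / 2 * (4 * B) / 3 + 5 / 2 * V1 ^ 3 * pd2 d 0) * (2 * E)"
    unfolding S3 Sc(3) K using S2 by (simp add: algebra_simps)
  also have "\<dots> = B * a1 + 4 / 3 * B\<^sup>2 * (E * E) + 5 * V1 ^ 3 * pd2 d 0 * E"
    by (simp add: algebra_simps power2_eq_square)
  finally have "3 * (15 * V1 ^ 3 * pd2 d 0 * E) = 3 * (2 * a2 - 12 * B\<^sup>2)"
    unfolding EE by (simp add: field_simps)
  then have "15 * V1 ^ 3 * pd2 d 0 * E = 2 * a2 - 12 * B\<^sup>2"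
    by (simp only: mult_cancel_left) simp
  then have "15 * V1 ^ 3 * pd2 d 0 * E * E = (2 * a2 - 12 * B\<^sup>2) * E" by (rule arg_cong)
  then have "15 * V1 ^ 3 * pd2 d 0 * (E * E) = E * (2 * a2 - 12 * B\<^sup>2)"
    by (simp only: mult_ac)
  then show ?thesis unfolding EE V1 a2 by (simp add: E_def B_def)
qed

end

subsection \<open>Smooth germs and right-left equivalence\<close>

definition smooth_at :: "('a::euclidean_space \<Rightarrow> 'b::euclidean_space) \<Rightarrow> 'a \<Rightarrow> bool" where
  "smooth_at f x \<longleftrightarrow> (\<exists>S. open S \<and> x \<in> S \<and> smooth_on S f)"

lemma smooth_atI: "open S \<Longrightarrow> x \<in> S \<Longrightarrow> smooth_on S f \<Longrightarrow> smooth_at f x"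
  unfolding smooth_at_def by blast

lemma smooth_at_linear: "bounded_linear L \<Longrightarrow> smooth_at L x"
  by (rule smooth_atI[OF open_UNIV UNIV_I]) (rule smooth_on_linear)

lemma smooth_at_const: "smooth_at (\<lambda>x. c) x"
  by (rule smooth_atI[OF open_UNIV UNIV_I]) (rule smooth_on_const)

lemma smooth_at_common:
  assumes "smooth_at f x" "smooth_at g x"
  obtains S where "open S" "x \<in> S" "smooth_on S f" "smooth_on S g"
proof -
  obtain S T where S: "open S" "x \<in> S" "smooth_on S f" and T: "open T" "x \<in> T" "smooth_on T g"
    using assms unfolding smooth_at_def by blast
  show ?thesis
    by (rule that[of "S \<inter> T"]) (use S T in \<open>auto intro: smooth_on_subset[OF S(3)] smooth_on_subset[OF T(3)]\<close>)
qed

lemma smooth_at_add: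
  assumes "smooth_at f x" "smooth_at g x" shows "smooth_at (\<lambda>x. f x + g x) x"
  by (rule smooth_at_common[OF assms]) (rule smooth_atI, assumption+, rule smooth_on_add)

lemma smooth_at_diff:
  assumes "smooth_at f x" "smooth_at g x" shows "smooth_at (\<lambda>x. f x - g x) x"
  by (rule smooth_at_common[OF assms]) (rule smooth_atI, assumption+, rule smooth_on_diff)

lemma smooth_at_Pair:
  assumes "smooth_at f x" "smooth_at g x" shows "smooth_at (\<lambda>x. (f x, g x)) x"
  by (rule smooth_at_common[OF assms]) (rule smooth_atI, assumption+, rule smooth_on_Pair)

lemma smooth_at_mult:
  fixes f g :: "'a::euclidean_space \<Rightarrow> real"
  assumes "smooth_at f x" "smooth_at g x" shows "smooth_at (\<lambda>x. f x * g x) x"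
  by (rule smooth_at_common[OF assms]) (rule smooth_atI, assumption+, rule smooth_on_mult)

lemma smooth_at_power:
  fixes f :: "'a::euclidean_space \<Rightarrow> real"
  shows "smooth_at f x \<Longrightarrow> smooth_at (\<lambda>x. f x ^ n) x"
  by (induction n) (auto intro: smooth_at_const smooth_at_mult)

lemma smooth_at_compose:
  assumes "smooth_at f (g x)" "smooth_at g x"
  shows "smooth_at (\<lambda>x. f (g x)) x"
proof -
  obtain T where T: "open T" "g x \<in> T" "smooth_on T f" using assms unfolding smooth_at_def by blast
  obtain S where S: "open S" "x \<in> S" "smooth_on S g" using assms unfolding smooth_at_def by blast
  have o: "open (g -` T \<inter> S)"
    using continuous_open_preimage[OF smooth_on_imp_continuous_on[OF S(3)] S(1) T(1)] by (simp add: Int_commute)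
  show ?thesis
    by (rule smooth_atI[OF o], use S T in simp, rule smooth_on_compose[OF o T(1) _ T(3) smooth_on_subset[OF S(3)]]) auto
qed

lemma smooth_at_tendsto: "smooth_at f x \<Longrightarrow> (f \<longlongrightarrow> f x) (nhds x)"
  unfolding smooth_at_def
  by (metis continuous_on_eq_continuous_at isCont_def smooth_on_imp_continuous_on tendsto_at_iff_tendsto_nhds)

lemma smooth_at_fst: "smooth_at f x \<Longrightarrow> smooth_at (\<lambda>x. fst (f x)) x"
  by (rule smooth_at_compose[OF smooth_at_linear[OF bounded_linear_fst]])

lemma smooth_at_snd: "smooth_at f x \<Longrightarrow> smooth_at (\<lambda>x. snd (f x)) x"
  by (rule smooth_at_compose[OF smooth_at_linear[OF bounded_linear_snd]])

lemma smooth_at_ident: "smooth_at (\<lambda>x. x) x"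
  by (rule smooth_at_linear[OF bounded_linear_ident])

lemma smooth_at_has_derivative:
  assumes "smooth_at f x"
  shows "(f has_derivative frechet_derivative f (at x)) (at x)"
  using assms smooth_on_imp_differentiable frechet_derivative_works unfolding smooth_at_def by metis

lemma eventually_smooth_at:
  assumes "smooth_at f x" shows "\<forall>\<^sub>F y in nhds x. smooth_at f y"
  using assms unfolding smooth_at_def eventually_nhds by blast

lemma smooth_at_frechet_derivative:
  "smooth_at f x \<Longrightarrow> smooth_at (\<lambda>x. frechet_derivative f (at x) v) x"
  unfolding smooth_at_def using smooth_on_frechet_derivative by blast

lemma smooth_at_eventually_compose:
  assumes "\<forall>\<^sub>F y in nhds (f x). P y" "smooth_at f x"
  shows "\<forall>\<^sub>F x in nhds x. P (f x)"
  using eventually_compose_filterlim[OF assms(1) smooth_at_tendsto[OF assms(2)]] .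

lemma analytic_imp_smooth_at: "f analytic_on {x} \<Longrightarrow> smooth_at f x"
  unfolding analytic_at using holomorphic_on_imp_smooth_on smooth_atI by blast

type_synonym r2 = "real \<times> real"
type_synonym r3 = "real \<times> real \<times> real"

definition inverse_germs :: "('a::euclidean_space \<Rightarrow> 'b::euclidean_space) \<Rightarrow> ('b \<Rightarrow> 'a) \<Rightarrow> bool" where
  "inverse_germs f f' \<longleftrightarrow> smooth_at f 0 \<and> smooth_at f' 0 \<and> f 0 = 0 \<and> f' 0 = 0 \<and>
     (\<forall>\<^sub>F x in nhds 0. f' (f x) = x) \<and> (\<forall>\<^sub>F y in nhds 0. f (f' y) = y)"

lemma inverse_germsI:
  "smooth_at f 0 \<Longrightarrow> smooth_at f' 0 \<Longrightarrow> f 0 = 0 \<Longrightarrow> f' 0 = 0 \<Longrightarrow>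
     (\<forall>\<^sub>F x in nhds 0. f' (f x) = x) \<Longrightarrow> (\<forall>\<^sub>F y in nhds 0. f (f' y) = y) \<Longrightarrow> inverse_germs f f'"
  unfolding inverse_germs_def by blast

lemma inverse_germs_sym: "inverse_germs f f' \<Longrightarrow> inverse_germs f' f"
  unfolding inverse_germs_def by blast

lemma inverse_germs_trans:
  assumes "inverse_germs f f'" "inverse_germs g g'"
  shows "inverse_germs (\<lambda>x. g (f x)) (\<lambda>x. f' (g' x))"
proof (rule inverse_germsI)
  note f = assms(1)[unfolded inverse_germs_def] and g = assms(2)[unfolded inverse_germs_def]
  show "smooth_at (\<lambda>x. g (f x)) 0" "smooth_at (\<lambda>x. f' (g' x)) 0"
    by (rule smooth_at_compose[where f = g and g = f], use f g in simp_all)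
      (rule smooth_at_compose[where f = f' and g = g'], use f g in simp_all)
  show "g (f 0) = 0" "f' (g' 0) = 0" using f g by auto
  have "\<forall>\<^sub>F x in nhds 0. g' (g (f x)) = f x"
    by (rule smooth_at_eventually_compose[where P = "\<lambda>y. g' (g y) = y"]) (use f g in simp_all)
  moreover have "\<forall>\<^sub>F x in nhds 0. f' (f x) = x" using f by blast
  ultimately show "\<forall>\<^sub>F x in nhds 0. f' (g' (g (f x))) = x" by eventually_elim simp
  have "\<forall>\<^sub>F x in nhds 0. f (f' (g' x)) = g' x"
    by (rule smooth_at_eventually_compose[where P = "\<lambda>y. f (f' y) = y"]) (use f g in simp_all)
  moreover have "\<forall>\<^sub>F x in nhds 0. g (g' x) = x" using g by blast
  ultimately show "\<forall>\<^sub>F y in nhds 0. g (f (f' (g' y))) = y" by eventually_elim simp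
qed

definition germ_equiv :: "(r2 \<Rightarrow> r3) \<Rightarrow> (r2 \<Rightarrow> r3) \<Rightarrow> bool" where
  "germ_equiv F G \<longleftrightarrow> (\<exists>\<sigma> \<sigma>' \<Theta> \<Theta>'. inverse_germs \<sigma> \<sigma>' \<and> inverse_germs \<Theta> \<Theta>' \<and>
     (\<forall>\<^sub>F x in nhds 0. \<Theta> (F (\<sigma> x)) = G x))"

lemma germ_equivI:
  "inverse_germs \<sigma> \<sigma>' \<Longrightarrow> inverse_germs \<Theta> \<Theta>' \<Longrightarrow> (\<forall>\<^sub>F x in nhds 0. \<Theta> (F (\<sigma> x)) = G x) \<Longrightarrow> germ_equiv F G"
  unfolding germ_equiv_def by blast

text \<open>The limit hypothesis makes \<open>F\<close> take values where the target change is
  invertible; only then can it be undone after \<open>F\<close>.\<close>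

lemma germ_equiv_sym:
  assumes "germ_equiv F G" "(F \<longlongrightarrow> 0) (nhds 0)"
  shows "germ_equiv G F"
proof -
  obtain \<sigma> \<sigma>' \<Theta> \<Theta>' where *: "inverse_germs \<sigma> \<sigma>'" "inverse_germs \<Theta> \<Theta>'" "\<forall>\<^sub>F x in nhds 0. \<Theta> (F (\<sigma> x)) = G x"
    using assms(1) unfolding germ_equiv_def by blast
  note s = *(1)[unfolded inverse_germs_def] and t = *(2)[unfolded inverse_germs_def]
  have "\<forall>\<^sub>F y in nhds 0. \<Theta> (F (\<sigma> (\<sigma>' y))) = G (\<sigma>' y)"
    by (rule smooth_at_eventually_compose[where f = \<sigma>' and x = 0 and P = "\<lambda>x. \<Theta> (F (\<sigma> x)) = G x"]) (use *(3) s in simp_all)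
  moreover have "\<forall>\<^sub>F y in nhds 0. \<sigma> (\<sigma>' y) = y" using s by blast
  moreover have "\<forall>\<^sub>F y in nhds 0. \<Theta>' (\<Theta> (F y)) = F y"
    using eventually_compose_filterlim[OF _ assms(2), of "\<lambda>y. \<Theta>' (\<Theta> y) = y"] t by blast
  ultimately have "\<forall>\<^sub>F y in nhds 0. \<Theta>' (G (\<sigma>' y)) = F y"
    by eventually_elim metis
  then show ?thesis using germ_equivI[OF inverse_germs_sym[OF *(1)] inverse_germs_sym[OF *(2)]] by blast
qed

lemma germ_equiv_trans:
  assumes "germ_equiv F G" "germ_equiv G H"
  shows "germ_equiv F H"
proof -
  obtain \<sigma> \<sigma>' \<Theta> \<Theta>' where 1: "inverse_germs \<sigma> \<sigma>'" "inverse_germs \<Theta> \<Theta>'" "\<forall>\<^sub>F x in nhds 0. \<Theta> (F (\<sigma> x)) = G x"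
    using assms(1) unfolding germ_equiv_def by blast
  obtain \<rho> \<rho>' \<Omega> \<Omega>' where 2: "inverse_germs \<rho> \<rho>'" "inverse_germs \<Omega> \<Omega>'" "\<forall>\<^sub>F x in nhds 0. \<Omega> (G (\<rho> x)) = H x"
    using assms(2) unfolding germ_equiv_def by blast
  have "\<forall>\<^sub>F x in nhds 0. \<Theta> (F (\<sigma> (\<rho> x))) = G (\<rho> x)"
    by (rule smooth_at_eventually_compose[where f = \<rho> and x = 0 and P = "\<lambda>x. \<Theta> (F (\<sigma> x)) = G x"])
      (use 1(3) 2(1)[unfolded inverse_germs_def] in simp_all)
  with 2(3) have "\<forall>\<^sub>F x in nhds 0. \<Omega> (\<Theta> (F (\<sigma> (\<rho> x)))) = H x"
    by eventually_elim metis
  then show ?thesis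
    using germ_equivI[OF inverse_germs_trans[OF 2(1) 1(1)] inverse_germs_trans[OF 1(2) 2(2)]] by blast
qed

subsection \<open>Real points of real holomorphic germs\<close>

definition cx :: "r2 \<Rightarrow> complex \<times> complex" where
  "cx x = (of_real (fst x), of_real (snd x))"

definition rr :: "(complex \<times> complex \<Rightarrow> complex) \<Rightarrow> r2 \<Rightarrow> real" where
  "rr f x = Re (f (cx x))"

lemma bounded_linear_cx: "bounded_linear cx"
  unfolding cx_def
  by (intro bounded_linear_Pair bounded_linear_compose[OF bounded_linear_of_real] bounded_linear_fst bounded_linear_snd)

lemma cx_0 [simp]: "cx 0 = 0"
  by (simp add: cx_def zero_prod_def)

lemma cnj2_cx [simp]: "cnj2 (cx x) = cx x"
  by (simp add: cnj2_def cx_def)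

lemma filterlim_cx: "filterlim cx (nhds 0) (nhds 0)"
  using smooth_at_tendsto[OF smooth_at_linear[OF bounded_linear_cx], of 0] by simp

lemma eventually_cx: "\<forall>\<^sub>F x in nhds 0. P x \<Longrightarrow> \<forall>\<^sub>F x in nhds 0. P (cx x)"
  by (rule eventually_compose_filterlim[OF _ filterlim_cx])

lemma rr_of_real: "rhol f \<Longrightarrow> \<forall>\<^sub>F x in nhds 0. f (cx x) = of_real (rr f x)"
  using eventually_cx[OF rhol_cnj]
  by (auto elim!: eventually_mono simp: rr_def complex_eq_iff)

lemma rr_0: "f 0 = 0 \<Longrightarrow> rr f 0 = 0"
  by (simp add: rr_def)

lemma smooth_at_rr: "rhol f \<Longrightarrow> smooth_at (rr f) 0"
proof -
  assume "rhol f"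
  then obtain e where e: "e > 0" "hol2 (ball 0 e) f" by (rule rhol_ballE) blast
  have "smooth_at f (cx 0)"
    by (rule smooth_atI[OF open_ball _ hol2_imp_smooth_on[OF open_ball e(2)]]) (use e in simp)
  from smooth_at_compose[OF this smooth_at_linear[OF bounded_linear_cx]]
  have "smooth_at (\<lambda>x. Re (f (cx x))) 0"
    by (rule smooth_at_compose[OF smooth_at_linear[OF bounded_linear_Re]])
  then show ?thesis by (simp add: rr_def[abs_def])
qed

lemma smooth_at_rr_compose:
  assumes "rhol f" "smooth_at p x" "smooth_at q x" "p x = 0" "q x = 0"
  shows "smooth_at (\<lambda>x. rr f (p x, q x)) x"
proof (rule smooth_at_compose[where f = "rr f" and g = "\<lambda>x. (p x, q x)"])
  have "(p x, q x) = 0" using assms by (simp add: zero_prod_def)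
  then show "smooth_at (rr f) (p x, q x)" using smooth_at_rr[OF assms(1)] by simp
  show "smooth_at (\<lambda>x. (p x, q x)) x" by (rule smooth_at_Pair[OF assms(2,3)])
qed

lemma rr_compose:
  assumes "rhol f" "rhol g1" "rhol g2"
  shows "\<forall>\<^sub>F x in nhds 0. rr (\<lambda>x. f (g1 x, g2 x)) x = rr f (rr g1 x, rr g2 x)"
  using rr_of_real[OF assms(2)] rr_of_real[OF assms(3)]
  by eventually_elim (simp add: rr_def cx_def)

lemma rr_fst_snd:
  "rr h x = y \<Longrightarrow> h (cx x) = fst (cx x) \<Longrightarrow> y = fst x"
  "rr h x = y \<Longrightarrow> h (cx x) = snd (cx x) \<Longrightarrow> y = snd x"
  by (auto simp: rr_def cx_def)

lemma rr_inverse_germs: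
  assumes "rhol f1" "rhol f2" "rhol g1" "rhol g2" "f1 0 = 0" "f2 0 = 0" "g1 0 = 0" "g2 0 = 0"
    and "\<forall>\<^sub>F y in nhds 0. f1 (g1 y, g2 y) = fst y \<and> f2 (g1 y, g2 y) = snd y"
    and "\<forall>\<^sub>F x in nhds 0. g1 (f1 x, f2 x) = fst x \<and> g2 (f1 x, f2 x) = snd x"
  shows "inverse_germs (\<lambda>x. (rr f1 x, rr f2 x)) (\<lambda>x. (rr g1 x, rr g2 x))"
proof (rule inverse_germsI)
  show "smooth_at (\<lambda>x. (rr f1 x, rr f2 x)) 0" "smooth_at (\<lambda>x. (rr g1 x, rr g2 x)) 0"
    by (intro smooth_at_Pair smooth_at_rr assms)+
  show "(rr f1 0, rr f2 0) = 0" "(rr g1 0, rr g2 0) = 0"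
    by (simp_all add: rr_0 assms prod_eq_iff)
  show "\<forall>\<^sub>F x in nhds 0. (rr g1 (rr f1 x, rr f2 x), rr g2 (rr f1 x, rr f2 x)) = x"
    using rr_compose[OF assms(3,1,2)] rr_compose[OF assms(4,1,2)] eventually_cx[OF assms(10)]
  proof eventually_elim
    case (elim x)
    from rr_fst_snd(1)[OF elim(1)] rr_fst_snd(2)[OF elim(2)] elim(3) show ?case by (simp add: prod_eq_iff)
  qed
  show "\<forall>\<^sub>F x in nhds 0. (rr f1 (rr g1 x, rr g2 x), rr f2 (rr g1 x, rr g2 x)) = x"
    using rr_compose[OF assms(1,3,4)] rr_compose[OF assms(2,3,4)] eventually_cx[OF assms(9)]
  proof eventually_elim
    case (elim x)
    from rr_fst_snd(1)[OF elim(1)] rr_fst_snd(2)[OF elim(2)] elim(3) show ?case by (simp add: prod_eq_iff)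
  qed
qed

subsection \<open>Normal forms\<close>

definition tri :: "(complex \<times> complex \<Rightarrow> complex) \<Rightarrow> (complex \<times> complex \<Rightarrow> complex) \<Rightarrow> (complex \<times> complex \<Rightarrow> complex) \<Rightarrow> r2 \<Rightarrow> r3" where
  "tri U Y Z x = (rr U x, rr Y x, rr Z x)"

definition Md :: "(complex \<times> complex \<Rightarrow> complex) \<Rightarrow> r2 \<Rightarrow> r3" where
  "Md d x = (fst x, (snd x)\<^sup>2, (snd x) ^ 3 * rr d (fst x, (snd x)\<^sup>2))"

lemma inverse_germs_shear:
  assumes a: "smooth_at (a :: real \<Rightarrow> real) 0" "a 0 = 0" and k: "smooth_at (k :: r2 \<Rightarrow> real) 0" "k 0 = 0"
  shows "inverse_germs (\<lambda>(x, y, z). (x, y - a x, z - k (x, y - a x))) (\<lambda>(x, y, z). (x, y + a x, z + k (x, y)))"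
proof (rule inverse_germsI)
  have x: "smooth_at (\<lambda>p :: r3. fst p) 0" and y: "smooth_at (\<lambda>p :: r3. fst (snd p)) 0" and z: "smooth_at (\<lambda>p :: r3. snd (snd p)) 0"
    by (intro smooth_at_fst smooth_at_snd smooth_at_ident)+
  have ax: "smooth_at (\<lambda>p :: r3. a (fst p)) 0"
    by (rule smooth_at_compose[OF _ x]) (use a in simp)
  have w: "smooth_at (\<lambda>p :: r3. fst (snd p) - a (fst p)) 0" by (rule smooth_at_diff[OF y ax])
  have k1: "smooth_at (\<lambda>p :: r3. k (fst p, fst (snd p) - a (fst p))) 0"
    by (rule smooth_at_compose[where f = k, OF _ smooth_at_Pair[OF x w]]) (use k a in \<open>simp add: zero_prod_def\<close>)
  have k2: "smooth_at (\<lambda>p :: r3. k (fst p, fst (snd p))) 0"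
    by (rule smooth_at_compose[where f = k, OF _ smooth_at_Pair[OF x y]]) (use k in \<open>simp add: zero_prod_def\<close>)
  show "smooth_at (\<lambda>(x, y, z). (x, y - a x, z - k (x, y - a x))) 0"
    unfolding split_beta by (intro smooth_at_Pair smooth_at_diff x y z ax k1)
  show "smooth_at (\<lambda>(x, y, z). (x, y + a x, z + k (x, y))) 0"
    unfolding split_beta by (intro smooth_at_Pair smooth_at_add x y z ax k2)
qed (use a k in \<open>auto simp: zero_prod_def intro!: always_eventually\<close>)

lemma smooth_at_rr_axis: "rhol f \<Longrightarrow> smooth_at (\<lambda>x. rr f (x, 0)) 0"
  using smooth_at_rr_compose[of f "\<lambda>x. x" 0 "\<lambda>x. 0"] by (simp add: smooth_at_ident smooth_at_const)

text \<open>The source is parametrized by \<open>(U, v)\<close>; in the target, shears remove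
  \<open>y0\<close> from the second component and then, with the second component equal to
  \<open>v^2\<close>, the even part \<open>K0\<close> from the third.\<close>

lemma (in fold_normal) germ_equiv_Md: "germ_equiv (tri U Y Z) (Md d)"
proof (rule germ_equivI)
  have y00: "y0 0 = 0"
    using eventually_nhds_x_imp_x[OF Y_eq] at0 v0 by (simp add: zero_prod_def)
  have K00: "K0 0 = 0"
    using eventually_nhds_x_imp_x[OF Z_eq] at0 v0 by (simp add: zero_prod_def)
  show "inverse_germs (\<lambda>x. (rr G1 x, rr G2 x)) (\<lambda>x. (rr U x, rr v x))"
    by (rule rr_inverse_germs[OF rn(6,7) rh(1) rn(1) G0 at0(1) v0 inv(2) inv(1)])
  show "inverse_germs (\<lambda>(x, y, z). (x, y - rr y0 (x, 0), z - rr K0 (x, y - rr y0 (x, 0))))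
    (\<lambda>(x, y, z). (x, y + rr y0 (x, 0), z + rr K0 (x, y)))"
    by (rule inverse_germs_shear[OF smooth_at_rr_axis[OF rn(3)] _ smooth_at_rr[OF rn(4)]])
      (use y00 K00 in \<open>simp_all add: rr_0 rr_def cx_def zero_prod_def\<close>)
  show "\<forall>\<^sub>F x in nhds 0. (\<lambda>(x, y, z). (x, y - rr y0 (x, 0), z - rr K0 (x, y - rr y0 (x, 0))))
     (tri U Y Z (rr G1 x, rr G2 x)) = Md d x"
    using rr_of_real[OF rn(6)] rr_of_real[OF rn(7)] eventually_cx[OF inv(1)]
      eventually_cx[OF rhol_eventually_compose[OF Y_eq rn(6,7) G0]]
      eventually_cx[OF rhol_eventually_compose[OF Z_eq rn(6,7) G0]]
  proof eventually_elim
    case (elim x)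
    have c: "cx (rr G1 x, rr G2 x) = (G1 (cx x), G2 (cx x))" using elim(1,2) by (simp add: cx_def)
    have e: "rr U (rr G1 x, rr G2 x) = fst x"
      "rr Y (rr G1 x, rr G2 x) = rr y0 (fst x, 0) + (snd x)\<^sup>2"
      "rr Z (rr G1 x, rr G2 x) = rr K0 (fst x, (snd x)\<^sup>2) + (snd x) ^ 3 * rr d (fst x, (snd x)\<^sup>2)"
      unfolding rr_def[of U] rr_def[of Y] rr_def[of Z] c using elim(3-5)
      by (simp_all add: rr_def cx_def flip: of_real_power)
    show ?case unfolding tri_def e by (simp add: Md_def)
  qed
qed

lemma rhol_fst_function:
  assumes "h analytic_on {0}"
  shows "rhol (\<lambda>x. (h (fst x) + cnj (h (cnj (fst x)))) / 2)"
proof -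
  obtain S where S: "open S" "0 \<in> S" "h holomorphic_on S" using assms unfolding analytic_at by blast
  have "\<forall>\<^sub>F z in nhds 0. z \<in> S" using S eventually_nhds_in_open by blast
  then have "\<forall>\<^sub>F x in nhds 0. fst (x :: complex \<times> complex) \<in> S"
    by (rule eventually_compose_filterlim) (use rhol_tendsto[OF rhol_fst] in simp)
  then have "\<forall>\<^sub>F x in nhds 0. \<exists>a b. has_pderivs (\<lambda>x. h (fst x)) a b x"
    by eventually_elim (use S holomorphic_derivI has_pderivs_field_compose[OF has_pderivs_fst] in blast)
  from rhol_symmetrize[OF this] show ?thesis by (simp add: cnj2_def)
qed

text \<open>Write \<open>d = w * e (u, w) + u^m * hh (u)\<close>. Dividing the third component by
  \<open>e\<close>, up to sign, leaves \<open>c * w + u^m * r\<close> with \<open>r\<close>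
  positive, and \<open>u\<close> times the \<open>m\<close>-th root of \<open>r\<close> becomes the
  new first coordinate. All changes depend on \<open>(u, w)\<close> with \<open>w = v^2\<close>, so
  the same formulas define changes of the target.\<close>

lemma Md_equiv_cuspS:
  assumes d: "rhol d" "pd2 d 0 \<noteq> 0"
    and h: "h analytic_on {0}" "h 0 \<noteq> 0" "\<forall>\<^sub>F u in nhds 0. d (u, 0) = u ^ (k + 1) * h u"
  shows "\<exists>s\<in>{1, -1}. germ_equiv (Md d) (cuspS_model k s)"
proof -
  define m where "m = k + 1"
  define hh where "hh = (\<lambda>x :: complex \<times> complex. (h (fst x) + cnj (h (cnj (fst x)))) / 2)"
  have hh: "rhol hh" unfolding hh_def by (rule rhol_fst_function[OF h(1)])
  have cnj_lim: "filterlim cnj (nhds 0) (nhds 0)"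
    using isCont_cnj[OF continuous_ident, of 0] tendsto_at_iff_tendsto_nhds[of cnj 0] by (simp add: isCont_def)
  have d_axis: "rhol (\<lambda>x. d (fst x, 0))" by (rule rhol_compose[OF d(1) rhol_fst rhol_const]) auto
  have dh: "\<forall>\<^sub>F u in nhds 0. d (u, 0) = u ^ m * h u \<and> d (u, 0) = u ^ m * cnj (h (cnj u))"
    using h(3) eventually_compose_filterlim[OF h(3) cnj_lim] eventually_axis[OF rhol_cnj[OF d(1)]]
  proof eventually_elim
    case (elim u)
    have "cnj (d (cnj u, 0)) = u ^ m * cnj (h (cnj u))" unfolding elim(2) by (simp add: m_def)
    then show ?case using elim(1,3) by (simp add: cnj2_def m_def)
  qed
  \<comment> \<open>Both \<open>h\<close> and its reflection are quotients of the real function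
    \<open>d (u, 0)\<close> by the same power; they agree for \<open>u \<noteq> 0\<close> near the
    origin, and hence at the origin by continuity. So symmetrizing does not change the value
    there.\<close>
  have hh0: "hh 0 = h 0"
  proof -
    have hc: "isCont h 0" using h(1) analytic_at_imp_isCont by blast
    have "\<forall>\<^sub>F u in at 0. h u = cnj (h (cnj u))"
      using filter_leD[OF at_within_le_nhds dh, of UNIV] eventually_at_topological
      by (auto simp: eventually_at_filter elim!: eventually_mono)
    moreover have "((\<lambda>u. cnj (h (cnj u))) \<longlongrightarrow> cnj (h (cnj 0))) (at 0)"
      using isCont_o2[OF isCont_cnj[OF continuous_ident], of 0 h] hc by (auto intro!: tendsto_cnj simp: isCont_def)
    ultimately have "(h \<longlongrightarrow> cnj (h (cnj 0))) (at 0)"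
      by (subst tendsto_cong) auto
    from tendsto_unique[OF at_neq_bot this isContD[OF hc]] have "h 0 = cnj (h 0)" by simp
    then have "h 0 + cnj (h 0) = h 0 + h 0" by simp
    then show ?thesis by (simp add: hh_def)
  qed
  have "rhol (\<lambda>x. d x - d (fst x, 0))" by (rule rhol_diff[OF d(1) d_axis])
  from rhol_divide_snd[OF this] obtain e where e: "rhol e" "\<forall>\<^sub>F x in nhds 0. d x - d (fst x, 0) = snd x * e x"
    by auto
  have e0: "e 0 = pd2 d 0"
  proof -
    have "\<forall>\<^sub>F x in nhds 0. has_pderivs (\<lambda>x. d x - d (fst x, 0)) (pd1 d x - pd1 (\<lambda>x. d (fst x, 0)) x) (pd2 d x - pd2 (\<lambda>x. d (fst x, 0)) x) x"
      using rhol_has_pderivs[OF d(1)] rhol_has_pderivs[OF d_axis] by eventually_elim (rule has_pderivs_diff)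
    from has_pderivs_unique[OF eventually_nhds_x_imp_x[OF eventually_has_pderivs_cong[OF this e(2)]]
        has_pderivs_mult[OF has_pderivs_snd rhol_has_pderivs_0[OF e(1)]]]
    show ?thesis by (simp add: pd2_def)
  qed
  have d_eq: "\<forall>\<^sub>F x in nhds 0. d x = snd x * e x + fst x ^ m * hh x"
  proof -
    have "filterlim fst (nhds 0) (nhds (0 :: complex \<times> complex))" using rhol_tendsto[OF rhol_fst] by simp
    from eventually_compose_filterlim[OF dh this] e(2) show ?thesis
    proof eventually_elim
      case (elim x)
      have "d (fst x, 0) = (d (fst x, 0) + d (fst x, 0)) / 2" by simp
      also have "\<dots> = fst x ^ m * hh x"
        using elim(1) unfolding hh_def by (metis distrib_left times_divide_eq_right)
      finally show ?case using elim(2) by (simp add: algebra_simps)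
    qed
  qed
  define e1 h1 where "e1 = Re (e 0)" and "h1 = Re (hh 0)"
  have re: "e 0 = of_real e1" "hh 0 = of_real h1"
    using rhol_real[OF e(1)] rhol_real[OF hh] by (simp_all add: e1_def h1_def complex_eq_iff)
  have nz: "e1 \<noteq> 0" "h1 \<noteq> 0" using re e0 d(2) hh0 h(2) by auto
  \<comment> \<open>This sign makes the radicand \<open>c * hh / e\<close> positive at the origin
    and becomes the sign of the model; \<open>c * c = 1\<close> lets it be moved between the two
    summands.\<close>
  define c where "c = sgn (h1 / e1)"
  have "sgn q = 1 \<or> sgn q = -1" "sgn q * q > 0" "sgn q * sgn q = 1" if "q \<noteq> 0" for q :: real
    using that by (auto simp: sgn_if)
  from this[of "h1 / e1"] nz have c: "c = 1 \<or> c = -1" "c * (h1 / e1) > 0" "c * c = 1" by (auto simp: c_def)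
  define r where "r = (\<lambda>x. of_real c * hh x / e x)"
  have r: "rhol r" unfolding r_def using re nz
    by (intro rhol_divide rhol_mult rhol_const hh e(1)) auto
  define \<rho> where "\<rho> = (\<lambda>x. exp (Ln (r x) / of_nat m))"
  have r0: "r 0 = of_real (c * (h1 / e1))" using re by (simp add: r_def)
  have \<rho>: "rhol \<rho>" unfolding \<rho>_def by (rule rhol_pos_power[OF r r0 c(2)]) (simp add: m_def)
  have \<rho>m: "\<forall>\<^sub>F x in nhds 0. \<rho> x ^ m = r x"
  proof -
    have "r 0 \<noteq> 0" using r0 c(2) by auto
    from rhol_eventually_ne[OF r this] show ?thesis
    proof eventually_elim
      case (elim x)
      have "\<rho> x ^ m = exp (of_nat m * (Ln (r x) / of_nat m))" unfolding \<rho>_def by (rule exp_of_nat_mult[symmetric])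
      also have "of_nat m * (Ln (r x) / of_nat m) = Ln (r x)"
      proof -
        have "of_nat m \<noteq> (0 :: complex)" unfolding m_def of_nat_eq_0_iff by simp
        then show ?thesis by simp
      qed
      finally show ?case using elim by simp
    qed
  qed
  \<comment> \<open>With the exact root absorbed, \<open>f1^m = u^m * r\<close>. The value of the
    root at the origin is nonzero, so \<open>(f1, w)\<close> are coordinates.\<close>
  define f1 where "f1 = (\<lambda>x. fst x * \<rho> x)"
  have f1: "rhol f1" "f1 0 = 0" unfolding f1_def by (auto intro: rhol_mult rhol_fst \<rho>)
  have "pd1 f1 0 = \<rho> 0"
    using has_pderivs_pd(1)[OF has_pderivs_mult[OF has_pderivs_fst rhol_has_pderivs_0[OF \<rho>]]] by (simp add: f1_def)
  then have "pd1 f1 0 * pd2 snd 0 - pd2 f1 0 * pd1 snd 0 \<noteq> 0"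
    using has_pderivs_pd[OF has_pderivs_snd] by (simp add: \<rho>_def)
  from rhol_inverse_function[OF f1(1) rhol_snd f1(2) _ this] obtain g1 g2 where
    g: "rhol g1" "rhol g2" "g1 0 = 0" "g2 0 = 0"
    "\<forall>\<^sub>F y in nhds 0. f1 (g1 y, g2 y) = fst y \<and> snd (g1 y, g2 y) = snd y"
    "\<forall>\<^sub>F x in nhds 0. g1 (f1 x, snd x) = fst x \<and> g2 (f1 x, snd x) = snd x" by auto
  have fg: "\<forall>\<^sub>F y in nhds 0. f1 (g1 y, snd y) = fst y" using g(5) by eventually_elim auto
  have gf: "\<forall>\<^sub>F x in nhds 0. g1 (f1 x, snd x) = fst x" using g(6) by eventually_elim auto
  have rfg: "\<forall>\<^sub>F y in nhds 0. rr f1 (rr g1 y, snd y) = fst y"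
    using rr_of_real[OF g(1)] eventually_cx[OF fg]
    by eventually_elim (simp add: rr_def cx_def)
  have rgf: "\<forall>\<^sub>F y in nhds 0. rr g1 (rr f1 y, snd y) = fst y"
    using rr_of_real[OF f1(1)] eventually_cx[OF gf]
    by eventually_elim (simp add: rr_def cx_def)
  define ei where "ei = (\<lambda>x. of_real c / e x)"
  have ei: "rhol ei" unfolding ei_def using re nz by (intro rhol_divide rhol_const e(1)) auto
  have ene: "e 0 \<noteq> 0" using re nz by simp
  have e_ei: "\<forall>\<^sub>F y in nhds 0. rr ei y * rr e y = c"
    using rr_of_real[OF e(1)] rr_of_real[OF ei] eventually_cx[OF rhol_eventually_ne[OF e(1) ene]]
  proof eventually_elim
    case (elim y)
    have "of_real (rr ei y * rr e y) = ei (cx y) * e (cx y)" using elim by simp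
    also have "\<dots> = of_real c" using elim(3) by (simp add: ei_def)
    finally show ?case by (simp only: of_real_eq_iff)
  qed
  have sq: "smooth_at (\<lambda>x :: r2. (snd x)\<^sup>2) 0" by (intro smooth_at_power smooth_at_snd smooth_at_ident)
  have lim2: "filterlim (\<lambda>x :: r2. (fst x, (snd x)\<^sup>2)) (nhds 0) (nhds 0)"
    using smooth_at_tendsto[OF smooth_at_Pair[OF smooth_at_fst[OF smooth_at_ident] sq]] by (simp add: zero_prod_def)
  have lim3: "filterlim (\<lambda>x :: r3. (fst x, fst (snd x))) (nhds 0) (nhds 0)"
    using smooth_at_tendsto[OF smooth_at_Pair[OF smooth_at_fst[OF smooth_at_ident] smooth_at_fst[OF smooth_at_snd[OF smooth_at_ident]]], of "0 :: r3"]
    by (simp add: zero_prod_def)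
  have src: "inverse_germs (\<lambda>x. (rr g1 (fst x, (snd x)\<^sup>2), snd x)) (\<lambda>x. (rr f1 (fst x, (snd x)\<^sup>2), snd x))"
  proof (rule inverse_germsI)
    show "smooth_at (\<lambda>x. (rr g1 (fst x, (snd x)\<^sup>2), snd x)) 0" "smooth_at (\<lambda>x. (rr f1 (fst x, (snd x)\<^sup>2), snd x)) 0"
      by (intro smooth_at_Pair smooth_at_rr_compose g f1 smooth_at_fst smooth_at_snd smooth_at_ident sq; simp)+
    show "\<forall>\<^sub>F x in nhds 0. (rr f1 (fst (rr g1 (fst x, (snd x)\<^sup>2), snd x), (snd (rr g1 (fst x, (snd x)\<^sup>2), snd x))\<^sup>2), snd (rr g1 (fst x, (snd x)\<^sup>2), snd x)) = x"
      using eventually_compose_filterlim[OF rfg lim2] by eventually_elim (simp add: prod_eq_iff)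
    show "\<forall>\<^sub>F x in nhds 0. (rr g1 (fst (rr f1 (fst x, (snd x)\<^sup>2), snd x), (snd (rr f1 (fst x, (snd x)\<^sup>2), snd x))\<^sup>2), snd (rr f1 (fst x, (snd x)\<^sup>2), snd x)) = x"
      using eventually_compose_filterlim[OF rgf lim2] by eventually_elim (simp add: prod_eq_iff)
  qed (use g(3) f1(2) in \<open>simp_all add: rr_def cx_def zero_prod_def\<close>)
  \<comment> \<open>The first component repeats the source change in the target variables
    \<open>(x, y)\<close>, which are \<open>(u, v^2)\<close> on the surface; the third is scaled by
    the unit \<open>c / e\<close>.\<close>
  define \<Theta> where "\<Theta> = (\<lambda>x :: r3. (rr f1 (fst x, fst (snd x)), fst (snd x), snd (snd x) * rr ei (fst x, fst (snd x))))"
  define \<Theta>' where "\<Theta>' = (\<lambda>x :: r3. (rr g1 (fst x, fst (snd x)), fst (snd x), snd (snd x) * (c * rr e (rr g1 (fst x, fst (snd x)), fst (snd x)))))"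
  have lim_g: "filterlim (\<lambda>y. (rr g1 y, snd y)) (nhds 0) (nhds 0)"
    using smooth_at_tendsto[OF smooth_at_Pair[OF smooth_at_rr[OF g(1)] smooth_at_snd[OF smooth_at_ident]]]
    by (simp add: rr_0[where f = g1, OF g(3)] zero_prod_def[symmetric])
  have tgt: "inverse_germs \<Theta> \<Theta>'"
  proof (rule inverse_germsI)
    have s1: "smooth_at (\<lambda>x :: r3. rr f (fst x, fst (snd x))) 0" if "rhol f" for f
      by (intro smooth_at_rr_compose that smooth_at_fst smooth_at_snd smooth_at_ident; simp)
    have s2: "smooth_at (\<lambda>x :: r3. rr e (rr g1 (fst x, fst (snd x)), fst (snd x))) 0"
      by (intro smooth_at_rr_compose s1 g e(1) smooth_at_fst smooth_at_snd smooth_at_ident)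
        (use g(3) in \<open>simp_all add: rr_def cx_def zero_prod_def\<close>)
    show "smooth_at \<Theta> 0" "smooth_at \<Theta>' 0" unfolding \<Theta>_def \<Theta>'_def
      by (intro smooth_at_Pair smooth_at_mult smooth_at_const s1 s2 ei f1 g smooth_at_fst smooth_at_snd smooth_at_ident)+
    show "\<Theta> 0 = 0" "\<Theta>' 0 = 0" using g(3) f1(2) by (simp_all add: \<Theta>_def \<Theta>'_def rr_def cx_def zero_prod_def)
    show "\<forall>\<^sub>F x in nhds 0. \<Theta>' (\<Theta> x) = x"
      using eventually_compose_filterlim[OF rgf lim3] eventually_compose_filterlim[OF e_ei lim3]
    proof eventually_elim
      case (elim x)
      have "snd (snd x) * rr ei (fst x, fst (snd x)) * (c * rr e (fst x, fst (snd x))) = snd (snd x) * (c * (rr ei (fst x, fst (snd x)) * rr e (fst x, fst (snd x))))"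
        by simp
      also have "\<dots> = snd (snd x)" unfolding elim(2) c(3) by simp
      finally show ?case using elim(1) by (simp add: \<Theta>_def \<Theta>'_def prod_eq_iff)
    qed
    show "\<forall>\<^sub>F x in nhds 0. \<Theta> (\<Theta>' x) = x"
      using eventually_compose_filterlim[OF rfg lim3] eventually_compose_filterlim[OF eventually_compose_filterlim[OF e_ei lim_g] lim3]
    proof eventually_elim
      case (elim x)
      define y where "y = (rr g1 (fst x, fst (snd x)), fst (snd x))"
      have "snd (snd x) * (c * rr e y) * rr ei y = snd (snd x) * (c * (rr ei y * rr e y))"
        by simp
      also have "\<dots> = snd (snd x)" using elim(2) c(3) by (simp add: y_def)
      finally show ?case using elim(1) by (simp add: \<Theta>_def \<Theta>'_def prod_eq_iff y_def)
    qed
  qed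
  have real_eq: "\<forall>\<^sub>F y in nhds 0. rr d y * rr ei y = c * snd y + rr f1 y ^ m"
    using eventually_cx[OF d_eq] eventually_cx[OF \<rho>m] rr_of_real[OF d(1)] rr_of_real[OF ei] rr_of_real[OF f1(1)]
      eventually_cx[OF rhol_eventually_ne[OF e(1) ene]]
  proof eventually_elim
    case (elim y)
    have "of_real (rr d y * rr ei y) = d (cx y) * ei (cx y)" using elim by simp
    also have "\<dots> = of_real c * snd (cx y) + fst (cx y) ^ m * r (cx y)"
      using elim(6) unfolding elim(1) by (simp add: ei_def r_def field_simps)
    also have "\<dots> = of_real c * snd (cx y) + f1 (cx y) ^ m"
      unfolding elim(2)[symmetric] by (simp add: f1_def power_mult_distrib)
    also have "\<dots> = of_real (c * snd y + rr f1 y ^ m)" using elim by (simp add: cx_def)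
    finally show ?case by (simp only: of_real_eq_iff)
  qed
  have "germ_equiv (Md d) (cuspS_model k c)"
  proof (rule germ_equivI[OF src tgt])
    show "\<forall>\<^sub>F x in nhds 0. \<Theta> (Md d (rr g1 (fst x, (snd x)\<^sup>2), snd x)) = cuspS_model k c x"
      using eventually_compose_filterlim[OF rfg lim2] eventually_compose_filterlim[OF eventually_compose_filterlim[OF real_eq lim_g] lim2]
    proof eventually_elim
      case (elim x)
      define y where "y = (rr g1 (fst x, (snd x)\<^sup>2), (snd x)\<^sup>2)"
      have 1: "rr f1 y = fst x" using elim(1) by (simp add: y_def)
      have 2: "rr d y * rr ei y = c * (snd x)\<^sup>2 + fst x ^ m" using elim(2) 1 by (simp add: y_def)
      have "snd x ^ 3 * rr d y * rr ei y = snd x ^ 3 * (c * (snd x)\<^sup>2 + fst x ^ m)"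
        unfolding 2[symmetric] by simp
      then show ?case using 1
        by (cases x) (simp add: \<Theta>_def Md_def cuspS_model_def y_def m_def add.commute)
    qed
  qed
  then show ?thesis using c(1) by auto
qed

subsection \<open>Invariants of cuspidal S singularities\<close>

text \<open>The remainder in the definition of the derivative is of smaller order than the
  displacement, whatever scale \<open>\<rho>\<close> measures it. Besides \<open>v\<close> the scale
  \<open>v^2\<close> occurs, because the model curves in the null direction are stationary to first
  order.\<close>

lemma derivative_along:
  fixes f :: "'a::real_normed_vector \<Rightarrow> 'b::real_normed_vector" and \<gamma> :: "'c \<Rightarrow> 'a" and \<rho> :: "'c \<Rightarrow> real"
  assumes f: "(f has_derivative f') (at x0)"
    and g: "((\<lambda>t. (\<gamma> t - x0) /\<^sub>R \<rho> t) \<longlongrightarrow> h) F" "(\<gamma> \<longlongrightarrow> x0) F" and r: "\<forall>\<^sub>F t in F. \<rho> t \<noteq> 0"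
  shows "((\<lambda>t. (f (\<gamma> t) - f x0) /\<^sub>R \<rho> t) \<longlongrightarrow> f' h) F"
proof -
  define R where "R = (\<lambda>y. (f y - f x0 - f' (y - x0)) /\<^sub>R norm (y - x0))"
  have bl: "bounded_linear f'" using f by (rule has_derivative_bounded_linear)
  have "(R \<longlongrightarrow> 0) (at x0)" using f by (simp add: has_derivative_at_within R_def)
  moreover have "R x0 = 0" by (simp add: R_def)
  ultimately have "(R \<longlongrightarrow> R x0) (nhds x0)" using tendsto_at_iff_tendsto_nhds[of R x0] by simp
  then have R: "((\<lambda>t. R (\<gamma> t)) \<longlongrightarrow> 0) F"
    using filterlim_compose[OF _ g(2), of R "nhds 0"] \<open>R x0 = 0\<close> by simp
  have "((\<lambda>t. norm (norm ((\<gamma> t - x0) /\<^sub>R \<rho> t) *\<^sub>R R (\<gamma> t))) \<longlongrightarrow> norm (norm h *\<^sub>R (0 :: 'b))) F"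
    by (intro tendsto_intros g(1) R)
  note a = this
  have 1: "((\<lambda>t. (norm (\<gamma> t - x0) / \<rho> t) *\<^sub>R R (\<gamma> t)) \<longlongrightarrow> 0) F"
  proof (rule tendsto_norm_zero_cancel)
    show "((\<lambda>t. norm ((norm (\<gamma> t - x0) / \<rho> t) *\<^sub>R R (\<gamma> t))) \<longlongrightarrow> 0) F"
      using a by (simp add: abs_mult divide_inverse mult_ac)
  qed
  have "((\<lambda>t. f' ((\<gamma> t - x0) /\<^sub>R \<rho> t)) \<longlongrightarrow> f' h) F"
    by (rule bounded_linear.tendsto[OF bl g(1)])
  from tendsto_add[OF this 1]
  have "((\<lambda>t. f' ((\<gamma> t - x0) /\<^sub>R \<rho> t) + (norm (\<gamma> t - x0) / \<rho> t) *\<^sub>R R (\<gamma> t)) \<longlongrightarrow> f' h) F" by simp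
  moreover have "f' ((\<gamma> t - x0) /\<^sub>R \<rho> t) + (norm (\<gamma> t - x0) / \<rho> t) *\<^sub>R R (\<gamma> t) = (f (\<gamma> t) - f x0) /\<^sub>R \<rho> t" for t
  proof (cases "\<gamma> t = x0")
    case True then show ?thesis using linear_simps(3)[OF bl] by (simp add: R_def)
  next
    case False
    then have "(norm (\<gamma> t - x0) / \<rho> t) *\<^sub>R R (\<gamma> t) = (f (\<gamma> t) - f x0 - f' (\<gamma> t - x0)) /\<^sub>R \<rho> t"
      by (simp add: R_def divide_inverse)
    moreover have "f' ((\<gamma> t - x0) /\<^sub>R \<rho> t) = f' (\<gamma> t - x0) /\<^sub>R \<rho> t" by (rule linear_simps(5)[OF bl])
    ultimately show ?thesis by (simp only: scaleR_add_right[symmetric]) simp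
  qed
  ultimately show ?thesis by simp
qed

lemma frechet_derivative_left_inverse:
  assumes "smooth_at f x" "smooth_at g (f x)" "\<forall>\<^sub>F y in nhds x. g (f y) = y"
  shows "frechet_derivative g (at (f x)) (frechet_derivative f (at x) h) = h"
proof -
  obtain S where S: "open S" "x \<in> S" "\<forall>y\<in>S. g (f y) = y" using assms(3) unfolding eventually_nhds by blast
  have "((\<lambda>y. g (f y)) has_derivative (\<lambda>h. frechet_derivative g (at (f x)) (frechet_derivative f (at x) h))) (at x)"
    by (rule has_derivative_compose[OF smooth_at_has_derivative[OF assms(1)] smooth_at_has_derivative[OF assms(2)]])
  from has_derivative_transform_within_open[OF this S(1,2), of "\<lambda>y. y"] S(3)
  have "((\<lambda>y. y) has_derivative (\<lambda>h. frechet_derivative g (at (f x)) (frechet_derivative f (at x) h))) (at x)"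
    by simp
  from fun_cong[OF has_derivative_unique[OF this has_derivative_ident]] show ?thesis .
qed

lemma frechet_derivative_inj:
  assumes "smooth_at f x" "smooth_at g (f x)" "\<forall>\<^sub>F y in nhds x. g (f y) = y"
    and "frechet_derivative f (at x) h = 0"
  shows "h = 0"
proof -
  have "frechet_derivative g (at (f x)) 0 = 0"
    by (rule linear_simps(3)[OF has_derivative_bounded_linear[OF smooth_at_has_derivative[OF assms(2)]]])
  then show ?thesis using frechet_derivative_left_inverse[OF assms(1-3), of h] assms(4) by simp
qed

lemma has_derivative_rr:
  assumes "has_pderivs f a b (cx x)"
  shows "(rr f has_derivative (\<lambda>h. Re (a * of_real (fst h) + b * of_real (snd h)))) (at x)"
proof -
  have "(cx has_derivative cx) (at x)" by (rule bounded_linear.has_derivative[OF bounded_linear_cx has_derivative_ident])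
  from has_derivative_compose[OF this assms[unfolded has_pderivs_def]]
  have "((\<lambda>x. f (cx x)) has_derivative (\<lambda>h. a * fst (cx h) + b * snd (cx h))) (at x)" .
  from bounded_linear.has_derivative[OF bounded_linear_Re this] show ?thesis
    by (simp add: rr_def[abs_def] cx_def)
qed

text \<open>The mean value theorem on the vertical segment from \<open>-z\<close> to
  \<open>z\<close>. For a target coordinate change it isolates the part that is odd in the third
  variable, without any Taylor expansion.\<close>

lemma symmetric_difference_mvt:
  fixes f :: "r3 \<Rightarrow> real"
  assumes "smooth_on (ball 0 \<delta>) f" "(u, w, z) \<in> ball 0 \<delta>"
  shows "\<exists>\<xi>. \<bar>\<xi>\<bar> \<le> \<bar>z\<bar> \<and> f (u, w, z) - f (u, w, - z) = 2 * z * frechet_derivative f (at (u, w, \<xi>)) (0, 0, 1)"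
proof -
  have b: "(u, w, t) \<in> ball 0 \<delta>" if "\<bar>t\<bar> \<le> \<bar>z\<bar>" for t
  proof -
    have "t\<^sup>2 \<le> z\<^sup>2" using that abs_le_square_iff by blast
    then have "norm (u, w, t) \<le> norm (u, w, z)" by (simp add: norm_Pair)
    then show ?thesis using assms(2) unfolding mem_ball_0 by linarith
  qed
  have D: "((\<lambda>t. f (u, w, t)) has_real_derivative frechet_derivative f (at (u, w, t)) (0, 0, 1)) (at t)" if "\<bar>t\<bar> \<le> \<bar>z\<bar>" for t
  proof -
    have s: "smooth_at f (u, w, t)" by (rule smooth_atI[OF open_ball b[OF that] assms(1)])
    have "((\<lambda>t. (u, w, t)) has_derivative (\<lambda>h. (0, 0, h))) (at t)"
      by (auto intro!: derivative_eq_intros)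
    from has_derivative_compose[OF this smooth_at_has_derivative[OF s]]
    have "((\<lambda>t. f (u, w, t)) has_derivative (\<lambda>h. frechet_derivative f (at (u, w, t)) (0, 0, h))) (at t)" .
    moreover have "(\<lambda>h. frechet_derivative f (at (u, w, t)) (0, 0, h)) = (*) (frechet_derivative f (at (u, w, t)) (0, 0, 1))"
    proof (rule ext)
      fix h
      show "frechet_derivative f (at (u, w, t)) (0, 0, h) = frechet_derivative f (at (u, w, t)) (0, 0, 1) * h"
        using linear_simps(5)[OF has_derivative_bounded_linear[OF smooth_at_has_derivative[OF s]], of h "(0, 0, 1)"]
        by (simp add: mult.commute)
    qed
    ultimately show ?thesis unfolding has_field_derivative_def by (simp only:)
  qed
  have pos: "\<exists>\<xi>. \<bar>\<xi>\<bar> \<le> \<bar>z\<bar> \<and> f (u, w, a) - f (u, w, - a) = 2 * a * frechet_derivative f (at (u, w, \<xi>)) (0, 0, 1)"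
    if "a > 0" "a = \<bar>z\<bar>" for a
  proof -
    have "\<exists>\<xi>. - a < \<xi> \<and> \<xi> < a \<and> f (u, w, a) - f (u, w, - a) = (a - - a) * frechet_derivative f (at (u, w, \<xi>)) (0, 0, 1)"
      by (rule MVT2) (use that D in auto)
    then obtain \<xi> where x: "- a < \<xi>" "\<xi> < a"
      "f (u, w, a) - f (u, w, - a) = (a - - a) * frechet_derivative f (at (u, w, \<xi>)) (0, 0, 1)" by blast
    have "\<bar>\<xi>\<bar> \<le> \<bar>z\<bar>" using x(1,2) that by simp
    moreover have "a - - a = 2 * a" by simp
    ultimately show ?thesis using x(3) by metis
  qed
  consider "z = 0" | "z > 0" | "z < 0" by linarith
  then show ?thesis
  proof cases
    case 1 then show ?thesis by (intro exI[of _ 0]) simp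
  next
    case 2 then show ?thesis using pos[of z] by simp
  next
    case 3
    have "\<exists>\<xi>. \<bar>\<xi>\<bar> \<le> \<bar>z\<bar> \<and> f (u, w, - z) - f (u, w, - (- z)) = 2 * (- z) * frechet_derivative f (at (u, w, \<xi>)) (0, 0, 1)"
      by (rule pos) (use 3 in simp_all)
    then obtain \<xi> where x: "\<bar>\<xi>\<bar> \<le> \<bar>z\<bar>"
      "f (u, w, - z) - f (u, w, - (- z)) = 2 * (- z) * frechet_derivative f (at (u, w, \<xi>)) (0, 0, 1)"
      by blast
    have "f (u, w, z) - f (u, w, - z) = - (f (u, w, - z) - f (u, w, - (- z)))" by simp
    also have "\<dots> = 2 * z * frechet_derivative f (at (u, w, \<xi>)) (0, 0, 1)" unfolding x(2) by simp
    finally show ?thesis using x(1) by blast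
  qed
qed

lemma cuspS_model_simp: "cuspS_model k s (u, v) = (u, v\<^sup>2, v ^ 3 * (u ^ (k + 1) + s * v\<^sup>2))"
  by (simp add: cuspS_model_def)

lemma cuspS_model_tendsto: "(cuspS_model k s \<longlongrightarrow> 0) (nhds 0)"
proof -
  have "smooth_at (\<lambda>x :: r2. (fst x, (snd x)\<^sup>2, (snd x) ^ 3 * (fst x ^ (k + 1) + s * (snd x)\<^sup>2))) 0"
    by (intro smooth_at_Pair smooth_at_mult smooth_at_add smooth_at_power smooth_at_const smooth_at_fst smooth_at_snd smooth_at_ident)
  moreover have "cuspS_model k s = (\<lambda>x. (fst x, (snd x)\<^sup>2, (snd x) ^ 3 * (fst x ^ (k + 1) + s * (snd x)\<^sup>2)))"
    by (auto simp: cuspS_model_def)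
  ultimately have "smooth_at (cuspS_model k s) 0" by simp
  from smooth_at_tendsto[OF this] show ?thesis
    by (simp add: cuspS_model_def zero_prod_def)
qed

lemma cuspS_curve:
  "((\<lambda>v. (cuspS_model k s (u, v) - (u, 0, 0)) /\<^sub>R v) \<longlongrightarrow> 0) (at 0)"
  "((\<lambda>v. (cuspS_model k s (u, v) - (u, 0, 0)) /\<^sub>R v\<^sup>2) \<longlongrightarrow> (0, 1, 0)) (at 0)"
  "((\<lambda>v. cuspS_model k s (u, v)) \<longlongrightarrow> (u, 0, 0)) (at 0)"
proof -
  have "((\<lambda>v::real. (0, v, v\<^sup>2 * (u ^ (k + 1) + s * v\<^sup>2))) \<longlongrightarrow> (0, 0, 0\<^sup>2 * (u ^ (k + 1) + s * 0\<^sup>2))) (at (0::real))"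
    by (intro tendsto_intros)
  moreover have "\<forall>\<^sub>F v in at (0::real). (0, v, v\<^sup>2 * (u ^ (k + 1) + s * v\<^sup>2)) = (cuspS_model k s (u, v) - (u, 0, 0)) /\<^sub>R v"
    by (auto simp: eventually_at_filter cuspS_model_simp power2_eq_square power3_eq_cube field_simps intro!: always_eventually)
  ultimately show "((\<lambda>v. (cuspS_model k s (u, v) - (u, 0, 0)) /\<^sub>R v) \<longlongrightarrow> 0) (at 0)"
    by (rule Lim_transform_eventually[THEN tendsto_eq_rhs]) (simp add: zero_prod_def)
  have "((\<lambda>v::real. (0, 1::real, v * (u ^ (k + 1) + s * v\<^sup>2))) \<longlongrightarrow> (0, 1, 0 * (u ^ (k + 1) + s * 0\<^sup>2))) (at (0::real))"
    by (intro tendsto_intros)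
  moreover have "\<forall>\<^sub>F v in at (0::real). (0, 1, v * (u ^ (k + 1) + s * v\<^sup>2)) = (cuspS_model k s (u, v) - (u, 0, 0)) /\<^sub>R v\<^sup>2"
    by (auto simp: eventually_at_filter cuspS_model_simp power2_eq_square power3_eq_cube field_simps intro!: always_eventually)
  ultimately show "((\<lambda>v. (cuspS_model k s (u, v) - (u, 0, 0)) /\<^sub>R v\<^sup>2) \<longlongrightarrow> (0, 1, 0)) (at 0)"
    by (rule Lim_transform_eventually[THEN tendsto_eq_rhs]) simp
  have "((\<lambda>v::real. (u, v\<^sup>2, v ^ 3 * (u ^ (k + 1) + s * v\<^sup>2))) \<longlongrightarrow> (u, 0\<^sup>2, 0 ^ 3 * (u ^ (k + 1) + s * 0\<^sup>2))) (at (0::real))"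
    by (intro tendsto_intros)
  then show "((\<lambda>v. cuspS_model k s (u, v)) \<longlongrightarrow> (u, 0, 0)) (at 0)"
    by (simp add: cuspS_model_simp)
qed

lemma at_0_ne: "\<forall>\<^sub>F v in at (0::real). v \<noteq> 0" "\<forall>\<^sub>F v in at (0::real). v\<^sup>2 \<noteq> 0"
  by (auto simp: eventually_at_filter intro: always_eventually)

lemma along_axes:
  "((\<lambda>y :: real. ((y, 0) - (0 :: r2)) /\<^sub>R y) \<longlongrightarrow> (1, 0)) (at 0)"
  "((\<lambda>y :: real. ((0, y) - (0 :: r2)) /\<^sub>R y) \<longlongrightarrow> (0, 1)) (at 0)"
  "((\<lambda>y :: real. ((y, 0, 0) - (0 :: r3)) /\<^sub>R y) \<longlongrightarrow> (1, 0, 0)) (at 0)"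
  by (rule tendsto_eventually, use at_0_ne(1) in eventually_elim, simp)+

lemma germ_equivE:
  assumes "germ_equiv F G" "(F \<longlongrightarrow> 0) (nhds 0)"
  obtains \<sigma> \<sigma>' \<Theta> \<Theta>' where "inverse_germs \<sigma> \<sigma>'" "inverse_germs \<Theta> \<Theta>'" "\<forall>\<^sub>F x in nhds 0. F (\<sigma> x) = \<Theta>' (G x)"
proof -
  obtain \<sigma> \<sigma>' \<Theta> \<Theta>' where *: "inverse_germs \<sigma> \<sigma>'" "inverse_germs \<Theta> \<Theta>'" "\<forall>\<^sub>F x in nhds 0. \<Theta> (F (\<sigma> x)) = G x"
    using assms(1) unfolding germ_equiv_def by blast
  have s: "(\<sigma> \<longlongrightarrow> 0) (nhds 0)" using *(1) smooth_at_tendsto[of \<sigma> 0] by (simp add: inverse_germs_def)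
  have "\<forall>\<^sub>F y in nhds 0. \<Theta>' (\<Theta> y) = y" using *(2) by (simp add: inverse_germs_def)
  from eventually_compose_filterlim[OF this filterlim_compose[OF assms(2) s]] *(3)
  have "\<forall>\<^sub>F x in nhds 0. F (\<sigma> x) = \<Theta>' (G x)" by eventually_elim metis
  then show ?thesis using that * by blast
qed

text \<open>On the curve, \<open>F = q * k (p, q) + p * l (p)\<close> with \<open>k\<close> and
  \<open>l\<close> vanishing at the origin and \<open>k\<close> stationary there in the second
  direction. As \<open>p\<close> is of smaller order than \<open>y\<close> and \<open>q\<close> is
  of order at most \<open>y\<close>, both terms are of smaller order than
  \<open>y^2\<close>.\<close>

lemma second_order_along:
  assumes F: "rhol F" "F 0 = 0" "pd1 F 0 = 0" "pd2 F 0 = 0" "pd2 (pd2 F) 0 = 0"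
    and p: "((\<lambda>y. p y / y) \<longlongrightarrow> 0) (at (0::real))" "(p \<longlongrightarrow> 0) (at 0)"
    and q: "((\<lambda>y. q y / y) \<longlongrightarrow> \<kappa>) (at (0::real))" "(q \<longlongrightarrow> 0) (at 0)"
  shows "((\<lambda>y. rr F (p y, q y) / y\<^sup>2) \<longlongrightarrow> 0) (at 0)"
proof -
  have c: "((\<lambda>y. cx (p y, q y)) \<longlongrightarrow> 0) (at 0)"
    using tendsto_Pair[OF tendsto_of_real[OF p(2)] tendsto_of_real[OF q(2)]]
    by (simp add: cx_def zero_prod_def)
  have F1: "rhol (\<lambda>x. F (fst x, 0))" by (rule rhol_compose[OF F(1) rhol_fst rhol_const]) auto
  \<comment> \<open>Division is available for the second variable, so the restriction of
    \<open>F\<close> to the first axis is viewed as a function of \<open>snd\<close>.\<close>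
  have F1s: "rhol (\<lambda>x. F (snd x, 0))" by (rule rhol_compose[OF F(1) rhol_snd rhol_const]) auto
  have "rhol (\<lambda>x. F x - F (fst x, 0))" by (rule rhol_diff[OF F(1) F1])
  from rhol_divide_snd[OF this] obtain k where k: "rhol k" "\<forall>\<^sub>F x in nhds 0. F x - F (fst x, 0) = snd x * k x" by auto
  from rhol_divide_snd[OF F1s] F(2) obtain l where l: "rhol l" "\<forall>\<^sub>F x in nhds 0. F (snd x, 0) = snd x * l x"
    by (auto simp: zero_prod_def)
  have kF: "\<forall>\<^sub>F x in nhds 0. k x + snd x * pd2 k x = pd2 F x"
  proof -
    have "\<forall>\<^sub>F x in nhds 0. has_pderivs (\<lambda>x. F x - F (fst x, 0)) (pd1 F x - pd1 (\<lambda>x. F (fst x, 0)) x) (pd2 F x - pd2 (\<lambda>x. F (fst x, 0)) x) x"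
      using rhol_has_pderivs[OF F(1)] rhol_has_pderivs[OF F1] by eventually_elim (rule has_pderivs_diff)
    from eventually_has_pderivs_cong[OF this k(2)] rhol_has_pderivs[OF k(1)]
    show ?thesis
    proof eventually_elim
      case (elim x)
      from has_pderivs_unique[OF elim(1) has_pderivs_mult[OF has_pderivs_snd elim(2)]]
      show ?case by (simp add: pd2_def[of "\<lambda>x. F (fst x, 0)"])
    qed
  qed
  have k0: "k 0 = 0" using eventually_nhds_x_imp_x[OF kF] F(4) by simp
  have "has_pderivs (\<lambda>x. k x + snd x * pd2 k x) (pd1 k 0 + (0 * pd2 k 0 + snd 0 * pd1 (pd2 k) 0)) (pd2 k 0 + (1 * pd2 k 0 + snd 0 * pd2 (pd2 k) 0)) 0"
    by (rule has_pderivs_eqI[OF has_pderivs_add[OF rhol_has_pderivs_0[OF k(1)] has_pderivs_mult[of snd 0 1 0 "pd2 k", OF has_pderivs_snd rhol_has_pderivs_0[OF rhol_pd(2)[OF k(1)]]]]]) simp_all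
  moreover obtain S where "open S" "0 \<in> S" "\<forall>x\<in>S. k x + snd x * pd2 k x = pd2 F x"
    using kF unfolding eventually_nhds by blast
  ultimately have "has_pderivs (pd2 F) (pd1 k 0 + (0 * pd2 k 0 + snd 0 * pd1 (pd2 k) 0)) (pd2 k 0 + (1 * pd2 k 0 + snd 0 * pd2 (pd2 k) 0)) 0"
    using has_pderivs_cong by blast
  from has_pderivs_pd(2)[OF this] have "pd2 (pd2 F) 0 = pd2 k 0 + pd2 k 0" by simp
  then have pk: "pd2 k 0 = 0" using F(5) by simp
  have l0: "l 0 = 0"
  proof -
    have a: "\<forall>\<^sub>F x in nhds 0. snd x * l x = F (snd x, 0)" using l(2) by eventually_elim simp
    have b: "\<forall>\<^sub>F x in nhds 0. has_pderivs (\<lambda>x. snd x * l x) (0 * l x + snd x * pd1 l x) (1 * l x + snd x * pd2 l x) x"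
      using rhol_has_pderivs[OF l(1)] by eventually_elim (rule has_pderivs_mult[OF has_pderivs_snd])
    from eventually_nhds_x_imp_x[OF eventually_has_pderivs_cong[OF b a]]
    have "has_pderivs (\<lambda>x. F (snd x, 0)) 0 (l 0) 0" by simp
    moreover have "has_pderivs (\<lambda>x. F (snd x, 0)) (pd1 F 0 * 0 + pd2 F 0 * 0) (pd1 F 0 * 1 + pd2 F 0 * 0) 0"
      by (rule has_pderivs_compose[of F _ _ snd 0 "\<lambda>_. 0"])
        (use rhol_has_pderivs_0[OF F(1)] in \<open>simp_all add: zero_prod_def[symmetric] has_pderivs_snd has_pderivs_const\<close>)
    ultimately have "l 0 = pd1 F 0 * 1 + pd2 F 0 * 0"
      using has_pderivs_unique by blast
    then show ?thesis using F(3) by simp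
  qed
  have pd: "(rr k has_derivative (\<lambda>h. Re (pd1 k 0 * of_real (fst h) + pd2 k 0 * of_real (snd h)))) (at 0)"
    "(rr l has_derivative (\<lambda>h. Re (pd1 l 0 * of_real (fst h) + pd2 l 0 * of_real (snd h)))) (at 0)"
    using has_derivative_rr[of k _ _ 0] has_derivative_rr[of l _ _ 0] rhol_has_pderivs_0[OF k(1)] rhol_has_pderivs_0[OF l(1)] by auto
  have z2: "(0, 0) = (0 :: r2)" by (simp add: zero_prod_def)
  have pq: "((\<lambda>y. ((p y, q y) - 0) /\<^sub>R y) \<longlongrightarrow> (0, \<kappa>)) (at 0)" "((\<lambda>y. (p y, q y)) \<longlongrightarrow> 0) (at 0)"
    using tendsto_Pair[OF p(1) q(1)] tendsto_Pair[OF p(2) q(2)] by (simp_all add: z2 divide_inverse mult.commute)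
  have pp: "((\<lambda>y. ((0 :: real, p y) - 0) /\<^sub>R y) \<longlongrightarrow> (0, 0)) (at 0)" "((\<lambda>y. (0 :: real, p y)) \<longlongrightarrow> 0) (at 0)"
    using tendsto_Pair[OF tendsto_const[of "0 :: real"] p(1)] tendsto_Pair[OF tendsto_const[of "0 :: real"] p(2)]
    by (simp_all add: z2 divide_inverse mult.commute)
  have K: "((\<lambda>y. rr k (p y, q y) / y) \<longlongrightarrow> 0) (at 0)"
    using derivative_along[OF pd(1) pq at_0_ne(1)] pk rr_0[of k] k0 by (simp add: divide_inverse mult.commute)
  have L: "((\<lambda>y. rr l (0, p y) / y) \<longlongrightarrow> 0) (at 0)"
    using derivative_along[OF pd(2) pp at_0_ne(1)] l0 rr_0[of l] by (simp add: divide_inverse mult.commute)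
  have c': "((\<lambda>y. cx (0, p y)) \<longlongrightarrow> 0) (at 0)"
    using tendsto_Pair[OF tendsto_const tendsto_of_real[OF p(2)]] by (simp add: cx_def zero_prod_def)
  have "\<forall>\<^sub>F y in at 0. rr F (p y, q y) / y\<^sup>2 = (q y / y) * (rr k (p y, q y) / y) + (p y / y) * (rr l (0, p y) / y)"
    using eventually_compose_filterlim[OF k(2) c] eventually_compose_filterlim[OF l(2) c'] at_0_ne(1)
  proof eventually_elim
    case (elim y)
    have "F (cx (p y, q y)) = of_real (q y) * k (cx (p y, q y)) + of_real (p y) * l (cx (0, p y))"
      using elim(1,2) by (simp add: cx_def algebra_simps)
    then have "rr F (p y, q y) = q y * rr k (p y, q y) + p y * rr l (0, p y)" by (simp add: rr_def)
    then show ?case using elim(3) by (simp add: field_simps power2_eq_square)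
  qed
  then have ev: "\<forall>\<^sub>F y in at 0. (q y / y) * (rr k (p y, q y) / y) + (p y / y) * (rr l (0, p y) / y) = rr F (p y, q y) / y\<^sup>2"
    by eventually_elim simp
  have "((\<lambda>y. (q y / y) * (rr k (p y, q y) / y) + (p y / y) * (rr l (0, p y) / y)) \<longlongrightarrow> \<kappa> * 0 + 0 * 0) (at 0)"
    by (intro tendsto_add tendsto_mult K L p q)
  from Lim_transform_eventually[OF this ev] show ?thesis by simp
qed

text \<open>In the model, the image of the differential is spanned by \<open>(1, 0, 0)\<close>,
  while along the null direction the scaled second-order limit is \<open>(0, 1, 0)\<close>. The
  derivative of the target change would send both into the first axis, contradicting its
  injectivity.\<close>

lemma not_cuspS_if_tangential:
  assumes rh: "rhol U" "rhol Y" "rhol Z" and z: "U 0 = 0" "Y 0 = 0" "Z 0 = 0"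
    and U: "pd1 U 0 \<noteq> 0" "pd2 U 0 = 0"
    and YZ: "pd1 Y 0 = 0" "pd2 Y 0 = 0" "pd2 (pd2 Y) 0 = 0" "pd1 Z 0 = 0" "pd2 Z 0 = 0" "pd2 (pd2 Z) 0 = 0"
  shows "\<not> germ_equiv (tri U Y Z) (cuspS_model k s)"
proof
  assume ge: "germ_equiv (tri U Y Z) (cuspS_model k s)"
  have st: "smooth_at (tri U Y Z) 0" unfolding tri_def[abs_def] by (intro smooth_at_Pair smooth_at_rr rh)
  have t0: "tri U Y Z 0 = 0" using z by (simp add: tri_def rr_0 zero_prod_def[symmetric])
  have tt: "(tri U Y Z \<longlongrightarrow> 0) (nhds 0)" using smooth_at_tendsto[OF st] t0 by simp
  obtain \<sigma> \<sigma>' \<Theta> \<Xi> where *: "inverse_germs \<sigma> \<sigma>'" "inverse_germs \<Theta> \<Xi>"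
    "\<forall>\<^sub>F x in nhds 0. tri U Y Z (\<sigma> x) = \<Xi> (cuspS_model k s x)"
    by (rule germ_equivE[OF ge tt])
  note s = *(1)[unfolded inverse_germs_def] and t = *(2)[unfolded inverse_germs_def]
  define B where "B = frechet_derivative \<sigma> (at 0)"
  define X where "X = frechet_derivative \<Xi> (at 0)"
  have dB: "(\<sigma> has_derivative B) (at 0)" unfolding B_def using s smooth_at_has_derivative by blast
  have dX: "(\<Xi> has_derivative X) (at 0)" unfolding X_def using t smooth_at_has_derivative by blast
  have Xinj: "X h = 0 \<Longrightarrow> h = 0" for h
    unfolding X_def by (rule frechet_derivative_inj[of \<Xi> 0 \<Theta>]) (use t in auto)
  have Xlin: "bounded_linear X" by (rule has_derivative_bounded_linear[OF dX])
  have rU: "pd1 U 0 = of_real (Re (pd1 U 0))" "Re (pd1 U 0) \<noteq> 0"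
    using rhol_real[OF rhol_pd(1)[OF rh(1)]] U(1) by (auto simp: complex_eq_iff)
  have dT: "(tri U Y Z has_derivative (\<lambda>h. (Re (pd1 U 0) * fst h, 0, 0))) (at 0)"
  proof -
    have p: "(rr f has_derivative (\<lambda>h. Re (pd1 f 0 * of_real (fst h) + pd2 f 0 * of_real (snd h)))) (at 0)" if "rhol f" for f
      using has_derivative_rr[of f _ _ 0] rhol_has_pderivs_0[OF that] by simp
    have "(tri U Y Z has_derivative (\<lambda>h. (Re (pd1 U 0 * of_real (fst h) + pd2 U 0 * of_real (snd h)),
       Re (pd1 Y 0 * of_real (fst h) + pd2 Y 0 * of_real (snd h)), Re (pd1 Z 0 * of_real (fst h) + pd2 Z 0 * of_real (snd h))))) (at 0)"
      unfolding tri_def[abs_def] by (intro has_derivative_Pair p rh)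
    then show ?thesis using U YZ by simp
  qed
  have dTs: "((\<lambda>x. tri U Y Z (\<sigma> x)) has_derivative (\<lambda>h. (Re (pd1 U 0) * fst (B h), 0, 0))) (at 0)"
    using has_derivative_compose[OF dB] dT s by simp
  have axis1: "filterlim (\<lambda>y. (y, 0)) (nhds (0 :: r2)) (at (0 :: real))"
    and axis2: "filterlim (\<lambda>y. (0, y)) (nhds (0 :: r2)) (at (0 :: real))"
    unfolding zero_prod_def by (intro tendsto_intros)+
  note along1 = along_axes(1) and along2 = along_axes(2)
  have z3: "(0, 0, 0) = (0 :: r3)" by (simp add: zero_prod_def)
  have c0: "tri U Y Z (\<sigma> 0) = 0" "\<Xi> 0 = 0" using s t t0 by auto
  have lim1: "((\<lambda>y. (tri U Y Z (\<sigma> (y, 0)) - 0) /\<^sub>R y) \<longlongrightarrow> (Re (pd1 U 0) * fst (B (1, 0)), 0, 0)) (at 0)"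
    using derivative_along[OF dTs along1 axis1 at_0_ne(1)] c0 by simp
  have "((\<lambda>y. (\<Xi> (y, 0, 0) - \<Xi> 0) /\<^sub>R y) \<longlongrightarrow> X (1, 0, 0)) (at 0)"
  proof (rule derivative_along[OF dX _ _ at_0_ne(1)])
    have "((\<lambda>y :: real. (y, 0, 0)) \<longlongrightarrow> (0 :: real, 0 :: real, 0 :: real)) (at 0)" by (intro tendsto_intros)
    then show "((\<lambda>y :: real. (y, 0, 0)) \<longlongrightarrow> (0 :: r3)) (at 0)" by (simp add: zero_prod_def)
    show "((\<lambda>y. ((y, 0, 0) - (0 :: r3)) /\<^sub>R y) \<longlongrightarrow> (1, 0, 0)) (at 0)" by (rule along_axes)
  qed
  note lx = this
  have "\<forall>\<^sub>F y in at 0. (\<Xi> (y, 0, 0) - \<Xi> 0) /\<^sub>R y = (tri U Y Z (\<sigma> (y, 0)) - 0) /\<^sub>R y"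
    using eventually_compose_filterlim[OF *(3) axis1] by eventually_elim (simp add: c0 cuspS_model_simp)
  from tendsto_unique[OF at_neq_bot Lim_transform_eventually[OF lx this] lim1]
  have X1: "X (1, 0, 0) = (Re (pd1 U 0) * fst (B (1, 0)), 0, 0)" .
  have cur: "((\<lambda>v. (\<Xi> (cuspS_model k s (0, v)) - \<Xi> (0, 0, 0)) /\<^sub>R v) \<longlongrightarrow> X 0) (at 0)"
    "((\<lambda>v. (\<Xi> (cuspS_model k s (0, v)) - \<Xi> (0, 0, 0)) /\<^sub>R v\<^sup>2) \<longlongrightarrow> X (0, 1, 0)) (at 0)"
    by (rule derivative_along[OF _ cuspS_curve(1,3) at_0_ne(1)], use dX in \<open>simp add: zero_prod_def\<close>)
      (rule derivative_along[OF _ cuspS_curve(2,3) at_0_ne(2)], use dX in \<open>simp add: zero_prod_def\<close>)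
  have ev: "\<forall>\<^sub>F v in at 0. tri U Y Z (\<sigma> (0, v)) = \<Xi> (cuspS_model k s (0, v)) - \<Xi> (0, 0, 0)"
    using eventually_compose_filterlim[OF *(3) axis2] by eventually_elim (simp add: z3 c0(2))
  have ev1: "\<forall>\<^sub>F v in at 0. (\<Xi> (cuspS_model k s (0, v)) - \<Xi> (0, 0, 0)) /\<^sub>R v = (tri U Y Z (\<sigma> (0, v)) - 0) /\<^sub>R v"
    and ev2: "\<forall>\<^sub>F v in at 0. (\<Xi> (cuspS_model k s (0, v)) - \<Xi> (0, 0, 0)) /\<^sub>R v\<^sup>2 = (tri U Y Z (\<sigma> (0, v)) - 0) /\<^sub>R v\<^sup>2"
    using ev by (eventually_elim, simp)+
  have lim2: "((\<lambda>y. (tri U Y Z (\<sigma> (0, y)) - 0) /\<^sub>R y) \<longlongrightarrow> (Re (pd1 U 0) * fst (B (0, 1)), 0, 0)) (at 0)"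
    using derivative_along[OF dTs along2 axis2 at_0_ne(1)] c0 by simp
  have "(Re (pd1 U 0) * fst (B (0, 1)), 0, 0) = X 0"
    by (rule tendsto_unique[OF at_neq_bot lim2 tendsto_cong[THEN iffD1, OF ev1 cur(1)]])
  then have B01: "fst (B (0, 1)) = 0" using rU(2) linear_simps(3)[OF Xlin] by (simp add: zero_prod_def)
  have sl: "((\<lambda>y. (\<sigma> (0, y) - \<sigma> 0) /\<^sub>R y) \<longlongrightarrow> B (0, 1)) (at 0)"
    by (rule derivative_along[OF dB along2 axis2 at_0_ne(1)])
  have p: "((\<lambda>y. fst (\<sigma> (0, y)) / y) \<longlongrightarrow> 0) (at 0)" "((\<lambda>y. snd (\<sigma> (0, y)) / y) \<longlongrightarrow> snd (B (0, 1))) (at 0)"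
    using tendsto_fst[OF sl] tendsto_snd[OF sl] s B01 by (simp_all add: divide_inverse mult.commute)
  have "((\<lambda>y. \<sigma> (0, y)) \<longlongrightarrow> 0) (at 0)"
    using filterlim_compose[OF smooth_at_tendsto[of \<sigma> 0] axis2] s by simp
  from tendsto_fst[OF this] tendsto_snd[OF this]
  have p': "((\<lambda>y. fst (\<sigma> (0, y))) \<longlongrightarrow> 0) (at 0)" "((\<lambda>y. snd (\<sigma> (0, y))) \<longlongrightarrow> 0) (at 0)"
    by simp_all
  have Y2: "((\<lambda>y. rr Y (\<sigma> (0, y)) / y\<^sup>2) \<longlongrightarrow> 0) (at 0)"
    using second_order_along[OF rh(2) z(2) YZ(1-3) p(1) p'(1) p(2) p'(2)] by simp
  have Z2: "((\<lambda>y. rr Z (\<sigma> (0, y)) / y\<^sup>2) \<longlongrightarrow> 0) (at 0)"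
    using second_order_along[OF rh(3) z(3) YZ(4-6) p(1) p'(1) p(2) p'(2)] by simp
  have l2: "((\<lambda>y. (tri U Y Z (\<sigma> (0, y)) - 0) /\<^sub>R y\<^sup>2) \<longlongrightarrow> X (0, 1, 0)) (at 0)"
    by (rule tendsto_cong[THEN iffD1, OF ev2 cur(2)])
  have "fst (snd (X (0, 1, 0))) = 0"
    by (rule tendsto_unique[OF at_neq_bot tendsto_fst[OF tendsto_snd[OF l2]]])
      (use Y2 in \<open>simp add: tri_def divide_inverse mult.commute\<close>)
  moreover have "snd (snd (X (0, 1, 0))) = 0"
    by (rule tendsto_unique[OF at_neq_bot tendsto_snd[OF tendsto_snd[OF l2]]])
      (use Z2 in \<open>simp add: tri_def divide_inverse mult.commute\<close>)
  ultimately obtain x2 where X2: "X (0, 1, 0) = (x2, 0, 0)" by (metis prod.collapse)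
  define x1 where "x1 = Re (pd1 U 0) * fst (B (1, 0))"
  \<comment> \<open>Both images are multiples of the first unit vector, so this combination of
    independent vectors is annihilated.\<close>
  have "X (x2 *\<^sub>R (1, 0, 0) + (- x1) *\<^sub>R (0, 1, 0)) = x2 *\<^sub>R X (1, 0, 0) + (- x1) *\<^sub>R X (0, 1, 0)"
    by (simp only: linear_simps(1,5)[OF Xlin])
  also have "\<dots> = 0" unfolding X1 X2 x1_def[symmetric] by (simp add: zero_prod_def)
  finally have "(x2 *\<^sub>R (1, 0, 0) + (- x1) *\<^sub>R (0, 1, 0)) = (0 :: r3)" by (rule Xinj)
  then have "x1 = 0" by (simp add: zero_prod_def)
  then have "X (1, 0, 0) = 0" unfolding X1 x1_def[symmetric] by (simp add: zero_prod_def)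
  from Xinj[OF this] show False by (simp add: zero_prod_def)
qed

section \<open>Invariants read off from a smooth equivalence\<close>

lemma Md_fst_snd: "fst (Md d x) = fst x" "fst (snd (Md d x)) = (snd x)\<^sup>2"
  "snd (snd (Md d x)) = (snd x) ^ 3 * rr d (fst x, (snd x)\<^sup>2)"
  by (simp_all add: Md_def)

lemma eventually_axis_point:
  assumes "\<forall>\<^sub>F x in nhds (0 :: r2). P x"
  shows "\<forall>\<^sub>F u in nhds (0 :: real). P (u, 0)"
proof (rule eventually_compose_filterlim[OF assms])
  have "((\<lambda>u. (u, 0)) \<longlongrightarrow> (0, 0)) (nhds (0 :: real))" by (intro tendsto_intros filterlim_ident)
  then show "filterlim (\<lambda>u. (u, 0)) (nhds (0 :: r2)) (nhds (0 :: real))" by (simp add: zero_prod_def)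
qed

lemma along_snd: "((\<lambda>v :: real. ((u, v) - (u :: real, 0)) /\<^sub>R v) \<longlongrightarrow> (0, 1)) (at 0)"
  "((\<lambda>v. (u, v)) \<longlongrightarrow> (u :: real, 0 :: real)) (at 0)"
  by (rule tendsto_eventually, use at_0_ne(1) in eventually_elim, simp) (intro tendsto_intros)

lemma filterlim_uminus_at_0: "filterlim uminus (at 0) (at (0 :: real))"
proof (rule filterlim_atI)
  show "(uminus \<longlongrightarrow> 0) (at (0 :: real))" using tendsto_minus[OF tendsto_ident_at, of 0 UNIV] by simp
  show "\<forall>\<^sub>F x in at (0 :: real). - x \<noteq> 0" using at_0_ne(1) by eventually_elim simp
qed

text \<open>The singular curve and the odd part of the third component determine the zero order of
  \<open>d (u, 0)\<close>. The quotients are formed with the difference of the values at \<open>v\<close> and \<open>- v\<close>,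
  where the even part of the target coordinate change cancels.\<close>

lemma Md_equiv_cuspSD:
  assumes d: "rhol d" and ge: "germ_equiv (Md d) (cuspS_model k s)" and s: "s \<noteq> 0"
  shows "\<exists>(x :: real \<Rightarrow> real) c. c \<noteq> 0 \<and> (x \<longlongrightarrow> 0) (at 0) \<and> (\<forall>\<^sub>F t in at 0. x t \<noteq> 0) \<and>
      ((\<lambda>t. rr d (x t, 0) / (x t) ^ (k + 1)) \<longlongrightarrow> c) (at 0)" (is ?A)
    and "k \<ge> 1 \<Longrightarrow> pd2 d 0 \<noteq> 0"
proof -
  have sMd: "smooth_at (Md d) 0"
    unfolding Md_def[abs_def]
    by (intro smooth_at_Pair smooth_at_mult smooth_at_power smooth_at_fst smooth_at_snd smooth_at_ident
        smooth_at_rr_compose d) simp_all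
  have z2: "(0, 0) = (0 :: r2)" and z3: "(0, 0, 0) = (0 :: r3)" by (simp_all add: zero_prod_def)
  have "Md d 0 = 0" by (simp add: Md_def z3)
  then have tt: "(Md d \<longlongrightarrow> 0) (nhds 0)" using smooth_at_tendsto[OF sMd] by simp
  obtain \<beta> \<beta>' \<Theta> \<Xi> where *: "inverse_germs \<beta> \<beta>'" "inverse_germs \<Theta> \<Xi>"
    "\<forall>\<^sub>F x in nhds 0. Md d (\<beta> x) = \<Xi> (cuspS_model k s x)"
    by (rule germ_equivE[OF ge tt])
  note b = *(1)[unfolded inverse_germs_def] and t = *(2)[unfolded inverse_germs_def]
  define J where "J u = frechet_derivative \<beta> (at (u, 0)) (0, 1)" for u
  define Xi3 where "Xi3 = (\<lambda>y. snd (snd (\<Xi> y)))"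
  have sXi3: "smooth_at Xi3 0" unfolding Xi3_def using t by (intro smooth_at_snd) simp
  obtain \<delta> where \<delta>: "\<delta> > 0" "smooth_on (ball 0 \<delta>) Xi3"
  proof -
    obtain S where "open S" "0 \<in> S" "smooth_on S Xi3" using sXi3 unfolding smooth_at_def by blast
    moreover from this obtain e where "e > 0" "ball 0 e \<subseteq> S" using openE by blast
    ultimately show ?thesis using that[of e] smooth_on_subset by blast
  qed
  define D where "D y = frechet_derivative Xi3 (at y) (0, 0, 1)" for y
  have contD: "isCont D y" if "y \<in> ball 0 \<delta>" for y
    using smooth_on_imp_continuous_on[OF smooth_on_frechet_derivative[OF \<delta>(2)]] that
    by (auto simp: continuous_on_eq_continuous_at D_def[abs_def])
  have contD0: "isCont D 0" by (rule contD) (use \<delta>(1) in simp)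
  have b1: "smooth_at \<beta> 0" "smooth_at \<beta>' 0" "\<beta> 0 = 0" "\<forall>\<^sub>F x in nhds 0. \<beta>' (\<beta> x) = x" using b by auto
  have X1: "smooth_at \<Xi> 0" "smooth_at \<Theta> 0" "\<Xi> 0 = 0" "\<forall>\<^sub>F x in nhds 0. \<Xi> (\<Theta> x) = x" "\<Theta> 0 = 0" using t by auto
  \<comment> \<open>The argument takes place at every axis point near the origin, since the order of
    vanishing is seen only by letting \<open>u\<close> vary; \<open>good\<close> collects what is
    needed at one such point.\<close>
  define good where "good x \<longleftrightarrow> smooth_at \<beta> x \<and> smooth_at \<beta>' (\<beta> x) \<and> (\<forall>\<^sub>F y in nhds x. \<beta>' (\<beta> y) = y)
     \<and> smooth_at \<Xi> (cuspS_model k s x) \<and> cuspS_model k s x \<in> ball 0 \<delta>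
     \<and> (\<forall>\<^sub>F y in nhds x. Md d (\<beta> y) = \<Xi> (cuspS_model k s y)) \<and> smooth_at (rr d) (fst (\<beta> x), (snd (\<beta> x))\<^sup>2)" for x
  have sq: "smooth_at (\<lambda>x. (fst (\<beta> x), (snd (\<beta> x))\<^sup>2)) 0"
    by (intro smooth_at_Pair smooth_at_power smooth_at_fst smooth_at_snd b1)
  have "\<forall>\<^sub>F x in nhds 0. smooth_at \<beta>' (\<beta> x)"
    by (rule smooth_at_eventually_compose[OF _ b1(1)]) (use eventually_smooth_at[OF b1(2)] b1(3) in simp)
  moreover have "\<forall>\<^sub>F x in nhds 0. smooth_at \<Xi> (cuspS_model k s x)"
    by (rule eventually_compose_filterlim[OF eventually_smooth_at[OF X1(1)] cuspS_model_tendsto])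
  moreover have "\<forall>\<^sub>F y in nhds 0. y \<in> ball (0 :: r3) \<delta>" using \<delta>(1) by (intro eventually_nhds_in_open) auto
  from eventually_compose_filterlim[OF this cuspS_model_tendsto]
  have "\<forall>\<^sub>F x in nhds 0. cuspS_model k s x \<in> ball 0 \<delta>" .
  moreover have "\<forall>\<^sub>F x in nhds 0. smooth_at (rr d) (fst (\<beta> x), (snd (\<beta> x))\<^sup>2)"
    by (rule smooth_at_eventually_compose[OF _ sq])
      (use eventually_smooth_at[OF smooth_at_rr[OF d]] b1(3) in \<open>simp add: z2\<close>)
  ultimately have ev_good: "\<forall>\<^sub>F x in nhds 0. good x"
    using eventually_smooth_at[OF b1(1)] eventually_eventually[THEN iffD2, OF b1(4)]
      eventually_eventually[THEN iffD2, OF *(3)]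
    unfolding good_def by eventually_elim blast
  have Mu0: "cuspS_model k s (u, 0) = (u, 0, 0)" for u by (simp add: cuspS_model_simp)
  \<comment> \<open>Along the axis \<open>v = 0\<close> the direction \<open>(0, 1)\<close> is null
    for the model. Transporting this through \<open>\<beta>\<close> shows that
    \<open>\<beta>\<close> maps the axis into the axis and null directions to null directions. The
    last equation compares the odd cubic terms in \<open>v\<close>.\<close>
  have null: "fst (J u) = 0 \<and> snd (J u) \<noteq> 0 \<and> snd (\<beta> (u, 0)) = 0 \<and>
      (snd (J u)) ^ 3 * rr d (fst (\<beta> (u, 0)), 0) = u ^ (k + 1) * D (u, 0, 0)"
    if g: "good (u, 0)" for u
  proof -
    note g' = g[unfolded good_def Mu0]
    have dB: "(\<beta> has_derivative frechet_derivative \<beta> (at (u, 0))) (at (u, 0))"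
      using g' smooth_at_has_derivative by blast
    have dX: "(\<Xi> has_derivative frechet_derivative \<Xi> (at (u, 0, 0))) (at (u, 0, 0))"
      using g' smooth_at_has_derivative by blast
    have lB: "((\<lambda>v. (\<beta> (u, v) - \<beta> (u, 0)) /\<^sub>R v) \<longlongrightarrow> J u) (at 0)"
      unfolding J_def by (rule derivative_along[OF dB along_snd at_0_ne(1)])
    have cB: "((\<lambda>v. \<beta> (u, v)) \<longlongrightarrow> \<beta> (u, 0)) (at 0)"
      using filterlim_compose[OF smooth_at_tendsto along_snd(2)] g' by blast
    have "((\<lambda>v. (\<Xi> (cuspS_model k s (u, v)) - \<Xi> (u, 0, 0)) /\<^sub>R v) \<longlongrightarrow> frechet_derivative \<Xi> (at (u, 0, 0)) 0) (at 0)"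
      by (rule derivative_along[OF dX cuspS_curve(1,3) at_0_ne(1)])
    then have lX: "((\<lambda>v. (\<Xi> (cuspS_model k s (u, v)) - \<Xi> (u, 0, 0)) /\<^sub>R v) \<longlongrightarrow> 0) (at 0)"
      using linear_simps(3)[OF has_derivative_bounded_linear[OF dX]] by simp
    have ev: "\<forall>\<^sub>F v in at 0. Md d (\<beta> (u, v)) = \<Xi> (cuspS_model k s (u, v))"
      using eventually_compose_filterlim[OF _ along_snd(2)] g' by blast
    have ev0: "Md d (\<beta> (u, 0)) = \<Xi> (u, 0, 0)"
      using eventually_nhds_x_imp_x[of "\<lambda>y. Md d (\<beta> y) = \<Xi> (cuspS_model k s y)" "(u, 0)"] g' by (simp add: Mu0)
    have "\<forall>\<^sub>F v in at 0. (\<Xi> (cuspS_model k s (u, v)) - \<Xi> (u, 0, 0)) /\<^sub>R v = (Md d (\<beta> (u, v)) - Md d (\<beta> (u, 0))) /\<^sub>R v"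
      using ev by eventually_elim (simp add: ev0)
    from Lim_transform_eventually[OF lX this]
    have lM: "((\<lambda>v. (Md d (\<beta> (u, v)) - Md d (\<beta> (u, 0))) /\<^sub>R v) \<longlongrightarrow> 0) (at 0)" .
    have J1: "fst (J u) = 0"
    proof -
      have "((\<lambda>v. (fst (\<beta> (u, v)) - fst (\<beta> (u, 0))) /\<^sub>R v) \<longlongrightarrow> 0) (at 0)"
        using tendsto_fst[OF lM] by (simp add: Md_fst_snd)
      moreover have "((\<lambda>v. (fst (\<beta> (u, v)) - fst (\<beta> (u, 0))) /\<^sub>R v) \<longlongrightarrow> fst (J u)) (at 0)"
        using tendsto_fst[OF lB] by simp
      ultimately show ?thesis using tendsto_unique[OF at_neq_bot] by blast
    qed
    have J0: "J u \<noteq> 0"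
    proof
      assume "J u = 0"
      then have "(0, 1) = (0 :: r2)"
        unfolding J_def using frechet_derivative_inj[of \<beta> "(u, 0)" \<beta>' "(0, 1)"] g' by blast
      then show False by (simp add: zero_prod_def)
    qed
    have J2: "snd (J u) \<noteq> 0" using J0 J1 by (auto simp: prod_eq_iff)
    \<comment> \<open>The second component of \<open>Md d\<close> is a square; its derivative in the
      null direction is twice the value times \<open>snd (J u)\<close>, and that factor is
      nonzero.\<close>
    have B0: "snd (\<beta> (u, 0)) = 0"
    proof -
      have "((\<lambda>v. ((snd (\<beta> (u, v)))\<^sup>2 - (snd (\<beta> (u, 0)))\<^sup>2) / v) \<longlongrightarrow> 0) (at 0)"
        using tendsto_fst[OF tendsto_snd[OF lM]] by (simp add: Md_fst_snd divide_inverse mult.commute)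
      note l0 = this
      have sq: "(p + q) * ((p - q) / v) = (p\<^sup>2 - q\<^sup>2) / v" for p q v :: real
        by (simp add: power2_eq_square algebra_simps)
      have "((\<lambda>v. (snd (\<beta> (u, v)) + snd (\<beta> (u, 0))) * ((snd (\<beta> (u, v)) - snd (\<beta> (u, 0))) / v)) \<longlongrightarrow>
          (snd (\<beta> (u, 0)) + snd (\<beta> (u, 0))) * snd (J u)) (at 0)"
        using tendsto_snd[OF lB] by (intro tendsto_mult tendsto_add tendsto_const tendsto_snd[OF cB]) (simp add: divide_inverse mult.commute)
      from tendsto_unique[OF at_neq_bot l0 this[unfolded sq]]
      have "(snd (\<beta> (u, 0)) + snd (\<beta> (u, 0))) * snd (J u) = 0" by simp
      then show ?thesis using J2 by simp
    qed
    have q: "((\<lambda>v. snd (\<beta> (u, v)) / v) \<longlongrightarrow> snd (J u)) (at 0)"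
      using tendsto_snd[OF lB] B0 by (simp add: divide_inverse mult.commute)
    define L where "L v = (snd (\<beta> (u, v))) ^ 3 * rr d (fst (\<beta> (u, v)), (snd (\<beta> (u, v)))\<^sup>2)" for v
    have evL: "\<forall>\<^sub>F v in at 0. L v = Xi3 (cuspS_model k s (u, v))"
      using ev by eventually_elim (simp only: L_def Xi3_def Md_fst_snd(3)[symmetric])
    have rd: "((\<lambda>v. rr d (fst (\<beta> (u, v)), (snd (\<beta> (u, v)))\<^sup>2)) \<longlongrightarrow> rr d (fst (\<beta> (u, 0)), 0)) (at 0)"
    proof -
      have "((\<lambda>v. (fst (\<beta> (u, v)), (snd (\<beta> (u, v)))\<^sup>2)) \<longlongrightarrow> (fst (\<beta> (u, 0)), (snd (\<beta> (u, 0)))\<^sup>2)) (at 0)"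
        by (intro tendsto_intros cB)
      from filterlim_compose[OF smooth_at_tendsto[of "rr d"] this] show ?thesis using g' B0 by simp
    qed
    have L1: "((\<lambda>v. L v / v ^ 3) \<longlongrightarrow> (snd (J u)) ^ 3 * rr d (fst (\<beta> (u, 0)), 0)) (at 0)"
      using tendsto_mult[OF tendsto_power[OF q, of 3] rd] by (simp add: L_def power_divide)
    have L2: "((\<lambda>v. L (- v) / (- v) ^ 3) \<longlongrightarrow> (snd (J u)) ^ 3 * rr d (fst (\<beta> (u, 0)), 0)) (at 0)"
      by (rule filterlim_compose[OF L1 filterlim_uminus_at_0])
    \<comment> \<open>The average equals \<open>(L v - L (- v)) / (2 * v^3)\<close>. Changing the
      sign of \<open>v\<close> in the model changes only the sign of the third entry, so this is a
      symmetric difference of \<open>Xi3\<close>.\<close>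
    have L3: "((\<lambda>v. (L v / v ^ 3 + L (- v) / (- v) ^ 3) / 2) \<longlongrightarrow> (snd (J u)) ^ 3 * rr d (fst (\<beta> (u, 0)), 0)) (at 0)"
      using tendsto_divide[OF tendsto_add[OF L1 L2] tendsto_const, of 2] by simp
    define z where "z v = v ^ 3 * (u ^ (k + 1) + s * v\<^sup>2)" for v
    have "\<forall>\<^sub>F y in nhds (u, 0, 0). y \<in> ball (0 :: r3) \<delta>" using g' by (intro eventually_nhds_in_open) auto
    from eventually_compose_filterlim[OF this cuspS_curve(3)[of k s u]]
    have evb: "\<forall>\<^sub>F v in at 0. (u, v\<^sup>2, z v) \<in> ball 0 \<delta>" by (simp add: cuspS_model_simp z_def)
    define P where "P v \<xi> \<longleftrightarrow> \<bar>\<xi>\<bar> \<le> \<bar>z v\<bar> \<and> Xi3 (u, v\<^sup>2, z v) - Xi3 (u, v\<^sup>2, - z v) = 2 * z v * D (u, v\<^sup>2, \<xi>)" for v \<xi>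
    \<comment> \<open>The intermediate point is bounded by \<open>\<bar>z v\<bar>\<close> and hence
      tends to 0 with \<open>v\<close>; any choice of it suffices.\<close>
    define \<xi> where "\<xi> v = (SOME x. P v x)" for v
    have ev\<xi>: "\<forall>\<^sub>F v in at 0. P v (\<xi> v)"
      using evb
    proof eventually_elim
      case (elim v)
      from symmetric_difference_mvt[OF \<delta>(2) this] have "\<exists>x. P v x" by (simp add: P_def D_def)
      then show ?case unfolding \<xi>_def by (rule someI_ex)
    qed
    have "((\<lambda>v. v ^ 3 * (u ^ (k + 1) + s * v\<^sup>2)) \<longlongrightarrow> 0 ^ 3 * (u ^ (k + 1) + s * 0\<^sup>2)) (at (0::real))"
      by (intro tendsto_intros)
    then have z0: "(z \<longlongrightarrow> 0) (at 0)" by (simp add: z_def[abs_def])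
    have "((\<lambda>v. \<bar>z v\<bar>) \<longlongrightarrow> 0) (at 0)" using tendsto_rabs[OF z0] by simp
    moreover have "\<forall>\<^sub>F v in at 0. norm (\<xi> v) \<le> \<bar>z v\<bar>" using ev\<xi> by eventually_elim (simp add: P_def)
    ultimately have \<xi>0: "(\<xi> \<longlongrightarrow> 0) (at 0)" by (rule Lim_null_comparison[rotated])
    have "((\<lambda>v. (u, v\<^sup>2, \<xi> v)) \<longlongrightarrow> (u, 0\<^sup>2, 0)) (at (0::real))" by (intro tendsto_intros \<xi>0)
    then have "((\<lambda>v. (u, v\<^sup>2, \<xi> v)) \<longlongrightarrow> (u, 0, 0)) (at (0::real))" by simp
    moreover have "isCont D (u, 0, 0)" using contD g' by blast
    ultimately have Dl: "((\<lambda>v. D (u, v\<^sup>2, \<xi> v)) \<longlongrightarrow> D (u, 0, 0)) (at 0)"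
      by (rule isCont_tendsto_compose[rotated])
    have "((\<lambda>v. (u ^ (k + 1) + s * v\<^sup>2) * D (u, v\<^sup>2, \<xi> v)) \<longlongrightarrow> (u ^ (k + 1) + s * 0\<^sup>2) * D (u, 0, 0)) (at (0::real))"
      by (intro tendsto_intros Dl)
    moreover have "\<forall>\<^sub>F v in at 0. (L v / v ^ 3 + L (- v) / (- v) ^ 3) / 2 = (u ^ (k + 1) + s * v\<^sup>2) * D (u, v\<^sup>2, \<xi> v)"
      using evL eventually_compose_filterlim[OF evL filterlim_uminus_at_0] ev\<xi> at_0_ne(1)
    proof eventually_elim
      case (elim v)
      have "(L v / v ^ 3 + L (- v) / (- v) ^ 3) / 2 = (L v - L (- v)) / (2 * v ^ 3)"
        by (simp add: power3_eq_cube diff_divide_distrib)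
      also have "L v - L (- v) = 2 * z v * D (u, v\<^sup>2, \<xi> v)"
        using elim(1-3) by (simp add: cuspS_model_simp z_def P_def)
      also have "2 * z v * D (u, v\<^sup>2, \<xi> v) / (2 * v ^ 3) = (u ^ (k + 1) + s * v\<^sup>2) * D (u, v\<^sup>2, \<xi> v)"
        using elim(4) by (simp add: z_def)
      finally show ?case .
    qed
    ultimately have "((\<lambda>v. (L v / v ^ 3 + L (- v) / (- v) ^ 3) / 2) \<longlongrightarrow> u ^ (k + 1) * D (u, 0, 0)) (at 0)"
      by (simp add: tendsto_cong)
    from tendsto_unique[OF at_neq_bot L3 this] show ?thesis using J1 J2 B0 by blast
  qed
  have good0: "good (0, 0)" using eventually_nhds_x_imp_x[OF ev_good] by (simp add: z2)
  note null0 = null[OF good0]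
  have ev_axis: "\<forall>\<^sub>F u in nhds (0 :: real). good (u, 0)" by (rule eventually_axis_point[OF ev_good])
  define B where "B = frechet_derivative \<beta> (at 0)"
  have dB: "(\<beta> has_derivative B) (at 0)" unfolding B_def by (rule smooth_at_has_derivative[OF b1(1)])
  have J0: "J 0 = B (0, 1)" by (simp add: J_def B_def z2)
  define x where "x u = fst (\<beta> (u, 0))" for u
  have axis1: "filterlim (\<lambda>y. (y, 0)) (nhds (0 :: r2)) (at (0 :: real))"
    and axis2: "filterlim (\<lambda>y. (0, y)) (nhds (0 :: r2)) (at (0 :: real))"
    unfolding zero_prod_def by (intro tendsto_intros)+
  have lb1: "((\<lambda>y. (\<beta> (y, 0) - \<beta> 0) /\<^sub>R y) \<longlongrightarrow> B (1, 0)) (at 0)"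
    by (rule derivative_along[OF dB along_axes(1) axis1 at_0_ne(1)])
  have lb2: "((\<lambda>y. (\<beta> (0, y) - \<beta> 0) /\<^sub>R y) \<longlongrightarrow> B (0, 1)) (at 0)"
    by (rule derivative_along[OF dB along_axes(2) axis2 at_0_ne(1)])
  have evs: "\<forall>\<^sub>F u in at 0. snd (\<beta> (u, 0)) = 0"
    using filter_leD[OF at_within_le_nhds ev_axis] by eventually_elim (use null in blast)
  have B10: "snd (B (1, 0)) = 0"
  proof -
    have "\<forall>\<^sub>F u in at 0. snd ((\<beta> (u, 0) - \<beta> 0) /\<^sub>R u) = 0" using evs by eventually_elim (simp add: b1(3))
    from tendsto_unique[OF at_neq_bot tendsto_snd[OF lb1] tendsto_eventually[OF this]] show ?thesis .
  qed
  have B1: "fst (B (1, 0)) \<noteq> 0"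
  proof
    assume "fst (B (1, 0)) = 0"
    then have "B (1, 0) = 0" using B10 by (simp add: prod_eq_iff)
    then have "(1, 0) = (0 :: r2)"
      unfolding B_def using frechet_derivative_inj[of \<beta> 0 \<beta>' "(1, 0)"] b1 by simp
    then show False by (simp add: zero_prod_def)
  qed
  have x1: "((\<lambda>u. x u / u) \<longlongrightarrow> fst (B (1, 0))) (at 0)"
    using tendsto_fst[OF lb1] by (simp add: x_def b1(3) divide_inverse mult.commute)
  have xne: "\<forall>\<^sub>F u in at 0. x u \<noteq> 0"
    using tendsto_imp_eventually_ne[OF x1 B1] by eventually_elim auto
  have "((\<lambda>y. \<beta> (y, 0)) \<longlongrightarrow> 0) (at 0)"
    using filterlim_compose[OF smooth_at_tendsto[OF b1(1)] axis1] b1(3) by simp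
  from tendsto_fst[OF this] have x0: "(x \<longlongrightarrow> 0) (at 0)" by (simp add: x_def[abs_def])
  have J2: "snd (J 0) \<noteq> 0" using null0 by blast
  have Jc: "((\<lambda>u. snd (J u)) \<longlongrightarrow> snd (J 0)) (at 0)"
  proof -
    have "((\<lambda>u. frechet_derivative \<beta> (at (u, 0)) (0, 1)) \<longlongrightarrow> frechet_derivative \<beta> (at 0) (0, 1)) (at 0)"
      by (rule filterlim_compose[OF smooth_at_tendsto[OF smooth_at_frechet_derivative[OF b1(1)]] axis1])
    from tendsto_snd[OF this] show ?thesis by (simp add: J_def z2)
  qed
  have Dc: "((\<lambda>u. D (u, 0, 0)) \<longlongrightarrow> D 0) (at 0)"
  proof -
    have "((\<lambda>u. (u, 0, 0)) \<longlongrightarrow> (0 :: r3)) (at (0 :: real))"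
      unfolding zero_prod_def by (intro tendsto_intros)
    from isCont_tendsto_compose[OF contD0 this] show ?thesis .
  qed
  \<comment> \<open>Here \<open>D\<close> and \<open>snd \<circ> J\<close> have nonzero limits and
    \<open>x u\<close> is comparable to \<open>u\<close>, so \<open>d\<close> on the axis has the
    exact order \<open>k + 1\<close>.\<close>
  have star: "\<forall>\<^sub>F u in at 0. rr d (x u, 0) = u ^ (k + 1) * D (u, 0, 0) / (snd (J u)) ^ 3"
    using filter_leD[OF at_within_le_nhds ev_axis]
  proof eventually_elim
    case (elim u)
    from null[OF this] have n: "snd (J u) \<noteq> 0" "(snd (J u)) ^ 3 * rr d (x u, 0) = u ^ (k + 1) * D (u, 0, 0)"
      by (auto simp: x_def)
    show ?case unfolding n(2)[symmetric] using n(1) by simp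
  qed
  have d00: "rr d 0 = 0"
    using null0 J2 b1(3) by (simp add: z2)
  define X where "X = frechet_derivative \<Xi> (at 0)"
  have dX: "(\<Xi> has_derivative X) (at 0)" unfolding X_def by (rule smooth_at_has_derivative[OF X1(1)])
  have Xlin: "bounded_linear X" by (rule has_derivative_bounded_linear[OF dX])
  have D0: "D 0 = snd (snd (X (0, 0, 1)))"
  proof -
    have "(Xi3 has_derivative (\<lambda>h. snd (snd (X h)))) (at 0)"
      unfolding Xi3_def by (intro has_derivative_snd dX)
    from frechet_derivative_at[OF this] show ?thesis unfolding D_def by metis
  qed
  have cur2: "((\<lambda>v. (\<Xi> (cuspS_model k s (0, v)) - \<Xi> 0) /\<^sub>R v\<^sup>2) \<longlongrightarrow> X (0, 1, 0)) (at 0)"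
    by (rule derivative_along[OF dX _ _ at_0_ne(2)])
      (use cuspS_curve(2,3)[of k s 0] in \<open>simp_all add: z3\<close>)
  have ev0: "\<forall>\<^sub>F v in at 0. Md d (\<beta> (0, v)) = \<Xi> (cuspS_model k s (0, v))"
    by (rule eventually_compose_filterlim[OF *(3) axis2])
  have "\<forall>\<^sub>F v in at 0. (\<Xi> (cuspS_model k s (0, v)) - \<Xi> 0) /\<^sub>R v\<^sup>2 = Md d (\<beta> (0, v)) /\<^sub>R v\<^sup>2"
    using ev0 by eventually_elim (simp add: X1(3))
  from Lim_transform_eventually[OF cur2 this]
  have lM2: "((\<lambda>v. Md d (\<beta> (0, v)) /\<^sub>R v\<^sup>2) \<longlongrightarrow> X (0, 1, 0)) (at 0)" .
  have p1: "((\<lambda>v. fst (\<beta> (0, v)) / v\<^sup>2) \<longlongrightarrow> fst (X (0, 1, 0))) (at 0)"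
    using tendsto_fst[OF lM2] by (simp add: Md_fst_snd divide_inverse mult.commute)
  have p2: "((\<lambda>v. snd (\<beta> (0, v)) / v) \<longlongrightarrow> snd (J 0)) (at 0)"
    using tendsto_snd[OF lb2] by (simp add: J0 b1(3) divide_inverse mult.commute)
  have p2': "((\<lambda>v. (snd (\<beta> (0, v)))\<^sup>2 / v\<^sup>2) \<longlongrightarrow> (snd (J 0))\<^sup>2) (at 0)"
    using tendsto_power[OF p2, of 2] by (simp add: power_divide)
  have bt: "((\<lambda>v. \<beta> (0, v)) \<longlongrightarrow> 0) (at 0)"
    using filterlim_compose[OF smooth_at_tendsto[OF b1(1)] axis2] b1(3) by simp
  have qt: "((\<lambda>v. (fst (\<beta> (0, v)), (snd (\<beta> (0, v)))\<^sup>2)) \<longlongrightarrow> 0) (at 0)"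
    using tendsto_Pair[OF tendsto_fst[OF bt] tendsto_power[OF tendsto_snd[OF bt], of 2]] by (simp add: z2)
  have rdt: "((\<lambda>v. rr d (fst (\<beta> (0, v)), (snd (\<beta> (0, v)))\<^sup>2)) \<longlongrightarrow> 0) (at 0)"
    using filterlim_compose[OF smooth_at_tendsto[OF smooth_at_rr[OF d]] qt] d00 by simp
  \<comment> \<open>At second order in \<open>v\<close> the third component of
    \<open>Md d \<circ> \<beta>\<close> is negligible, because it contains a cube.\<close>
  have X010: "snd (snd (X (0, 1, 0))) = 0"
  proof -
    have "((\<lambda>v. (snd (\<beta> (0, v)))\<^sup>2 / v\<^sup>2 * (snd (\<beta> (0, v)) * rr d (fst (\<beta> (0, v)), (snd (\<beta> (0, v)))\<^sup>2))) \<longlongrightarrow> (snd (J 0))\<^sup>2 * (snd (0 :: r2) * 0)) (at 0)"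
      by (intro tendsto_mult p2' tendsto_snd[OF bt] rdt)
    moreover have "snd (snd (Md d (\<beta> (0, v)) /\<^sub>R v\<^sup>2)) = (snd (\<beta> (0, v)))\<^sup>2 / v\<^sup>2 * (snd (\<beta> (0, v)) * rr d (fst (\<beta> (0, v)), (snd (\<beta> (0, v)))\<^sup>2))" for v
      by (simp add: Md_fst_snd divide_inverse power2_eq_square power3_eq_cube)
    ultimately have "((\<lambda>v. snd (snd (Md d (\<beta> (0, v)) /\<^sub>R v\<^sup>2))) \<longlongrightarrow> 0) (at 0)" by simp
    from tendsto_unique[OF at_neq_bot tendsto_snd[OF tendsto_snd[OF lM2]] this] show ?thesis .
  qed
  have X100: "snd (snd (X (1, 0, 0))) = 0"
  proof -
    have ax3: "((\<lambda>u. (u, 0, 0)) \<longlongrightarrow> (0 :: r3)) (at (0 :: real))"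
      unfolding zero_prod_def by (intro tendsto_intros)
    have "((\<lambda>u. (\<Xi> (u, 0, 0) - \<Xi> 0) /\<^sub>R u) \<longlongrightarrow> X (1, 0, 0)) (at 0)"
      by (rule derivative_along[OF dX along_axes(3) ax3 at_0_ne(1)])
    moreover have "\<forall>\<^sub>F u in at 0. snd (snd ((\<Xi> (u, 0, 0) - \<Xi> 0) /\<^sub>R u)) = 0"
      using eventually_compose_filterlim[OF *(3) axis1] evs
    proof eventually_elim
      case (elim u)
      have "snd (snd (\<Xi> (u, 0, 0))) = snd (snd (Md d (\<beta> (u, 0))))" using elim(1) by (simp add: Mu0)
      also have "\<dots> = 0" using elim(2) by (simp add: Md_fst_snd)
      finally show ?case by (simp add: X1(3))
    qed
    ultimately show ?thesis
      using tendsto_unique[OF at_neq_bot tendsto_snd[OF tendsto_snd] tendsto_eventually] by blast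
  qed
  \<comment> \<open>Otherwise the third component of the derivative \<open>X\<close> would vanish on
    all three unit vectors, although \<open>X\<close> has a right inverse.\<close>
  have Dn: "D 0 \<noteq> 0"
  proof
    assume "D 0 = 0"
    then have X001: "snd (snd (X (0, 0, 1))) = 0" using D0 by simp
    have "snd (snd (X h)) = 0" for h
    proof -
      obtain p q r where h: "h = (p, q, r)" by (cases h)
      have "h = p *\<^sub>R (1, 0, 0) + (q *\<^sub>R (0, 1, 0) + r *\<^sub>R (0, 0, 1))" by (simp add: h)
      then have "X h = p *\<^sub>R X (1, 0, 0) + (q *\<^sub>R X (0, 1, 0) + r *\<^sub>R X (0, 0, 1))"
        by (simp only: linear_simps(1,5)[OF Xlin])
      then show ?thesis using X100 X010 X001 by simp
    qed
    moreover have "X (frechet_derivative \<Theta> (at 0) (0, 0, 1)) = (0, 0, 1)"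
      unfolding X_def using frechet_derivative_left_inverse[of \<Theta> 0 \<Xi> "(0, 0, 1)"] X1 by simp
    ultimately show False by (metis snd_conv zero_neq_one)
  qed
  define c where "c = (1 / fst (B (1, 0))) ^ (k + 1) * D 0 / (snd (J 0)) ^ 3"
  have c0: "c \<noteq> 0" using B1 Dn J2 by (simp add: c_def)
  have lim: "((\<lambda>u. rr d (x u, 0) / (x u) ^ (k + 1)) \<longlongrightarrow> c) (at 0)"
  proof -
    have "((\<lambda>u. (1 / (x u / u)) ^ (k + 1) * D (u, 0, 0) / (snd (J u)) ^ 3) \<longlongrightarrow> c) (at 0)"
      unfolding c_def by (intro tendsto_intros x1 B1 Dc Jc) (use J2 in simp)
    moreover have "\<forall>\<^sub>F u in at 0. (1 / (x u / u)) ^ (k + 1) * D (u, 0, 0) / (snd (J u)) ^ 3 = rr d (x u, 0) / (x u) ^ (k + 1)"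
      using star by eventually_elim (simp add: power_divide)
    ultimately show ?thesis by (rule Lim_transform_eventually)
  qed
  show ?A using c0 x0 xne lim by blast
  show "pd2 d 0 \<noteq> 0" if k: "k \<ge> 1"
  proof
    assume p0: "pd2 d 0 = 0"
    have dd: "(rr d has_derivative (\<lambda>h. Re (pd1 d 0) * fst h)) (at 0)"
      using has_derivative_rr[of d "pd1 d 0" 0 0] rhol_has_pderivs_0[OF d] p0 by simp
    \<comment> \<open>On the axis \<open>d\<close> is of order at least 2, since
      \<open>k \<ge> 1\<close>; thus its first-direction derivative at the origin vanishes as
      well.\<close>
    have du: "Re (pd1 d 0) = 0"
    proof -
      have "((\<lambda>u. ((x u, 0) - 0) /\<^sub>R u) \<longlongrightarrow> (fst (B (1, 0)), 0 :: real)) (at 0)"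
        using tendsto_Pair[OF x1 tendsto_const[of "0 :: real"]] by (simp add: z2 divide_inverse mult.commute)
      moreover have "((\<lambda>u. (x u, 0)) \<longlongrightarrow> (0 :: r2)) (at 0)"
        using tendsto_Pair[OF x0 tendsto_const[of "0 :: real"]] by (simp add: z2)
      ultimately have 1: "((\<lambda>u. (rr d (x u, 0) - rr d 0) /\<^sub>R u) \<longlongrightarrow> Re (pd1 d 0) * fst (fst (B (1, 0)), 0 :: real)) (at 0)"
        by (rule derivative_along[OF dd _ _ at_0_ne(1)])
      have 2: "((\<lambda>u. u ^ k * D (u, 0, 0) / (snd (J u)) ^ 3) \<longlongrightarrow> 0 ^ k * D 0 / (snd (J 0)) ^ 3) (at 0)"
        by (intro tendsto_intros Dc Jc) (use J2 in simp)
      have "\<forall>\<^sub>F u in at 0. u ^ k * D (u, 0, 0) / (snd (J u)) ^ 3 = (rr d (x u, 0) - rr d 0) /\<^sub>R u"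
        using star at_0_ne(1) by eventually_elim (simp add: d00)
      from tendsto_unique[OF at_neq_bot Lim_transform_eventually[OF 2 this] 1]
      show ?thesis using B1 k by (simp add: power_0_left)
    qed
    define L where "L v = (snd (\<beta> (0, v))) ^ 3 * rr d (fst (\<beta> (0, v)), (snd (\<beta> (0, v)))\<^sup>2)" for v
    have dt: "((\<lambda>v. rr d (fst (\<beta> (0, v)), (snd (\<beta> (0, v)))\<^sup>2) / v\<^sup>2) \<longlongrightarrow> 0) (at 0)"
    proof -
      have "((\<lambda>v. ((fst (\<beta> (0, v)), (snd (\<beta> (0, v)))\<^sup>2) - 0) /\<^sub>R v\<^sup>2) \<longlongrightarrow> (fst (X (0, 1, 0)), (snd (J 0))\<^sup>2)) (at 0)"
        using tendsto_Pair[OF p1 p2'] by (simp add: divide_inverse mult.commute)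
      from derivative_along[OF dd this qt at_0_ne(2)] show ?thesis
        using du d00 by (simp add: divide_inverse mult.commute)
    qed
    \<comment> \<open>With both first derivatives of \<open>d\<close> zero, the third component is
      of smaller order than \<open>v^5\<close>, whereas the odd part of the model on
      \<open>u = 0\<close> is exactly \<open>s * v^5\<close>. This forces
      \<open>s * D 0 = 0\<close>, a contradiction.\<close>
    have L1: "((\<lambda>v. L v / v ^ 5) \<longlongrightarrow> 0) (at 0)"
    proof -
      have "((\<lambda>v. (snd (\<beta> (0, v)) / v) ^ 3 * (rr d (fst (\<beta> (0, v)), (snd (\<beta> (0, v)))\<^sup>2) / v\<^sup>2)) \<longlongrightarrow> (snd (J 0)) ^ 3 * 0) (at 0)"
        by (intro tendsto_mult tendsto_power p2 dt)
      moreover have "(snd (\<beta> (0, v)) / v) ^ 3 * (rr d (fst (\<beta> (0, v)), (snd (\<beta> (0, v)))\<^sup>2) / v\<^sup>2) = L v / v ^ 5" for v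
        by (simp add: L_def power_divide flip: power_add)
      ultimately show ?thesis by simp
    qed
    have L2: "((\<lambda>v. L (- v) / (- v) ^ 5) \<longlongrightarrow> 0) (at 0)"
      by (rule filterlim_compose[OF L1 filterlim_uminus_at_0])
    have L3: "((\<lambda>v. (L v / v ^ 5 + L (- v) / (- v) ^ 5) / 2) \<longlongrightarrow> 0) (at 0)"
      using tendsto_divide[OF tendsto_add[OF L1 L2] tendsto_const, of 2] by simp
    have evL: "\<forall>\<^sub>F v in at 0. L v = Xi3 (cuspS_model k s (0, v))"
      using ev0 by eventually_elim (simp only: L_def Xi3_def Md_fst_snd(3)[symmetric])
    define z where "z v = v ^ 3 * (s * v\<^sup>2)" for v
    have k0: "(0 :: real) ^ (k + 1) = 0" by simp
    have "\<forall>\<^sub>F y in nhds 0. y \<in> ball (0 :: r3) \<delta>" using \<delta>(1) by (intro eventually_nhds_in_open) auto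
    moreover have "filterlim (\<lambda>v. cuspS_model k s (0, v)) (nhds (0 :: r3)) (at 0)"
      using cuspS_curve(3)[of k s 0] by (simp only: z3)
    ultimately have "\<forall>\<^sub>F v in at 0. cuspS_model k s (0, v) \<in> ball 0 \<delta>"
      by (rule eventually_compose_filterlim)
    then have evb: "\<forall>\<^sub>F v in at 0. (0 :: real, v\<^sup>2, z v) \<in> ball 0 \<delta>"
      by (simp only: cuspS_model_simp z_def k0 add_0)
    define P where "P v \<xi> \<longleftrightarrow> \<bar>\<xi>\<bar> \<le> \<bar>z v\<bar> \<and> Xi3 (0, v\<^sup>2, z v) - Xi3 (0, v\<^sup>2, - z v) = 2 * z v * D (0, v\<^sup>2, \<xi>)" for v \<xi>
    define \<xi> where "\<xi> v = (SOME x. P v x)" for v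
    have ev\<xi>: "\<forall>\<^sub>F v in at 0. P v (\<xi> v)"
      using evb
    proof eventually_elim
      case (elim v)
      from symmetric_difference_mvt[OF \<delta>(2) this] have "\<exists>x. P v x" by (simp add: P_def D_def)
      then show ?case unfolding \<xi>_def by (rule someI_ex)
    qed
    have "((\<lambda>v. v ^ 3 * (s * v\<^sup>2)) \<longlongrightarrow> 0 ^ 3 * (s * 0\<^sup>2)) (at (0::real))"
      by (intro tendsto_intros)
    then have zl: "(z \<longlongrightarrow> 0) (at 0)" by (simp add: z_def[abs_def])
    have "((\<lambda>v. \<bar>z v\<bar>) \<longlongrightarrow> 0) (at 0)" using tendsto_rabs[OF zl] by simp
    moreover have "\<forall>\<^sub>F v in at 0. norm (\<xi> v) \<le> \<bar>z v\<bar>" using ev\<xi> by eventually_elim (simp add: P_def)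
    ultimately have \<xi>0: "(\<xi> \<longlongrightarrow> 0) (at 0)" by (rule Lim_null_comparison[rotated])
    have "((\<lambda>v. (0, v\<^sup>2, \<xi> v)) \<longlongrightarrow> (0, 0\<^sup>2, 0)) (at (0::real))" by (intro tendsto_intros \<xi>0)
    then have "((\<lambda>v. (0, v\<^sup>2, \<xi> v)) \<longlongrightarrow> (0 :: r3)) (at (0::real))" by (simp add: zero_prod_def)
    from isCont_tendsto_compose[OF contD0 this]
    have Dl: "((\<lambda>v. D (0, v\<^sup>2, \<xi> v)) \<longlongrightarrow> D 0) (at 0)" .
    have "((\<lambda>v. s * D (0, v\<^sup>2, \<xi> v)) \<longlongrightarrow> s * D 0) (at (0::real))"
      by (intro tendsto_intros Dl)
    moreover have "\<forall>\<^sub>F v in at 0. s * D (0, v\<^sup>2, \<xi> v) = (L v / v ^ 5 + L (- v) / (- v) ^ 5) / 2"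
      using evL eventually_compose_filterlim[OF evL filterlim_uminus_at_0] ev\<xi> at_0_ne(1)
    proof eventually_elim
      case (elim v)
      have "(L v / v ^ 5 + L (- v) / (- v) ^ 5) / 2 = (L v - L (- v)) / (2 * v ^ 5)"
        by (simp add: power_minus_odd diff_divide_distrib)
      also have "L v - L (- v) = 2 * z v * D (0, v\<^sup>2, \<xi> v)"
        using elim(1-3) by (simp add: cuspS_model_simp z_def P_def)
      also have "2 * z v * D (0, v\<^sup>2, \<xi> v) / (2 * v ^ 5) = s * D (0, v\<^sup>2, \<xi> v)"
        using elim(4) by (simp add: z_def field_simps eval_nat_numeral)
      finally show ?case by simp
    qed
    ultimately have "((\<lambda>v. (L v / v ^ 5 + L (- v) / (- v) ^ 5) / 2) \<longlongrightarrow> s * D 0) (at 0)"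
      by (rule Lim_transform_eventually)
    from tendsto_unique[OF at_neq_bot L3 this] show False using s Dn by simp
  qed
qed

subsection \<open>Orders of zeros\<close>

definition zero_of_order :: "(complex \<Rightarrow> complex) \<Rightarrow> nat \<Rightarrow> bool" where
  "zero_of_order F m \<longleftrightarrow> (\<exists>h. h analytic_on {0} \<and> h 0 \<noteq> 0 \<and> (\<forall>\<^sub>F z in nhds 0. F z = z ^ m * h z))"

lemma zero_of_order_subdegree:
  assumes "F has_fps_expansion f" "f \<noteq> 0"
  shows "zero_of_order F (subdegree f)"
proof -
  define n where "n = subdegree f"
  define h where "h x = (if x = 0 then fps_nth f n else F x / x ^ n)" for x
  have "h has_fps_expansion fps_shift n f"
    unfolding h_def by (rule has_fps_expansion_shift[OF assms(1)]) (simp_all add: n_def)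
  then have "h analytic_on {0}" by (rule has_fps_expansion_imp_analytic_0)
  moreover have "h 0 \<noteq> 0" using assms(2) by (simp add: h_def n_def)
  moreover have "F z = z ^ n * h z" for z
  proof (cases "z = 0")
    case True
    have "F 0 = fps_nth f 0" by (rule has_fps_expansion_imp_0_eq_fps_nth_0[OF assms(1)])
    moreover have "fps_nth f 0 = 0" if "n \<noteq> 0" using that by (intro nth_less_subdegree_zero) (simp add: n_def)
    ultimately show ?thesis using True by (cases "n = 0") (simp_all add: h_def power_0_left)
  qed (simp add: h_def)
  ultimately show ?thesis
    unfolding zero_of_order_def n_def[symmetric] by (intro exI[of _ h] conjI always_eventually allI)
qed

lemma zero_of_order_iff_deriv:
  assumes "F analytic_on {0}"
  shows "zero_of_order F m \<longleftrightarrow> (\<forall>j<m. (deriv ^^ j) F 0 = 0) \<and> (deriv ^^ m) F 0 \<noteq> 0" (is "_ \<longleftrightarrow> ?D")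
proof -
  define f where "f = fps_expansion F 0"
  have f: "F has_fps_expansion f" unfolding f_def by (rule analytic_at_imp_has_fps_expansion_0[OF assms])
  have n: "(deriv ^^ j) F 0 = fact j * fps_nth f j" for j
    by (simp add: fps_nth_fps_expansion[OF f])
  show ?thesis
  proof
    assume "zero_of_order F m"
    then obtain h where h: "h analytic_on {0}" "h 0 \<noteq> 0" "\<forall>\<^sub>F z in nhds 0. F z = z ^ m * h z"
      unfolding zero_of_order_def by blast
    define H where "H = fps_expansion h 0"
    have H: "h has_fps_expansion H" unfolding H_def by (rule analytic_at_imp_has_fps_expansion_0[OF h(1)])
    have "(\<lambda>z. z ^ m * h z) has_fps_expansion fps_X ^ m * H"
      by (intro has_fps_expansion_mult has_fps_expansion_fps_X_power H)
    with h(3) have "F has_fps_expansion fps_X ^ m * H"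
      by (simp add: has_fps_expansion_cong)
    then have "f = fps_X ^ m * H" by (rule fps_expansion_unique_complex[OF f])
    moreover have "fps_nth H 0 \<noteq> 0" using has_fps_expansion_imp_0_eq_fps_nth_0[OF H] h(2) by simp
    ultimately show ?D by (simp add: n fps_X_power_mult_nth)
  next
    assume D: ?D
    then have nz: "fps_nth f m \<noteq> 0" and z: "\<forall>j<m. fps_nth f j = 0" by (simp_all add: n)
    then have "subdegree f = m" by (intro subdegreeI) auto
    with zero_of_order_subdegree[OF f] nz show "zero_of_order F m" by auto
  qed
qed

lemma power_quotient_tendsto_unique:
  fixes s :: "'a \<Rightarrow> complex"
  assumes "Fl \<noteq> bot" "(s \<longlongrightarrow> 0) Fl" "\<forall>\<^sub>F x in Fl. s x \<noteq> 0" "((\<lambda>x. s x ^ n / s x ^ m) \<longlongrightarrow> c) Fl" "c \<noteq> 0"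
  shows "n = m"
proof (rule ccontr)
  have z: "((\<lambda>x. s x ^ k) \<longlongrightarrow> 0) Fl" if "k > 0" for k
    using tendsto_power[OF assms(2), of k] that by (simp add: power_0_left)
  assume "n \<noteq> m"
  then consider "n > m" | "n < m" by linarith
  then show False
  proof cases
    case 1
    have "\<forall>\<^sub>F x in Fl. s x ^ (n - m) = s x ^ n / s x ^ m"
      using assms(3) by eventually_elim (use 1 in \<open>simp add: power_diff\<close>)
    from tendsto_unique[OF assms(1) Lim_transform_eventually[OF z this] assms(4)] 1 assms(5)
    show False by simp
  next
    case 2
    have "\<forall>\<^sub>F x in Fl. s x ^ (m - n) = inverse (s x ^ n / s x ^ m)"
      using assms(3) by eventually_elim (use 2 in \<open>simp add: power_diff\<close>)
    from tendsto_unique[OF assms(1) Lim_transform_eventually[OF z this] tendsto_inverse[OF assms(4,5)]] 2 assms(5)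
    show False by simp
  qed
qed

text \<open>A nonzero limit excludes the zero germ, so \<open>F\<close> has some order
  \<open>n\<close>; then the quotient of powers \<open>s^n / s^m\<close> has a nonzero limit, which
  forces \<open>n = m\<close>. An arbitrary filter is allowed because a smooth equivalence supplies
  only real points approaching the origin.\<close>

lemma zero_of_order_if_tendsto:
  assumes F: "F analytic_on {0}" and Fl: "Fl \<noteq> bot" and s: "(s \<longlongrightarrow> 0) Fl" "\<forall>\<^sub>F x in Fl. s x \<noteq> 0"
    and l: "((\<lambda>x. F (s x) / s x ^ m) \<longlongrightarrow> c) Fl" "c \<noteq> 0"
  shows "zero_of_order F m"
proof -
  define f where "f = fps_expansion F 0"
  have f: "F has_fps_expansion f" unfolding f_def by (rule analytic_at_imp_has_fps_expansion_0[OF F])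
  have "f \<noteq> 0"
  proof
    assume "f = 0"
    then have "\<forall>\<^sub>F z in nhds 0. F z = 0" using f has_fps_expansion_0_iff by blast
    from eventually_compose_filterlim[OF this s(1)]
    have "\<forall>\<^sub>F x in Fl. F (s x) / s x ^ m = 0" by eventually_elim simp
    from tendsto_unique[OF Fl tendsto_eventually[OF this] l(1)] l(2) show False by simp
  qed
  from zero_of_order_subdegree[OF f this] obtain n where n: "zero_of_order F n" by blast
  then obtain h where h: "h analytic_on {0}" "h 0 \<noteq> 0" "\<forall>\<^sub>F z in nhds 0. F z = z ^ n * h z"
    unfolding zero_of_order_def by blast
  have "isCont h 0" using h(1) by (rule analytic_at_imp_isCont)
  then have hs: "((\<lambda>x. h (s x)) \<longlongrightarrow> h 0) Fl" using s(1) by (rule isCont_tendsto_compose)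
  have "((\<lambda>x. F (s x) / s x ^ m / h (s x)) \<longlongrightarrow> c / h 0) Fl"
    by (rule tendsto_divide[OF l(1) hs h(2)])
  moreover have "\<forall>\<^sub>F x in Fl. F (s x) / s x ^ m / h (s x) = s x ^ n / s x ^ m"
    using eventually_compose_filterlim[OF h(3) s(1)] tendsto_imp_eventually_ne[OF hs h(2)]
    by eventually_elim simp
  ultimately have "((\<lambda>x. s x ^ n / s x ^ m) \<longlongrightarrow> c / h 0) Fl" by (rule Lim_transform_eventually)
  from power_quotient_tendsto_unique[OF Fl s this] l(2) h(2) n show ?thesis by simp
qed

lemma zero_of_order_tendsto:
  assumes "zero_of_order F m" "(s \<longlongrightarrow> 0) Fl" "\<forall>\<^sub>F x in Fl. s x \<noteq> 0"
  shows "\<exists>c. c \<noteq> 0 \<and> ((\<lambda>x. F (s x) / s x ^ m) \<longlongrightarrow> c) Fl"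
proof -
  obtain h where h: "h analytic_on {0}" "h 0 \<noteq> 0" "\<forall>\<^sub>F z in nhds 0. F z = z ^ m * h z"
    using assms(1) unfolding zero_of_order_def by blast
  have "isCont h 0" using h(1) by (rule analytic_at_imp_isCont)
  then have hs: "((\<lambda>x. h (s x)) \<longlongrightarrow> h 0) Fl" using assms(2) by (rule isCont_tendsto_compose)
  have "\<forall>\<^sub>F x in Fl. h (s x) = F (s x) / s x ^ m"
    using eventually_compose_filterlim[OF h(3) assms(2)] assms(3) by eventually_elim simp
  from Lim_transform_eventually[OF hs this] h(2) show ?thesis by blast
qed

text \<open>The order is tested by limits of quotients, so the factor \<open>\<rho>\<close> only
  needs a nonzero limit and \<open>t\<close> only a nonzero derivative at the origin.\<close>

lemma zero_of_order_change:
  assumes F: "F analytic_on {0}" and A: "A analytic_on {0}"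
    and t: "(t has_field_derivative t') (at 0)" "t 0 = 0" "t' \<noteq> 0"
    and r: "(\<rho> \<longlongrightarrow> r) (at 0)" "r \<noteq> 0" and eq: "\<forall>\<^sub>F u in at 0. F u = A (t u) * \<rho> u"
  shows "zero_of_order F m \<longleftrightarrow> zero_of_order A m"
proof -
  have tu: "((\<lambda>u. t u / u) \<longlongrightarrow> t') (at 0)"
    using t(1,2) by (simp add: has_field_derivative_iff)
  have t0: "(t \<longlongrightarrow> 0) (at 0)" using DERIV_isCont[OF t(1)] t(2) by (simp add: isCont_def)
  have u0: "\<forall>\<^sub>F u in at 0. u \<noteq> (0 :: complex)" by (simp add: eventually_at_filter)
  have tn: "\<forall>\<^sub>F u in at 0. t u \<noteq> 0"
    using tendsto_imp_eventually_ne[OF tu t(3)] by eventually_elim auto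
  have rn: "\<forall>\<^sub>F u in at 0. \<rho> u \<noteq> 0" by (rule tendsto_imp_eventually_ne[OF r])
  show ?thesis
  proof
    assume "zero_of_order F m"
    from zero_of_order_tendsto[OF this tendsto_ident_at u0]
    obtain c where c: "c \<noteq> 0" "((\<lambda>u. F u / u ^ m) \<longlongrightarrow> c) (at 0)" by blast
    have "((\<lambda>u. F u / u ^ m / \<rho> u / (t u / u) ^ m) \<longlongrightarrow> c / r / t' ^ m) (at 0)"
      by (intro tendsto_divide tendsto_power c tu r) (use t(3) in auto)
    moreover have "\<forall>\<^sub>F u in at 0. F u / u ^ m / \<rho> u / (t u / u) ^ m = A (t u) / t u ^ m"
      using eq u0 rn by eventually_elim (simp add: power_divide)
    ultimately have "((\<lambda>u. A (t u) / t u ^ m) \<longlongrightarrow> c / r / t' ^ m) (at 0)" by (rule Lim_transform_eventually)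
    from zero_of_order_if_tendsto[OF A at_neq_bot t0 tn this] show "zero_of_order A m"
      using c(1) r(2) t(3) by simp
  next
    assume "zero_of_order A m"
    from zero_of_order_tendsto[OF this t0 tn]
    obtain c where c: "c \<noteq> 0" "((\<lambda>u. A (t u) / t u ^ m) \<longlongrightarrow> c) (at 0)" by blast
    have "((\<lambda>u. A (t u) / t u ^ m * \<rho> u * (t u / u) ^ m) \<longlongrightarrow> c * r * t' ^ m) (at 0)"
      by (intro tendsto_mult tendsto_power c tu r)
    moreover have "\<forall>\<^sub>F u in at 0. A (t u) / t u ^ m * \<rho> u * (t u / u) ^ m = F u / u ^ m"
      using eq u0 tn by eventually_elim (simp add: power_divide)
    ultimately have "((\<lambda>u. F u / u ^ m) \<longlongrightarrow> c * r * t' ^ m) (at 0)" by (rule Lim_transform_eventually)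
    from zero_of_order_if_tendsto[OF F at_neq_bot tendsto_ident_at u0 this] show "zero_of_order F m"
      using c(1) r(2) t(3) by simp
  qed
qed

subsection \<open>The real part along the imaginary axis\<close>

text \<open>For real \<open>z\<close> this is the real part of \<open>F (\<i> * z)\<close>; the
  reflected second summand makes it holomorphic.\<close>

definition re_axis :: "(complex \<Rightarrow> complex) \<Rightarrow> complex \<Rightarrow> complex" where
  "re_axis F z = (F (\<i> * z) + cnj (F (\<i> * cnj z))) / 2"

lemma cnj_ball: "cnj z \<in> ball 0 r \<longleftrightarrow> z \<in> ball 0 r"
  by simp

lemma deriv_iterate_cnj:
  assumes "F holomorphic_on ball 0 r" "z \<in> ball 0 r"
  shows "(deriv ^^ n) (\<lambda>w. cnj (F (cnj w))) z = cnj ((deriv ^^ n) F (cnj z))"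
  using assms(2)
proof (induction n arbitrary: z)
  case (Suc n)
  have "(deriv ^^ n) F field_differentiable at (cnj z)"
    using holomorphic_higher_deriv[OF assms(1) open_ball, of n] Suc.prems
    by (metis cnj_ball holomorphic_on_imp_differentiable_at open_ball)
  then have "((deriv ^^ n) F has_field_derivative (deriv ^^ Suc n) F (cnj z)) (at (cnj z))"
    by (simp add: field_differentiable_derivI)
  from has_field_derivative_cnj_cnj[OF this]
  have d: "((\<lambda>w. cnj ((deriv ^^ n) F (cnj w))) has_field_derivative cnj ((deriv ^^ Suc n) F (cnj z))) (at z)"
    by (simp add: o_def)
  have "((deriv ^^ n) (\<lambda>w. cnj (F (cnj w))) has_field_derivative cnj ((deriv ^^ Suc n) F (cnj z))) (at z)"
    by (rule has_field_derivative_transform_within_open[OF d open_ball Suc.prems]) (use Suc.IH in simp)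
  then show ?case by (simp add: DERIV_imp_deriv)
qed simp

text \<open>Each derivative of \<open>F (\<i> * z)\<close> brings out a factor \<open>\<i>\<close>,
  and reflection conjugates the derivatives at 0. This is the source of the powers of
  \<open>\<i>\<close> in the criterion.\<close>

lemma re_axis_analytic:
  assumes "F holomorphic_on ball 0 r" "r > 0"
  shows "re_axis F holomorphic_on ball 0 r" "(deriv ^^ j) (re_axis F) 0 = of_real (Re (\<i> ^ j * (deriv ^^ j) F 0))"
proof -
  have "(*) \<i> ` ball 0 r \<subseteq> ball 0 r" by (auto simp: norm_mult)
  moreover have "(*) \<i> holomorphic_on ball 0 r" by (intro holomorphic_intros)
  ultimately have h1: "(\<lambda>z. F (\<i> * z)) holomorphic_on ball 0 r"
    using holomorphic_on_compose_gen[of "\<lambda>z. \<i> * z" "ball 0 r" F "ball 0 r"] assms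
    by (simp add: o_def)
  have h2: "(\<lambda>z. cnj ((\<lambda>w. F (\<i> * w)) (cnj z))) holomorphic_on ball 0 r"
  proof -
    have "cnj ` ball 0 r = ball 0 r" by (auto intro!: image_eqI[of _ cnj "cnj _"])
    then show ?thesis
      using holomorphic_on_compose_cnj_cnj[of "\<lambda>w. F (\<i> * w)" "ball 0 r"] h1 by (simp add: o_def)
  qed
  have ra: "re_axis F = (\<lambda>z. 1 / 2 * (F (\<i> * z) + cnj ((\<lambda>w. F (\<i> * w)) (cnj z))))"
    by (simp add: re_axis_def fun_eq_iff)
  have h12: "(\<lambda>z. F (\<i> * z) + cnj ((\<lambda>w. F (\<i> * w)) (cnj z))) holomorphic_on ball 0 r"
    by (intro holomorphic_on_add h1 h2)
  show "re_axis F holomorphic_on ball 0 r"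
    unfolding ra by (intro holomorphic_on_mult h12) simp
  have z: "0 \<in> ball (0 :: complex) r" using assms(2) by simp
  have d1: "(deriv ^^ j) (\<lambda>z. F (\<i> * z)) 0 = \<i> ^ j * (deriv ^^ j) F 0"
    using higher_deriv_compose_linear[OF assms(1) open_ball open_ball z, of \<i> j] by (simp add: norm_mult)
  have "(deriv ^^ j) (re_axis F) 0 = 1 / 2 * ((deriv ^^ j) (\<lambda>z. F (\<i> * z)) 0 + (deriv ^^ j) (\<lambda>z. cnj ((\<lambda>w. F (\<i> * w)) (cnj z))) 0)"
    unfolding ra
    by (simp only: higher_deriv_cmult[OF h12 z open_ball] higher_deriv_add[OF h1 h2 open_ball z])
  also have "(deriv ^^ j) (\<lambda>z. cnj ((\<lambda>w. F (\<i> * w)) (cnj z))) 0 = cnj (\<i> ^ j * (deriv ^^ j) F 0)"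
    using deriv_iterate_cnj[OF h1 z, of j] d1 by (simp only: complex_cnj_zero)
  also have "1 / 2 * ((deriv ^^ j) (\<lambda>z. F (\<i> * z)) 0 + cnj (\<i> ^ j * (deriv ^^ j) F 0)) = of_real (Re (\<i> ^ j * (deriv ^^ j) F 0))"
    unfolding d1 complex_add_cnj by simp
  finally show "(deriv ^^ j) (re_axis F) 0 = of_real (Re (\<i> ^ j * (deriv ^^ j) F 0))" .
qed

lemma rhol_axis:
  assumes "rhol F"
  shows "(\<lambda>u. F (u, 0)) analytic_on {0}" "((\<lambda>u. F (u, 0)) has_field_derivative pd1 F 0) (at 0)"
proof -
  have "\<forall>\<^sub>F u in nhds 0. (\<lambda>u. F (u, 0)) field_differentiable (at u)"
    using eventually_axis[OF rhol_has_pderivs[OF assms]]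
    unfolding field_differentiable_def by eventually_elim (rule exI, erule has_pderivs_fst_line)
  then show "(\<lambda>u. F (u, 0)) analytic_on {0}"
    unfolding eventually_nhds analytic_at
    by (auto simp: holomorphic_on_def intro: field_differentiable_at_within)
  show "((\<lambda>u. F (u, 0)) has_field_derivative pd1 F 0) (at 0)"
    using has_pderivs_fst_line[of F "pd1 F 0" "pd2 F 0" 0 0] rhol_has_pderivs_0[OF assms] by (simp add: zero_prod_def)
qed

lemma isCont_tendsto_nhds: "isCont f a \<Longrightarrow> (f \<longlongrightarrow> f a) (nhds a)"
  by (simp add: isCont_def tendsto_at_iff_tendsto_nhds)

lemma filterlim_hp_hm:
  "filterlim (\<lambda>x :: complex \<times> complex. fst x + \<i> * snd x) (nhds 0) (nhds 0)"
  "filterlim (\<lambda>x :: complex \<times> complex. cnj (fst x - \<i> * snd x)) (nhds 0) (nhds 0)"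
proof -
  have c: "isCont (\<lambda>x :: complex \<times> complex. fst x + \<i> * snd x) 0" "isCont (\<lambda>x :: complex \<times> complex. cnj (fst x - \<i> * snd x)) 0"
    by (intro continuous_intros)+
  then show "filterlim (\<lambda>x :: complex \<times> complex. fst x + \<i> * snd x) (nhds 0) (nhds 0)"
    "filterlim (\<lambda>x :: complex \<times> complex. cnj (fst x - \<i> * snd x)) (nhds 0) (nhds 0)"
    using isCont_tendsto_nhds[OF c(1)] isCont_tendsto_nhds[OF c(2)] by simp_all
qed

section \<open>The logarithm of \<open>g\<close> as a coordinate\<close>

context frame
begin

definition "Lg z = Ln (g z / g 0)"

lemma g0: "g 0 \<noteq> 0" using init(5) by auto

lemma g0_cnj: "g 0 * cnj (g 0) = 1"
  using init(5) complex_norm_square[of "g 0"] by simp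

lemma eventually_g_ratio: "\<forall>\<^sub>F z in nhds 0. g z / g 0 \<notin> \<real>\<^sub>\<le>\<^sub>0"
proof -
  have "isCont g 0" using DERIV_isCont[OF Dg] R by simp
  then have "isCont (\<lambda>z. g z / g 0) 0" by (intro continuous_intros g0)
  then have t: "((\<lambda>z. g z / g 0) \<longlongrightarrow> 1) (nhds 0)"
    using isCont_tendsto_nhds g0 by fastforce
  have "\<forall>\<^sub>F w in nhds (1 :: complex). w \<in> - \<real>\<^sub>\<le>\<^sub>0"
    by (intro eventually_nhds_in_open) (auto simp: open_Compl)
  from eventually_compose_filterlim[OF this t] show ?thesis by simp
qed

lemma Lg_0: "Lg 0 = 0"
  using g0 by (simp add: Lg_def)

lemma Lg_deriv: "\<forall>\<^sub>F z in nhds 0. (Lg has_field_derivative \<phi> z) (at z)"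
proof -
  have "\<forall>\<^sub>F z in nhds 0. z \<in> ball 0 R" using R by (intro eventually_nhds_in_open) auto
  with eventually_g_ratio show ?thesis
  proof eventually_elim
    case (elim z)
    from elim(1) have gz: "g z \<noteq> 0" by auto
    have "((\<lambda>z. g z / g 0) has_field_derivative \<phi> z * g z / g 0) (at z)"
      by (rule DERIV_cdivide[OF Dg[OF elim(2)]])
    from DERIV_chain2[OF has_field_derivative_Ln[OF elim(1)] this]
    show ?case using gz g0 by (simp add: Lg_def[abs_def])
  qed
qed

lemma Lg_tendsto: "(Lg \<longlongrightarrow> 0) (nhds 0)"
  using isCont_tendsto_nhds[OF DERIV_isCont[OF eventually_nhds_x_imp_x[OF Lg_deriv]]] Lg_0 by simp

end

text \<open>\<open>\<Phi>\<close> is \<open>\<phi>\<close> as a function of \<open>log g\<close>. In this coordinate \<open>V\<close> is differentiation, and the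
  singular curve is a segment of the imaginary axis.\<close>

locale frame_log = frame +
  fixes \<Phi> r
  assumes r: "r > 0" and hol_Phi: "\<Phi> holomorphic_on ball 0 r"
    and phi_Phi: "\<forall>\<^sub>F z in nhds 0. \<phi> z = \<Phi> (Ln (g z / g 0))"
begin

text \<open>Let \<open>w\<close> and \<open>w'\<close> be the arguments of the holomorphic and of
  the conjugated factor. On \<open>mu = 0\<close> one has \<open>g w * cnj (g w') = 1\<close>, so
  the two logarithms are reflections of each other in the imaginary axis; this is the pairing built
  into \<open>re_axis\<close>.\<close>

lemma aa_singular:
  "\<forall>\<^sub>F x in nhds 0. mu x = 0 \<longrightarrow> aa x = re_axis \<Phi> (- \<i> * Lg (fst x + \<i> * snd x))"
proof -
  have ev: "\<forall>\<^sub>F z in nhds 0. \<phi> z = \<Phi> (Lg z) \<and> g z / g 0 \<notin> \<real>\<^sub>\<le>\<^sub>0"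
    using phi_Phi eventually_g_ratio unfolding Lg_def by (rule eventually_conj)
  from eventually_compose_filterlim[OF ev filterlim_hp_hm(1)] eventually_compose_filterlim[OF ev filterlim_hp_hm(2)]
  show ?thesis
  proof eventually_elim
    case (elim x)
    define w w' where "w = fst x + \<i> * snd x" and "w' = cnj (fst x - \<i> * snd x)"
    note e = elim[folded w_def w'_def]
    show ?case unfolding w_def[symmetric]
    proof
      assume "mu x = 0"
      then have "g w * cnj (g w') = 1" by (simp add: mu_def hp_def hm_def w_def w'_def)
      then have "g w / g 0 * cnj (g w' / g 0) = 1"
        using g0_cnj g0 by (simp add: field_simps)
      then have "cnj (g w' / g 0) = inverse (g w / g 0)"
        by (metis inverse_unique)
      then have "cnj (Lg w') = - Lg w"
        unfolding Lg_def using cnj_Ln[of "g w' / g 0"] Ln_inverse[of "g w / g 0"] e by simp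
      then have L: "Lg w' = - cnj (Lg w)" by (metis complex_cnj_cnj complex_cnj_minus)
      have "aa x = (\<phi> w + cnj (\<phi> w')) / 2" by (simp add: aa_def hp_def hm_def w_def w'_def)
      then show "aa x = re_axis \<Phi> (- \<i> * Lg w)" using e L by (simp add: re_axis_def)
    qed
  qed
qed

lemma deriv_phi: "\<forall>\<^sub>F z in nhds 0. deriv \<phi> z = deriv \<Phi> (Lg z) * \<phi> z"
  and deriv2_phi: "deriv (deriv \<phi>) 0 = deriv (deriv \<Phi>) 0 * \<phi> 0 * \<phi> 0 + deriv \<Phi> 0 * deriv \<phi> 0"
proof -
  have "\<forall>\<^sub>F w in nhds 0. w \<in> ball 0 r" using r by (intro eventually_nhds_in_open) auto
  from eventually_compose_filterlim[OF this Lg_tendsto] have b: "\<forall>\<^sub>F z in nhds 0. Lg z \<in> ball 0 r" .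
  have c: "((\<lambda>z. \<Psi> (Lg z)) has_field_derivative deriv \<Psi> (Lg z) * \<phi> z) (at z)"
    if "\<Psi> holomorphic_on ball 0 r" "Lg z \<in> ball 0 r" "(Lg has_field_derivative \<phi> z) (at z)" for \<Psi> z
    by (rule DERIV_chain2[OF holomorphic_derivI[OF that(1) open_ball that(2)] that(3)])
  show 1: "\<forall>\<^sub>F z in nhds 0. deriv \<phi> z = deriv \<Phi> (Lg z) * \<phi> z"
    using eventually_eventually[THEN iffD2, OF phi_Phi] b Lg_deriv
  proof eventually_elim
    case (elim z)
    have "deriv \<phi> z = deriv (\<lambda>z. \<Phi> (Lg z)) z"
      by (rule deriv_cong_ev[OF _ refl]) (use elim(1) in \<open>simp add: Lg_def\<close>)
    also have "\<dots> = deriv \<Phi> (Lg z) * \<phi> z" by (rule DERIV_imp_deriv[OF c[OF hol_Phi elim(2,3)]])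
    finally show ?case .
  qed
  have "deriv (deriv \<phi>) 0 = deriv (\<lambda>z. deriv \<Phi> (Lg z) * \<phi> z) 0"
    by (rule deriv_cong_ev[OF 1 refl])
  also have "\<dots> = deriv \<Phi> (Lg 0) * deriv \<phi> 0 + deriv (deriv \<Phi>) (Lg 0) * \<phi> 0 * \<phi> 0"
    by (rule DERIV_imp_deriv[OF DERIV_mult'[OF c[OF holomorphic_deriv[OF hol_Phi open_ball]] holomorphic_derivI[OF hol_phi open_ball]]])
      (use eventually_nhds_x_imp_x[OF Lg_deriv] Lg_0 r R in auto)
  finally show "deriv (deriv \<phi>) 0 = deriv (deriv \<Phi>) 0 * \<phi> 0 * \<phi> 0 + deriv \<Phi> 0 * deriv \<phi> 0"
    by (simp add: Lg_0)
qed

lemma phi_0: "\<phi> 0 = \<Phi> 0"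
  using eventually_nhds_x_imp_x[OF phi_Phi] g0 by simp

text \<open>At the base point \<open>\<phi>\<close> is imaginary and the derivative of
  \<open>\<Phi>\<close> is real. Hence \<open>\<phi>' = \<Phi>' * \<phi>\<close> is imaginary, and
  in \<open>\<phi>'' = \<Phi>'' * \<phi>^2 + \<Phi>' * \<phi>'\<close> only the first term has a
  real part. A second derivative in the imaginary direction adds a sign, cancelling that of
  \<open>\<phi>^2\<close>.\<close>

lemma jets:
  assumes "Re (\<phi> 0) = 0" "Re (\<i> * deriv \<Phi> 0) = 0"
  shows "aa 0 = 0" "pd2 bb 0 = 0" "pd2 (pd2 aa) 0 = of_real ((Im (\<phi> 0))\<^sup>2 * Re (deriv (deriv \<Phi>) 0))"
proof -
  have p: "has_pderivs (\<lambda>x. k * (hp \<psi> x + l * hm \<psi> x)) (k * (hp (deriv \<psi>) x + l * hm (deriv \<psi>) x))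
     (k * \<i> * (hp (deriv \<psi>) x + - l * hm (deriv \<psi>) x)) x" if "x \<in> good" "\<psi> holomorphic_on ball 0 R" for x k l \<psi>
    using has_pderivs_mult[OF has_pderivs_const has_pderivs_add[OF pderivs_phi(1)[OF that]
         has_pderivs_mult[OF has_pderivs_const pderivs_phi(2)[OF that]]], of k l] by (simp add: algebra_simps)
  have p1: "deriv \<phi> 0 = deriv \<Phi> 0 * \<phi> 0" using eventually_nhds_x_imp_x[OF deriv_phi] by (simp add: Lg_0)
  have at0: "hp \<psi> 0 = \<psi> 0" "hm \<psi> 0 = cnj (\<psi> 0)" for \<psi> by (simp_all add: hp_def hm_def)
  show "aa 0 = 0" using assms(1) by (simp add: ab_0)
  have bb: "bb = (\<lambda>x. 1 / (2 * \<i>) * (hp \<phi> x + - 1 * hm \<phi> x))" by (simp add: bb_def fun_eq_iff)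
  have "pd2 bb 0 = 1 / (2 * \<i>) * \<i> * (hp (deriv \<phi>) 0 + - (- 1) * hm (deriv \<phi>) 0)"
    unfolding bb by (rule has_pderivs_pd(2)[OF p[OF good_0 hol_phi]])
  also have "\<dots> = of_real (Re (deriv \<phi> 0))" by (simp add: at0 complex_add_cnj)
  also have "Re (deriv \<phi> 0) = 0" using assms by (simp add: p1)
  finally show "pd2 bb 0 = 0" by simp
  have aa: "aa = (\<lambda>x. 1 / 2 * (hp \<phi> x + 1 * hm \<phi> x))" by (simp add: aa_def fun_eq_iff)
  have a2: "pd2 aa x = 1 / 2 * \<i> * (hp (deriv \<phi>) x + - 1 * hm (deriv \<phi>) x)" if "x \<in> good" for x
    unfolding aa by (rule has_pderivs_pd(2)[OF p[OF that hol_phi]])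
  have "pd2 (pd2 aa) 0 = 1 / 2 * \<i> * \<i> * (hp (deriv (deriv \<phi>)) 0 + - (- 1) * hm (deriv (deriv \<phi>)) 0)"
    by (rule has_pderivs_pd(2), rule has_pderivs_cong[OF p[OF good_0 holomorphic_deriv[OF hol_phi open_ball]] open_good good_0])
      (simp add: a2)
  also have "\<dots> = of_real (- Re (deriv (deriv \<phi>) 0))" by (simp add: at0 complex_add_cnj)
  also have "- Re (deriv (deriv \<phi>) 0) = (Im (\<phi> 0))\<^sup>2 * Re (deriv (deriv \<Phi>) 0)"
    using assms by (simp add: deriv2_phi p1 power2_eq_square)
  finally show "pd2 (pd2 aa) 0 = of_real ((Im (\<phi> 0))\<^sup>2 * Re (deriv (deriv \<Phi>) 0))" .
qed

end

section \<open>The criterion in terms of the derivatives of \<open>\<Phi>\<close>\<close>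

locale regular_frame_log = frame_log + regular_frame_normal
begin

lemma pd2_v: "pd2 v 0 \<noteq> 0"
proof -
  have "pd2 v 0 = pd2 mu 0 * s 0"
    unfolding v_def
    using has_pderivs_pd(2)[OF has_pderivs_mult[OF rhol_has_pderivs_0[OF rh(4)] rhol_has_pderivs_0[OF rn(2)]]] at0(4) by simp
  then show ?thesis using s0 nondeg(2) by simp
qed

text \<open>The singular curve is parametrized by \<open>u\<close> through the inverse coordinates
  \<open>(G1, G2)\<close>. On it \<open>d (u, 0)\<close> is \<open>re_axis \<Phi>\<close> at the
  logarithmic parameter \<open>t u\<close>, times a factor with nonzero limit, so the orders
  coincide.\<close>

lemma d_order: "zero_of_order (\<lambda>u. d (u, 0)) m \<longleftrightarrow> zero_of_order (re_axis \<Phi>) m"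
proof -
  define X where "X u = (G1 (u, 0), G2 (u, 0))" for u
  define t where "t u = - \<i> * Lg (G1 (u, 0) + \<i> * G2 (u, 0))" for u
  define \<rho> where "\<rho> u = 4 / 3 * (cf (X u) * den (X u) - num (X u) * cg (X u)) / (pd2 v (X u) * (den (X u))\<^sup>2)" for u
  have Xt: "((\<lambda>u. X u) \<longlongrightarrow> 0) (nhds 0)"
    unfolding X_def using filterlim_compose[OF rhol_tendsto_Pair[OF rn(6,7) G0] filterlim_axis] .
  have U1: "pd1 U 0 = 2" "pd2 U 0 = 0" using pd_frame[OF good_0] by (simp_all add: weights_0 mu_0)
  have Y1: "pd1 (Xw w) 0 = 2 * Pw w 0" for w using pd_frame[OF good_0] by (simp add: mu_0)
  have eps0: "\<epsilon> \<noteq> 0" using eps2 by auto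
  have z: "num 0 = 0" "den 0 = 2 * of_real \<epsilon>" "cf 0 = 1"
    by (simp_all add: num_def den_def cf_def U1 Y1 weights_0)
  then have den0: "den 0 \<noteq> 0" using eps0 by simp
  have rc: "rhol cf" "rhol cg"
    unfolding cf_def[abs_def] cg_def[abs_def] by (intro rhol_diff rhol_mult rhol_frame herm_weights)+
  have pt: "((\<lambda>u. f (X u)) \<longlongrightarrow> f 0) (at 0)" if "rhol f" for f
    using filterlim_mono[OF filterlim_compose[OF rhol_tendsto[OF that] Xt] order_refl at_within_le_nhds] .
  have r0: "(\<rho> \<longlongrightarrow> 4 / 3 * (cf 0 * den 0 - num 0 * cg 0) / (pd2 v 0 * (den 0)\<^sup>2)) (at 0)"
    unfolding \<rho>_def by (intro tendsto_intros pt rc rhol_num rhol_pd rn) (use pd2_v z eps0 in simp)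
  have ev: "\<forall>\<^sub>F u in nhds 0. d (u, 0) = re_axis \<Phi> (t u) * \<rho> u"
    using eventually_compose_filterlim[OF d_singular Xt] eventually_compose_filterlim[OF aa_singular Xt]
      eventually_axis[OF inv(1)] eventually_compose_filterlim[OF rhol_eventually_ne[OF rn(2) s0(1)] Xt]
      eventually_compose_filterlim[OF rhol_eventually_ne[OF rhol_num(2) den0] Xt]
      eventually_compose_filterlim[OF rhol_eventually_ne[OF rhol_pd(2)[OF rn(1)] pd2_v] Xt]
  proof eventually_elim
    case (elim u)
    have Uu: "U (X u) = u" "v (X u) = 0" using elim(3) by (simp_all add: X_def)
    then have m: "mu (X u) = 0" using elim(4) v_def by simp
    have aX: "aa (X u) = re_axis \<Phi> (t u)" using elim(2) m by (simp add: X_def t_def)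
    have dn: "den (X u) \<noteq> 0" using elim(5) eps0 by simp
    have "3 / 2 * pd2 v (X u) * d (u, 0) * (den (X u))\<^sup>2 = 2 * aa (X u) * (cf (X u) * den (X u) - num (X u) * cg (X u))"
      using elim(1) m Uu by simp
    then have "d (u, 0) = aa (X u) * \<rho> u"
      using dn elim(6) by (simp add: \<rho>_def field_simps)
    then show ?case by (simp add: aX)
  qed
  have inj: "pd1 G1 0 = 1 / 2"
  proof -
    have "\<forall>\<^sub>F y in nhds 0. U (G1 y, G2 y) = fst y" using inv(1) by eventually_elim simp
    from eventually_nhds_x_imp_x[OF eventually_has_pderivs_cong[OF rhol_chain[OF rh(1) rn(6,7) G0] this]]
    have "has_pderivs fst (pd1 U (G1 0, G2 0) * pd1 G1 0 + pd2 U (G1 0, G2 0) * pd1 G2 0)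
       (pd1 U (G1 0, G2 0) * pd2 G1 0 + pd2 U (G1 0, G2 0) * pd2 G2 0) 0" .
    from has_pderivs_unique[OF this has_pderivs_fst] G0 U1
    show ?thesis by (simp add: zero_prod_def[symmetric] mult.commute)
  qed
  \<comment> \<open>The derivative of \<open>G1 + \<i> * G2\<close> cannot vanish:
    \<open>pd1 G1 0 = 1 / 2\<close>, and \<open>pd1 G2 0\<close> is real.\<close>
  have real: "cnj (pd1 G2 0) = pd1 G2 0" by (rule rhol_real[OF rhol_pd(1)[OF rn(7)]])
  then have "Im (pd1 G2 0) = 0" by (simp add: complex_eq_iff)
  then have ne: "pd1 G1 0 + \<i> * pd1 G2 0 \<noteq> 0" unfolding inj by (simp add: complex_eq_iff)
  have G00: "G1 (0, 0) = 0" "G2 (0, 0) = 0" using G0 by (simp_all add: zero_prod_def)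
  have dG: "((\<lambda>u. G1 (u, 0) + \<i> * G2 (u, 0)) has_field_derivative pd1 G1 0 + \<i> * pd1 G2 0) (at 0)"
    by (intro DERIV_add DERIV_cmult rhol_axis(2) rn)
  have dL: "(Lg has_field_derivative \<phi> 0) (at (G1 (0, 0) + \<i> * G2 (0, 0)))"
    using eventually_nhds_x_imp_x[OF Lg_deriv] by (simp add: G00)
  have dt: "(t has_field_derivative - \<i> * (\<phi> 0 * (pd1 G1 0 + \<i> * pd1 G2 0))) (at 0)"
    unfolding t_def[abs_def] by (rule DERIV_cmult[OF DERIV_chain2[OF dL dG]])
  have phi0: "\<phi> 0 \<noteq> 0" using b by auto
  have t0: "t 0 = 0" by (simp add: t_def G00 Lg_0)
  have an: "re_axis \<Phi> analytic_on {0}"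
    using re_axis_analytic(1)[OF hol_Phi r] r unfolding analytic_at by (intro exI[of _ "ball 0 r"]) auto
  have tn: "- \<i> * (\<phi> 0 * (pd1 G1 0 + \<i> * pd1 G2 0)) \<noteq> 0" using ne phi0 by simp
  have rn0: "4 / 3 * (cf 0 * den 0 - num 0 * cg 0) / (pd2 v 0 * (den 0)\<^sup>2) \<noteq> 0"
    using pd2_v eps0 unfolding z by simp
  have ev': "\<forall>\<^sub>F u in at 0. d (u, 0) = re_axis \<Phi> (t u) * \<rho> u"
    by (rule filter_leD[OF at_within_le_nhds ev])
  show ?thesis
    by (rule zero_of_order_change[OF rhol_axis(1)[OF rn(5)] an dt t0 tn r0 rn0 ev'])
qed

lemma pd2_d:
  assumes "k \<ge> 1" "zero_of_order (\<lambda>u. d (u, 0)) (k + 1)" "\<forall>j\<le>k. Re (\<i> ^ j * (deriv ^^ j) \<Phi> 0) = 0"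
  shows "pd2 d 0 \<noteq> 0 \<longleftrightarrow> Re ((deriv ^^ 2) \<Phi> 0) \<noteq> 12"
proof -
  have z: "\<forall>j<k + 1. (deriv ^^ j) (\<lambda>u. d (u, 0)) 0 = 0"
    using zero_of_order_iff_deriv[OF rhol_axis(1)[OF rn(5)], of "k + 1"] assms(2) by blast
  have "(deriv ^^ 0) (\<lambda>u. d (u, 0)) 0 = 0" by (rule z[rule_format]) simp
  then have d1: "d 0 = 0" by (simp add: zero_prod_def)
  have "(deriv ^^ 1) (\<lambda>u. d (u, 0)) 0 = 0" by (rule z[rule_format]) (use assms(1) in simp)
  then have d2: "pd1 d 0 = 0"
    using DERIV_imp_deriv[OF rhol_axis(2)[OF rn(5)]] by simp
  have "Re (\<phi> 0) = 0" "Re (\<i> * deriv \<Phi> 0) = 0"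
    using assms(3)[rule_format, of 0] assms(3)[rule_format, of 1] assms(1) by (simp_all add: phi_0)
  note j = jets[OF this]
  \<comment> \<open>Both terms of the jet identity carry the factor \<open>b^2\<close>, which leaves
    the second derivative of \<open>\<Phi>\<close> compared with 12.\<close>
  have eq: "15 * (pd2 v 0) ^ 3 * pd2 d 0 = of_real (\<epsilon> * b\<^sup>2 * (Re (deriv (deriv \<Phi>) 0) - 12))"
    using jet_identity[OF j(1,2) d1 d2] unfolding j(3) b(1)[symmetric] by (simp add: algebra_simps)
  have e: "\<epsilon> \<noteq> 0" using eps2 by auto
  have "pd2 d 0 = 0 \<longleftrightarrow> 15 * (pd2 v 0) ^ 3 * pd2 d 0 = 0" using pd2_v by simp
  also have "\<dots> \<longleftrightarrow> \<epsilon> * b\<^sup>2 * (Re (deriv (deriv \<Phi>) 0) - 12) = 0" unfolding eq of_real_eq_0_iff ..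
  also have "\<dots> \<longleftrightarrow> Re ((deriv ^^ 2) \<Phi> 0) = 12" using e b(2) by (simp add: numeral_2_eq_2)
  finally show ?thesis by simp
qed

lemma tri_tendsto: "(tri U (Xw (wY \<epsilon>)) (Xw wZ) \<longlongrightarrow> 0) (nhds 0)"
proof -
  have "smooth_at (tri U (Xw (wY \<epsilon>)) (Xw wZ)) 0"
    unfolding tri_def[abs_def] by (intro smooth_at_Pair smooth_at_rr rh)
  from smooth_at_tendsto[OF this] show ?thesis
    using at0 by (simp add: tri_def rr_def flip: zero_prod_def)
qed

text \<open>The map is replaced by \<open>Md d\<close> in both directions. The smooth invariants
  give the order of \<open>d (u, 0)\<close> and the nonvanishing of \<open>pd2 d 0\<close>;
  conversely these two facts are the hypotheses of the reduction to the model.\<close>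

lemma cuspidal_iff:
  assumes k: "k \<ge> 1"
  shows "(\<exists>s\<in>{1, -1}. germ_equiv (tri U (Xw (wY \<epsilon>)) (Xw wZ)) (cuspS_model k s)) \<longleftrightarrow>
    (\<forall>j\<le>k. Re (\<i> ^ j * (deriv ^^ j) \<Phi> 0) = 0) \<and> Re (\<i> ^ (k + 1) * (deriv ^^ (k + 1)) \<Phi> 0) \<noteq> 0 \<and>
    Re ((deriv ^^ 2) \<Phi> 0) \<noteq> 12" (is "?L \<longleftrightarrow> ?C1 \<and> ?C2 \<and> ?C3")
proof -
  have an: "re_axis \<Phi> analytic_on {0}"
    using re_axis_analytic(1)[OF hol_Phi r] r unfolding analytic_at by (intro exI[of _ "ball 0 r"]) auto
  have D: "(deriv ^^ j) (re_axis \<Phi>) 0 = of_real (Re (\<i> ^ j * (deriv ^^ j) \<Phi> 0))" for j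
    by (rule re_axis_analytic(2)[OF hol_Phi r])
  have ord: "zero_of_order (\<lambda>u. d (u, 0)) (k + 1) \<longleftrightarrow> ?C1 \<and> ?C2"
    unfolding d_order zero_of_order_iff_deriv[OF an] D of_real_eq_0_iff using less_Suc_eq_le by simp
  show ?thesis
  proof
    assume ?L
    then obtain s' where s': "s' \<in> {1, -1}" "germ_equiv (tri U (Xw (wY \<epsilon>)) (Xw wZ)) (cuspS_model k s')" by blast
    have "germ_equiv (Md d) (cuspS_model k s')"
      by (rule germ_equiv_trans[OF germ_equiv_sym[OF germ_equiv_Md tri_tendsto] s'(2)])
    note S = Md_equiv_cuspSD[OF rn(5) this]
    have s0': "s' \<noteq> 0" using s'(1) by auto
    obtain x :: "real \<Rightarrow> real" and c where x: "c \<noteq> 0" "(x \<longlongrightarrow> 0) (at 0)" "\<forall>\<^sub>F t in at 0. x t \<noteq> 0"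
      "((\<lambda>t. rr d (x t, 0) / (x t) ^ (k + 1)) \<longlongrightarrow> c) (at 0)"
      using S(1)[OF s0'] by blast
    have "((\<lambda>t. (x t, 0)) \<longlongrightarrow> (0 :: r2)) (at 0)"
      using tendsto_Pair[OF x(2) tendsto_const[of "0 :: real"]] by (simp add: zero_prod_def)
    from eventually_compose_filterlim[OF rr_of_real[OF rn(5)] this]
    have e: "\<forall>\<^sub>F t in at 0. of_real (rr d (x t, 0) / (x t) ^ (k + 1)) = d (of_real (x t), 0) / of_real (x t) ^ (k + 1)"
      by eventually_elim (simp add: cx_def)
    have l: "((\<lambda>t. d (of_real (x t), 0) / of_real (x t) ^ (k + 1)) \<longlongrightarrow> complex_of_real c) (at 0)"
      by (rule Lim_transform_eventually[OF tendsto_of_real[OF x(4)] e])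
    have x0: "((\<lambda>t. complex_of_real (x t)) \<longlongrightarrow> 0) (at 0)" using tendsto_of_real[OF x(2)] by simp
    have xn: "\<forall>\<^sub>F t in at 0. complex_of_real (x t) \<noteq> 0" using x(3) by eventually_elim simp
    have o: "zero_of_order (\<lambda>u. d (u, 0)) (k + 1)"
      by (rule zero_of_order_if_tendsto[OF rhol_axis(1)[OF rn(5)] at_neq_bot x0 xn l]) (use x(1) in simp)
    then have C: "?C1" "?C2" unfolding ord by blast+
    have "?C3" by (rule iffD1[OF pd2_d[OF k o C(1)] S(2)[OF s0' k]])
    then show "?C1 \<and> ?C2 \<and> ?C3" by (intro conjI C)
  next
    assume C: "?C1 \<and> ?C2 \<and> ?C3"
    then have C': "?C1" "?C3" by blast+
    have o: "zero_of_order (\<lambda>u. d (u, 0)) (k + 1)" unfolding ord using C by blast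
    have p: "pd2 d 0 \<noteq> 0" by (rule iffD2[OF pd2_d[OF k o C'(1)] C'(2)])
    obtain h where h: "h analytic_on {0}" "h 0 \<noteq> 0" "\<forall>\<^sub>F u in nhds 0. d (u, 0) = u ^ (k + 1) * h u"
      using o unfolding zero_of_order_def by blast
    obtain s' where "s' \<in> {1, -1}" "germ_equiv (Md d) (cuspS_model k s')"
      using Md_equiv_cuspS[OF rn(5) p h] by (rule bexE)
    from this(1) germ_equiv_trans[OF germ_equiv_Md this(2)] show ?L by (rule bexI[rotated])
  qed
qed

end

subsection \<open>Germs of maps into de Sitter space\<close>

text \<open>The neighbourhoods are cut down to those points whose image again lies in the
  neighbourhood on the other side, so that the image is exactly an open domain of the
  inverse.\<close>

lemma local_inverse_open:
  fixes f :: "'a::euclidean_space \<Rightarrow> 'b::euclidean_space"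
  assumes "smooth_at f a" "smooth_at f' (f a)" "f' (f a) = a"
    and "\<forall>\<^sub>F x in nhds a. f' (f x) = x" "\<forall>\<^sub>F y in nhds (f a). f (f' y) = y" "\<forall>\<^sub>F x in nhds a. P x"
  obtains S T where "open S" "a \<in> S" "open T" "f ` S = T" "smooth_on S f" "smooth_on T f'"
    "\<And>x. x \<in> S \<Longrightarrow> f' (f x) = x" "\<And>y. y \<in> T \<Longrightarrow> f (f' y) = y" "\<And>x. x \<in> S \<Longrightarrow> P x"
proof -
  obtain S1 where S1: "open S1" "a \<in> S1" "smooth_on S1 f" using assms(1) unfolding smooth_at_def by blast
  obtain T1 where T1: "open T1" "f a \<in> T1" "smooth_on T1 f'" using assms(2) unfolding smooth_at_def by blast
  obtain S2 where S2: "open S2" "a \<in> S2" "\<forall>x\<in>S2. f' (f x) = x \<and> P x"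
    using eventually_conj[OF assms(4,6)] unfolding eventually_nhds by blast
  obtain T2 where T2: "open T2" "f a \<in> T2" "\<forall>y\<in>T2. f (f' y) = y"
    using assms(5) unfolding eventually_nhds by blast
  define S T where "S = (S1 \<inter> S2) \<inter> f -` (T1 \<inter> T2)" and "T = (T1 \<inter> T2) \<inter> f' -` (S1 \<inter> S2)"
  have oS: "open S" unfolding S_def
    by (rule continuous_open_preimage) (use S1 S2 T1 T2 smooth_on_imp_continuous_on[OF S1(3)] in
      \<open>auto intro: continuous_on_subset\<close>)
  have oT: "open T" unfolding T_def
    by (rule continuous_open_preimage) (use S1 S2 T1 T2 smooth_on_imp_continuous_on[OF T1(3)] in
      \<open>auto intro: continuous_on_subset\<close>)
  have fS: "f ` S = T"
  proof
    show "f ` S \<subseteq> T" using S2(3) by (auto simp: S_def T_def)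
    show "T \<subseteq> f ` S"
    proof
      fix y assume y: "y \<in> T"
      then have "f (f' y) = y" using T2(3) by (simp add: T_def)
      moreover from this have "f' y \<in> S" using y by (simp add: S_def T_def)
      ultimately show "y \<in> f ` S" by (metis image_eqI)
    qed
  qed
  show ?thesis
  proof (rule that[OF oS _ oT fS])
    show "a \<in> S" using S1 S2 T1 T2 by (simp add: S_def)
    show "smooth_on S f" by (rule smooth_on_subset[OF S1(3)]) (auto simp: S_def)
    show "smooth_on T f'" by (rule smooth_on_subset[OF T1(3)]) (auto simp: T_def)
    show "\<And>x. x \<in> S \<Longrightarrow> f' (f x) = x" "\<And>x. x \<in> S \<Longrightarrow> P x" using S2(3) by (auto simp: S_def)
    show "\<And>y. y \<in> T \<Longrightarrow> f (f' y) = y" using T2(3) by (auto simp: T_def)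
  qed
qed

text \<open>A source chart \<open>\<kappa>\<close> and a chart \<open>\<Psi>\<close> of de Sitter
  space turn equivalence of maps into the hypersurface into equivalence of germs between Euclidean
  spaces. \<open>\<Psi>\<close> is defined on the ambient space; its inverse \<open>\<psi>\<close>
  takes values in the hypersurface.\<close>

locale dS_chart =
  fixes D :: "complex set" and f :: "complex \<Rightarrow> herm2" and p :: complex
    and \<kappa> :: "r2 \<Rightarrow> complex" and \<kappa>' :: "complex \<Rightarrow> r2"
    and A :: "herm2 set" and B :: "r3 set" and \<Psi> :: "herm2 \<Rightarrow> r3" and \<psi> :: "r3 \<Rightarrow> herm2"
  assumes D: "open D" "p \<in> D" and f: "isCont f p" "\<And>z. z \<in> D \<Longrightarrow> f z \<in> deSitter3"
    and \<kappa>: "smooth_at \<kappa> 0" "smooth_at \<kappa>' p" "\<kappa> 0 = p" "\<kappa>' p = 0"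
      "\<forall>\<^sub>F x in nhds 0. \<kappa>' (\<kappa> x) = x" "\<forall>\<^sub>F z in nhds p. \<kappa> (\<kappa>' z) = z"
    and AB: "open A" "open B" "0 \<in> B" "f p \<in> A"
    and chart: "smooth_on UNIV \<Psi>" "smooth_on B \<psi>" "\<Psi> (f p) = 0"
      "\<And>y. y \<in> B \<Longrightarrow> \<psi> y \<in> A \<inter> deSitter3 \<and> \<Psi> (\<psi> y) = y"
      "\<And>X. X \<in> A \<inter> deSitter3 \<Longrightarrow> \<Psi> X \<in> B \<and> \<psi> (\<Psi> X) = X"
begin

lemma f_tendsto: "(f \<longlongrightarrow> f p) (nhds p)"
  using f(1) by (simp add: isCont_def tendsto_at_iff_tendsto_nhds)

lemma fp: "f p \<in> A \<inter> deSitter3" "\<psi> 0 = f p"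
  using AB(4) f(2)[OF D(2)] chart(5)[of "f p"] chart(3) by auto

lemma continuous_\<Psi>: "continuous_on UNIV \<Psi>"
  by (rule smooth_on_imp_continuous_on[OF chart(1)])

lemma A_equiv_if_germ_equiv:
  assumes "germ_equiv (\<lambda>x. \<Psi> (f (\<kappa> x))) G"
  shows "A_equiv_germ_dS D f p G"
proof -
  obtain \<sigma> \<sigma>' \<Theta> \<Theta>' where 1: "inverse_germs \<sigma> \<sigma>'" "inverse_germs \<Theta> \<Theta>'"
    "\<forall>\<^sub>F x in nhds 0. \<Theta> (\<Psi> (f (\<kappa> (\<sigma> x)))) = G x"
    using assms unfolding germ_equiv_def by blast
  note s = 1(1)[unfolded inverse_germs_def] and t = 1(2)[unfolded inverse_germs_def]
  have "\<forall>\<^sub>F y in nhds 0. y \<in> B" using AB by (intro eventually_nhds_in_open)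
  then obtain S T where ST: "open S" "0 \<in> S" "open T" "\<Theta> ` S = T" "smooth_on S \<Theta>" "smooth_on T \<Theta>'"
    "\<And>x. x \<in> S \<Longrightarrow> \<Theta>' (\<Theta> x) = x" "\<And>y. y \<in> T \<Longrightarrow> \<Theta> (\<Theta>' y) = y" "\<And>x. x \<in> S \<Longrightarrow> x \<in> B"
    using local_inverse_open[of \<Theta> 0 \<Theta>' "\<lambda>y. y \<in> B"] t by auto
  \<comment> \<open>An ambient open set whose part in the hypersurface is carried by
    \<open>\<Psi>\<close> onto the domain \<open>S\<close> of the target change.\<close>
  define W where "W = A \<inter> \<Psi> -` S"
  have oW: "open W" unfolding W_def
    using AB(1) continuous_\<Psi> ST(1) by (intro open_Int open_vimage)
  have fW: "f p \<in> W" using fp chart(3) ST(2) by (simp add: W_def)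
  have \<Theta>'S: "\<Theta>' y \<in> S" if "y \<in> T" for y using that ST(4,7) by auto
  have sk: "smooth_at (\<lambda>x. \<kappa> (\<sigma> x)) 0" "smooth_at (\<lambda>z. \<sigma>' (\<kappa>' z)) p"
    by (rule smooth_at_compose[of \<kappa> \<sigma>], use s \<kappa> in simp_all) (rule smooth_at_compose[of \<sigma>' \<kappa>'], use s \<kappa> in simp_all)
  have st: "(\<sigma> \<longlongrightarrow> 0) (nhds 0)" "(\<kappa>' \<longlongrightarrow> 0) (nhds p)" "((\<lambda>x. \<kappa> (\<sigma> x)) \<longlongrightarrow> p) (nhds 0)"
    using smooth_at_tendsto[of \<sigma> 0] smooth_at_tendsto[OF \<kappa>(2)] smooth_at_tendsto[OF sk(1)] s \<kappa> by simp_all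
  have e1: "\<forall>\<^sub>F x in nhds 0. \<sigma>' (\<kappa>' (\<kappa> (\<sigma> x))) = x"
    using eventually_compose_filterlim[OF \<kappa>(5) st(1)] s[THEN conjunct2, THEN conjunct2, THEN conjunct2, THEN conjunct2, THEN conjunct1]
    by eventually_elim simp
  have e2: "\<forall>\<^sub>F z in nhds p. \<kappa> (\<sigma> (\<sigma>' (\<kappa>' z))) = z"
    using eventually_compose_filterlim[OF s[THEN conjunct2, THEN conjunct2, THEN conjunct2, THEN conjunct2, THEN conjunct2] st(2)] \<kappa>(6)
    by eventually_elim simp
  have "\<forall>\<^sub>F z in nhds p. z \<in> D \<and> f z \<in> W"
    using eventually_nhds_in_open[OF D] eventually_compose_filterlim[OF eventually_nhds_in_open[OF oW fW] f_tendsto]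
    by (rule eventually_conj)
  from eventually_conj[OF eventually_compose_filterlim[OF this st(3)] 1(3)]
  have e3: "\<forall>\<^sub>F x in nhds 0. (\<kappa> (\<sigma> x) \<in> D \<and> f (\<kappa> (\<sigma> x)) \<in> W) \<and> \<Theta> (\<Psi> (f (\<kappa> (\<sigma> x)))) = G x" .
  obtain S2 T2 where ST2: "open S2" "0 \<in> S2" "open T2" "(\<lambda>x. \<kappa> (\<sigma> x)) ` S2 = T2" "smooth_on S2 (\<lambda>x. \<kappa> (\<sigma> x))" "smooth_on T2 (\<lambda>z. \<sigma>' (\<kappa>' z))"
    "\<And>x. x \<in> S2 \<Longrightarrow> \<sigma>' (\<kappa>' (\<kappa> (\<sigma> x))) = x" "\<And>z. z \<in> T2 \<Longrightarrow> \<kappa> (\<sigma> (\<sigma>' (\<kappa>' z))) = z"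
    "\<And>x. x \<in> S2 \<Longrightarrow> (\<kappa> (\<sigma> x) \<in> D \<and> f (\<kappa> (\<sigma> x)) \<in> W) \<and> \<Theta> (\<Psi> (f (\<kappa> (\<sigma> x)))) = G x"
    using local_inverse_open[of "\<lambda>x. \<kappa> (\<sigma> x)" 0 "\<lambda>z. \<sigma>' (\<kappa>' z)", OF sk(1) _ _ e1 _ e3] sk(2) s \<kappa> e2 by auto
  have diff: "diffeo_on S2 (\<lambda>x. \<kappa> (\<sigma> x))"
    unfolding diffeo_on_def ST2(4) using ST2 by (intro conjI exI[of _ "\<lambda>z. \<sigma>' (\<kappa>' z)"]) auto
  have sub: "(\<lambda>x. \<kappa> (\<sigma> x)) ` S2 \<subseteq> D" using ST2(9) by auto
  have sm1: "smooth_on W (\<lambda>X. \<Theta> (\<Psi> X))"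
    by (rule smooth_on_compose[OF oW ST(1) _ ST(5) smooth_on_subset[OF chart(1) subset_UNIV]]) (auto simp: W_def)
  have sm2: "smooth_on T (\<lambda>y. \<psi> (\<Theta>' y))"
    by (rule smooth_on_compose[OF ST(3) AB(2) _ chart(2) ST(6)]) (use \<Theta>'S ST(9) in blast)
  have inW: "\<psi> (\<Theta>' y) \<in> W \<inter> deSitter3 \<and> \<Theta> (\<Psi> (\<psi> (\<Theta>' y))) = y" if "y \<in> T" for y
    using chart(4)[OF ST(9)[OF \<Theta>'S[OF that]]] \<Theta>'S[OF that] ST(8)[OF that] by (simp add: W_def)
  have inX: "\<psi> (\<Theta>' (\<Theta> (\<Psi> X))) = X" if "X \<in> W \<inter> deSitter3" for X
    using chart(5)[of X] ST(7)[of "\<Psi> X"] that by (simp add: W_def)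
  have img: "(\<lambda>X. \<Theta> (\<Psi> X)) ` (W \<inter> deSitter3) = T"
  proof
    show "(\<lambda>X. \<Theta> (\<Psi> X)) ` (W \<inter> deSitter3) \<subseteq> T" using ST(4) by (auto simp: W_def)
    show "T \<subseteq> (\<lambda>X. \<Theta> (\<Psi> X)) ` (W \<inter> deSitter3)"
    proof
      fix y assume "y \<in> T"
      note inW[OF this]
      then show "y \<in> (\<lambda>X. \<Theta> (\<Psi> X)) ` (W \<inter> deSitter3)"
        by (intro image_eqI[of _ _ "\<psi> (\<Theta>' y)"]) simp_all
    qed
  qed
  have k0: "\<kappa> (\<sigma> 0) = p" using s \<kappa> by simp
  have P0: "\<Theta> (\<Psi> (f p)) = 0" using chart(3) t by simp
  show ?thesis unfolding A_equiv_germ_dS_def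
    by (rule exI[of _ S2], rule exI[of _ "\<lambda>x. \<kappa> (\<sigma> x)"], rule exI[of _ W], rule exI[of _ "\<lambda>X. \<Theta> (\<Psi> X)"],
        rule exI[of _ T], rule exI[of _ "\<lambda>y. \<psi> (\<Theta>' y)"])
      (intro conjI ballI ST2(2) diff k0 sub oW fW sm1 P0 ST(3) sm2 img inX; use inW ST2(9) in blast)
qed

text \<open>The charts supplied by the equivalence are compared with the fixed ones; the transition
  maps on both sides are the required changes of coordinates.\<close>

lemma germ_equiv_if_A_equiv:
  assumes "A_equiv_germ_dS D f p G"
  shows "germ_equiv (\<lambda>x. \<Psi> (f (\<kappa> x))) G"
proof -
  obtain S \<sigma> W \<Psi>1 Ob \<psi>1 where h: "(0::r2) \<in> S" "diffeo_on S \<sigma>" "\<sigma> 0 = p" "\<sigma> ` S \<subseteq> D"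
    "open W" "f p \<in> W" "smooth_on W \<Psi>1" "\<Psi>1 (f p) = 0" "open Ob" "smooth_on Ob \<psi>1" "\<Psi>1 ` (W \<inter> deSitter3) = Ob"
    "\<forall>y\<in>Ob. \<psi>1 y \<in> W \<inter> deSitter3 \<and> \<Psi>1 (\<psi>1 y) = y" "\<forall>X\<in>W \<inter> deSitter3. \<psi>1 (\<Psi>1 X) = X"
    "\<forall>x\<in>S. f (\<sigma> x) \<in> W \<and> \<Psi>1 (f (\<sigma> x)) = G x"
    using assms unfolding A_equiv_germ_dS_def by (elim exE conjE) blast
  obtain \<sigma>' where sg: "open S" "open (\<sigma> ` S)" "smooth_on S \<sigma>" "smooth_on (\<sigma> ` S) \<sigma>'"
    "\<forall>x\<in>S. \<sigma>' (\<sigma> x) = x" "\<forall>z\<in>\<sigma> ` S. \<sigma> (\<sigma>' z) = z"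
    using h(2) unfolding diffeo_on_def by blast
  have pS: "p \<in> \<sigma> ` S" using h(1,3) by blast
  have sp: "\<sigma>' p = 0" using sg(5) h(1,3) by blast
  have s1: "smooth_at \<sigma> 0" "smooth_at \<sigma>' p"
    using smooth_atI[OF sg(1) h(1) sg(3)] smooth_atI[OF sg(2) pS sg(4)] .
  have fpW: "f p \<in> W \<inter> deSitter3" using h(6) fp by blast
  have Ob0: "0 \<in> Ob" using h(8,11) fpW by (metis image_eqI)
  have \<psi>10: "\<psi>1 0 = f p" using h(8,13) fpW by metis
  have s2: "smooth_at \<Psi>1 (f p)" "smooth_at \<psi>1 0" "smooth_at \<psi> 0" "smooth_at \<Psi> (f p)"
    using smooth_atI[OF h(5,6,7)] smooth_atI[OF h(9) Ob0 h(10)] smooth_atI[OF AB(2,3) chart(2)]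
      smooth_atI[OF open_UNIV UNIV_I chart(1)] .
  have t\<sigma>: "(\<sigma> \<longlongrightarrow> p) (nhds 0)" "(\<kappa> \<longlongrightarrow> p) (nhds 0)" "(\<psi> \<longlongrightarrow> f p) (nhds 0)" "(\<psi>1 \<longlongrightarrow> f p) (nhds 0)"
    using smooth_at_tendsto[OF s1(1)] smooth_at_tendsto[OF \<kappa>(1)] smooth_at_tendsto[OF s2(3)] smooth_at_tendsto[OF s2(2)]
      h(3) \<kappa>(3) fp(2) \<psi>10 by simp_all
  have eW: "\<forall>\<^sub>F X in nhds (f p). X \<in> W" and eA: "\<forall>\<^sub>F X in nhds (f p). X \<in> A"
    using eventually_nhds_in_open[OF h(5,6)] eventually_nhds_in_open[OF AB(1,4)] .
  have eS: "\<forall>\<^sub>F x in nhds 0. x \<in> S" and eO: "\<forall>\<^sub>F y in nhds 0. y \<in> Ob" and eB: "\<forall>\<^sub>F y in nhds 0. y \<in> B"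
    using eventually_nhds_in_open[OF sg(1) h(1)] eventually_nhds_in_open[OF h(9) Ob0] eventually_nhds_in_open[OF AB(2,3)] .
  have i1: "inverse_germs (\<lambda>x. \<kappa>' (\<sigma> x)) (\<lambda>x. \<sigma>' (\<kappa> x))"
  proof (rule inverse_germsI)
    show "smooth_at (\<lambda>x. \<kappa>' (\<sigma> x)) 0" by (rule smooth_at_compose[of \<kappa>' \<sigma>]) (use s1 \<kappa> h(3) in simp_all)
    show "smooth_at (\<lambda>x. \<sigma>' (\<kappa> x)) 0" by (rule smooth_at_compose[of \<sigma>' \<kappa>]) (use s1 \<kappa> in simp_all)
    show "\<kappa>' (\<sigma> 0) = 0" "\<sigma>' (\<kappa> 0) = 0" using h(3) \<kappa> sp by simp_all
    show "\<forall>\<^sub>F x in nhds 0. \<sigma>' (\<kappa> (\<kappa>' (\<sigma> x))) = x"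
      using eventually_compose_filterlim[OF \<kappa>(6) t\<sigma>(1)] eS by eventually_elim (use sg(5) in simp)
    show "\<forall>\<^sub>F x in nhds 0. \<kappa>' (\<sigma> (\<sigma>' (\<kappa> x))) = x"
      using \<kappa>(5) eventually_compose_filterlim[OF eventually_nhds_in_open[OF sg(2) pS] t\<sigma>(2)]
    proof eventually_elim
      case (elim x)
      then show ?case using bspec[OF sg(6) elim(2)] by simp
    qed
  qed
  have i2: "inverse_germs (\<lambda>y. \<Psi>1 (\<psi> y)) (\<lambda>y. \<Psi> (\<psi>1 y))"
  proof (rule inverse_germsI)
    show "smooth_at (\<lambda>y. \<Psi>1 (\<psi> y)) 0" by (rule smooth_at_compose[of \<Psi>1 \<psi>]) (use s2 fp(2) in simp_all)
    show "smooth_at (\<lambda>y. \<Psi> (\<psi>1 y)) 0" by (rule smooth_at_compose[of \<Psi> \<psi>1]) (use s2 \<psi>10 in simp_all)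
    show "\<Psi>1 (\<psi> 0) = 0" "\<Psi> (\<psi>1 0) = 0" using fp(2) h(8) \<psi>10 chart(3) by simp_all
    show "\<forall>\<^sub>F y in nhds 0. \<Psi> (\<psi>1 (\<Psi>1 (\<psi> y))) = y"
      using eventually_compose_filterlim[OF eW t\<sigma>(3)] eB
      by eventually_elim (use chart(4) h(13) in auto)
    show "\<forall>\<^sub>F y in nhds 0. \<Psi>1 (\<psi> (\<Psi> (\<psi>1 y))) = y"
      using eventually_compose_filterlim[OF eA t\<sigma>(4)] eO
      by eventually_elim (use chart(5) h(12) in auto)
  qed
  have "\<forall>\<^sub>F x in nhds 0. \<Psi>1 (\<psi> (\<Psi> (f (\<kappa> (\<kappa>' (\<sigma> x)))))) = G x"
    using eventually_compose_filterlim[OF \<kappa>(6) t\<sigma>(1)]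
      eventually_compose_filterlim[OF eventually_compose_filterlim[OF eA f_tendsto] t\<sigma>(1)] eS
  proof eventually_elim
    case (elim x)
    have "f (\<sigma> x) \<in> A \<inter> deSitter3" using elim(2,3) h(4) f(2) by blast
    then show ?case using chart(5) elim(1,3) h(14) by simp
  qed
  with i1 i2 show ?thesis by (rule germ_equivI)
qed

lemma A_equiv_iff: "A_equiv_germ_dS D f p G \<longleftrightarrow> germ_equiv (\<lambda>x. \<Psi> (f (\<kappa> x))) G"
  using A_equiv_if_germ_equiv germ_equiv_if_A_equiv by blast

end

subsection \<open>Hermitian matrices\<close>

fun ent :: "herm2 \<Rightarrow> bool \<Rightarrow> bool \<Rightarrow> complex" where
  "ent (a, d, b1, b2) False False = of_real a"
| "ent (a, d, b1, b2) True True = of_real d"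
| "ent (a, d, b1, b2) False True = Complex b1 b2"
| "ent (a, d, b1, b2) True False = Complex b1 (- b2)"

definition conjugate_ent :: "(bool \<Rightarrow> bool \<Rightarrow> complex) \<Rightarrow> herm2 \<Rightarrow> bool \<Rightarrow> bool \<Rightarrow> complex" where
  "conjugate_ent n X j k = n j False * cnj (n k False) * ent X False False + n j False * cnj (n k True) * ent X False True
     + n j True * cnj (n k False) * ent X True False + n j True * cnj (n k True) * ent X True True"

definition act :: "(bool \<Rightarrow> bool \<Rightarrow> complex) \<Rightarrow> herm2 \<Rightarrow> herm2" where
  "act n X = (Re (conjugate_ent n X False False), Re (conjugate_ent n X True True),
     Re (conjugate_ent n X False True), Im (conjugate_ent n X False True))"

definition adjugate :: "(bool \<Rightarrow> bool \<Rightarrow> complex) \<Rightarrow> bool \<Rightarrow> bool \<Rightarrow> complex" where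
  "adjugate n j k = (if j = k then n (\<not> j) (\<not> k) else - n j k)"

text \<open>Modulus one, not determinant one: the determinant of \<open>n X n*\<close> gains only
  the squared modulus, and the normalizing matrix used later has determinant
  \<open>g p\<close>.\<close>

definition unimodular :: "(bool \<Rightarrow> bool \<Rightarrow> complex) \<Rightarrow> bool" where
  "unimodular n \<longleftrightarrow> cmod (n False False * n True True - n False True * n True False) = 1"

lemma ent_cnj: "ent X k j = cnj (ent X j k)"
  by (cases X; cases j; cases k) (simp_all add: complex_eq_iff)

lemma ent_act: "ent (act n X) j k = conjugate_ent n X j k"
proof -
  have c: "conjugate_ent n X k j = cnj (conjugate_ent n X j k)" for j k
    unfolding conjugate_ent_def by (simp add: ent_cnj[symmetric] ac_simps)
  show ?thesis
    using c[of False False] c[of True True] c[of True False]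
    by (cases j; cases k) (simp_all add: act_def complex_eq_iff)
qed

lemma herm2_eqI: "(\<And>j k. ent X j k = ent Y j k) \<Longrightarrow> X = Y"
proof -
  assume e: "\<And>j k. ent X j k = ent Y j k"
  show "X = Y" using e[of False False] e[of True True] e[of False True]
    by (cases X; cases Y) (simp add: complex_eq_iff)
qed

lemma herm_det_ent: "of_real (herm_det X) = ent X False False * ent X True True - ent X False True * ent X True False"
  by (cases X) (simp add: herm_det_def complex_eq_iff power2_eq_square)

lemma unimodular_cnj:
  assumes "unimodular n"
  shows "(n False False * n True True - n False True * n True False) *
    (cnj (n False False) * cnj (n True True) - cnj (n False True) * cnj (n True False)) = 1"
  using assms complex_norm_square[of "n False False * n True True - n False True * n True False"]
  by (simp add: unimodular_def)

lemma herm_det_act: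
  assumes "unimodular n"
  shows "herm_det (act n X) = herm_det X"
proof -
  have "complex_of_real (herm_det (act n X)) = of_real (herm_det X)"
    unfolding herm_det_ent ent_act conjugate_ent_def
    using unimodular_cnj[OF assms] by algebra
  then show ?thesis by simp
qed

text \<open>The adjugate is the inverse times the determinant. That factor has modulus one and
  cancels against its conjugate in the two-sided action.\<close>

lemma act_adjugate:
  assumes "unimodular n"
  shows "act (adjugate n) (act n X) = X" "act n (act (adjugate n) X) = X"
proof -
  note u = unimodular_cnj[OF assms]
  note unf = conjugate_ent_def ent_act adjugate_def simp_thms if_True if_False complex_cnj_minus
  have FF: "conjugate_ent (adjugate n) (act n X) False False = ent X False False"
    using u by (simp only: unf) algebra
  have FT: "conjugate_ent (adjugate n) (act n X) False True = ent X False True"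
    using u by (simp only: unf) algebra
  have TF: "conjugate_ent (adjugate n) (act n X) True False = ent X True False"
    using u by (simp only: unf) algebra
  have TT: "conjugate_ent (adjugate n) (act n X) True True = ent X True True"
    using u by (simp only: unf) algebra
  show "act (adjugate n) (act n X) = X"
  proof (rule herm2_eqI, unfold ent_act)
    fix j k show "conjugate_ent (adjugate n) (act n X) j k = ent X j k" using FF FT TF TT by (cases j; cases k) simp_all
  qed
  have FF: "conjugate_ent n (act (adjugate n) X) False False = ent X False False"
    using u by (simp only: unf) algebra
  have FT: "conjugate_ent n (act (adjugate n) X) False True = ent X False True"
    using u by (simp only: unf) algebra
  have TF: "conjugate_ent n (act (adjugate n) X) True False = ent X True False"
    using u by (simp only: unf) algebra
  have TT: "conjugate_ent n (act (adjugate n) X) True True = ent X True True"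
    using u by (simp only: unf) algebra
  show "act n (act (adjugate n) X) = X"
  proof (rule herm2_eqI, unfold ent_act)
    fix j k show "conjugate_ent n (act (adjugate n) X) j k = ent X j k" using FF FT TF TT by (cases j; cases k) simp_all
  qed
qed

lemma bounded_linear_act: "bounded_linear (act n)"
proof -
  have a: "ent (X + Y) j k = ent X j k + ent Y j k" for X Y j k
    by (cases X; cases Y; cases j; cases k) (simp_all add: complex_eq_iff)
  have s: "ent (r *\<^sub>R X) j k = of_real r * ent X j k" for r X j k
    by (cases X; cases j; cases k) (simp_all add: complex_eq_iff)
  have "linear (act n)"
  proof (rule linearI)
    show "act n (X + Y) = act n X + act n Y" for X Y
      by (rule herm2_eqI) (simp add: ent_act a conjugate_ent_def algebra_simps)
    show "act n (r *\<^sub>R X) = r *\<^sub>R act n X" for r X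
      by (rule herm2_eqI) (simp add: ent_act s conjugate_ent_def algebra_simps)
  qed
  then show ?thesis by (simp add: linear_conv_bounded_linear)
qed

lemma ent_Fe3Fstar:
  "ent (Fe3Fstar F11 F12 F21 F22 z) j k =
    (if j then F21 else F11) z * cnj ((if k then F21 else F11) z) - (if j then F22 else F12) z * cnj ((if k then F22 else F12) z)"
  by (cases j; cases k) (simp_all add: Fe3Fstar_def Let_def cmod_power2 complex_eq_iff, simp_all add: power2_eq_square)

lemma herm_det_Fe3Fstar:
  assumes "F11 z * F22 z - F12 z * F21 z = 1"
  shows "Fe3Fstar F11 F12 F21 F22 z \<in> deSitter3"
proof -
  have c: "cnj (F11 z) * cnj (F22 z) - cnj (F12 z) * cnj (F21 z) = 1"
    using arg_cong[OF assms, of cnj] by simp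
  have "complex_of_real (herm_det (Fe3Fstar F11 F12 F21 F22 z)) = of_real (- 1)"
    unfolding herm_det_ent ent_Fe3Fstar if_True if_False of_real_minus of_real_1 using assms c by algebra
  then show ?thesis unfolding deSitter3_def of_real_eq_iff by simp
qed

section \<open>A graph chart of de Sitter space\<close>

definition dS_coords :: "herm2 \<Rightarrow> r3" where
  "dS_coords X = (fst X - 1, - snd (snd (snd X)), - fst (snd X) / 2)"

definition dS_root :: "r3 \<Rightarrow> real" where
  "dS_root y = 1 - 2 * (1 + fst y) * snd (snd y) - fst (snd y) * fst (snd y)"

text \<open>The equation \<open>det X = -1\<close> is solved for the real part of the off-diagonal
  entry. The negative root is taken since that entry is -1 at the normalized base point.\<close>

definition dS_point :: "r3 \<Rightarrow> herm2" where
  "dS_point y = (1 + fst y, - 2 * snd (snd y), - sqrt (dS_root y), - fst (snd y))"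

lemma dS_coords_point: "dS_coords (dS_point y) = y"
  by (simp add: dS_coords_def dS_point_def)

lemma dS_point_coords:
  assumes "herm_det X = - 1" "fst (snd (snd X)) < 0"
  shows "dS_root (dS_coords X) > 0" "dS_point (dS_coords X) = X"
proof -
  obtain a d b1 b2 where X: "X = (a, d, b1, b2)" by (cases X)
  have "dS_root (dS_coords X) = b1\<^sup>2"
    using assms(1) by (simp add: X dS_root_def dS_coords_def herm_det_def power2_eq_square algebra_simps)
  note r = this
  show "dS_root (dS_coords X) > 0" using r assms(2) by (simp add: X)
  have "sqrt (dS_root (dS_coords X)) = - b1" using r assms(2) by (simp add: X)
  then show "dS_point (dS_coords X) = X"
    by (simp add: dS_point_def) (simp add: X dS_coords_def)
qed

lemma dS_point_deSitter:
  assumes "dS_root y > 0"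
  shows "herm_det (dS_point y) = - 1" "fst (snd (snd (dS_point y))) < 0"
  using assms by (simp_all add: herm_det_def dS_point_def) (simp add: dS_root_def power2_eq_square algebra_simps)

lemma continuous_dS_root: "continuous_on UNIV dS_root"
  unfolding dS_root_def by (intro continuous_intros)

lemma smooth_dS_root: "open S \<Longrightarrow> smooth_on S dS_root"
  unfolding dS_root_def[abs_def]
  by (intro smooth_on_diff smooth_on_mult smooth_on_add smooth_on_const smooth_on_linear bounded_linear_fst
      bounded_linear_compose[OF bounded_linear_fst bounded_linear_snd] bounded_linear_compose[OF bounded_linear_snd bounded_linear_snd])

text \<open>Smoothness is inherited from the principal complex square root, which is holomorphic off
  the closed negative axis.\<close>

lemma smooth_sqrt: "smooth_on {0<..} sqrt"
proof -
  have o: "open (- \<real>\<^sub>\<le>\<^sub>0 :: complex set)" by (simp add: open_Compl)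
  have c: "smooth_on (- \<real>\<^sub>\<le>\<^sub>0) csqrt"
    by (rule holomorphic_on_imp_smooth_on[OF o]) (intro holomorphic_intros, simp)
  have "smooth_on {0<..} (\<lambda>t :: real. csqrt (of_real t))"
    by (rule smooth_on_compose[OF _ o _ c smooth_on_linear[OF bounded_linear_of_real]]) auto
  from smooth_on_linear_comp[OF _ bounded_linear_Re this]
  have "smooth_on {0<..} (\<lambda>t. Re (csqrt (of_real t)))" by simp
  then show ?thesis by (rule smooth_on_cong[rotated -1]) auto
qed

lemma smooth_dS_point: "smooth_on {y. dS_root y > 0} dS_point"
proof -
  have o: "open {y. dS_root y > 0}"
    using open_Collect_less[OF continuous_on_const continuous_dS_root, of 0] by simp
  have 1: "smooth_on {y. dS_root y > 0} (\<lambda>y. sqrt (dS_root y))"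
    by (rule smooth_on_compose[OF o _ _ smooth_sqrt smooth_dS_root[OF o]]) auto
  have 2: "smooth_on {y. dS_root y > 0} (\<lambda>y. (1 + fst y, - 2 * snd (snd y), 0 - sqrt (dS_root y), 0 - fst (snd y)))"
    by (intro smooth_on_Pair smooth_on_add smooth_on_mult smooth_on_diff smooth_on_const o 1 smooth_on_linear bounded_linear_fst
      bounded_linear_compose[OF bounded_linear_fst bounded_linear_snd] bounded_linear_compose[OF bounded_linear_snd bounded_linear_snd])
  have "dS_point = (\<lambda>y. (1 + fst y, - 2 * snd (snd y), 0 - sqrt (dS_root y), 0 - fst (snd y)))"
    by (simp add: dS_point_def fun_eq_iff)
  with 2 show ?thesis by simp
qed

lemma smooth_dS_coords: "smooth_on UNIV dS_coords"
proof -
  have l: "bounded_linear (\<lambda>X :: herm2. fst (snd X))" "bounded_linear (\<lambda>X :: herm2. snd (snd (snd X)))"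
    by (intro bounded_linear_compose[OF bounded_linear_fst bounded_linear_snd]
        bounded_linear_compose[OF bounded_linear_snd bounded_linear_compose[OF bounded_linear_snd bounded_linear_snd]])+
  have "smooth_on UNIV (\<lambda>X :: herm2. (fst X - 1, 0 - snd (snd (snd X)), (- 1 / 2) * fst (snd X)))"
    by (intro smooth_on_Pair smooth_on_diff smooth_on_mult smooth_on_const smooth_on_linear bounded_linear_fst l open_UNIV)
  moreover have "dS_coords = (\<lambda>X. (fst X - 1, 0 - snd (snd (snd X)), (- 1 / 2) * fst (snd X)))"
    by (simp add: dS_coords_def fun_eq_iff)
  ultimately show ?thesis by simp
qed

subsection \<open>Local coordinates\<close>

lemma local_holomorphic_inverse:
  fixes F :: "complex \<Rightarrow> complex"
  assumes F: "F holomorphic_on S" and S: "open S" "a \<in> S" and ne: "deriv F a \<noteq> 0"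
  obtains G r where "r > 0" "G (F a) = a" "\<And>y. y \<in> ball (F a) r \<Longrightarrow> G y \<in> S \<and> F (G y) = y"
    "\<And>y. y \<in> ball (F a) r \<Longrightarrow> (G has_field_derivative inverse (deriv F (G y))) (at y)"
    "\<forall>\<^sub>F x in nhds a. G (F x) = x"
proof -
  obtain s where s: "s > 0" "ball a s \<subseteq> S" "inj_on F (ball a s)"
    using has_complex_derivative_locally_injective[OF F S(2,1) ne] by blast
  have Fb: "F holomorphic_on ball a s" using holomorphic_on_subset[OF F s(2)] .
  obtain G where G: "G holomorphic_on F ` ball a s" "\<And>z. z \<in> ball a s \<Longrightarrow> deriv F z * deriv G (F z) = 1"
    "\<And>z. z \<in> ball a s \<Longrightarrow> G (F z) = z"
    using holomorphic_has_inverse[OF Fb open_ball s(3)] by blast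
  have o: "open (F ` ball a s)" by (rule open_mapping_thm3[OF Fb open_ball s(3)])
  have "F a \<in> F ` ball a s" using s(1) by simp
  then obtain r where r: "r > 0" "ball (F a) r \<subseteq> F ` ball a s" using o openE by blast
  show ?thesis
  proof (rule that[OF r(1)])
    show "G (F a) = a" using G(3) s(1) by simp
    show "G y \<in> S \<and> F (G y) = y" if y: "y \<in> ball (F a) r" for y
    proof -
      obtain x where "x \<in> ball a s" "y = F x" using y r(2) by blast
      then show ?thesis using G(3) s(2) by auto
    qed
    show "(G has_field_derivative inverse (deriv F (G y))) (at y)" if y: "y \<in> ball (F a) r" for y
    proof -
      obtain x where x: "x \<in> ball a s" "y = F x" using y r(2) by blast
      have "(G has_field_derivative deriv G y) (at y)"
        using holomorphic_derivI[OF G(1) o] x by blast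
      moreover have "deriv G y = inverse (deriv F (G y))"
        using G(2)[OF x(1)] G(3)[OF x(1)] x(2) by (metis inverse_unique)
      ultimately show ?thesis by simp
    qed
    show "\<forall>\<^sub>F x in nhds a. G (F x) = x"
      using eventually_nhds_in_open[of "ball a s" a] s(1) by (auto elim!: eventually_mono simp: G(3))
  qed
qed

subsection \<open>CMC 1 faces\<close>

lemma germ_equiv_cong:
  assumes "\<forall>\<^sub>F x in nhds 0. F x = F' x" "germ_equiv F G"
  shows "germ_equiv F' G"
proof -
  obtain \<sigma> \<sigma>' \<Theta> \<Theta>' where *: "inverse_germs \<sigma> \<sigma>'" "inverse_germs \<Theta> \<Theta>'" "\<forall>\<^sub>F x in nhds 0. \<Theta> (F (\<sigma> x)) = G x"
    using assms(2) unfolding germ_equiv_def by blast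
  have "(\<sigma> \<longlongrightarrow> 0) (nhds 0)" using *(1) smooth_at_tendsto[of \<sigma> 0] unfolding inverse_germs_def by simp
  from eventually_compose_filterlim[OF assms(1) this] *(3)
  have "\<forall>\<^sub>F x in nhds 0. \<Theta> (F' (\<sigma> x)) = G x" by eventually_elim simp
  with *(1,2) show ?thesis by (rule germ_equivI)
qed

text \<open>Allows the sign \<open>\<epsilon>\<close> of the second coordinate to be changed at
  will.\<close>

lemma germ_equiv_flip:
  "germ_equiv (\<lambda>x. (F1 x, - F2 x, F3 x)) (\<lambda>x. (F1 x, F2 x, F3 x))"
proof (rule germ_equivI)
  let ?f = "\<lambda>y :: r3. (fst y, - fst (snd y), snd (snd y))"
  have "smooth_at ?f 0"
    by (rule smooth_at_linear) (intro bounded_linear_Pair bounded_linear_minus bounded_linear_fst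
      bounded_linear_compose[OF bounded_linear_fst bounded_linear_snd] bounded_linear_compose[OF bounded_linear_snd bounded_linear_snd])
  then show "inverse_germs ?f ?f"
    by (intro inverse_germsI) (simp_all add: zero_prod_def)
  show "inverse_germs (\<lambda>x. x) (\<lambda>x. x)"
    by (intro inverse_germsI smooth_at_ident) simp_all
qed simp

locale cmc_point =
  fixes D g h F11 F12 F21 F22 p
  assumes data: "CMC1_face_data D g h F11 F12 F21 F22" and sing: "p \<in> singular_set D g"
begin

definition "f = Fe3Fstar F11 F12 F21 F22"
definition "row1 j = (if j then F21 else F11)"
definition "row2 j = (if j then F22 else F12)"

lemma basic: "open D" "p \<in> D" "\<not> is_pole g p" "cmod (g p) = 1" "g p \<noteq> 0" "h holomorphic_on D"
  "row1 j holomorphic_on D" "row2 j holomorphic_on D" "z \<in> D \<Longrightarrow> F11 z * F22 z - F12 z * F21 z = 1"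
  using data sing unfolding CMC1_face_data_def singular_set_def row1_def row2_def by auto

lemma deriv_rows:
  assumes "z \<in> D" "\<not> is_pole g z"
  shows "(row1 j has_field_derivative (row1 j z * g z + row2 j z) * h z) (at z)"
    "(row2 j has_field_derivative (- row1 j z * (g z)\<^sup>2 - row2 j z * g z) * h z) (at z)"
proof -
  have "deriv (row1 j) z = (row1 j z * g z + row2 j z) * h z"
    "deriv (row2 j) z = (- row1 j z * (g z)\<^sup>2 - row2 j z * g z) * h z"
    using data assms unfolding CMC1_face_data_def row1_def row2_def by auto
  then show "(row1 j has_field_derivative (row1 j z * g z + row2 j z) * h z) (at z)"
    "(row2 j has_field_derivative (- row1 j z * (g z)\<^sup>2 - row2 j z * g z) * h z) (at z)"
    using holomorphic_derivI[OF basic(7) basic(1) assms(1), of j] holomorphic_derivI[OF basic(8) basic(1) assms(1), of j] by simp_all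
qed

lemma f_deSitter: "z \<in> D \<Longrightarrow> f z \<in> deSitter3"
  unfolding f_def by (rule herm_det_Fe3Fstar) (rule basic)

lemma isCont_f: "isCont f p"
proof -
  have c: "isCont (row1 j) p" "isCont (row2 j) p" for j
    using DERIV_isCont[OF deriv_rows(1)[OF basic(2,3)]] DERIV_isCont[OF deriv_rows(2)[OF basic(2,3)]] .
  show ?thesis
    unfolding f_def Fe3Fstar_def[abs_def] Let_def
    using c[of False] c[of True] unfolding row1_def row2_def by (intro continuous_intros) simp_all
qed

lemma regular_nhd:
  obtains B where "open B" "p \<in> B" "convex B" "B \<subseteq> D" "\<And>z. z \<in> B \<Longrightarrow> \<not> is_pole g z \<and> g z \<noteq> 0 \<and> h z \<noteq> 0" "g holomorphic_on B"
proof -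
  have "g analytic_on {p}"
    using nicely_meromorphic_on_imp_analytic_at[OF _ basic(2,3)] data unfolding CMC1_face_data_def by blast
  then obtain S where S: "open S" "p \<in> S" "g holomorphic_on S" unfolding analytic_at by blast
  have "(1 + (cmod (g p))\<^sup>2)\<^sup>2 * (cmod (h p))\<^sup>2 > 0"
    using data basic(2,3) unfolding CMC1_face_data_def by blast
  then have hp: "h p \<noteq> 0" by auto
  have c: "isCont g p" "isCont h p"
    using holomorphic_on_imp_continuous_on[OF S(3)] holomorphic_on_imp_continuous_on[OF basic(6)] S(1,2) basic(1,2)
    by (auto simp: continuous_on_eq_continuous_at)
  have "\<forall>\<^sub>F z in nhds p. z \<in> S \<inter> D" using S basic(1,2) by (intro eventually_nhds_in_open) auto
  then have "\<forall>\<^sub>F z in nhds p. z \<in> S \<inter> D \<and> g z \<noteq> 0 \<and> h z \<noteq> 0"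
    using tendsto_imp_eventually_ne[OF isCont_tendsto_nhds[OF c(1)] basic(5)]
      tendsto_imp_eventually_ne[OF isCont_tendsto_nhds[OF c(2)] hp] by eventually_elim blast
  then obtain e where e: "e > 0" "\<And>z. dist z p < e \<Longrightarrow> z \<in> S \<inter> D \<and> g z \<noteq> 0 \<and> h z \<noteq> 0"
    unfolding eventually_nhds_metric by blast
  show ?thesis
  proof (rule that[of "ball p e"])
    show "p \<in> ball p e" using e(1) by simp
    show "ball p e \<subseteq> D" using e(2) by (auto simp: dist_commute)
    show "g holomorphic_on ball p e" by (rule holomorphic_on_subset[OF S(3)]) (use e(2) in \<open>auto simp: dist_commute\<close>)
    show "\<not> is_pole g z \<and> g z \<noteq> 0 \<and> h z \<noteq> 0" if "z \<in> ball p e" for z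
      using e(2)[of z] that not_is_pole_holomorphic[OF S(1) _ S(3)] by (auto simp: dist_commute)
  qed simp_all
qed

end

text \<open>\<open>T\<close> is the coordinate with \<open>dT = g * h * dz\<close> centred at
  \<open>p\<close>, and \<open>Z\<close> is its local inverse.\<close>

locale cmc_chart = cmc_point +
  fixes B :: "complex set" and Z T :: "complex \<Rightarrow> complex" and R :: real
  assumes B: "open B" "p \<in> B" "B \<subseteq> D" "\<And>z. z \<in> B \<Longrightarrow> \<not> is_pole g z \<and> g z \<noteq> 0 \<and> h z \<noteq> 0" "g holomorphic_on B"
    and R: "R > 0" and Z: "Z 0 = p" "\<And>t. t \<in> ball 0 R \<Longrightarrow> Z t \<in> B \<and> T (Z t) = t"
      "\<And>t. t \<in> ball 0 R \<Longrightarrow> (Z has_field_derivative inverse (g (Z t) * h (Z t))) (at t)"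
    and T: "T p = 0" "T analytic_on {p}" "\<forall>\<^sub>F z in nhds p. Z (T z) = z"

text \<open>A primitive of \<open>g * h\<close> exists on a convex neighbourhood; both factors are
  nonzero at \<open>p\<close>, so the primitive is locally invertible.\<close>

lemma (in cmc_point) cmc_chart_exists: "\<exists>B Z T R. cmc_chart D g h F11 F12 F21 F22 p B Z T R"
proof -
  obtain B where B: "open B" "p \<in> B" "convex B" "B \<subseteq> D" "\<And>z. z \<in> B \<Longrightarrow> \<not> is_pole g z \<and> g z \<noteq> 0 \<and> h z \<noteq> 0" "g holomorphic_on B"
    by (rule regular_nhd) blast
  have gh: "(\<lambda>z. g z * h z) holomorphic_on B"
    by (intro holomorphic_intros B(6) holomorphic_on_subset[OF basic(6) B(4)])
  obtain T0 where T0': "\<And>z. z \<in> B \<Longrightarrow> (T0 has_field_derivative g z * h z) (at z within B)"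
  proof (rule holomorphic_convex_primitive'[OF B(3,1) gh])
    fix T1 assume "\<And>z. z \<in> B \<Longrightarrow> (T1 has_field_derivative g z * h z) (at z within B)"
    then show thesis by (rule that)
  qed
  have T0: "(T0 has_field_derivative g z * h z) (at z)" if "z \<in> B" for z
    using T0'[OF that] unfolding at_within_open[OF that B(1)] .
  define T where "T z = T0 z - T0 p" for z
  have dT: "(T has_field_derivative g z * h z) (at z)" if "z \<in> B" for z
    unfolding T_def[abs_def] using DERIV_diff[OF T0[OF that] DERIV_const] by simp
  have hT: "T holomorphic_on B" unfolding holomorphic_on_open[OF B(1)] using dT by blast
  have Tp: "T p = 0" by (simp add: T_def)
  have ne: "deriv T p \<noteq> 0" using DERIV_imp_deriv[OF dT[OF B(2)]] B(2,5) by simp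
  obtain Z R where Z: "R > 0" "Z (T p) = p" "\<And>y. y \<in> ball (T p) R \<Longrightarrow> Z y \<in> B \<and> T (Z y) = y"
    "\<And>y. y \<in> ball (T p) R \<Longrightarrow> (Z has_field_derivative inverse (deriv T (Z y))) (at y)" "\<forall>\<^sub>F x in nhds p. Z (T x) = x"
  proof (rule local_holomorphic_inverse[OF hT B(1,2) ne])
    fix G r
    assume "r > 0" "G (T p) = p" "\<And>y. y \<in> ball (T p) r \<Longrightarrow> G y \<in> B \<and> T (G y) = y"
      "\<And>y. y \<in> ball (T p) r \<Longrightarrow> (G has_field_derivative inverse (deriv T (G y))) (at y)" "\<forall>\<^sub>F x in nhds p. G (T x) = x"
    then show thesis by (rule that)
  qed
  have "cmc_chart D g h F11 F12 F21 F22 p B Z T R"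
  proof
    show "(Z has_field_derivative inverse (g (Z t) * h (Z t))) (at t)" if t: "t \<in> ball 0 R" for t
      using Z(4)[of t] Z(3)[of t] DERIV_imp_deriv[OF dT] t Tp by simp
    show "T analytic_on {p}" using hT B(1,2) unfolding analytic_at by blast
  qed (use B Z Tp in simp_all)
  then show ?thesis by blast
qed

context cmc_chart
begin

definition "Cz j z = row2 j z / g z"
definition "Ez j z = row1 j z + Cz j z"

text \<open>The inverse of the matrix with columns \<open>Ez\<close> and \<open>Cz\<close> at
  \<open>p\<close>. That matrix has determinant \<open>1 / g p\<close>, which explains the factors
  \<open>g p\<close>.\<close>

definition n :: "bool \<Rightarrow> bool \<Rightarrow> complex" where
  "n j k = (if j then (if k then g p * Ez False p else - g p * Ez True p) else (if k then - g p * Cz False p else g p * Cz True p))"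

definition "e j t = n j False * Ez False (Z t) + n j True * Ez True (Z t)"
definition "c j t = n j False * Cz False (Z t) + n j True * Cz True (Z t)"
definition "phi t = char_phi g h (Z t)"
definition "gg t = g (Z t)"

lemma rows: "z \<in> B \<Longrightarrow> row1 j z = Ez j z - Cz j z" "z \<in> B \<Longrightarrow> row2 j z = g z * Cz j z"
  using B(4) by (simp_all add: Ez_def Cz_def)

lemma dg: "z \<in> B \<Longrightarrow> (g has_field_derivative deriv g z) (at z)"
  by (rule holomorphic_derivI[OF B(5,1)])

lemma d_ECz:
  assumes t: "t \<in> ball 0 R"
  shows "((\<lambda>t. Ez j (Z t)) has_field_derivative - phi t * Cz j (Z t)) (at t)"
    "((\<lambda>t. Cz j (Z t)) has_field_derivative - Ez j (Z t) - phi t * Cz j (Z t)) (at t)"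
    "(gg has_field_derivative phi t * gg t) (at t)"
proof -
  define z where "z = Z t"
  have zB: "z \<in> B" using Z(2)[OF t] by (simp add: z_def)
  have nz: "g z \<noteq> 0" "h z \<noteq> 0" "\<not> is_pole g z" "z \<in> D" using B(3) B(4)[OF zB] zB by auto
  note dr = deriv_rows[OF nz(4,3)]
  have dC: "(Cz j has_field_derivative (((- row1 j z * (g z)\<^sup>2 - row2 j z * g z) * h z) * g z - row2 j z * deriv g z) / (g z * g z)) (at z)"
    unfolding Cz_def[abs_def] by (rule DERIV_divide[OF dr(2) dg[OF zB] nz(1)])
  have dE: "(Ez j has_field_derivative (row1 j z * g z + row2 j z) * h z + (((- row1 j z * (g z)\<^sup>2 - row2 j z * g z) * h z) * g z - row2 j z * deriv g z) / (g z * g z)) (at z)"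
    unfolding Ez_def[abs_def] by (rule DERIV_add[OF dr(1) dC])
  note ch = DERIV_chain2[where g = Z, OF _ Z(3)[OF t], folded z_def]
  show "((\<lambda>t. Ez j (Z t)) has_field_derivative - phi t * Cz j (Z t)) (at t)"
    by (rule DERIV_cong[OF ch[OF dE]])
      (use nz in \<open>simp add: phi_def char_phi_def Cz_def z_def[symmetric] field_simps power2_eq_square\<close>)
  show "((\<lambda>t. Cz j (Z t)) has_field_derivative - Ez j (Z t) - phi t * Cz j (Z t)) (at t)"
    by (rule DERIV_cong[OF ch[OF dC]])
      (use nz in \<open>simp add: phi_def char_phi_def Ez_def Cz_def z_def[symmetric] field_simps power2_eq_square\<close>)
  show "(gg has_field_derivative phi t * gg t) (at t)"
    unfolding gg_def[abs_def]
    by (rule DERIV_cong[OF ch[OF dg[OF zB]]])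
      (use nz in \<open>simp add: phi_def char_phi_def z_def[symmetric] field_simps power2_eq_square\<close>)
qed

lemma det_p: "(Ez False p * Cz True p - Cz False p * Ez True p) * g p = 1"
proof -
  have "F11 p * F22 p - F12 p * F21 p = 1" by (rule basic(9)[OF basic(2)])
  moreover have "Ez False p * Cz True p - Cz False p * Ez True p = (F11 p * F22 p - F12 p * F21 p) / g p"
    by (simp add: Ez_def Cz_def row1_def row2_def diff_divide_distrib algebra_simps)
  ultimately show ?thesis using basic(5) by simp
qed

lemma phi_holomorphic: "phi holomorphic_on ball 0 R"
proof -
  have hZ: "Z holomorphic_on ball 0 R" unfolding holomorphic_on_open[OF open_ball] using Z(3) by blast
  have "char_phi g h holomorphic_on B"
    unfolding char_phi_def
    by (intro holomorphic_intros B(5) holomorphic_deriv[OF B(5,1)] holomorphic_on_subset[OF basic(6) B(3)]) (use B(4) in simp)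
  moreover have "Z ` ball 0 R \<subseteq> B" using Z(2) by blast
  ultimately show ?thesis
    using holomorphic_on_compose_gen[OF hZ] unfolding o_def phi_def[abs_def] by blast
qed

sublocale fr: frame e c phi gg R
proof
  show "(e j has_field_derivative - phi t * c j t) (at t)" if t: "t \<in> ball 0 R" for j t
    unfolding e_def[abs_def]
    by (rule DERIV_cong[OF DERIV_add[OF DERIV_cmult[OF d_ECz(1)[OF t]] DERIV_cmult[OF d_ECz(1)[OF t]]]])
      (simp add: c_def algebra_simps)
  show "(c j has_field_derivative - e j t - phi t * c j t) (at t)" if t: "t \<in> ball 0 R" for j t
    unfolding c_def[abs_def]
    by (rule DERIV_cong[OF DERIV_add[OF DERIV_cmult[OF d_ECz(2)[OF t]] DERIV_cmult[OF d_ECz(2)[OF t]]]])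
      (simp add: e_def algebra_simps)
  show "(gg has_field_derivative phi t * gg t) (at t)" if "t \<in> ball 0 R" for t
    by (rule d_ECz(3)[OF that])
  show "e False 0 = 1" "e True 0 = 0" "c False 0 = 0" "c True 0 = 1" "cmod (gg 0) = 1"
    using det_p basic(4) by (simp_all add: e_def c_def n_def gg_def Z(1) algebra_simps)
qed (use R phi_holomorphic in simp_all)

lemma unimodular_n: "unimodular n"
proof -
  have "n False False * n True True - n False True * n True False = g p * ((Ez False p * Cz True p - Cz False p * Ez True p) * g p)"
    by (simp add: n_def algebra_simps)
  then show ?thesis unfolding unimodular_def det_p by (simp add: basic(4))
qed

lemma conjugate_ent_f:
  assumes t: "t \<in> ball 0 R"
  shows "conjugate_ent n (f (Z t)) j k = (e j t - c j t) * cnj (e k t - c k t) - gg t * cnj (gg t) * (c j t * cnj (c k t))"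
proof -
  have zB: "Z t \<in> B" using Z(2)[OF t] by simp
  have r: "ent (f (Z t)) j k = row1 j (Z t) * cnj (row1 k (Z t)) - row2 j (Z t) * cnj (row2 k (Z t))" for j k
    unfolding f_def ent_Fe3Fstar row1_def row2_def by (cases j; cases k) simp_all
  show ?thesis
    unfolding conjugate_ent_def r rows[OF zB] e_def c_def gg_def
    by (simp add: algebra_simps)
qed

text \<open>The rows of \<open>F\<close> are \<open>Ez - Cz\<close> and \<open>g * Cz\<close>, so
  after normalization the surface is the matrix \<open>Xw\<close> evaluates; the three weights pick
  out precisely the chart coordinates.\<close>

lemma tri_eq:
  assumes t: "Complex (fst x) (snd x) \<in> ball 0 R"
  shows "tri fr.U (fr.Xw (wY 1)) (fr.Xw wZ) x = dS_coords (act n (f (Z (Complex (fst x) (snd x)))))"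
proof -
  define t where "t = Complex (fst x) (snd x)"
  define X where "X j k = conjugate_ent n (f (Z t)) j k" for j k
  have cc: "fst (cx x) + \<i> * snd (cx x) = t" "cnj (fst (cx x) - \<i> * snd (cx x)) = t"
    by (simp_all add: cx_def t_def complex_eq_iff)
  have X: "X j k = e j t * cnj (e k t) - (e j t * cnj (c k t) + c j t * cnj (e k t)) + (1 - gg t * cnj (gg t)) * (c j t * cnj (c k t))" for j k
    unfolding X_def conjugate_ent_f[OF assms, folded t_def] by (simp add: algebra_simps)
  have w: "fr.Xw w (cx x) = w False False * X False False + w False True * X False True + w True False * X True False + w True True * X True True" for w
    unfolding fr.Xw_def fr.mu_def bil_def hp_def hm_def cc X by (simp add: algebra_simps)
  have "X True False = cnj (X False True)" unfolding X_def ent_act[symmetric] by (rule ent_cnj)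
  then show ?thesis
    by (simp add: tri_def rr_def fr.U_def w dS_coords_def act_def wU_def wY_def wZ_def X_def t_def)
qed

lemma act_f_p: "act n (f p) = (1, 0, - 1, 0)"
proof -
  have "0 \<in> ball 0 R" using R by simp
  note ce = conjugate_ent_f[OF this, unfolded fr.init Z(1)]
  have "gg 0 * cnj (gg 0) = 1" by (rule fr.g0_cnj)
  then show ?thesis unfolding act_def by (simp add: ce fr.init)
qed

lemma dS_chart: "dS_chart D f p (\<lambda>x. Z (Complex (fst x) (snd x))) (\<lambda>z. (Re (T z), Im (T z)))
   {X. fst (snd (snd (act n X))) < 0} {y. dS_root y > 0} (\<lambda>X. dS_coords (act n X)) (\<lambda>y. act (adjugate n) (dS_point y))"
proof
  have Cx: "bounded_linear (\<lambda>x :: r2. Complex (fst x) (snd x))"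
  proof -
    have "bounded_linear (\<lambda>x :: r2. of_real (fst x) + \<i> * of_real (snd x))"
      by (intro bounded_linear_add bounded_linear_compose[OF bounded_linear_of_real] bounded_linear_fst
          bounded_linear_compose[OF bounded_linear_mult_right] bounded_linear_snd)
    then show ?thesis by (simp add: complex_eq[symmetric] Complex_eq)
  qed
  have C0: "Complex (fst (0 :: r2)) (snd (0 :: r2)) = 0" by (simp add: complex_eq_iff)
  have Zh: "Z holomorphic_on ball 0 R" unfolding holomorphic_on_open[OF open_ball] using Z(3) by blast
  show "smooth_at (\<lambda>x. Z (Complex (fst x) (snd x))) 0"
  proof (rule smooth_at_compose[OF _ smooth_at_linear[OF Cx]])
    show "smooth_at Z (Complex (fst (0 :: r2)) (snd (0 :: r2)))"
      unfolding C0 by (rule smooth_atI[OF open_ball _ holomorphic_on_imp_smooth_on[OF open_ball Zh]]) (use R in simp)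
  qed
  have sT: "smooth_at T p" by (rule analytic_imp_smooth_at[OF T(2)])
  show "smooth_at (\<lambda>z. (Re (T z), Im (T z))) p"
    by (intro smooth_at_Pair smooth_at_compose[OF smooth_at_linear[OF bounded_linear_Re] sT]
        smooth_at_compose[OF smooth_at_linear[OF bounded_linear_Im] sT])
  show "Z (Complex (fst (0 :: r2)) (snd (0 :: r2))) = p" unfolding C0 by (rule Z(1))
  show "(Re (T p), Im (T p)) = 0" by (simp add: T(1) zero_prod_def)
  have "((\<lambda>x :: r2. Complex (fst x) (snd x)) \<longlongrightarrow> 0) (nhds 0)"
    using smooth_at_tendsto[OF smooth_at_linear[OF Cx], of 0] unfolding C0 .
  from eventually_compose_filterlim[OF eventually_nhds_in_open[OF open_ball] this, of 0 R] R
  have "\<forall>\<^sub>F x :: r2 in nhds 0. Complex (fst x) (snd x) \<in> ball 0 R" by simp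
  then show "\<forall>\<^sub>F x :: r2 in nhds 0. (Re (T (Z (Complex (fst x) (snd x)))), Im (T (Z (Complex (fst x) (snd x))))) = x"
    by eventually_elim (simp add: Z(2))
  show "\<forall>\<^sub>F z in nhds p. Z (Complex (fst (Re (T z), Im (T z))) (snd (Re (T z), Im (T z)))) = z"
    using T(3) by simp
  have ca: "continuous_on UNIV (act n)" using linear_continuous_on[OF bounded_linear_act] .
  show "open {X. fst (snd (snd (act n X))) < 0}"
    by (intro open_Collect_less continuous_intros ca)
  show "open {y. 0 < dS_root y}"
    by (intro open_Collect_less continuous_intros continuous_dS_root)
  show "smooth_on UNIV (\<lambda>X. dS_coords (act n X))"
    by (rule smooth_on_compose[OF open_UNIV open_UNIV _ smooth_dS_coords smooth_on_linear[OF bounded_linear_act]]) simp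
  show "smooth_on {y. 0 < dS_root y} (\<lambda>y. act (adjugate n) (dS_point y))"
    by (rule smooth_on_linear_comp[OF \<open>open {y. 0 < dS_root y}\<close> bounded_linear_act smooth_dS_point])
  have U: "unimodular (adjugate n)"
    using unimodular_n by (simp add: unimodular_def adjugate_def mult.commute)
  show "act (adjugate n) (dS_point y) \<in> {X. fst (snd (snd (act n X))) < 0} \<inter> deSitter3 \<and> dS_coords (act n (act (adjugate n) (dS_point y))) = y"
    if "y \<in> {y. 0 < dS_root y}" for y
    using that dS_point_deSitter[of y]
    by (simp add: act_adjugate[OF unimodular_n] dS_coords_point deSitter3_def herm_det_act[OF U])
  show "dS_coords (act n X) \<in> {y. 0 < dS_root y} \<and> act (adjugate n) (dS_point (dS_coords (act n X))) = X"
    if "X \<in> {X. fst (snd (snd (act n X))) < 0} \<inter> deSitter3" for X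
    using that dS_point_coords[of "act n X"]
    by (simp add: act_adjugate[OF unimodular_n] deSitter3_def herm_det_act[OF unimodular_n])
qed (use basic isCont_f f_deSitter act_f_p in \<open>simp_all add: dS_coords_def dS_root_def zero_prod_def\<close>)

lemma A_equiv_tri:
  "A_equiv_germ_dS D f p G \<longleftrightarrow> germ_equiv (tri fr.U (fr.Xw (wY 1)) (fr.Xw wZ)) G"
proof -
  have "isCont (\<lambda>x :: r2. Complex (fst x) (snd x)) 0" unfolding Complex_eq by (intro continuous_intros)
  from isCont_tendsto_nhds[OF this]
  have t: "((\<lambda>x :: r2. Complex (fst x) (snd x)) \<longlongrightarrow> 0) (nhds 0)" by (simp add: Complex_eq)
  have "\<forall>\<^sub>F w in nhds 0. w \<in> ball (0 :: complex) R" using R by (intro eventually_nhds_in_open) auto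
  from eventually_compose_filterlim[OF this t]
  have e: "\<forall>\<^sub>F x in nhds 0. tri fr.U (fr.Xw (wY 1)) (fr.Xw wZ) x = dS_coords (act n (f (Z (Complex (fst x) (snd x)))))"
    by eventually_elim (rule tri_eq)
  then have e': "\<forall>\<^sub>F x in nhds 0. dS_coords (act n (f (Z (Complex (fst x) (snd x))))) = tri fr.U (fr.Xw (wY 1)) (fr.Xw wZ) x"
    by eventually_elim simp
  show ?thesis
    unfolding dS_chart.A_equiv_iff[OF dS_chart] using germ_equiv_cong[OF e] germ_equiv_cong[OF e'] by (rule iffI[rotated])
qed

end

section \<open>Iterates of \<open>V\<close> and the logarithmic coordinate at
  \<open>p\<close>\<close>

lemma (in cmc_point) iterate_V:
  assumes Phi: "\<Phi> holomorphic_on ball 0 r" "r > 0"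
    and eq: "\<forall>\<^sub>F z in nhds p. \<phi> z = \<Phi> (Ln (g z / g p))" and dg: "deriv g p \<noteq> 0"
  shows "\<forall>\<^sub>F z in nhds p. (char_V g ^^ j) \<phi> z = (deriv ^^ j) \<Phi> (Ln (g z / g p))"
proof (induction j)
  case 0
  then show ?case using eq by simp
next
  case (Suc j)
  obtain B where B: "open B" "p \<in> B" "\<And>z. z \<in> B \<Longrightarrow> g z \<noteq> 0" "g holomorphic_on B"
    by (rule regular_nhd) blast
  have hd: "deriv g holomorphic_on B" by (rule holomorphic_deriv[OF B(4,1)])
  have c: "isCont g p" "isCont (deriv g) p"
    using holomorphic_on_imp_continuous_on[OF B(4)] holomorphic_on_imp_continuous_on[OF hd] B(1,2)
    by (auto simp: continuous_on_eq_continuous_at)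
  have t: "((\<lambda>z. g z / g p) \<longlongrightarrow> 1) (nhds p)"
    using isCont_tendsto_nhds[OF isCont_divide[OF c(1) continuous_const basic(5)]] basic(5) by simp
  have "\<forall>\<^sub>F w in nhds (1 :: complex). w \<in> - \<real>\<^sub>\<le>\<^sub>0"
    by (intro eventually_nhds_in_open) (auto simp: open_Compl)
  from eventually_compose_filterlim[OF this t] have s: "\<forall>\<^sub>F z in nhds p. g z / g p \<notin> \<real>\<^sub>\<le>\<^sub>0" by simp
  have "((\<lambda>z. Ln (g z / g p)) \<longlongrightarrow> Ln 1) (nhds p)"
    by (rule tendsto_Ln[OF t]) simp
  then have L: "((\<lambda>z. Ln (g z / g p)) \<longlongrightarrow> 0) (nhds p)" by simp
  have "\<forall>\<^sub>F w in nhds 0. w \<in> ball (0 :: complex) r" using Phi(2) by (intro eventually_nhds_in_open) auto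
  from eventually_compose_filterlim[OF this L] have b: "\<forall>\<^sub>F z in nhds p. Ln (g z / g p) \<in> ball 0 r" .
  have hj: "(deriv ^^ j) \<Phi> holomorphic_on ball 0 r" by (rule holomorphic_higher_deriv[OF Phi(1) open_ball])
  \<comment> \<open>The induction hypothesis holds on a neighbourhood of each nearby point and may
    be differentiated there; the factor \<open>deriv g z / g z\<close> from the chain rule is
    removed by \<open>V\<close>.\<close>
  show ?case
    using eventually_eventually[THEN iffD2, OF Suc.IH] s b tendsto_imp_eventually_ne[OF isCont_tendsto_nhds[OF c(2)] dg]
      eventually_nhds_in_open[OF B(1,2)]
  proof eventually_elim
    case (elim z)
    have gz: "g z \<noteq> 0" by (rule B(3)[OF elim(5)])
    have "((\<lambda>z. g z / g p) has_field_derivative deriv g z / g p) (at z)"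
      by (rule DERIV_cdivide[OF holomorphic_derivI[OF B(4,1) elim(5)]])
    from DERIV_chain2[OF holomorphic_derivI[OF hj open_ball elim(3)] DERIV_chain2[OF has_field_derivative_Ln[OF elim(2)] this]]
    have "((\<lambda>z. (deriv ^^ j) \<Phi> (Ln (g z / g p))) has_field_derivative
      deriv ((deriv ^^ j) \<Phi>) (Ln (g z / g p)) * (inverse (g z / g p) * (deriv g z / g p))) (at z)" .
    from DERIV_imp_deriv[OF this]
    have "deriv ((char_V g ^^ j) \<phi>) z = (deriv ^^ Suc j) \<Phi> (Ln (g z / g p)) * (deriv g z / g z)"
      unfolding deriv_cong_ev[OF elim(1) refl] using basic(5) by (simp add: field_simps)
    moreover have "char_V g \<psi> z = g z * deriv \<psi> z / deriv g z" for \<psi> by (simp add: char_V_def)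
    ultimately show ?case using elim(4) gz by simp
  qed
qed

lemma (in cmc_point) log_coordinate:
  assumes dg: "deriv g p \<noteq> 0"
  obtains \<Phi> r where "r > 0" "\<Phi> holomorphic_on ball 0 r" "\<forall>\<^sub>F z in nhds p. char_phi g h z = \<Phi> (Ln (g z / g p))"
proof -
  obtain B where B: "open B" "p \<in> B" "B \<subseteq> D" "\<And>z. z \<in> B \<Longrightarrow> g z \<noteq> 0 \<and> h z \<noteq> 0" "g holomorphic_on B"
    by (rule regular_nhd) blast
  define S where "S = B \<inter> (\<lambda>z. g z / g p) -` (- \<real>\<^sub>\<le>\<^sub>0)"
  have hq: "(\<lambda>z. g z / g p) holomorphic_on B" by (intro holomorphic_intros B(5)) (rule basic(5))
  have o: "open S" unfolding S_def
    by (rule continuous_open_preimage[OF holomorphic_on_imp_continuous_on[OF hq] B(1)]) (simp add: open_Compl)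
  have pS: "p \<in> S" using B(2) basic(5) by (simp add: S_def)
  have hL: "(\<lambda>z. Ln (g z / g p)) holomorphic_on S"
  proof -
    have l: "Ln holomorphic_on - \<real>\<^sub>\<le>\<^sub>0" by (intro holomorphic_intros) auto
    have q: "(\<lambda>z. g z / g p) holomorphic_on S" by (rule holomorphic_on_subset[OF hq]) (auto simp: S_def)
    have "(\<lambda>z. g z / g p) ` S \<subseteq> - \<real>\<^sub>\<le>\<^sub>0" by (auto simp: S_def)
    from holomorphic_on_compose_gen[OF q l this] show ?thesis by (simp add: o_def)
  qed
  have dL: "((\<lambda>z. Ln (g z / g p)) has_field_derivative inverse (g p / g p) * (deriv g p / g p)) (at p)"
    by (rule DERIV_chain2[OF has_field_derivative_Ln DERIV_cdivide[OF holomorphic_derivI[OF B(5,1,2)]]])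
      (use basic(5) in simp)
  have ne: "deriv (\<lambda>z. Ln (g z / g p)) p \<noteq> 0"
    using DERIV_imp_deriv[OF dL] dg basic(5) by simp
  have L0: "Ln (g p / g p) = 0" using basic(5) by simp
  obtain G r where G: "r > 0" "G 0 = p" "\<And>y. y \<in> ball 0 r \<Longrightarrow> G y \<in> S \<and> Ln (g (G y) / g p) = y"
    "\<And>y. y \<in> ball 0 r \<Longrightarrow> (G has_field_derivative inverse (deriv (\<lambda>z. Ln (g z / g p)) (G y))) (at y)"
    "\<forall>\<^sub>F x in nhds p. G (Ln (g x / g p)) = x"
  proof (rule local_holomorphic_inverse[OF hL o pS ne, unfolded L0])
    fix H s
    assume "s > 0" "H 0 = p" "\<And>y. y \<in> ball 0 s \<Longrightarrow> H y \<in> S \<and> Ln (g (H y) / g p) = y"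
      "\<And>y. y \<in> ball 0 s \<Longrightarrow> (H has_field_derivative inverse (deriv (\<lambda>z. Ln (g z / g p)) (H y))) (at y)"
      "\<forall>\<^sub>F x in nhds p. H (Ln (g x / g p)) = x"
    then show thesis by (rule that)
  qed
  have hG: "G holomorphic_on ball 0 r" unfolding holomorphic_on_open[OF open_ball] using G(4) by blast
  have hphi: "char_phi g h holomorphic_on S"
    unfolding char_phi_def
    by (intro holomorphic_intros holomorphic_on_subset[OF B(5)] holomorphic_on_subset[OF holomorphic_deriv[OF B(5,1)]]
        holomorphic_on_subset[OF basic(6)]) (use B(3,4) in \<open>auto simp: S_def\<close>)
  have GS: "G ` ball 0 r \<subseteq> S" using G(3) by blast
  show ?thesis
  proof (rule that[OF G(1)])
    show "(\<lambda>y. char_phi g h (G y)) holomorphic_on ball 0 r"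
      using holomorphic_on_compose_gen[OF hG hphi GS] by (simp add: o_def)
    show "\<forall>\<^sub>F z in nhds p. char_phi g h z = char_phi g h (G (Ln (g z / g p)))"
      using G(5) by eventually_elim simp
  qed
qed

context cmc_chart
begin

text \<open>If \<open>Im \<phi>\<close> vanishes, then so does the second-direction derivative of
  \<open>mu\<close>; with \<open>mu\<close> itself zero at the point, the second null derivative of
  each component, a derivative of \<open>mu * Nw\<close>, vanishes as well.\<close>

lemma not_cuspidal:
  assumes "Im (char_phi g h p) = 0"
  shows "\<not> germ_equiv (tri fr.U (fr.Xw (wY 1)) (fr.Xw wZ)) (cuspS_model k s)"
proof (rule not_cuspS_if_tangential)
  show "rhol fr.U" "rhol (fr.Xw (wY 1))" "rhol (fr.Xw wZ)"
    by (intro fr.rhol_U fr.rhol_frame herm_weights)+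
  show "fr.U 0 = 0" "fr.Xw (wY 1) 0 = 0" "fr.Xw wZ 0 = 0"
    by (simp_all add: fr.U_def fr.Xw_0)
  note pd = fr.pd_frame[OF fr.good_0]
  show "pd1 fr.U 0 \<noteq> 0" "pd2 fr.U 0 = 0" "pd1 (fr.Xw (wY 1)) 0 = 0" "pd2 (fr.Xw (wY 1)) 0 = 0"
    "pd1 (fr.Xw wZ) 0 = 0" "pd2 (fr.Xw wZ) 0 = 0"
    using pd by (simp_all add: fr.mu_0 fr.weights_0)
  have "pd2 (pd2 (fr.Xw w)) 0 = 0" if w: "herm_weight w" for w
  proof -
    have "has_pderivs (\<lambda>x. fr.mu x * fr.Nw w x) (pd1 fr.mu 0 * fr.Nw w 0 + fr.mu 0 * pd1 (fr.Nw w) 0)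
        (pd2 fr.mu 0 * fr.Nw w 0 + fr.mu 0 * pd2 (fr.Nw w) 0) 0"
      by (rule has_pderivs_mult[OF rhol_has_pderivs_0[OF fr.rhol_mu] rhol_has_pderivs_0[OF fr.rhol_frame(3)[OF w]]])
    from has_pderivs_cong[OF this fr.open_good fr.good_0, of "pd2 (fr.Xw w)"]
    have "has_pderivs (pd2 (fr.Xw w)) (pd1 fr.mu 0 * fr.Nw w 0 + fr.mu 0 * pd1 (fr.Nw w) 0)
        (pd2 fr.mu 0 * fr.Nw w 0 + fr.mu 0 * pd2 (fr.Nw w) 0) 0"
      using fr.pd_frame(4) by simp
    moreover have "pd2 fr.mu 0 = 0"
      using pd(6) assms by (simp add: fr.mu_0 fr.ab_0 phi_def Z(1))
    ultimately show ?thesis using has_pderivs_pd(2) fr.mu_0 by simp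
  qed
  then show "pd2 (pd2 (fr.Xw (wY 1))) 0 = 0" "pd2 (pd2 (fr.Xw wZ)) 0 = 0"
    using herm_weights by blast+
qed

lemma germ_equiv_eps:
  assumes "\<epsilon> \<in> {1, - 1}"
  shows "germ_equiv (tri fr.U (fr.Xw (wY \<epsilon>)) (fr.Xw wZ)) G \<longleftrightarrow> germ_equiv (tri fr.U (fr.Xw (wY 1)) (fr.Xw wZ)) G"
proof (cases "\<epsilon> = 1")
  case False
  then have e: "\<epsilon> = - 1" using assms by simp
  have "fr.Xw (wY (- 1)) x = - fr.Xw (wY 1) x" for x
    by (simp add: fr.Xw_def bil_def wY_def algebra_simps)
  then have r: "rr (fr.Xw (wY (- 1))) x = - rr (fr.Xw (wY 1)) x" for x by (simp add: rr_def)
  have 1: "germ_equiv (tri fr.U (fr.Xw (wY (- 1))) (fr.Xw wZ)) (tri fr.U (fr.Xw (wY 1)) (fr.Xw wZ))"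
    unfolding tri_def[abs_def] r by (rule germ_equiv_flip)
  have 2: "germ_equiv (tri fr.U (fr.Xw (wY 1)) (fr.Xw wZ)) (tri fr.U (fr.Xw (wY (- 1))) (fr.Xw wZ))"
    using germ_equiv_flip[of "rr fr.U" "rr (fr.Xw (wY (- 1)))" "rr (fr.Xw wZ)"]
    unfolding tri_def[abs_def] r by simp
  show ?thesis unfolding e using germ_equiv_trans[OF 1] germ_equiv_trans[OF 2] by blast
qed simp

lemma cuspidal_S_iff:
  assumes k: "k \<ge> 1"
  defines "\<phi> \<equiv> char_phi g h" and "V \<equiv> char_V g"
  shows "cuspidal_S k D f p \<longleftrightarrow> Im (\<phi> p) \<noteq> 0 \<and> (\<forall>j\<le>k. Re (\<i> ^ j * (V ^^ j) \<phi> p) = 0) \<and>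
    Re (\<i> ^ (k + 1) * (V ^^ (k + 1)) \<phi> p) \<noteq> 0 \<and> Re ((V ^^ 2) \<phi> p) \<noteq> 12"
proof (cases "Im (\<phi> p) = 0")
  case True
  then show ?thesis
    using not_cuspidal unfolding cuspidal_S_def A_equiv_tri \<phi>_def by blast
next
  case False
  define b where "b = Im (phi 0)"
  have b: "b \<noteq> 0" using False by (simp add: b_def phi_def Z(1) \<phi>_def)
  \<comment> \<open>A nonzero value of \<open>\<phi>\<close> means that \<open>g\<close> is locally
    injective, so that \<open>log g\<close> is a coordinate.\<close>
  have dg: "deriv g p \<noteq> 0"
  proof
    assume "deriv g p = 0"
    then show False using False by (simp add: \<phi>_def char_phi_def)
  qed
  obtain \<Phi> r where Phi: "r > 0" "\<Phi> holomorphic_on ball 0 r" "\<forall>\<^sub>F z in nhds p. char_phi g h z = \<Phi> (Ln (g z / g p))"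
    by (rule log_coordinate[OF dg])
  have V: "(V ^^ j) \<phi> p = (deriv ^^ j) \<Phi> 0" for j
    using eventually_nhds_x_imp_x[OF iterate_V[OF Phi(2,1,3) dg, of j]] basic(5) by (simp add: V_def \<phi>_def)
  interpret rf: regular_frame e c phi gg R b "sgn b"
    by unfold_locales (simp_all add: b_def b[unfolded b_def])
  obtain v s y0 K0 d G1 G2 where nf: "fold_normal fr.U (fr.Xw (wY (sgn b))) (fr.Xw wZ) fr.mu (fr.Nw wU) (fr.Nw (wY (sgn b))) (fr.Nw wZ)
      (1 / (4 * \<bar>b\<bar>)) v s y0 K0 d G1 G2"
    using rf.fold_normal_exists by blast
  have Zc: "(Z \<longlongrightarrow> p) (nhds 0)"
    using isCont_tendsto_nhds[OF DERIV_isCont[OF Z(3)[of 0]]] R Z(1) by simp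
  have ev: "\<forall>\<^sub>F t in nhds 0. phi t = \<Phi> (Ln (gg t / gg 0))"
    using eventually_compose_filterlim[OF Phi(3) Zc] by (simp add: phi_def gg_def Z(1))
  have fl: "frame_log e c phi gg R \<Phi> r"
    by unfold_locales (use Phi(1,2) ev in simp_all)
  interpret L: regular_frame_log e c phi gg R \<Phi> r b "sgn b" v s y0 K0 d G1 G2
    by (rule regular_frame_log.intro[OF fl regular_frame_normal.intro[OF rf.regular_frame_axioms
          regular_frame_normal_axioms.intro[OF nf]]])
  have sg: "sgn b \<in> {1, - 1}" using b by (simp add: sgn_if)
  have "cuspidal_S k D f p \<longleftrightarrow> (\<exists>s\<in>{1, -1}. germ_equiv (tri fr.U (fr.Xw (wY (sgn b))) (fr.Xw wZ)) (cuspS_model k s))"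
    unfolding cuspidal_S_def A_equiv_tri germ_equiv_eps[OF sg] ..
  also have "\<dots> \<longleftrightarrow> (\<forall>j\<le>k. Re (\<i> ^ j * (V ^^ j) \<phi> p) = 0) \<and> Re (\<i> ^ (k + 1) * (V ^^ (k + 1)) \<phi> p) \<noteq> 0 \<and> Re ((V ^^ 2) \<phi> p) \<noteq> 12"
    unfolding V by (rule L.cuspidal_iff[OF k])
  finally show ?thesis using False by blast
qed

end

theorem theorem5p7:
  fixes D :: "complex set" and g h F11 F12 F21 F22 :: "complex \<Rightarrow> complex" and p :: complex
  assumes "CMC1_face_data D g h F11 F12 F21 F22"
    and "p \<in> singular_set D g"
  defines "f \<equiv> Fe3Fstar F11 F12 F21 F22"
    and "\<phi> \<equiv> char_phi g h"
    and "V \<equiv> char_V g"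
  shows "(cuspidal_S 1 D f p \<longleftrightarrow>
            Im (\<phi> p) \<noteq> 0 \<and> Re (\<phi> p) = 0 \<and> Im (V \<phi> p) = 0 \<and>
            Re ((V ^^ 2) \<phi> p) \<notin> {0, 12})
       \<and> (\<forall>k::nat. k > 1 \<longrightarrow>
           (cuspidal_S k D f p \<longleftrightarrow>
              Im (\<phi> p) \<noteq> 0 \<and>
              (\<forall>j\<le>k. Re (\<i> ^ j * (V ^^ j) \<phi> p) = 0) \<and>
              Re (\<i> ^ (k + 1) * (V ^^ (k + 1)) \<phi> p) \<noteq> 0))"
proof -
  interpret P: cmc_point D g h F11 F12 F21 F22 p by unfold_locales (fact assms(1,2))+
  obtain B Z T R where "cmc_chart D g h F11 F12 F21 F22 p B Z T R" using P.cmc_chart_exists by blast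
  then interpret C: cmc_chart D g h F11 F12 F21 F22 p B Z T R .
  have iff: "cuspidal_S k D f p \<longleftrightarrow> Im (\<phi> p) \<noteq> 0 \<and> (\<forall>j\<le>k. Re (\<i> ^ j * (V ^^ j) \<phi> p) = 0) \<and>
    Re (\<i> ^ (k + 1) * (V ^^ (k + 1)) \<phi> p) \<noteq> 0 \<and> Re ((V ^^ 2) \<phi> p) \<noteq> 12" if "k \<ge> 1" for k
    using C.cuspidal_S_iff[OF that] unfolding P.f_def f_def \<phi>_def V_def .
  \<comment> \<open>For \<open>k = 1\<close> the second-order condition becomes
    \<open>Re (V^2 \<phi>) \<noteq> 0\<close>, while the condition for \<open>j = 1\<close> is the
    vanishing of \<open>Im (V \<phi>)\<close>, in both cases up to sign.\<close>
  have i2: "Re (\<i> ^ 2 * (V ^^ 2) \<phi> p) = - Re ((V ^^ 2) \<phi> p)" by simp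
  have le1: "(\<forall>j\<le>1. P j) \<longleftrightarrow> P 0 \<and> P 1" for P :: "nat \<Rightarrow> bool"
    by (auto simp: le_Suc_eq)
  show ?thesis
  proof (intro conjI allI impI)
    show "cuspidal_S 1 D f p \<longleftrightarrow>
            Im (\<phi> p) \<noteq> 0 \<and> Re (\<phi> p) = 0 \<and> Im (V \<phi> p) = 0 \<and> Re ((V ^^ 2) \<phi> p) \<notin> {0, 12}"
      unfolding iff[OF order_refl] le1 one_add_one i2 by auto
    fix k :: nat assume k: "k > 1"
    \<comment> \<open>For \<open>k > 1\<close> the index \<open>j = 2\<close> is among the vanishing
      conditions, which excludes the value 12 automatically.\<close>
    have "Re ((V ^^ 2) \<phi> p) = 0" if "\<forall>j\<le>k. Re (\<i> ^ j * (V ^^ j) \<phi> p) = 0"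
      using that[rule_format, of 2] k i2 by simp
    then show "cuspidal_S k D f p \<longleftrightarrow> Im (\<phi> p) \<noteq> 0 \<and> (\<forall>j\<le>k. Re (\<i> ^ j * (V ^^ j) \<phi> p) = 0) \<and>
        Re (\<i> ^ (k + 1) * (V ^^ (k + 1)) \<phi> p) \<noteq> 0"
      using iff[of k] k by fastforce
  qed
qed

end
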